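(* Let $X=\{X(t)\}$ be a supOU process with characteristic quadruple $(a,b,\mu_L,\pi)$, finite variance and zero mean, and let $X^*(t)=\int_0^t X(s)\,ds$, $t\ge 0$. Suppose that $\pi$ has a density $p$ satisfying $$p(x)\sim \alpha\,\ell(x^{-1})\,x^{\alpha-1}\quad\text{as } x\to 0,$$ for some $\alpha\in(0,1)$ and some function $\ell$ slowly varying at infinity. If $b>0$, then as $T\to\infty$ $$\left\{\frac{1}{T^{1-\alpha/2}\,\ell(T)^{1/2}}\,X^*(Tt)\right\}_{t\ge 0}\longrightarrow \left\{\widetilde\sigma\,B_H(t)\right\}_{t\ge 0}$$ in the sense of convergence of all finite dimensional distributions, where $\{B_H(t)\}$ is standard fractional Brownian motion with $H=1-\alpha/2$ and $$\widetilde\sigma^2=b\,\frac{\Gamma(1+\alpha)}{(2-\alpha)(1-\alpha)}.$$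
   Context: SupOU process: let $\pi$ be a probability measure on $\mathbb{R}_+=(0,\infty)$ and let $\kappa_L(\zeta)=\log \mathbb{E}e^{i\zeta L(1)}$ be the cumulant function of an infinitely divisible random variable $L(1)$ with Lévy–Khintchine triplet $(a,b,\mu_L)$: $\kappa_L(\zeta)=i\zeta a-\frac{\zeta^2}{2}b+\int_{\mathbb{R}}(e^{i\zeta x}-1-i\zeta x\mathbf{1}_{[-1,1]}(x))\mu_L(dx)$. Let $\Lambda$ be the homogeneous Lévy basis (independently scattered infinitely divisible random measure) on $\mathbb{R}_+\times\mathbb{R}$ with $\log\mathbb{E}e^{i\zeta\Lambda(A)}=(\pi\times \mathrm{Leb})(A)\,\kappa_L(\zeta)$ for Borel sets $A$ (of finite measure). The supOU process with characteristic quadruple $(a,b,\mu_L,\pi)$ is the strictly stationary process $$X(t)=\int_{\mathbb{R}_+}\int_{\mathbb{R}}e^{-\xi t+s}\mathbf{1}_{[0,\infty)}(\xi t-s)\,\Lambda(d\xi,ds),\quad t\in\mathbb{R},$$ where the stochastic integral is in the sense of Rajput–Rosiński: for $\Lambda$-integrable $f$, $\log\mathbb{E}\exp(i\zeta\int f\,d\Lambda)=\int\int\kappa_L(\zeta f(\xi,s))\,ds\,\pi(d\xi)$. Under zero mean and finite variance of $X$, $\int x^2\mu_L(dx)<\infty$, $\mathbb{E}L(1)=0$ and $\kappa_L(\zeta)=-\frac{\zeta^2}{2}b+\int_{\mathbb{R}}(e^{i\zeta x}-1-i\zeta x)\mu_L(dx)$. Standard fractional Brownian motion $B_H$ is the centered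 Gaussian process with covariance $\frac12(s^{2H}+t^{2H}-|t-s|^{2H})$. *)

theory Defs
  imports "HOL-Probability.Probability" "HOL-Library.Landau_Symbols"
begin

section \<open>Levy-Khintchine triplets\<close>

definition levy_measure :: "real measure \<Rightarrow> bool" where
  "levy_measure \<mu> \<longleftrightarrow> sets \<mu> = sets borel \<and> emeasure \<mu> {0} = 0 \<and>
     (\<integral>\<^sup>+x. ennreal (min 1 (x^2)) \<partial>\<mu>) < \<infinity>"

definition levy_cumulant :: "real \<Rightarrow> real \<Rightarrow> real measure \<Rightarrow> real \<Rightarrow> complex" where
  "levy_cumulant a b \<mu> \<zeta> =
     \<i> * of_real (\<zeta> * a) - of_real (\<zeta>^2 / 2 * b) +
     (CLINT x|\<mu>. iexp (\<zeta> * x) - 1 - \<i> * of_real (\<zeta> * x * indicator {-1..1} x))"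


section \<open>Levy bases and the Rajput-Rosinski integral\<close>

text \<open>
  The random measure is indexed by the \<open>\<delta>\<close>-ring of sets of finite control measure; its values
  on other sets are irrelevant. Infinite divisibility of \<open>\<Lambda> A\<close> is part of the characteristic
  function condition (\<open>\<kappa>\<close> is going to be a Levy-Khintchine cumulant), which is stated in
  exponentiated form to avoid choosing a branch of the complex logarithm.
\<close>

definition levy_ring :: "'s measure \<Rightarrow> 's set set" where
  "levy_ring m = {A \<in> sets m. emeasure m A < \<infinity>}"

definition levy_basis ::
  "'w measure \<Rightarrow> 's measure \<Rightarrow> (real \<Rightarrow> complex) \<Rightarrow> ('s set \<Rightarrow> 'w \<Rightarrow> real) \<Rightarrow> bool" where
  "levy_basis M m \<kappa> \<Lambda> \<longleftrightarrow>
     (\<forall>A\<in>levy_ring m. \<Lambda> A \<in> borel_measurable M) \<and>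
     (\<forall>A :: nat \<Rightarrow> 's set. range A \<subseteq> levy_ring m \<and> disjoint_family A \<longrightarrow>
        prob_space.indep_vars M (\<lambda>_. borel) (\<lambda>n. \<Lambda> (A n)) UNIV \<and>
        ((\<Union>n. A n) \<in> levy_ring m \<longrightarrow>
           (AE \<omega> in M. (\<lambda>n. \<Lambda> (A n) \<omega>) sums \<Lambda> (\<Union>n. A n) \<omega>))) \<and>
     (\<forall>A\<in>levy_ring m. \<forall>\<zeta>. char (distr M borel (\<Lambda> A)) \<zeta> = exp (of_real (measure m A) * \<kappa> \<zeta>))"

definition conv_in_prob :: "'w measure \<Rightarrow> (nat \<Rightarrow> 'w \<Rightarrow> real) \<Rightarrow> ('w \<Rightarrow> real) \<Rightarrow> bool" where
  "conv_in_prob M Y Z \<longleftrightarrow>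
     (\<forall>\<epsilon>>0. (\<lambda>n. measure M {\<omega> \<in> space M. \<bar>Y n \<omega> - Z \<omega>\<bar> > \<epsilon>}) \<longlonglongrightarrow> 0)"

text \<open>
  Integral of a function \<open>\<phi>\<close> with finitely many values,
  vanishing off a set of finite \<open>m\<close>-measure.
\<close>

definition simple_levy_integral ::
  "'s measure \<Rightarrow> ('s set \<Rightarrow> 'w \<Rightarrow> real) \<Rightarrow> ('s \<Rightarrow> real) \<Rightarrow> 'w \<Rightarrow> real" where
  "simple_levy_integral m \<Lambda> \<phi> \<omega> =
     (\<Sum>y\<in>\<phi> ` space m - {0}. y * \<Lambda> (\<phi> -` {y} \<inter> space m) \<omega>)"

text \<open>
  \<open>f\<close> is \<open>\<Lambda>\<close>-integrable with integral (a version of) \<open>Y\<close>: there are simple functions converging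
  to \<open>f\<close> almost everywhere whose integrals over every measurable set converge in probability,
  and \<open>Y\<close> is the limit over the whole space.
\<close>

definition has_levy_integral ::
  "'w measure \<Rightarrow> 's measure \<Rightarrow> ('s set \<Rightarrow> 'w \<Rightarrow> real) \<Rightarrow> ('s \<Rightarrow> real) \<Rightarrow> ('w \<Rightarrow> real) \<Rightarrow> bool" where
  "has_levy_integral M m \<Lambda> f Y \<longleftrightarrow>
     f \<in> borel_measurable m \<and> Y \<in> borel_measurable M \<and>
     (\<exists>\<phi> :: nat \<Rightarrow> 's \<Rightarrow> real.
        (\<forall>n. simple_function m (\<phi> n) \<and> emeasure m {x \<in> space m. \<phi> n x \<noteq> 0} < \<infinity>) \<and>
        (AE x in m. (\<lambda>n. \<phi> n x) \<longlonglongrightarrow> f x) \<and>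
        (\<forall>A\<in>sets m. \<exists>Z\<in>borel_measurable M.
           conv_in_prob M (\<lambda>n. simple_levy_integral m \<Lambda> (\<lambda>x. \<phi> n x * indicator A x)) Z) \<and>
        conv_in_prob M (\<lambda>n. simple_levy_integral m \<Lambda> (\<phi> n)) Y)"


section \<open>SupOU processes\<close>

definition supOU_kernel :: "real \<Rightarrow> real \<times> real \<Rightarrow> real" where
  "supOU_kernel t = (\<lambda>(\<xi>, s). exp (- \<xi> * t + s) * indicator {0..} (\<xi> * t - s))"

definition supOU_process ::
  "'w measure \<Rightarrow> real \<Rightarrow> real \<Rightarrow> real measure \<Rightarrow> real measure \<Rightarrow> (real \<Rightarrow> 'w \<Rightarrow> real) \<Rightarrow> bool" where
  "supOU_process M a b \<mu> \<pi> X \<longleftrightarrow>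
     prob_space M \<and> b \<ge> 0 \<and> levy_measure \<mu> \<and>
     prob_space \<pi> \<and> sets \<pi> = sets (restrict_space borel {0<..}) \<and>
     (\<exists>\<Lambda>. levy_basis M (\<pi> \<Otimes>\<^sub>M lborel) (levy_cumulant a b \<mu>) \<Lambda> \<and>
          (\<forall>t. has_levy_integral M (\<pi> \<Otimes>\<^sub>M lborel) \<Lambda> (supOU_kernel t) (X t)))"

definition integrated_process :: "(real \<Rightarrow> 'w \<Rightarrow> real) \<Rightarrow> real \<Rightarrow> 'w \<Rightarrow> real" where
  "integrated_process X t \<omega> = (LBINT s:{0..t}. X s \<omega>)"


section \<open>Slow variation\<close>

definition slowly_varying :: "(real \<Rightarrow> real) \<Rightarrow> bool" where
  "slowly_varying l \<longleftrightarrow>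
     (\<exists>x0. l \<in> borel_measurable (restrict_space borel {x0..}) \<and> (\<forall>x\<ge>x0. l x > 0)) \<and>
     (\<forall>c>0. ((\<lambda>x. l (c * x) / l x) \<longlongrightarrow> 1) at_top)"


section \<open>Fractional Brownian motion and finite dimensional convergence\<close>

text \<open>Point masses count as (degenerate) normal distributions.\<close>

definition normal_rv :: "'w measure \<Rightarrow> ('w \<Rightarrow> real) \<Rightarrow> bool" where
  "normal_rv M Y \<longleftrightarrow> Y \<in> borel_measurable M \<and>
     ((\<exists>m s. s > 0 \<and> distributed M lborel Y (\<lambda>x. ennreal (normal_density m s x))) \<or>
      (\<exists>m. AE \<omega> in M. Y \<omega> = m))"

definition gaussian_process :: "'w measure \<Rightarrow> 'i set \<Rightarrow> ('i \<Rightarrow> 'w \<Rightarrow> real) \<Rightarrow> bool" where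
  "gaussian_process M I Y \<longleftrightarrow> prob_space M \<and>
     (\<forall>J c. finite J \<and> J \<subseteq> I \<longrightarrow> normal_rv M (\<lambda>\<omega>. \<Sum>j\<in>J. c j * Y j \<omega>))"

definition standard_fBm :: "'w measure \<Rightarrow> real \<Rightarrow> (real \<Rightarrow> 'w \<Rightarrow> real) \<Rightarrow> bool" where
  "standard_fBm M H B \<longleftrightarrow>
     gaussian_process M {0..} B \<and>
     (\<forall>t\<ge>0. integral\<^sup>L M (B t) = 0) \<and>
     (\<forall>s\<ge>0. \<forall>t\<ge>0. integral\<^sup>L M (\<lambda>\<omega>. B s \<omega> * B t \<omega>) =
        (s powr (2 * H) + t powr (2 * H) - \<bar>t - s\<bar> powr (2 * H)) / 2)"

text \<open>
  For every finite set \<open>J\<close> of indices the random vectors \<open>(Y T j)\<close>, \<open>j \<in> J\<close>, converge weakly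
  to \<open>(Z j)\<close>, \<open>j \<in> J\<close>, tested against bounded continuous functions on \<open>\<real>\<^sup>J\<close>. The limit process may
  live on a different probability space.
\<close>

definition fdd_converges ::
  "'t filter \<Rightarrow> 'i set \<Rightarrow> 'w measure \<Rightarrow> ('t \<Rightarrow> 'i \<Rightarrow> 'w \<Rightarrow> real) \<Rightarrow>
     'v measure \<Rightarrow> ('i \<Rightarrow> 'v \<Rightarrow> real) \<Rightarrow> bool" where
  "fdd_converges F I M Y N Z \<longleftrightarrow>
     (\<forall>J g. finite J \<and> J \<subseteq> I \<and> continuous_map (powertop_real J) euclideanreal g \<and>
        bounded (g ` topspace (powertop_real J)) \<longrightarrow>
        ((\<lambda>T. LINT \<omega>|M. g (\<lambda>j\<in>J. Y T j \<omega>)) \<longlongrightarrow> (LINT \<omega>|N. g (\<lambda>j\<in>J. Z j \<omega>))) F)"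

end

theory Submission
  imports Defs
begin

text \<open>
  By Fubini, \<open>X\<^sup>*(T t)\<close> is the integral of \<open>k\<^sub>T(\<xi>, s) = \<integral>\<^bsub>[0, T t]\<^esub> e\<^bsup>- \<xi> u + s\<^esup> 1(s \<le> \<xi> u) du\<close> with respect to the Levy basis,
  and \<open>k\<^sub>T(\<xi>, s) = T k\<^sub>1(T \<xi>, s)\<close>. Hence the log characteristic function of a linear combination of the normalized
  process is \<open>\<integral> p(\<xi>) r\<^sup>2 q\<^sub>T(T \<xi>) d\<xi>\<close> with \<open>r\<^sup>2 = T\<^sup>\<alpha> / l(T)\<close> and \<open>q\<^sub>T(x) = r\<^sup>-\<^sup>2 \<integral> \<kappa>(r G(x, s)) ds\<close>,
  where \<open>G\<close> is the same linear combination of the kernels \<open>k\<^sub>1\<close>. Since \<open>r \<rightarrow> \<infinity>\<close> and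
  \<open>\<kappa>(z) / z\<^sup>2 \<rightarrow> - b / 2\<close> at infinity, only the Gaussian part survives in \<open>q\<^sub>T\<close>, while regular variation of \<open>p\<close> at 0
  and Potter's bound replace \<open>p(\<xi>) r\<^sup>2 d\<xi>\<close> by \<open>\<alpha> x\<^bsup>\<alpha> - 1\<^esup> dx\<close>. The limit \<open>- b / 2 \<integral>\<integral> \<alpha> x\<^bsup>\<alpha> - 1\<^esup> G(x, s)\<^sup>2 ds dx\<close> is
  a Gamma integral and gives the covariance of fractional Brownian motion.

  Finite variance of \<open>X\<close> and \<open>b > 0\<close> force the kernel into \<open>L\<^sup>2\<close> and \<open>\<mu>\<close> to have a second moment, so the
  stochastic integral is an \<open>L\<^sup>2\<close> isometry, which justifies the Fubini step.
\<close>

section \<open>The continuity theorem for random vectors\<close>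

text \<open>The stochastic integral is given only as a limit in probability, which by itself says
  nothing about mean squares. What makes it tractable is \<open>b > 0\<close>: the modulus of the
  characteristic function of a simple integral is at most
  \<open>exp (- b / 2 * s^2 * \<integral>g^2)\<close>, so integrals that are close in probability
  have integrands that are close in mean square. Moduli are used because they do not see the drift
  of the basis, which is split off by centring and never computed from the zero mean of
  \<open>X\<close>. The Fubini step does not discretise the time integral: a random variable is
  recognised as the integral of \<open>f\<close> by its norm and its inner products with simple
  integrals, and both pass through the time integral. Weak convergence of vectors is tested on
  arbitrary bounded continuous functions, whereas the limit computation yields only characteristic
  functions of linear combinations; the gap is closed by tilting the law with one coordinate at a
  time and by Stone-Weierstrass.\<close>

text \<open>Dividing the weights by their means turns them into probability densities, so that the
  one-dimensional continuity theorem applies to the tilted laws.\<close>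

lemma weighted_levy_continuity:
  fixes w U :: "nat \<Rightarrow> 'w \<Rightarrow> real" and W V :: "'v \<Rightarrow> real"
  assumes M: "prob_space M" and N: "prob_space N"
    and w [measurable]: "\<And>n. w n \<in> borel_measurable M" and W [measurable]: "W \<in> borel_measurable N"
    and U [measurable]: "\<And>n. U n \<in> borel_measurable M" and V [measurable]: "V \<in> borel_measurable N"
    and wb: "\<And>n \<omega>. 1 \<le> w n \<omega> \<and> w n \<omega> \<le> C" and Wb: "\<And>\<omega>. 1 \<le> W \<omega> \<and> W \<omega> \<le> C"
    and conv: "\<And>t. (\<lambda>n. CLINT \<omega>|M. w n \<omega> * iexp (t * U n \<omega>)) \<longlonglongrightarrow> (CLINT \<omega>|N. W \<omega> * iexp (t * V \<omega>))"
    and h: "\<And>x. isCont h x" and hb: "\<And>x. norm (h x) \<le> (B::real)"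
  shows "(\<lambda>n. LINT \<omega>|M. w n \<omega> * h (U n \<omega>)) \<longlonglongrightarrow> (LINT \<omega>|N. W \<omega> * h (V \<omega>))"
proof -
  have hm [measurable]: "h \<in> borel_measurable borel"
    using h by (intro borel_measurable_continuous_onI continuous_at_imp_continuous_on) auto
  \<comment> \<open>Formulated for an arbitrary probability space, so as to serve both the sequence
    on \<open>M\<close> and the limit on \<open>N\<close>. The lower bound 1 keeps the normalising
    mean away from 0.\<close>
  have tilt: "1 \<le> integral\<^sup>L Q u \<and>
      real_distribution (distr (density Q (\<lambda>\<omega>. ennreal (u \<omega> / integral\<^sup>L Q u))) borel S) \<and>
      (\<forall>t. char (distr (density Q (\<lambda>\<omega>. ennreal (u \<omega> / integral\<^sup>L Q u))) borel S) t =
        (CLINT \<omega>|Q. u \<omega> * iexp (t * S \<omega>)) / of_real (integral\<^sup>L Q u)) \<and>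
      integral\<^sup>L (distr (density Q (\<lambda>\<omega>. ennreal (u \<omega> / integral\<^sup>L Q u))) borel S) h =
        (LINT \<omega>|Q. u \<omega> * h (S \<omega>)) / integral\<^sup>L Q u"
    if Q: "prob_space Q" and u[measurable]: "u \<in> borel_measurable Q" and ub: "\<And>\<omega>. 1 \<le> u \<omega> \<and> u \<omega> \<le> C"
      and S[measurable]: "S \<in> borel_measurable Q" for Q :: "'q measure" and u S :: "'q \<Rightarrow> real"
  proof -
    interpret Q: prob_space Q by fact
    have iu: "integrable Q u"
      by (rule Q.integrable_const_bound[where B=C]) (use ub in \<open>auto simp: abs_of_nonneg[OF order_trans[OF zero_le_one conjunct1[OF ub]]]\<close>)
    have c1: "1 \<le> integral\<^sup>L Q u"
      using Q.prob_space integral_mono[OF _ iu, of "\<lambda>_. 1"] ub by auto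
    let ?c = "integral\<^sup>L Q u"
    let ?D = "density Q (\<lambda>\<omega>. ennreal (u \<omega> / ?c))"
    have nn: "0 \<le> u \<omega> / ?c" for \<omega>
      using ub[of \<omega>] c1 by auto
    have "(\<integral>\<^sup>+\<omega>. ennreal (u \<omega> / ?c) \<partial>Q) = ennreal (\<integral>\<omega>. u \<omega> / ?c \<partial>Q)"
      by (rule nn_integral_eq_integral) (use iu nn in auto)
    also have "\<dots> = 1" using c1 by simp
    finally have "prob_space ?D"
      by (intro prob_spaceI) (simp add: emeasure_density)
    then have rd: "real_distribution (distr ?D borel S)"
      by (intro prob_space.real_distribution_distr) auto
    have ch: "char (distr ?D borel S) t = (CLINT \<omega>|Q. u \<omega> * iexp (t * S \<omega>)) / of_real ?c" for t
    proof -
      have "char (distr ?D borel S) t = (CLINT \<omega>|?D. iexp (t * S \<omega>))"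
        by (simp add: char_def integral_distr)
      also have "\<dots> = (CLINT \<omega>|Q. (u \<omega> / ?c) *\<^sub>R iexp (t * S \<omega>))"
        by (rule integral_density) (use nn in auto)
      also have "\<dots> = (CLINT \<omega>|Q. (u \<omega> * iexp (t * S \<omega>)) / of_real ?c)"
        by (intro Bochner_Integration.integral_cong) (auto simp: scaleR_conv_of_real)
      finally show ?thesis by simp
    qed
    have "integral\<^sup>L (distr ?D borel S) h = (LINT \<omega>|?D. h (S \<omega>))"
      by (simp add: integral_distr)
    also have "\<dots> = (LINT \<omega>|Q. (u \<omega> / ?c) *\<^sub>R h (S \<omega>))"
      by (rule integral_density) (use nn in auto)
    finally show ?thesis using c1 rd ch by auto
  qed
  note tM = tilt[OF M w wb U] and tN = tilt[OF N W Wb V]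
  let ?P = "\<lambda>n. distr (density M (\<lambda>\<omega>. ennreal (w n \<omega> / integral\<^sup>L M (w n)))) borel (U n)"
  let ?R = "distr (density N (\<lambda>\<omega>. ennreal (W \<omega> / integral\<^sup>L N W))) borel V"
  \<comment> \<open>At \<open>t = 0\<close> the hypothesis \<open>conv\<close> says that the
    normalising means converge; they are multiplied back at the end.\<close>
  have "(\<lambda>n. complex_of_real (integral\<^sup>L M (w n))) \<longlonglongrightarrow> complex_of_real (integral\<^sup>L N W)"
    using conv[of 0] by simp
  then have c: "(\<lambda>n. integral\<^sup>L M (w n)) \<longlonglongrightarrow> integral\<^sup>L N W"
    by (subst (asm) tendsto_of_real_iff)
  have "weak_conv_m ?P ?R"
  proof (rule levy_continuity)
    fix t
    have chP: "char (?P n) t = (CLINT \<omega>|M. w n \<omega> * iexp (t * U n \<omega>)) / of_real (integral\<^sup>L M (w n))" for n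
      using tM[of n n] by blast
    have chR: "char ?R t = (CLINT \<omega>|N. W \<omega> * iexp (t * V \<omega>)) / of_real (integral\<^sup>L N W)"
      using tN by blast
    have "complex_of_real (integral\<^sup>L N W) \<noteq> 0" using tN by auto
    then show "(\<lambda>n. char (?P n) t) \<longlonglongrightarrow> char ?R t"
      unfolding chP chR by (intro tendsto_divide conv tendsto_of_real c)
  qed (use tM tN in auto)
  then have "(\<lambda>n. integral\<^sup>L (?P n) h) \<longlonglongrightarrow> integral\<^sup>L ?R h"
    using tM tN h hb by (intro weak_conv_imp_integral_bdd_continuous_conv) auto
  from tendsto_mult[OF this c]
  have "(\<lambda>n. integral\<^sup>L (?P n) h * integral\<^sup>L M (w n)) \<longlonglongrightarrow> integral\<^sup>L ?R h * integral\<^sup>L N W" .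
  then show ?thesis
  proof -
    have "integral\<^sup>L (?P n) h * integral\<^sup>L M (w n) = (LINT \<omega>|M. w n \<omega> * h (U n \<omega>))" for n
      using tM[of n n] by auto
    moreover have "integral\<^sup>L ?R h * integral\<^sup>L N W = (LINT \<omega>|N. W \<omega> * h (V \<omega>))"
      using tN by auto
    ultimately show ?thesis using \<open>(\<lambda>n. integral\<^sup>L (?P n) h * integral\<^sup>L M (w n)) \<longlonglongrightarrow> _\<close> by simp
  qed
qed

text \<open>Induction on \<open>K\<close> inserts the test functions one coordinate at a time. The
  product over the earlier coordinates acts as a weight, and the new coordinate \<open>Y n k\<close>
  is handled by the one-dimensional theorem. The exponential of the full linear combination is
  carried along with arbitrary coefficients: it is what the induction hypothesis needs in order to
  supply the characteristic functions of the tilted law in the next round.\<close>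

lemma product_test_convergence:
  fixes Y :: "nat \<Rightarrow> 'i \<Rightarrow> 'w \<Rightarrow> real" and Z :: "'i \<Rightarrow> 'v \<Rightarrow> real"
  assumes M: "prob_space M" and N: "prob_space N" and J: "finite J"
    and Y: "\<And>n j. j \<in> J \<Longrightarrow> Y n j \<in> borel_measurable M"
    and Z: "\<And>j. j \<in> J \<Longrightarrow> Z j \<in> borel_measurable N"
    and cf: "\<And>c. (\<lambda>n. CLINT \<omega>|M. iexp (\<Sum>j\<in>J. c j * Y n j \<omega>)) \<longlonglongrightarrow> (CLINT \<omega>|N. iexp (\<Sum>j\<in>J. c j * Z j \<omega>))"
    and K: "K \<subseteq> J"
    and h: "\<And>j x. j \<in> K \<Longrightarrow> isCont (h j) x" and hb: "\<And>j x. j \<in> K \<Longrightarrow> 1 \<le> h j x \<and> h j x \<le> B j"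
  shows "(\<lambda>n. CLINT \<omega>|M. of_real (\<Prod>j\<in>K. h j (Y n j \<omega>)) * iexp (\<Sum>j\<in>J. c j * Y n j \<omega>)) \<longlonglongrightarrow>
         (CLINT \<omega>|N. of_real (\<Prod>j\<in>K. h j (Z j \<omega>)) * iexp (\<Sum>j\<in>J. c j * Z j \<omega>))"
proof -
  have "finite K" using J K finite_subset by blast
  then show ?thesis using K h hb
  proof (induction K arbitrary: c rule: finite_induct)
    case empty
    then show ?case using cf by simp
  next
    case (insert k K)
    have kJ: "k \<in> J" and KJ: "K \<subseteq> J" using insert by auto
    have hm: "h j \<in> borel_measurable borel" if "j \<in> insert k K" for j
      using insert.prems(2)[OF that] by (intro borel_measurable_continuous_onI continuous_at_imp_continuous_on) auto
    define w where "w n \<omega> = (\<Prod>j\<in>K. h j (Y n j \<omega>))" for n \<omega>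
    define W where "W \<omega> = (\<Prod>j\<in>K. h j (Z j \<omega>))" for \<omega>
    define S where "S c n \<omega> = (\<Sum>j\<in>J. c j * Y n j \<omega>)" for c n \<omega>
    define T where "T c \<omega> = (\<Sum>j\<in>J. c j * Z j \<omega>)" for c \<omega>
    have wm [measurable]: "w n \<in> borel_measurable M" "S c n \<in> borel_measurable M" "Y n k \<in> borel_measurable M" for c n
      unfolding w_def S_def using hm Y KJ kJ
      by (auto intro!: borel_measurable_prod borel_measurable_sum borel_measurable_times intro: measurable_compose)
    have Wm [measurable]: "W \<in> borel_measurable N" "T c \<in> borel_measurable N" "Z k \<in> borel_measurable N" for c
      unfolding W_def T_def using hm Z KJ kJ
      by (auto intro!: borel_measurable_prod borel_measurable_sum borel_measurable_times intro: measurable_compose)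
    have hkm [measurable]: "h k \<in> borel_measurable borel" using hm by auto
    define C where "C = (\<Prod>j\<in>K. B j)"
    have wb: "1 \<le> w n \<omega> \<and> w n \<omega> \<le> C" for n \<omega>
      unfolding w_def C_def using insert.prems(3)
      by (auto intro!: prod_ge_1 prod_mono) (smt (verit))
    have Wb: "1 \<le> W \<omega> \<and> W \<omega> \<le> C" for \<omega>
      unfolding W_def C_def using insert.prems(3)
      by (auto intro!: prod_ge_1 prod_mono) (smt (verit))
    have IH: "(\<lambda>n. CLINT \<omega>|M. of_real (w n \<omega>) * iexp (S c n \<omega>)) \<longlonglongrightarrow>
         (CLINT \<omega>|N. of_real (W \<omega>) * iexp (T c \<omega>))" for c
      unfolding w_def W_def S_def T_def using insert KJ by auto
    \<comment> \<open>A multiple of \<open>Y n k\<close> in the exponent only changes the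
      coefficient at \<open>k\<close>, so the induction hypothesis covers it.\<close>
    have Sk: "S c n \<omega> + t * Y n k \<omega> = S (\<lambda>j. c j + (if j = k then t else 0)) n \<omega>"
      "T c \<omega>' + t * Z k \<omega>' = T (\<lambda>j. c j + (if j = k then t else 0)) \<omega>'" for c n \<omega> t \<omega>'
      using J kJ by (simp_all add: S_def T_def distrib_right sum.distrib if_distrib[of "\<lambda>a. a * _"] sum.delta cong: if_cong)
    have neg: "- S c n \<omega> = S (\<lambda>j. - c j) n \<omega>" "- T c \<omega>' = T (\<lambda>j. - c j) \<omega>'" for c n \<omega> \<omega>'
      by (simp_all add: S_def T_def sum_negf)
    interpret M: prob_space M by fact
    interpret N: prob_space N by fact
    have aw: "\<bar>w n \<omega>\<bar> \<le> C" "\<bar>W \<omega>'\<bar> \<le> C" for n \<omega> \<omega>'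
      using wb[of n \<omega>] Wb[of \<omega>'] by auto
    have bnd: "integrable M (\<lambda>\<omega>. of_real (w n \<omega>) * iexp (S c n \<omega>))" for n c
      by (rule M.integrable_const_bound[where B=C]) (use aw in \<open>auto simp: norm_mult\<close>)
    have bnd': "integrable N (\<lambda>\<omega>. of_real (W \<omega>) * iexp (T c \<omega>))" for c
      by (rule N.integrable_const_bound[where B=C]) (use aw in \<open>auto simp: norm_mult\<close>)
    note bnd = bnd bnd'
    let ?lim = "\<lambda>v V. (\<lambda>n. LINT \<omega>|M. w n \<omega> * v n \<omega> * h k (Y n k \<omega>)) \<longlonglongrightarrow> (LINT \<omega>|N. W \<omega> * V \<omega> * h k (Z k \<omega>))"
    have wbd: "1 \<le> p * (2 + q) \<and> p * (2 + q) \<le> C * 3" if "1 \<le> p \<and> p \<le> C" "\<bar>q\<bar> \<le> 1" for p q :: real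
      using mult_mono[of 1 p 1 "2 + q"] mult_mono[of p C "2 + q" 3] that by (auto simp: abs_le_iff)
    \<comment> \<open>The exponential is complex and cannot be a weight. Its real part, rotated by
      \<open>z\<close> and raised by 2, lies between 1 and 3 and can.\<close>
    have key: "?lim (\<lambda>n \<omega>. 2 + Re (z * iexp (S c n \<omega>))) (\<lambda>\<omega>. 2 + Re (z * iexp (T c \<omega>)))" if z: "norm z \<le> 1" for z
    proof (rule weighted_levy_continuity[OF M N, where C="C * 3" and B = "B k" and h="h k"
          and w="\<lambda>n \<omega>. w n \<omega> * (2 + Re (z * iexp (S c n \<omega>)))" and U="\<lambda>n \<omega>. Y n k \<omega>"
          and W="\<lambda>\<omega>. W \<omega> * (2 + Re (z * iexp (T c \<omega>)))" and V="\<lambda>\<omega>. Z k \<omega>"])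
      have r: "\<bar>Re (z * iexp x)\<bar> \<le> 1" for x
        using abs_Re_le_cmod[of "z * iexp x"] z by (simp add: norm_mult)
      show "1 \<le> w n \<omega> * (2 + Re (z * iexp (S c n \<omega>))) \<and> w n \<omega> * (2 + Re (z * iexp (S c n \<omega>))) \<le> C * 3" for n \<omega>
        using wbd[OF wb r] .
      show "1 \<le> W \<omega> * (2 + Re (z * iexp (T c \<omega>))) \<and> W \<omega> * (2 + Re (z * iexp (T c \<omega>))) \<le> C * 3" for \<omega>
        using wbd[OF Wb r] .
      show "isCont (h k) x" "norm (h k x) \<le> B k" for x using insert.prems(2,3)[of k x] by auto
      fix t :: real
      define a where "a j = (if j = k then t else 0)" for j
      define c1 where "c1 = (\<lambda>j. c j + a j)"
      define c2 where "c2 = (\<lambda>j. - c j + a j)"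
      have ReE: "complex_of_real (Re x) = (x + cnj x) / 2" for x
        by (simp add: complex_eq_iff)
      \<comment> \<open>Since \<open>Re x = (x + cnj x) / 2\<close>, the tilted integrand is a
        combination of three exponentials, each of the kind treated by the induction
        hypothesis.\<close>
      have eq: "complex_of_real (p * (2 + Re (z * iexp s))) * iexp (t * y) =
         2 * (of_real p * iexp (t * y)) + z / 2 * (of_real p * iexp (s + t * y)) + cnj z / 2 * (of_real p * iexp (- s + t * y))"
        for p s y
      proof -
        have "iexp (s + t * y) = iexp s * iexp (t * y)" "iexp (- s + t * y) = cnj (iexp s) * iexp (t * y)"
          by (simp_all only: of_real_add distrib_left exp_add exp_cnj) simp_all
        then show ?thesis
          unfolding of_real_mult of_real_add ReE
          by (simp only: complex_cnj_mult of_real_numeral) (simp add: algebra_simps add_divide_distrib)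
      qed
      have tS: "t * Y n k \<omega> = S a n \<omega>" "t * Z k \<omega>' = T a \<omega>'" for n \<omega> \<omega>'
        using Sk(1)[of "\<lambda>_. 0" n \<omega> t] Sk(2)[of "\<lambda>_. 0" \<omega>' t] by (simp_all add: S_def T_def a_def)
      have L: "(CLINT \<omega>|M. of_real (w n \<omega> * (2 + Re (z * iexp (S c n \<omega>)))) * iexp (t * Y n k \<omega>)) =
         2 * (CLINT \<omega>|M. of_real (w n \<omega>) * iexp (S a n \<omega>)) + z / 2 * (CLINT \<omega>|M. of_real (w n \<omega>) * iexp (S c1 n \<omega>))
         + cnj z / 2 * (CLINT \<omega>|M. of_real (w n \<omega>) * iexp (S c2 n \<omega>))" for n
        unfolding eq neg Sk c1_def c2_def a_def[symmetric] unfolding tS using bnd by simp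
      have R: "(CLINT \<omega>|N. of_real (W \<omega> * (2 + Re (z * iexp (T c \<omega>)))) * iexp (t * Z k \<omega>)) =
         2 * (CLINT \<omega>|N. of_real (W \<omega>) * iexp (T a \<omega>)) + z / 2 * (CLINT \<omega>|N. of_real (W \<omega>) * iexp (T c1 \<omega>))
         + cnj z / 2 * (CLINT \<omega>|N. of_real (W \<omega>) * iexp (T c2 \<omega>))"
        unfolding eq neg Sk c1_def c2_def a_def[symmetric] unfolding tS using bnd by simp
      show "(\<lambda>n. CLINT \<omega>|M. of_real (w n \<omega> * (2 + Re (z * iexp (S c n \<omega>)))) * iexp (t * Y n k \<omega>)) \<longlonglongrightarrow>
        (CLINT \<omega>|N. of_real (W \<omega> * (2 + Re (z * iexp (T c \<omega>)))) * iexp (t * Z k \<omega>))"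
        unfolding L R by (intro tendsto_intros IH)
    qed measurable
    have hk: "\<bar>h k x\<bar> \<le> B k" for x using insert.prems(3)[of k x] by auto
    have pqr: "\<bar>p * q * r\<bar> \<le> C * B k" if "\<bar>p\<bar> \<le> C" "\<bar>q\<bar> \<le> 1" "\<bar>r\<bar> \<le> B k" for p q r :: real
      using mult_mono[OF mult_mono[OF that(1,2)] that(3)] that by (simp add: abs_mult)
    have ib: "integrable M (\<lambda>\<omega>. w n \<omega> * v \<omega> * h k (Y n k \<omega>))" if "v \<in> borel_measurable M" "\<And>\<omega>. \<bar>v \<omega>\<bar> \<le> 1" for n v
      by (rule M.integrable_const_bound[where B="C * B k"]) (use that(1) pqr[OF aw(1) that(2) hk] in auto)
    have ib': "integrable N (\<lambda>\<omega>. W \<omega> * v \<omega> * h k (Z k \<omega>))" if "v \<in> borel_measurable N" "\<And>\<omega>. \<bar>v \<omega>\<bar> \<le> 1" for v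
      by (rule N.integrable_const_bound[where B="C * B k"]) (use that(1) pqr[OF aw(2) that(2) hk] in auto)
    have key': "?lim (\<lambda>n \<omega>. Re (z * iexp (S c n \<omega>))) (\<lambda>\<omega>. Re (z * iexp (T c \<omega>)))" if z: "norm z \<le> 1" for z
    proof -
      have r: "\<bar>Re (z * iexp x)\<bar> \<le> 1" for x
        using abs_Re_le_cmod[of "z * iexp x"] z by (simp add: norm_mult)
      \<comment> \<open>The summand 2 is removed again by subtracting the case \<open>z = 0\<close>
        of \<open>key\<close>.\<close>
      have a1: "(LINT \<omega>|M. w n \<omega> * Re (z * iexp (S c n \<omega>)) * h k (Y n k \<omega>)) =
         (LINT \<omega>|M. w n \<omega> * (2 + Re (z * iexp (S c n \<omega>))) * h k (Y n k \<omega>)) - (LINT \<omega>|M. w n \<omega> * (2 + Re (0 * iexp (S c n \<omega>))) * h k (Y n k \<omega>))" for n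
      proof -
        have i0: "integrable M (\<lambda>\<omega>. w n \<omega> * 1 * h k (Y n k \<omega>))" by (rule ib) auto
        have i1: "integrable M (\<lambda>\<omega>. w n \<omega> * Re (z * iexp (S c n \<omega>)) * h k (Y n k \<omega>))" by (rule ib[OF _ r]) measurable
        have "(LINT \<omega>|M. w n \<omega> * (2 + Re (z * iexp (S c n \<omega>))) * h k (Y n k \<omega>)) = 
          (LINT \<omega>|M. 2 * (w n \<omega> * 1 * h k (Y n k \<omega>)) + w n \<omega> * (Re (z * iexp (S c n \<omega>))) * h k (Y n k \<omega>))"
          by (intro Bochner_Integration.integral_cong) (auto simp: algebra_simps)
        also have "\<dots> = 2 * (LINT \<omega>|M. (w n \<omega> * 1 * h k (Y n k \<omega>))) + (LINT \<omega>|M. w n \<omega> * (Re (z * iexp (S c n \<omega>))) * h k (Y n k \<omega>))"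
          by (subst Bochner_Integration.integral_add) (simp_all only: i0 i1 Bochner_Integration.integrable_mult_right integral_mult_right_zero)
        moreover have "(LINT \<omega>|M. w n \<omega> * (2 + Re (0 * iexp (S c n \<omega>))) * h k (Y n k \<omega>)) = 2 * (LINT \<omega>|M. (w n \<omega> * 1 * h k (Y n k \<omega>)))"
          by (subst integral_mult_right_zero[symmetric]) (simp add: ac_simps)
        ultimately show ?thesis by linarith
      qed
      have a2: "(LINT \<omega>|N. W \<omega> * Re (z * iexp (T c \<omega>)) * h k (Z k \<omega>)) =
         (LINT \<omega>|N. W \<omega> * (2 + Re (z * iexp (T c \<omega>))) * h k (Z k \<omega>)) - (LINT \<omega>|N. W \<omega> * (2 + Re (0 * iexp (T c \<omega>))) * h k (Z k \<omega>))"
      proof -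
        have i0: "integrable N (\<lambda>\<omega>. W \<omega> * 1 * h k (Z k \<omega>))" by (rule ib') auto
        have i1: "integrable N (\<lambda>\<omega>. W \<omega> * Re (z * iexp (T c \<omega>)) * h k (Z k \<omega>))" by (rule ib'[OF _ r]) measurable
        have "(LINT \<omega>|N. W \<omega> * (2 + Re (z * iexp (T c \<omega>))) * h k (Z k \<omega>)) = 
          (LINT \<omega>|N. 2 * (W \<omega> * 1 * h k (Z k \<omega>)) + W \<omega> * (Re (z * iexp (T c \<omega>))) * h k (Z k \<omega>))"
          by (intro Bochner_Integration.integral_cong) (auto simp: algebra_simps)
        also have "\<dots> = 2 * (LINT \<omega>|N. (W \<omega> * 1 * h k (Z k \<omega>))) + (LINT \<omega>|N. W \<omega> * (Re (z * iexp (T c \<omega>))) * h k (Z k \<omega>))"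
          by (subst Bochner_Integration.integral_add) (simp_all only: i0 i1 Bochner_Integration.integrable_mult_right integral_mult_right_zero)
        moreover have "(LINT \<omega>|N. W \<omega> * (2 + Re (0 * iexp (T c \<omega>))) * h k (Z k \<omega>)) = 2 * (LINT \<omega>|N. (W \<omega> * 1 * h k (Z k \<omega>)))"
          by (subst integral_mult_right_zero[symmetric]) (simp add: ac_simps)
        ultimately show ?thesis by linarith
      qed
      show ?thesis unfolding a1 a2 by (intro tendsto_diff key z) auto
    qed
    have icM: "integrable M (\<lambda>\<omega>. of_real (\<Prod>j\<in>insert k K. h j (Y n j \<omega>)) * iexp (S c n \<omega>))" for n
      by (rule M.integrable_const_bound[where B="B k * C"])
        (use insert.hyps hk aw in \<open>auto simp: norm_mult w_def[symmetric] abs_mult intro!: AE_I2 mult_mono order_trans[OF abs_ge_zero hk]\<close>)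
    have icN: "integrable N (\<lambda>\<omega>. of_real (\<Prod>j\<in>insert k K. h j (Z j \<omega>)) * iexp (T c \<omega>))"
      by (rule N.integrable_const_bound[where B="B k * C"])
        (use insert.hyps hk aw in \<open>auto simp: norm_mult W_def[symmetric] abs_mult intro!: AE_I2 mult_mono order_trans[OF abs_ge_zero hk]\<close>)
    have pw: "(\<Prod>j\<in>insert k K. h j (Y n j \<omega>)) = h k (Y n k \<omega>) * w n \<omega>"
      "(\<Prod>j\<in>insert k K. h j (Z j \<omega>')) = h k (Z k \<omega>') * W \<omega>'" for n \<omega> \<omega>'
      using insert.hyps by (simp_all add: w_def W_def)
    have ReM: "Re (z * (CLINT \<omega>|M. of_real (\<Prod>j\<in>insert k K. h j (Y n j \<omega>)) * iexp (S c n \<omega>))) =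
        (LINT \<omega>|M. w n \<omega> * Re (z * iexp (S c n \<omega>)) * h k (Y n k \<omega>))" for n z
      unfolding integral_mult_right_zero[symmetric]
      by (subst integral_Re[OF integrable_mult_right[OF icM], symmetric])
        (auto intro!: Bochner_Integration.integral_cong simp del: prod.insert simp add: pw algebra_simps)
    have ReN: "Re (z * (CLINT \<omega>|N. of_real (\<Prod>j\<in>insert k K. h j (Z j \<omega>)) * iexp (T c \<omega>))) =
        (LINT \<omega>|N. W \<omega> * Re (z * iexp (T c \<omega>)) * h k (Z k \<omega>))" for z
      unfolding integral_mult_right_zero[symmetric]
      by (subst integral_Re[OF integrable_mult_right[OF icN], symmetric])
        (auto intro!: Bochner_Integration.integral_cong simp del: prod.insert simp add: pw algebra_simps)
    have "(\<lambda>n. Re (z * (CLINT \<omega>|M. of_real (\<Prod>j\<in>insert k K. h j (Y n j \<omega>)) * iexp (S c n \<omega>)))) \<longlonglongrightarrow>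
        Re (z * (CLINT \<omega>|N. of_real (\<Prod>j\<in>insert k K. h j (Z j \<omega>)) * iexp (T c \<omega>)))" if "norm z \<le> 1" for z
      unfolding ReM ReN by (rule key'[OF that])
    \<comment> \<open>The choices \<open>1\<close> and \<open>-\<i>\<close> for \<open>z\<close>
      give the real and the imaginary part.\<close>
    from this[of 1] this[of "-\<i>"] show ?case
      unfolding S_def[symmetric] T_def[symmetric] tendsto_complex_iff[of _ "CLINT \<omega>|N. _ \<omega>"]
      by simp
  qed
qed

text \<open>The factors are bounded below by 1 so that they can serve as weights in
  \<open>weighted_levy_continuity\<close>; sums with coefficients of either sign compensate for this.\<close>

inductive_set product_sums :: "'i set \<Rightarrow> (('i \<Rightarrow> real) \<Rightarrow> real) set" for J where
  base: "(\<And>j x. j \<in> J \<Longrightarrow> isCont (h j) x) \<Longrightarrow> (\<And>j x. j \<in> J \<Longrightarrow> 1 \<le> h j x \<and> h j x \<le> B j) \<Longrightarrow>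
    (\<lambda>y. a * (\<Prod>j\<in>J. h j (y j))) \<in> product_sums J"
| add: "f \<in> product_sums J \<Longrightarrow> g \<in> product_sums J \<Longrightarrow> (\<lambda>y. f y + g y) \<in> product_sums J"

text \<open>The bounds from below by 1 and from above are stable under products, so that the sums
  form an algebra, as Stone-Weierstrass demands.\<close>

lemma product_sums_mult:
  assumes "f \<in> product_sums J" "g \<in> product_sums J"
  shows "(\<lambda>y. f y * g y) \<in> product_sums J"
  using assms
proof (induction f)
  case f: (base h B a)
  from f.prems f.hyps show ?case
  proof (induction g)
    case g: (base h' B' a')
    have "(\<lambda>y. (a * a') * (\<Prod>j\<in>J. (\<lambda>j x. h j x * h' j x) j (y j))) \<in> product_sums J"
    proof (rule product_sums.base[where B="\<lambda>j. B j * B' j"])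
      fix j x assume j: "j \<in> J"
      show "isCont (\<lambda>x. h j x * h' j x) x"
        using f g j by (intro continuous_intros) auto
      have "1 \<le> h j x" "h j x \<le> B j" "1 \<le> h' j x" "h' j x \<le> B' j" using f g j by auto
      then show "1 \<le> h j x * h' j x \<and> h j x * h' j x \<le> B j * B' j"
        using mult_mono[of 1 "h j x" 1 "h' j x"] by (auto intro!: mult_mono)
    qed
    then show ?case by (simp add: prod.distrib ac_simps)
  next
    case (add f' g')
    then show ?case
      using product_sums.add by (fastforce simp: algebra_simps)
  qed
next
  case (add f' g')
  then show ?case using product_sums.add[OF add.IH] by (simp add: algebra_simps)
qed

lemma product_sums_const: "(\<lambda>_. c) \<in> product_sums J"
  using product_sums.base[of J "\<lambda>_ _. 1" "\<lambda>_. 1" c] by simp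

text \<open>An approximant from Stone-Weierstrass is controlled only on a cube. After clamping, its
  values off the cube are values taken on the cube, so they inherit the bound on
  \<open>g\<close>.\<close>

lemma product_sums_clamp:
  assumes "f \<in> product_sums J" "L \<ge> (0::real)"
  shows "(\<lambda>y. f (\<lambda>j\<in>J. max (- L) (min L (y j)))) \<in> product_sums J"
  using assms(1)
proof induction
  case (base h B a)
  have "(\<lambda>y. a * (\<Prod>j\<in>J. (\<lambda>j x. h j (max (- L) (min L x))) j (y j))) \<in> product_sums J"
  proof (rule product_sums.base[where B=B])
    fix j x assume j: "j \<in> J"
    have c: "continuous_on UNIV (h j)" using base j by (auto simp: continuous_on_eq_continuous_at)
    have "continuous_on UNIV (\<lambda>x. h j (max (- L) (min L x)))"
      by (intro continuous_on_compose2[OF c] continuous_intros) auto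
    then show "isCont (\<lambda>x. h j (max (- L) (min L x))) x"
      by (auto simp: continuous_on_eq_continuous_at)
  qed (use base in auto)
  then show ?case by (simp cong: prod.cong)
qed (auto intro: product_sums.add)

lemma product_sums_bounded:
  assumes "f \<in> product_sums J" shows "\<exists>C. \<forall>y. \<bar>f y\<bar> \<le> C"
  using assms
proof induction
  case (base h B a)
  have "\<bar>a * (\<Prod>j\<in>J. h j (y j))\<bar> \<le> \<bar>a\<bar> * (\<Prod>j\<in>J. B j)" for y
    unfolding abs_mult abs_prod
    by (intro mult_left_mono prod_mono) (use base in \<open>auto simp: abs_le_iff, (smt (verit))\<close>)
  then show ?case by blast
next
  case (add f g)
  then obtain C D where "\<forall>y. \<bar>f y\<bar> \<le> C" "\<forall>y. \<bar>g y\<bar> \<le> D" by auto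
  then have "\<forall>y. \<bar>f y + g y\<bar> \<le> C + D" by (meson abs_triangle_ineq add_mono order_trans)
  then show ?case by blast
qed

lemma product_sums_measurable:
  assumes "f \<in> product_sums J" and Y: "\<And>j. j \<in> J \<Longrightarrow> Y j \<in> borel_measurable M"
  shows "(\<lambda>\<omega>. f (\<lambda>j\<in>J. Y j \<omega>)) \<in> borel_measurable M"
  using assms(1)
proof induction
  case (base h B a)
  have "(\<lambda>\<omega>. h j (Y j \<omega>)) \<in> borel_measurable M" if "j \<in> J" for j
  proof -
    have "h j \<in> borel_measurable borel"
      using base(1)[OF that] by (intro borel_measurable_continuous_onI continuous_at_imp_continuous_on) auto
    then show ?thesis using Y[OF that] by (rule measurable_compose_rev)
  qed
  then have "(\<lambda>\<omega>. a * (\<Prod>j\<in>J. h j (Y j \<omega>))) \<in> borel_measurable M"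
    by (intro borel_measurable_times borel_measurable_prod) auto
  then show ?case by (simp cong: prod.cong)
qed auto

lemma product_sums_convergence:
  fixes Y :: "nat \<Rightarrow> 'i \<Rightarrow> 'w \<Rightarrow> real" and Z :: "'i \<Rightarrow> 'v \<Rightarrow> real"
  assumes M: "prob_space M" and N: "prob_space N" and J: "finite J"
    and Y: "\<And>n j. j \<in> J \<Longrightarrow> Y n j \<in> borel_measurable M"
    and Z: "\<And>j. j \<in> J \<Longrightarrow> Z j \<in> borel_measurable N"
    and cf: "\<And>c. (\<lambda>n. CLINT \<omega>|M. iexp (\<Sum>j\<in>J. c j * Y n j \<omega>)) \<longlonglongrightarrow> (CLINT \<omega>|N. iexp (\<Sum>j\<in>J. c j * Z j \<omega>))"
    and f: "f \<in> product_sums J"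
  shows "(\<lambda>n. LINT \<omega>|M. f (\<lambda>j\<in>J. Y n j \<omega>)) \<longlonglongrightarrow> (LINT \<omega>|N. f (\<lambda>j\<in>J. Z j \<omega>))"
  using f
proof induction
  case (base h B a)
  \<comment> \<open>The exponential was needed only inside the induction; zero coefficients switch
    it off.\<close>
  have "(\<lambda>n. CLINT \<omega>|M. of_real (\<Prod>j\<in>J. h j (Y n j \<omega>)) * iexp (\<Sum>j\<in>J. 0 * Y n j \<omega>)) \<longlonglongrightarrow>
         (CLINT \<omega>|N. of_real (\<Prod>j\<in>J. h j (Z j \<omega>)) * iexp (\<Sum>j\<in>J. 0 * Z j \<omega>))"
    by (rule product_test_convergence[OF M N J Y Z cf]) (use base in auto)
  then have "(\<lambda>n. complex_of_real (LINT \<omega>|M. (\<Prod>j\<in>J. h j (Y n j \<omega>)))) \<longlonglongrightarrow> of_real (LINT \<omega>|N. (\<Prod>j\<in>J. h j (Z j \<omega>)))"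
    by (simp del: of_real_prod add: integral_complex_of_real)
  then have "(\<lambda>n. LINT \<omega>|M. (\<Prod>j\<in>J. h j (Y n j \<omega>))) \<longlonglongrightarrow> (LINT \<omega>|N. (\<Prod>j\<in>J. h j (Z j \<omega>)))"
    by (subst (asm) tendsto_of_real_iff)
  then show ?case by (auto intro!: tendsto_mult cong: prod.cong)
next
  case (add f g)
  interpret M: prob_space M by fact
  interpret N: prob_space N by fact
  have iM: "integrable M (\<lambda>\<omega>. u (\<lambda>j\<in>J. Y n j \<omega>))" if u: "u \<in> product_sums J" for u n
  proof -
    obtain C where "\<forall>y. \<bar>u y\<bar> \<le> C" using product_sums_bounded[OF u] by blast
    then show ?thesis by (intro M.integrable_const_bound[where B=C] product_sums_measurable[OF u Y]) auto
  qed
  have iN: "integrable N (\<lambda>\<omega>. u (\<lambda>j\<in>J. Z j \<omega>))" if u: "u \<in> product_sums J" for u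
  proof -
    obtain C where "\<forall>y. \<bar>u y\<bar> \<le> C" using product_sums_bounded[OF u] by blast
    then show ?thesis by (intro N.integrable_const_bound[where B=C] product_sums_measurable[OF u Z]) auto
  qed
  show ?case using tendsto_add[OF add.IH] by (simp only: Bochner_Integration.integral_add iM iN add.hyps)
qed

text \<open>Stone-Weierstrass on a compact cube. Over a countable index type the product topology is
  metrizable; \<open>product_sums_dense\<close> then removes countability by numbering the finite
  set \<open>J\<close>.\<close>

lemma product_sums_dense_countable:
  fixes g :: "('i::countable \<Rightarrow> real) \<Rightarrow> real"
  assumes J: "finite J" and g: "continuous_map (powertop_real J) euclideanreal g" and e: "e > 0"
  shows "\<exists>f\<in>product_sums J. \<forall>y\<in>extensional J. (\<forall>j\<in>J. \<bar>y j\<bar> \<le> L) \<longrightarrow> \<bar>g y - f y\<bar> < e"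
proof -
  \<comment> \<open>Coordinates outside \<open>J\<close> are frozen at \<open>undefined\<close>,
    which makes the cube of extensional functions a compact subset of the full product.\<close>
  define S where "S = (\<Pi>\<^sub>E j\<in>UNIV. if j \<in> J then {-L..L} else {undefined::real})"
  have S: "S = {y \<in> extensional J. \<forall>j\<in>J. \<bar>y j\<bar> \<le> L}"
    by (auto simp: S_def PiE_iff extensional_def abs_le_iff split: if_splits) (smt (verit))+
  have "compactin (product_topology (\<lambda>_::'i. euclideanreal) UNIV) S"
    unfolding S_def compactin_PiE by auto
  then have cS: "compact S" by (simp add: euclidean_product_topology)
  have "continuous_map (top_of_set S) (powertop_real J) (\<lambda>y. y)"
    unfolding continuous_map_componentwise
  proof (intro conjI ballI)
    show "(\<lambda>y. y) ` topspace (top_of_set S) \<subseteq> extensional J" by (auto simp: S)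
    show "continuous_map (top_of_set S) euclideanreal (\<lambda>y. y j)" for j
      by (simp add: continuous_on_subset[OF continuous_on_product_coordinates])
  qed
  then have gS: "continuous_on S g"
    using continuous_map_compose[OF _ g, of "top_of_set S" "\<lambda>y. y"] by (simp add: o_def)
  have cont: "continuous_on S f" if "f \<in> product_sums J" for f
    using that
  proof induction
    case (base h B a)
    have "continuous_on S (\<lambda>y. h j (y j))" if "j \<in> J" for j
    proof (rule continuous_on_compose2[of UNIV "h j" S "\<lambda>y. y j"])
      show "continuous_on UNIV (h j)" using base(1)[OF that] by (auto simp: continuous_on_eq_continuous_at)
    qed (auto intro: continuous_on_subset[OF continuous_on_product_coordinates])
    then show ?case by (intro continuous_intros) auto
  qed (intro continuous_intros)
  have sep: "\<exists>f\<in>product_sums J. f x \<noteq> f y" if xy: "x \<in> S" "y \<in> S" "x \<noteq> y" for x y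
  proof -
    from xy(3) obtain j where "x j \<noteq> y j" by auto
    with xy have j: "j \<in> J" "x j \<noteq> y j" by (auto simp: S extensional_def)
    have b: "- 2 < arctan z" "arctan z < 2" for z
      using arctan_lbound[of z] arctan_ubound[of z] pi_half_less_two by auto
    \<comment> \<open>Points are separated by an injective function of one coordinate;
      \<open>3 + arctan\<close> is injective and has values between 1 and 5, as \<open>base\<close>
      requires.\<close>
    define F where "F y = 1 * (\<Prod>i\<in>J. (\<lambda>i z. if i = j then 3 + arctan z else 1) i (y i))" for y
    have "F \<in> product_sums J"
      unfolding F_def
    proof (rule product_sums.base[where B="\<lambda>_. 5"])
      fix i and x :: real
      show "isCont (\<lambda>z. if i = j then 3 + arctan z else 1) x"
        by (cases "i = j") (auto intro!: continuous_intros)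
      show "1 \<le> (if i = j then 3 + arctan x else 1) \<and> (if i = j then 3 + arctan x else 1) \<le> 5"
        using b[of x] by auto
    qed
    moreover have "F z = 3 + arctan (z j)" for z
      using j J by (simp add: F_def prod.delta)
    then have "F x \<noteq> F y" using j by (simp add: arctan_eq_iff)
    ultimately show ?thesis by blast
  qed
  interpret function_ring_on "product_sums J" S
    by (rule function_ring_on.intro) (use cS cont sep product_sums.add product_sums_mult product_sums_const in auto)
  from Stone_Weierstrass_basic[OF gS e] show ?thesis by (auto simp: S)
qed

lemma product_sums_reindex:
  assumes "f \<in> product_sums K" and \<phi>: "bij_betw \<phi> K J"
  shows "(\<lambda>y. f (\<lambda>k\<in>K. y (\<phi> k))) \<in> product_sums J"
  using assms(1)
proof induction
  case (base h B a)
  have inv: "inv_into K \<phi> j \<in> K" if "j \<in> J" for j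
    using bij_betw_apply[OF bij_betw_inv_into[OF \<phi>] that] .
  have "(\<lambda>y. a * (\<Prod>j\<in>J. h (inv_into K \<phi> j) (y j))) \<in> product_sums J"
    by (rule product_sums.base[where B="\<lambda>j. B (inv_into K \<phi> j)"]) (use base inv in auto)
  moreover have "(\<Prod>j\<in>J. h (inv_into K \<phi> j) (y j)) = (\<Prod>k\<in>K. h k (y (\<phi> k)))" for y
    using \<phi> by (subst prod.reindex_bij_betw[OF \<phi>, symmetric]) (auto simp: bij_betw_def intro!: prod.cong)
  ultimately show ?case by (simp cong: prod.cong)
qed (auto intro: product_sums.add)

lemma product_sums_dense:
  fixes g :: "('i \<Rightarrow> real) \<Rightarrow> real"
  assumes J: "finite J" and g: "continuous_map (powertop_real J) euclideanreal g" and e: "e > 0"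
  shows "\<exists>f\<in>product_sums J. \<forall>y\<in>extensional J. (\<forall>j\<in>J. \<bar>y j\<bar> \<le> L) \<longrightarrow> \<bar>g y - f y\<bar> < e"
proof -
  define K where "K = {0..<card J}"
  obtain \<phi> where \<phi>: "bij_betw \<phi> K J"
    using ex_bij_betw_nat_finite[OF J] by (auto simp: K_def)
  let ?i = "inv_into K \<phi>"
  have inv: "?i j \<in> K" "\<phi> (?i j) = j" if "j \<in> J" for j
    using bij_betw_apply[OF bij_betw_inv_into[OF \<phi>] that] bij_betw_inv_into_right[OF \<phi> that] by auto
  have "continuous_map (powertop_real K) (powertop_real J) (\<lambda>z. \<lambda>j\<in>J. z (?i j))"
    unfolding continuous_map_componentwise
  proof (intro conjI ballI)
    fix j assume "j \<in> J"
    then show "continuous_map (powertop_real K) euclideanreal (\<lambda>z. (\<lambda>j\<in>J. z (?i j)) j)"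
      using continuous_map_product_projection[OF inv(1)[of j], of "\<lambda>_. euclideanreal"] by simp
  qed auto
  from continuous_map_compose[OF this g]
  have "continuous_map (powertop_real K) euclideanreal (\<lambda>z. g (\<lambda>j\<in>J. z (?i j)))" by (simp add: o_def)
  from product_sums_dense_countable[OF _ this e, of L] obtain f where f: "f \<in> product_sums K"
    and fg: "\<And>y. y \<in> extensional K \<Longrightarrow> (\<forall>k\<in>K. \<bar>y k\<bar> \<le> L) \<Longrightarrow> \<bar>g (\<lambda>j\<in>J. y (?i j)) - f y\<bar> < e"
    by (auto simp: K_def)
  show ?thesis
  proof (intro bexI[OF _ product_sums_reindex[OF f \<phi>]] ballI impI)
    fix y assume y: "y \<in> extensional J" "\<forall>j\<in>J. \<bar>y j\<bar> \<le> L"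
    have "(\<lambda>j\<in>J. (\<lambda>k\<in>K. y (\<phi> k)) (?i j)) = y"
      using y(1) inv by (auto simp: fun_eq_iff extensional_def)
    then show "\<bar>g y - f (\<lambda>k\<in>K. y (\<phi> k))\<bar> < e"
      using fg[of "\<lambda>k\<in>K. y (\<phi> k)"] y \<phi> by (auto simp: bij_betw_def)
  qed
qed

text \<open>The function \<open>g\<close> is replaced by a clamped approximant \<open>f'\<close>
  from \<open>product_sums\<close>. The error is dominated by \<open>u\<close>, which belongs to
  \<open>product_sums\<close> as well. Its mean under \<open>Y n\<close> therefore converges to its
  mean under \<open>Z\<close>, which is small for a large cube, and tightness of the laws of
  \<open>Y n\<close> comes for free.\<close>

proposition continuous_test_convergence:
  fixes Y :: "nat \<Rightarrow> 'i \<Rightarrow> 'w \<Rightarrow> real" and Z :: "'i \<Rightarrow> 'v \<Rightarrow> real"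
  assumes M: "prob_space M" and N: "prob_space N" and J: "finite J"
    and Y: "\<And>n j. j \<in> J \<Longrightarrow> Y n j \<in> borel_measurable M"
    and Z: "\<And>j. j \<in> J \<Longrightarrow> Z j \<in> borel_measurable N"
    and cf: "\<And>c. (\<lambda>n. CLINT \<omega>|M. iexp (\<Sum>j\<in>J. c j * Y n j \<omega>)) \<longlonglongrightarrow> (CLINT \<omega>|N. iexp (\<Sum>j\<in>J. c j * Z j \<omega>))"
    and g: "continuous_map (powertop_real J) euclideanreal g" and gb: "bounded (g ` topspace (powertop_real J))"
  shows "(\<lambda>n. LINT \<omega>|M. g (\<lambda>j\<in>J. Y n j \<omega>)) \<longlonglongrightarrow> (LINT \<omega>|N. g (\<lambda>j\<in>J. Z j \<omega>))"
proof -
  interpret M: prob_space M by fact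
  interpret N: prob_space N by fact
  from gb obtain B where B: "B > 0" "\<And>y. y \<in> extensional J \<Longrightarrow> \<bar>g y\<bar> \<le> B"
    unfolding bounded_pos by (auto simp: PiE_def)
  \<comment> \<open>Measurability of the composition is not immediate, since \<open>g\<close> is
    continuous only for a product topology on a function space. It is a pointwise limit of
    compositions with members of \<open>product_sums\<close>, accurate on growing cubes.\<close>
  have gmeas: "(\<lambda>\<omega>. g (\<lambda>j\<in>J. U j \<omega>)) \<in> borel_measurable Q"
    if U: "\<And>j. j \<in> J \<Longrightarrow> U j \<in> borel_measurable Q" for U :: "'i \<Rightarrow> 'q \<Rightarrow> real" and Q
  proof -
    have "\<exists>f. \<forall>n. f n \<in> product_sums J \<and>
        (\<forall>y\<in>extensional J. (\<forall>j\<in>J. \<bar>y j\<bar> \<le> real n) \<longrightarrow> \<bar>g y - f n y\<bar> < inverse (Suc n))"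
      using product_sums_dense[OF J g] by (intro choice) (meson inverse_positive_iff_positive of_nat_0_less_iff zero_less_Suc)
    then obtain f where f: "\<And>n. f n \<in> product_sums J"
      and fg: "\<And>n y. y \<in> extensional J \<Longrightarrow> (\<forall>j\<in>J. \<bar>y j\<bar> \<le> real n) \<Longrightarrow> \<bar>g y - f n y\<bar> < inverse (Suc n)"
      by blast
    show ?thesis
    proof (rule borel_measurable_LIMSEQ_real)
      show "(\<lambda>\<omega>. f n (\<lambda>j\<in>J. U j \<omega>)) \<in> borel_measurable Q" for n
        by (rule product_sums_measurable[OF f U])
      fix \<omega>
      let ?y = "\<lambda>j\<in>J. U j \<omega>"
      obtain m where m: "(\<Sum>j\<in>J. \<bar>?y j\<bar>) \<le> real m" using real_arch_simple by blast
      have "\<bar>?y j\<bar> \<le> real n" if "j \<in> J" "n \<ge> m" for j n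
        using member_le_sum[of j J "\<lambda>j. \<bar>?y j\<bar>"] J m that by auto
      then have "\<bar>g ?y - f n ?y\<bar> < inverse (Suc n)" if "n \<ge> m" for n
        using that by (intro fg) auto
      then have "\<forall>\<^sub>F n in sequentially. norm (f n ?y - g ?y) \<le> inverse (Suc n)"
        by (intro eventually_sequentiallyI[of m]) (simp add: abs_minus_commute less_imp_le del: of_nat_Suc)
      from Lim_null_comparison[OF this LIMSEQ_inverse_real_of_nat]
      show "(\<lambda>n. f n ?y) \<longlonglongrightarrow> g ?y" by (rule LIM_zero_cancel)
    qed
  qed
  show ?thesis
  proof (rule tendstoI)
    fix e :: real assume e: "e > 0"
    \<comment> \<open>The final estimate collects two errors below \<open>4 * d\<close> and one
      below \<open>d\<close>.\<close>
    define d where "d = e / 12"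
    have d: "d > 0" using e by (simp add: d_def)
    \<comment> \<open>A continuous substitute for the indicator of leaving the cube: it vanishes
      while all coordinates are at most \<open>L\<close> in modulus and is at least 1 once one of
      them exceeds \<open>L + 1\<close>.\<close>
    define h where "h L y = (\<Sum>j\<in>J. min 1 (max 0 (\<bar>y j\<bar> - L)))" for L :: real and y :: "'i \<Rightarrow> real"
    have hnn: "0 \<le> h L y" for L y by (auto simp: h_def intro!: sum_nonneg)
    have hm: "(\<lambda>\<omega>. h L (\<lambda>j\<in>J. U j \<omega>)) \<in> borel_measurable Q"
      if U: "\<And>j. j \<in> J \<Longrightarrow> U j \<in> borel_measurable Q" for U :: "'i \<Rightarrow> 'q \<Rightarrow> real" and Q L
      unfolding h_def using U by (intro borel_measurable_sum borel_measurable_min borel_measurable_max) auto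
    have hS: "(\<lambda>y. h L y) \<in> product_sums J" for L
    proof -
      have "(\<lambda>y. (\<Sum>j\<in>K. min 1 (max 0 (\<bar>y j\<bar> - L)))) \<in> product_sums J" if "K \<subseteq> J" for K
        using finite_subset[OF that J] that
      proof (induction K rule: finite_induct)
        case (insert k K)
        \<comment> \<open>Adding 1 lifts the factor into the range from 1 to 2; the constant is
          subtracted below.\<close>
        have "(\<lambda>y. 1 * (\<Prod>j\<in>J. (\<lambda>j z. if j = k then 1 + min 1 (max 0 (\<bar>z\<bar> - L)) else 1) j (y j))) \<in> product_sums J"
        proof (rule product_sums.base[where B="\<lambda>_. 2"])
          show "isCont (\<lambda>z. if j = k then 1 + min 1 (max 0 (\<bar>z\<bar> - L)) else 1) x" for j x
            by (cases "j = k") (auto intro!: continuous_intros)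
        qed auto
        then have "(\<lambda>y. 1 + min 1 (max 0 (\<bar>y k\<bar> - L))) \<in> product_sums J"
          using insert.prems J by (simp add: prod.delta)
        from product_sums.add[OF product_sums.add[OF this product_sums_const[of "-1"]] insert.IH] show ?case
          using insert by simp
      qed (simp add: product_sums_const)
      then show ?thesis unfolding h_def by auto
    qed
    have "(\<lambda>l. LINT \<omega>|N. h (real l) (\<lambda>j\<in>J. Z j \<omega>)) \<longlonglongrightarrow> (LINT \<omega>|N. 0)"
    proof (rule integral_dominated_convergence[where w="\<lambda>_. real (card J)"])
      show "AE \<omega> in N. (\<lambda>l. h (real l) (\<lambda>j\<in>J. Z j \<omega>)) \<longlonglongrightarrow> 0"
      proof (rule AE_I2)
        fix \<omega>
        have "(\<lambda>l. min 1 (max 0 (\<bar>x\<bar> - real l))) \<longlonglongrightarrow> 0" for x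
        proof (rule tendsto_eventually)
          obtain l0 where "\<bar>x\<bar> \<le> real l0" using real_arch_simple by blast
          then show "\<forall>\<^sub>F l in sequentially. min 1 (max 0 (\<bar>x\<bar> - real l)) = 0"
            by (intro eventually_sequentiallyI[of l0]) auto
        qed
        then have "(\<lambda>l. \<Sum>j\<in>J. min 1 (max 0 (\<bar>(\<lambda>j\<in>J. Z j \<omega>) j\<bar> - real l))) \<longlonglongrightarrow> (\<Sum>j\<in>J. 0)"
          by (intro tendsto_sum)
        then show "(\<lambda>l. h (real l) (\<lambda>j\<in>J. Z j \<omega>)) \<longlonglongrightarrow> 0" by (simp add: h_def)
      qed
      show "AE \<omega> in N. norm (h (real l) (\<lambda>j\<in>J. Z j \<omega>)) \<le> real (card J)" for l
        using hnn sum_bounded_above[of J "\<lambda>j. min 1 (max 0 (\<bar>(\<lambda>j\<in>J. Z j \<omega>) j\<bar> - real l))" 1 for \<omega>]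
        by (intro AE_I2) (simp add: h_def abs_of_nonneg sum_nonneg)
    qed (use hm[OF Z] in auto)
    then have "\<forall>\<^sub>F l in sequentially. norm (LINT \<omega>|N. h (real l) (\<lambda>j\<in>J. Z j \<omega>)) < d / B"
      using d B by (intro order_tendstoD(2)[OF tendsto_norm_zero]) auto
    then obtain l where "norm (LINT \<omega>|N. h (real l) (\<lambda>j\<in>J. Z j \<omega>)) < d / B"
      by (auto simp: eventually_sequentially)
    then have l: "(LINT \<omega>|N. h (real l) (\<lambda>j\<in>J. Z j \<omega>)) < d / B" by simp
    define L where "L = real l + 1"
    have L0: "L \<ge> 0" by (simp add: L_def)
    \<comment> \<open>Accuracy at most \<open>B\<close> keeps \<open>f'\<close> below
      \<open>2 * B\<close> in modulus everywhere, whence the factor \<open>3 * B\<close> in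
      \<open>u\<close> for points off the cube.\<close>
    define d' where "d' = min d B"
    have d': "d' > 0" "d' \<le> d" "d' \<le> B" using d B by (auto simp: d'_def)
    obtain f where f: "f \<in> product_sums J"
      and fg: "\<And>y. y \<in> extensional J \<Longrightarrow> (\<forall>j\<in>J. \<bar>y j\<bar> \<le> L) \<Longrightarrow> \<bar>g y - f y\<bar> < d'"
      using product_sums_dense[OF J g d'(1), of L] by blast
    define f' where "f' = (\<lambda>y. f (\<lambda>j\<in>J. max (- L) (min L (y j))))"
    have f': "f' \<in> product_sums J" unfolding f'_def by (rule product_sums_clamp[OF f L0])
    define u where "u y = 3 * B * h (real l) y + d" for y
    have uS: "u \<in> product_sums J"
      unfolding u_def using product_sums.add[OF product_sums_mult[OF product_sums_const hS] product_sums_const] .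
    have gf: "\<bar>g y - f' y\<bar> \<le> u y" if y: "y \<in> extensional J" for y
    proof (cases "\<forall>j\<in>J. \<bar>y j\<bar> \<le> L")
      case True
      then have "(\<lambda>j\<in>J. max (- L) (min L (y j))) = y"
        using y by (auto simp: fun_eq_iff extensional_def abs_le_iff)
      then show ?thesis using fg[OF y True] d' hnn[of "real l" y] B(1)
        unfolding f'_def u_def by (smt (verit) mult_nonneg_nonneg)
    next
      case False
      then obtain j where j: "j \<in> J" "\<bar>y j\<bar> > L" by auto
      let ?c = "\<lambda>j\<in>J. max (- L) (min L (y j))"
      have "\<bar>g ?c - f ?c\<bar> < d'" using L0 by (intro fg) auto
      moreover have "\<bar>g ?c\<bar> \<le> B" "\<bar>g y\<bar> \<le> B" using y by (auto intro!: B)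
      moreover have "1 \<le> h (real l) y"
      proof -
        have "1 = min 1 (max 0 (\<bar>y j\<bar> - real l))" using j by (auto simp: L_def)
        also have "\<dots> \<le> h (real l) y" unfolding h_def by (rule member_le_sum) (use j J in auto)
        finally show ?thesis .
      qed
      then have "3 * B \<le> 3 * B * h (real l) y" using B(1) by simp
      ultimately show ?thesis using d d' unfolding f'_def u_def by linarith
    qed
    have diff: "\<bar>(LINT \<omega>|Q. g (\<lambda>j\<in>J. U j \<omega>)) - (LINT \<omega>|Q. f' (\<lambda>j\<in>J. U j \<omega>))\<bar> \<le> (LINT \<omega>|Q. u (\<lambda>j\<in>J. U j \<omega>))"
      if U: "\<And>j. j \<in> J \<Longrightarrow> U j \<in> borel_measurable Q" and Q: "prob_space Q" for U :: "'i \<Rightarrow> 'q \<Rightarrow> real" and Q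
    proof -
      interpret Q: prob_space Q by fact
      have i: "integrable Q (\<lambda>\<omega>. v (\<lambda>j\<in>J. U j \<omega>))" if v: "v \<in> product_sums J" for v
      proof -
        obtain C where "\<forall>y. \<bar>v y\<bar> \<le> C" using product_sums_bounded[OF v] by blast
        then show ?thesis by (intro Q.integrable_const_bound[where B=C] product_sums_measurable[OF v U]) auto
      qed
      have ig: "integrable Q (\<lambda>\<omega>. g (\<lambda>j\<in>J. U j \<omega>))"
        by (rule Q.integrable_const_bound[where B=B]) (auto intro!: B gmeas U)
      have "\<bar>(LINT \<omega>|Q. g (\<lambda>j\<in>J. U j \<omega>)) - (LINT \<omega>|Q. f' (\<lambda>j\<in>J. U j \<omega>))\<bar> = \<bar>LINT \<omega>|Q. g (\<lambda>j\<in>J. U j \<omega>) - f' (\<lambda>j\<in>J. U j \<omega>)\<bar>"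
        using ig i[OF f'] by simp
      also have "\<dots> \<le> (LINT \<omega>|Q. u (\<lambda>j\<in>J. U j \<omega>))"
        by (rule integral_abs_bound[THEN order_trans], rule integral_mono) (use ig i f' uS gf in auto)
      finally show ?thesis .
    qed
    have uZ: "(LINT \<omega>|N. u (\<lambda>j\<in>J. Z j \<omega>)) < 4 * d"
    proof -
      have "integrable N (\<lambda>\<omega>. h (real l) (\<lambda>j\<in>J. Z j \<omega>))"
      proof -
        obtain C where "\<forall>y. \<bar>h (real l) y\<bar> \<le> C" using product_sums_bounded[OF hS] by blast
        then show ?thesis by (intro N.integrable_const_bound[where B=C] product_sums_measurable[OF hS Z]) auto
      qed
      then have "(LINT \<omega>|N. u (\<lambda>j\<in>J. Z j \<omega>)) = 3 * B * (LINT \<omega>|N. h (real l) (\<lambda>j\<in>J. Z j \<omega>)) + d"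
        by (simp add: u_def N.prob_space)
      then show ?thesis using l B(1) by (simp add: field_simps)
    qed
    have conv: "(\<lambda>n. LINT \<omega>|M. v (\<lambda>j\<in>J. Y n j \<omega>)) \<longlonglongrightarrow> (LINT \<omega>|N. v (\<lambda>j\<in>J. Z j \<omega>))" if "v \<in> product_sums J" for v
      using M N J Y Z cf that by (rule product_sums_convergence)
    have dY: "\<bar>(LINT \<omega>|M. g (\<lambda>j\<in>J. Y n j \<omega>)) - (LINT \<omega>|M. f' (\<lambda>j\<in>J. Y n j \<omega>))\<bar> \<le> (LINT \<omega>|M. u (\<lambda>j\<in>J. Y n j \<omega>))" for n
      using Y M by (rule diff)
    have dZ: "\<bar>(LINT \<omega>|N. g (\<lambda>j\<in>J. Z j \<omega>)) - (LINT \<omega>|N. f' (\<lambda>j\<in>J. Z j \<omega>))\<bar> \<le> (LINT \<omega>|N. u (\<lambda>j\<in>J. Z j \<omega>))"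
      using Z N by (rule diff)
    have "\<forall>\<^sub>F n in sequentially. (LINT \<omega>|M. u (\<lambda>j\<in>J. Y n j \<omega>)) < 4 * d"
      using order_tendstoD(2)[OF conv[OF uS] uZ] by simp
    moreover have "\<forall>\<^sub>F n in sequentially. dist (LINT \<omega>|M. f' (\<lambda>j\<in>J. Y n j \<omega>)) (LINT \<omega>|N. f' (\<lambda>j\<in>J. Z j \<omega>)) < d"
      using tendstoD[OF conv[OF f'] d] by simp
    ultimately show "\<forall>\<^sub>F n in sequentially. dist (LINT \<omega>|M. g (\<lambda>j\<in>J. Y n j \<omega>)) (LINT \<omega>|N. g (\<lambda>j\<in>J. Z j \<omega>)) < e"
    proof eventually_elim
      case (elim n)
      then show ?case
        using dY[of n] dZ uZ unfolding dist_real_def d_def by linarith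
    qed
  qed
qed

section \<open>Regularly varying densities\<close>

text \<open>Uniform convergence for slowly varying functions in additive form. Two sets of small measure cannot
  cover an interval, so some \<open>t\<close> controls both \<open>h (x + t) - h x\<close> and \<open>h (x + t) - h (x + c)\<close>.\<close>

lemma additive_uniform_convergence:
  fixes h :: "real \<Rightarrow> real"
  assumes h[measurable]: "h \<in> borel_measurable borel"
    and lim: "\<And>u. ((\<lambda>x. h (x + u) - h x) \<longlongrightarrow> 0) at_top" and e: "e > 0"
  obtains X where "\<And>x c. x \<ge> X \<Longrightarrow> 0 \<le> c \<Longrightarrow> c \<le> 1 \<Longrightarrow> \<bar>h (x + c) - h x\<bar> < e"
proof -
  \<comment> \<open>Offsets range up to 2 so that \<open>{c..2}\<close> has length at least 1 for
    every \<open>c \<le> 1\<close>, more than two exceptional sets of measure below 1/2 can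
    cover.\<close>
  define S where "S x = {t \<in> {0..2}. \<bar>h (x + t) - h x\<bar> \<ge> e / 2}" for x
  have Sm[measurable]: "S x \<in> sets borel" for x unfolding S_def by measurable
  have Sfin: "emeasure lborel (S x) < \<infinity>" for x
  proof -
    have "emeasure lborel (S x) \<le> emeasure lborel {0..2::real}" by (rule emeasure_mono) (auto simp: S_def)
    also have "\<dots> < \<infinity>" by simp
    finally show ?thesis .
  qed
  have "((\<lambda>x. integral\<^sup>L lborel (\<lambda>t. indicat_real (S x) t)) \<longlongrightarrow> integral\<^sup>L lborel (\<lambda>t::real. 0::real)) at_top"
  proof (rule integral_dominated_convergence_at_top[where w="indicat_real {0..2::real}" and s="\<lambda>x t. indicat_real (S x) t"])
    show "\<forall>\<^sub>F x in at_top. AE t in lborel. norm (indicat_real (S x) t) \<le> indicator {0..2} t"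
      by (intro always_eventually allI AE_I2) (auto simp: S_def indicator_def)
    show "AE t in lborel. ((\<lambda>x. indicat_real (S x) t) \<longlongrightarrow> 0) at_top"
    proof (rule AE_I2)
      fix t
      have "\<forall>\<^sub>F x in at_top. norm (h (x + t) - h x) < e / 2"
        using order_tendstoD(2)[OF tendsto_norm[OF lim[of t]], of "e / 2"] e by simp
      then have "\<forall>\<^sub>F x in at_top. indicat_real (S x) t = 0"
        by eventually_elim (auto simp: S_def)
      then show "((\<lambda>x. indicat_real (S x) t) \<longlongrightarrow> 0) at_top" by (rule tendsto_eventually)
    qed
  qed (simp_all add: integrable_real_indicator)
  then have "((\<lambda>x. \<integral>t. indicat_real (S x) t \<partial>lborel) \<longlongrightarrow> 0) at_top" by (simp only: integral_zero)
  then have "\<forall>\<^sub>F x in at_top. (\<integral>t. indicat_real (S x) t \<partial>lborel) < 1 / 2" by (rule order_tendstoD) simp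
  then obtain X where X: "\<And>x. x \<ge> X \<Longrightarrow> (\<integral>t. indicat_real (S x) t \<partial>lborel) < 1 / 2"
    unfolding eventually_at_top_linorder by blast
  show ?thesis
  proof
    fix x c assume x: "x \<ge> X" and c: "0 \<le> c" "c \<le> (1::real)"
    define S' where "S' = {t. t - c \<in> S (x + c)}"
    have S'm: "S' \<in> sets borel" unfolding S'_def by measurable
    have "emeasure lborel S' = emeasure (distr lborel borel ((+) c)) S'" by (simp add: lborel_distr_plus)
    also have "\<dots> = emeasure lborel (S (x + c))" using S'm by (simp add: emeasure_distr S'_def vimage_def)
    finally have eq: "emeasure lborel S' = emeasure lborel (S (x + c))" .
    have em: "emeasure lborel (S y) < ennreal (1 / 2)" if "y \<ge> X" for y
    proof -
      have "ennreal (\<integral>t. indicat_real (S y) t \<partial>lborel) = (\<integral>\<^sup>+t. ennreal (indicat_real (S y) t) \<partial>lborel)"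
        by (rule nn_integral_eq_integral[symmetric]) (use Sfin in \<open>auto intro!: integrable_real_indicator\<close>)
      also have "\<dots> = emeasure lborel (S y)" by (simp add: ennreal_indicator)
      finally show ?thesis using ennreal_lessI[OF _ X[OF that]] by (simp only: zero_less_divide_1_iff zero_less_numeral)
    qed
    have "\<exists>t\<in>{c..2}. t \<notin> S x \<and> t \<notin> S'"
    proof (rule ccontr)
      assume "\<not> ?thesis"
      then have "{c..2} \<subseteq> S x \<union> S'" by auto
      then have "emeasure lborel {c..2} \<le> emeasure lborel (S x \<union> S')" by (rule emeasure_mono) (use S'm in simp)
      also have "\<dots> \<le> emeasure lborel (S x) + emeasure lborel S'" by (rule emeasure_subadditive) (use S'm in simp_all)
      also have "\<dots> < ennreal (1 / 2) + ennreal (1 / 2)"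
        unfolding eq using x c by (intro add_strict_mono em) auto
      also have "\<dots> = ennreal 1" by (subst ennreal_plus[symmetric]) auto
      also have "\<dots> \<le> ennreal (2 - c)" using c by (intro ennreal_leI) auto
      finally show False using c by simp
    qed
    then obtain t where t: "c \<le> t" "t \<le> 2" "t \<notin> S x" "t \<notin> S'" by auto
    have "\<bar>h (x + t) - h x\<bar> < e / 2" using t c by (auto simp: S_def)
    moreover have "\<bar>h (x + c + (t - c)) - h (x + c)\<bar> < e / 2" using t c by (auto simp: S'_def S_def)
    then have "\<bar>h (x + t) - h (x + c)\<bar> < e / 2" by simp
    ultimately show "\<bar>h (x + c) - h x\<bar> < e" by linarith
  qed
qed

text \<open>In the logarithmic variable \<open>h t = ln (l (exp t))\<close> slow variation says that
  increments of \<open>h\<close> vanish at infinity. Uniform convergence bounds an increment over a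
  step of length at most 1 by \<open>e\<close>; chaining such steps gives growth at most
  \<open>e * (\<bar>y - x\<bar> + 1)\<close>, where the extra 1 pays for the last incomplete step
  and becomes the factor \<open>exp e\<close>.\<close>

lemma potter_bound:
  assumes l: "slowly_varying l" and e: "e > 0"
  obtains X where "X > 0" "\<And>x. x \<ge> X \<Longrightarrow> l x > 0"
    "\<And>x y. x \<ge> X \<Longrightarrow> y \<ge> X \<Longrightarrow> l y \<le> exp e * l x * exp (e * \<bar>ln y - ln x\<bar>)"
proof -
  from l obtain x0 where lm: "l \<in> borel_measurable (restrict_space borel {x0..})" and lpos: "\<And>x. x \<ge> x0 \<Longrightarrow> l x > 0"
    and lc: "\<And>c. c > 0 \<Longrightarrow> ((\<lambda>x. l (c * x) / l x) \<longlongrightarrow> 1) at_top" unfolding slowly_varying_def by blast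
  \<comment> \<open>Positivity and measurability of \<open>l\<close> are known only from
    \<open>x0\<close> on; the value 1 elsewhere keeps the logarithm meaningful and does not affect
    the limit.\<close>
  define l' where "l' x = (if x \<in> {x0..} then l x else 1)" for x
  have l'm[measurable]: "l' \<in> borel_measurable borel"
    unfolding l'_def using lm by (subst (asm) measurable_restrict_space_iff[where c=1]) auto
  have l'pos: "l' x > 0" for x using lpos by (auto simp: l'_def)
  define h where "h t = ln (l' (exp t))" for t
  have hm: "h \<in> borel_measurable borel" unfolding h_def by measurable
  have hlim: "((\<lambda>x. h (x + u) - h x) \<longlongrightarrow> 0) at_top" for u
  proof -
    have "((\<lambda>x. l (exp u * x) / l x) \<longlongrightarrow> 1) at_top" by (rule lc) simp
    from filterlim_compose[OF this exp_at_top]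
    have "((\<lambda>x. l (exp u * exp x) / l (exp x)) \<longlongrightarrow> 1) at_top" .
    from tendsto_ln[OF this] have L: "((\<lambda>x. ln (l (exp u * exp x) / l (exp x))) \<longlongrightarrow> 0) at_top" by simp
    have "\<forall>\<^sub>F x in at_top. exp x \<ge> x0" using exp_at_top by (simp add: filterlim_at_top)
    moreover have "\<forall>\<^sub>F x in at_top. exp u * exp x \<ge> x0"
      using filterlim_tendsto_pos_mult_at_top[OF tendsto_const[of "exp u"] _ exp_at_top] by (simp add: filterlim_at_top)
    ultimately have "\<forall>\<^sub>F x in at_top. ln (l (exp u * exp x) / l (exp x)) = h (x + u) - h x"
    proof eventually_elim
      case (elim x)
      have "l (exp u * exp x) > 0" "l (exp x) > 0" using elim lpos by auto
      then show ?case using elim by (simp add: h_def l'_def exp_add mult.commute ln_div)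
    qed
    from tendsto_cong[OF this] L show ?thesis by simp
  qed
  obtain X where X: "\<And>x c. x \<ge> X \<Longrightarrow> 0 \<le> c \<Longrightarrow> c \<le> 1 \<Longrightarrow> \<bar>h (x + c) - h x\<bar> < e"
    using additive_uniform_convergence[OF hm hlim e] by blast
  have step: "\<bar>h y - h x\<bar> \<le> e * real (n + 1)" if "X \<le> x" "x \<le> y" "y \<le> x + real (n + 1)" for x y n
    using that
  proof (induction n arbitrary: y)
    case 0
    then show ?case using X[of x "y - x"] by simp
  next
    case (Suc n)
    \<comment> \<open>One step of length at most 1 back from \<open>y\<close>, without falling below
      \<open>x\<close>.\<close>
    define z where "z = max x (y - 1)"
    have "\<bar>h z - h x\<bar> \<le> e * real (n + 1)" using Suc.prems by (intro Suc.IH) (auto simp: z_def)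
    moreover have "\<bar>h (z + (y - z)) - h z\<bar> < e" using Suc.prems by (intro X) (auto simp: z_def)
    ultimately show ?case by (simp add: algebra_simps)
  qed
  have hb: "\<bar>h y - h x\<bar> \<le> e * (\<bar>y - x\<bar> + 1)" if "X \<le> x" "X \<le> y" for x y
  proof -
    have *: "\<bar>h y - h x\<bar> \<le> e * (y - x + 1)" if "X \<le> x" "x \<le> y" for x y
    proof -
      have "\<bar>h y - h x\<bar> \<le> e * real (nat \<lfloor>y - x\<rfloor> + 1)" using that by (intro step) linarith+
      also have "\<dots> \<le> e * (y - x + 1)" using e that by (intro mult_left_mono) linarith+
      finally show ?thesis .
    qed
    show ?thesis using *[of x y] *[of y x] that by (cases "x \<le> y") (auto simp: abs_minus_commute)
  qed
  show ?thesis
  proof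
    let ?X = "max (exp X) (max x0 1)"
    show "?X > 0" by simp
    show "l x > 0" if "x \<ge> ?X" for x using that lpos by simp
    fix x y assume xy: "x \<ge> ?X" "y \<ge> ?X"
    have pos: "x > 0" "y > 0" "l x > 0" "l y > 0" using xy lpos by auto
    have hx: "h (ln x) = ln (l x)" "h (ln y) = ln (l y)" using xy pos by (auto simp: h_def l'_def)
    have "X \<le> ln x" "X \<le> ln y" using xy pos by (simp_all add: ln_ge_iff)
    from hb[OF this] have "ln (l y) \<le> ln (l x) + e + e * \<bar>ln y - ln x\<bar>" unfolding hx by (simp add: algebra_simps)
    then have "exp (ln (l y)) \<le> exp (ln (l x) + e + e * \<bar>ln y - ln x\<bar>)" by simp
    then show "l y \<le> exp e * l x * exp (e * \<bar>ln y - ln x\<bar>)" using pos by (simp add: exp_add mult.commute)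
  qed
qed

section \<open>Integrals against a regularly varying density\<close>

lemma set_integrable_powr_0_1:
  assumes "a > 0" shows "set_integrable lborel {0<..<1} (\<lambda>x::real. x powr (a - 1))"
proof -
  have "set_integrable lborel (einterval (ereal 0) (ereal 1)) (\<lambda>x::real. x powr (a - 1))"
  proof (rule interval_integral_FTC_nonneg(1)[where F="\<lambda>x. x powr a / a" and A=0 and B="1 / a"])
    show "DERIV (\<lambda>x. x powr a / a) x :> x powr (a - 1)" if "ereal 0 < ereal x" "ereal x < ereal 1" for x
      using that assms by (auto intro!: derivative_eq_intros simp: powr_diff)
    show "isCont (\<lambda>x. x powr (a - 1)) x" if "ereal 0 < ereal x" "ereal x < ereal 1" for x
      using that by (auto intro!: continuous_intros)
    have "((\<lambda>x. x powr a / a) \<longlongrightarrow> 0 powr a / a) (at_right 0)"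
      by (rule tendsto_divide[OF tendsto_powr'[OF tendsto_ident_at tendsto_const]]) (use assms in \<open>auto simp: eventually_at_filter\<close>)
    then show "(((\<lambda>x. x powr a / a) \<circ> real_of_ereal) \<longlongrightarrow> 0) (at_right (ereal 0))"
      by (simp add: ereal_tendsto_simps)
    have "((\<lambda>x. x powr a / a) \<longlongrightarrow> 1 powr a / a) (at_left 1)"
      using assms by (intro tendsto_intros) auto
    then show "(((\<lambda>x. x powr a / a) \<circ> real_of_ereal) \<longlongrightarrow> 1 / a) (at_left (ereal 1))"
      by (simp add: ereal_tendsto_simps)
  qed auto
  then show ?thesis by (simp add: einterval_def greaterThanLessThan_def greaterThan_def lessThan_def Int_def)
qed

lemma set_integrable_powr_1_inf:
  assumes "a > 0" shows "set_integrable lborel {1<..} (\<lambda>x::real. x powr (- a - 1))"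
proof -
  have "set_integrable lborel (einterval (ereal 1) \<infinity>) (\<lambda>x::real. x powr (- a - 1))"
  proof (rule interval_integral_FTC_nonneg(1)[where F="\<lambda>x. - (x powr (- a)) / a" and A="- 1 / a" and B="0"])
    show "DERIV (\<lambda>x. - (x powr (- a)) / a) x :> x powr (- a - 1)" if "ereal 1 < ereal x" "ereal x < \<infinity>" for x
      using that assms by (auto intro!: derivative_eq_intros simp: powr_diff)
    show "isCont (\<lambda>x. x powr (- a - 1)) x" if "ereal 1 < ereal x" "ereal x < \<infinity>" for x
      using that by (auto intro!: continuous_intros)
    have "((\<lambda>x. - (x powr (- a)) / a) \<longlongrightarrow> - (1 powr (- a)) / a) (at_right 1)"
      using assms by (intro tendsto_intros) auto
    then show "(((\<lambda>x. - (x powr (- a)) / a) \<circ> real_of_ereal) \<longlongrightarrow> - 1 / a) (at_right (ereal 1))"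
      by (simp add: ereal_tendsto_simps)
    have "((\<lambda>x. - (x powr (- a)) / a) \<longlongrightarrow> - 0 / a) at_top"
      using assms by (intro tendsto_intros tendsto_neg_powr filterlim_ident) auto
    then show "(((\<lambda>x. - (x powr (- a)) / a) \<circ> real_of_ereal) \<longlongrightarrow> 0) (at_left \<infinity>)"
      by (simp add: ereal_tendsto_simps)
  qed auto
  then show ?thesis by (simp add: einterval_def greaterThan_def)
qed

text \<open>Rescaling the variable by \<open>T n\<close> turns the prefactor and the density into
  \<open>R n\<close>, which tends pointwise to \<open>\<alpha> * x powr (\<alpha> - 1)\<close> by
  regular variation. Potter's bound dominates \<open>R n\<close> only for
  \<open>x < d * T n\<close>, where the argument of \<open>p\<close> is close to 0. Beyond that
  nothing is known about \<open>p\<close> except its finite mass, but there \<open>q\<close> is at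
  most \<open>K / (d * T n)\<close>, and the contribution is of order
  \<open>T n powr (- (1 - \<alpha> - e))\<close>.\<close>

lemma regularly_varying_density_limit:
  fixes q :: "nat \<Rightarrow> real \<Rightarrow> complex" and p l :: "real \<Rightarrow> real"
  assumes \<alpha>: "0 < \<alpha>" "\<alpha> < 1" and l: "slowly_varying l"
    and pm: "p \<in> borel_measurable (restrict_space borel {0<..})" and p0: "\<And>x. x > 0 \<Longrightarrow> p x \<ge> 0"
    and pint: "set_integrable lborel {0<..} p"
    and asymp: "p \<sim>[at_right 0] (\<lambda>x. \<alpha> * l (inverse x) * x powr (\<alpha> - 1))"
    and T: "filterlim T at_top sequentially"
    and qm: "\<And>n. (\<lambda>x. indicator {0<..} x *\<^sub>R q n x) \<in> borel_measurable borel"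
    and Qm: "(\<lambda>x. indicator {0<..} x *\<^sub>R Q x) \<in> borel_measurable borel"
    and qK: "\<And>n x. x > 0 \<Longrightarrow> norm (q n x) \<le> K * min 1 (1 / x)"
    and qQ: "\<And>x. x > 0 \<Longrightarrow> (\<lambda>n. q n x) \<longlonglongrightarrow> Q x"
  shows "(\<lambda>n. of_real (T n powr \<alpha> / l (T n)) * (CLINT x|lborel. indicator {0<..} x *\<^sub>R (of_real (p x) * q n (T n * x))))
    \<longlonglongrightarrow> (CLINT x|lborel. indicator {0<..} x *\<^sub>R (of_real (\<alpha> * x powr (\<alpha> - 1)) * Q x))"
proof -
  \<comment> \<open>Small enough that \<open>x powr (\<alpha> - e - 1)\<close> is integrable at 0
    and \<open>x powr (\<alpha> + e - 2)\<close> at infinity.\<close>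
  define e where "e = min \<alpha> (1 - \<alpha>) / 2"
  have e: "e > 0" "\<alpha> - e > 0" "1 - \<alpha> - e > 0" using \<alpha> by (auto simp: e_def min_def)
  obtain X where X: "X > 0" "\<And>x. x \<ge> X \<Longrightarrow> l x > 0"
    "\<And>x y. x \<ge> X \<Longrightarrow> y \<ge> X \<Longrightarrow> l y \<le> exp e * l x * exp (e * \<bar>ln y - ln x\<bar>)"
    using potter_bound[OF l e(1)] by blast
  have K: "K \<ge> 0" using order_trans[OF norm_ge_zero qK[of 1 0]] by simp
  define p' where "p' x = (if x \<in> {0<..} then p x else 0)" for x
  have p'm[measurable]: "p' \<in> borel_measurable borel"
    unfolding p'_def using pm by (subst (asm) measurable_restrict_space_iff[where c=0]) auto
  have p'0: "p' x \<ge> 0" for x using p0 by (auto simp: p'_def)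
  have p'int: "integrable lborel p'"
  proof -
    have "(\<lambda>x. indicator {0<..} x *\<^sub>R p x) = p'" by (auto simp: p'_def fun_eq_iff indicator_def)
    then show ?thesis using pint by (simp add: set_integrable_def)
  qed
  have asymp': "((\<lambda>x. p x / (\<alpha> * l (inverse x) * x powr (\<alpha> - 1))) \<longlongrightarrow> 1) (at_right 0)"
  proof -
    have pos: "\<forall>\<^sub>F x in at_right 0. x > 0 \<and> inverse x \<ge> X"
    proof -
      have "filterlim inverse at_top (at_right (0::real))" by (rule filterlim_inverse_at_top_right)
      then have "\<forall>\<^sub>F x in at_right 0. inverse x \<ge> X" by (simp add: filterlim_at_top)
      moreover have "\<forall>\<^sub>F x in at_right (0::real). x > 0" by (simp add: eventually_at_right_less)
      ultimately show ?thesis by eventually_elim auto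
    qed
    \<comment> \<open>Asymptotic equivalence reads the quotient 0/0 as 1. Near 0 the comparison
      function is positive, so the ordinary quotient converges.\<close>
    from asymp have "((\<lambda>x. if p x = 0 \<and> \<alpha> * l (inverse x) * x powr (\<alpha> - 1) = 0 then 1 else p x / (\<alpha> * l (inverse x) * x powr (\<alpha> - 1))) \<longlongrightarrow> 1) (at_right 0)"
      by (simp add: asymp_equiv_def)
    moreover have "\<forall>\<^sub>F x in at_right 0. (if p x = 0 \<and> \<alpha> * l (inverse x) * x powr (\<alpha> - 1) = 0 then 1 else p x / (\<alpha> * l (inverse x) * x powr (\<alpha> - 1))) =
        p x / (\<alpha> * l (inverse x) * x powr (\<alpha> - 1))"
      using pos
    proof eventually_elim
      case (elim x)
      then have "\<alpha> * l (inverse x) * x powr (\<alpha> - 1) \<noteq> 0" using X(2)[of "inverse x"] \<alpha> by auto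
      then show ?case by (simp only: simp_thms if_False)
    qed
    ultimately show ?thesis using tendsto_cong by force
  qed
  then have "\<forall>\<^sub>F x in at_right 0. p x / (\<alpha> * l (inverse x) * x powr (\<alpha> - 1)) < 2" by (rule order_tendstoD) simp
  then obtain d0 where d0: "d0 > 0" "\<And>x. 0 < x \<Longrightarrow> x < d0 \<Longrightarrow> p x / (\<alpha> * l (inverse x) * x powr (\<alpha> - 1)) < 2"
    by (auto simp: eventually_at_right_field)
  \<comment> \<open>The bound \<open>1 / X\<close> puts the reciprocal of any \<open>x < d\<close>
    into the range where \<open>l\<close> is positive and Potter's bound holds.\<close>
  define d where "d = min d0 (1 / X)"
  have d: "d > 0" using d0 X by (simp add: d_def)
  have dX: "X \<le> 1 / x" if "0 < x" "x < d" for x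
    using that X(1) by (auto simp: d_def field_simps)
  have pd: "p x \<le> 2 * (\<alpha> * l (1 / x) * x powr (\<alpha> - 1))" if "0 < x" "x < d" for x
  proof -
    have "l (1 / x) > 0" using X(2)[OF dX[OF that]] .
    then have "\<alpha> * l (1 / x) * x powr (\<alpha> - 1) > 0" using \<alpha> that by simp
    moreover have "p x / (\<alpha> * l (1 / x) * x powr (\<alpha> - 1)) < 2" using d0(2)[of x] that by (simp add: d_def inverse_eq_divide)
    ultimately show ?thesis by (simp add: divide_less_eq)
  qed
  have evT: "\<forall>\<^sub>F n in sequentially. T n \<ge> max X 1" using T unfolding filterlim_at_top by blast
  define q' where "q' n x = indicator {0<..} x *\<^sub>R q n x" for n x
  have q'm[measurable]: "q' n \<in> borel_measurable borel" for n unfolding q'_def by (rule qm)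
  have q'K: "norm (q' n x) \<le> K * min 1 (1 / x)" if "x > 0" for n x using qK[OF that] that by (simp add: q'_def)
  define A where "A n = T n powr \<alpha> / l (T n)" for n
  define R where "R n x = A n / T n * p' (x / T n)" for n x
  have subst: "of_real (A n) * (CLINT x|lborel. indicator {0<..} x *\<^sub>R (of_real (p x) * q n (T n * x))) =
      (CLINT x|lborel. of_real (R n x) * q' n x)" if Tn: "T n > 0" for n
  proof -
    have "(CLINT x|lborel. indicator {0<..} x *\<^sub>R (of_real (p x) * q n (T n * x))) =
        \<bar>1 / T n\<bar> *\<^sub>R (CLINT x|lborel. (\<lambda>x. indicator {0<..} x *\<^sub>R (of_real (p x) * q n (T n * x))) (0 + 1 / T n * x))"
      by (rule lborel_integral_real_affine) (use Tn in simp)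
    also have "(CLINT x|lborel. (\<lambda>x. indicator {0<..} x *\<^sub>R (of_real (p x) * q n (T n * x))) (0 + 1 / T n * x)) =
        (CLINT x|lborel. of_real (p' (x / T n)) * q' n x)"
      by (intro Bochner_Integration.integral_cong refl) (use Tn in \<open>auto simp: p'_def q'_def indicator_def zero_less_divide_iff\<close>)
    also have "of_real (A n) * (\<bar>1 / T n\<bar> *\<^sub>R (CLINT x|lborel. of_real (p' (x / T n)) * q' n x)) =
        of_real (A n / T n) * (CLINT x|lborel. of_real (p' (x / T n)) * q' n x)"
      using Tn by (simp add: scaleR_conv_of_real)
    also have "\<dots> = (CLINT x|lborel. of_real (R n x) * q' n x)"
      by (simp add: R_def mult.assoc integral_mult_right_zero[symmetric] del: integral_mult_right_zero)
    finally show ?thesis .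
  qed
  have Rm[measurable]: "R n \<in> borel_measurable borel" for n unfolding R_def by measurable
  have A0: "A n > 0" if "T n \<ge> max X 1" for n
    using X(2)[of "T n"] that by (simp add: A_def)
  have R0: "R n x \<ge> 0" if "T n \<ge> max X 1" for n x
    using A0[OF that] p'0 that by (simp add: R_def)
  \<comment> \<open>The Potter factor \<open>exp (e * \<bar>ln x\<bar>)\<close> is
    \<open>x powr (- e)\<close> below 1 and \<open>x powr e\<close> above, where the decay of
    \<open>q\<close> contributes another \<open>1 / x\<close>. The point 1 has its own summand
    because the domination is proved at every point.\<close>
  define w where "w x = 2 * \<alpha> * K * exp e * (indicator {0<..<1} x * x powr ((\<alpha> - e) - 1) + indicator {1<..} x * x powr (- (1 - \<alpha> - e) - 1) + indicator {1} x)" for x :: real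
  have wint: "integrable lborel w"
    unfolding w_def using set_integrable_powr_0_1[OF e(2)] set_integrable_powr_1_inf[OF e(3)]
    by (intro integrable_mult_right Bochner_Integration.integrable_add) (simp_all add: set_integrable_def integrable_real_indicator)
  have Rw: "norm (of_real (R n x) * q' n x) \<le> w x" if Tn: "T n \<ge> max X 1" and x: "0 < x" "x < d * T n" for n x
  proof -
    have Tp: "T n > 0" "T n \<ge> X" using Tn by auto
    have xT: "0 < x / T n" "x / T n < d" using x Tp by (auto simp: field_simps)
    have lT: "l (T n) > 0" using X(2)[OF Tp(2)] .
    have "R n x \<le> A n / T n * (2 * (\<alpha> * l (1 / (x / T n)) * (x / T n) powr (\<alpha> - 1)))"
      unfolding R_def using pd[OF xT] xT A0[OF Tn] Tp by (intro mult_left_mono) (auto simp: p'_def)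
    also have "\<dots> = 2 * \<alpha> * x powr (\<alpha> - 1) * (l (T n / x) / l (T n))"
    proof -
      have "T n powr \<alpha> / T n * (x / T n) powr (\<alpha> - 1) = x powr (\<alpha> - 1)"
        using Tp x by (simp add: powr_divide powr_diff)
      then show ?thesis by (simp add: A_def divide_simps)
    qed
    also have "\<dots> \<le> 2 * \<alpha> * x powr (\<alpha> - 1) * (exp e * exp (e * \<bar>ln x\<bar>))"
    proof (intro mult_left_mono)
      have "l (T n / x) \<le> exp e * l (T n) * exp (e * \<bar>ln (T n / x) - ln (T n)\<bar>)"
        using dX[OF xT] Tp by (intro X(3)) auto
      also have "\<bar>ln (T n / x) - ln (T n)\<bar> = \<bar>ln x\<bar>" using Tp x by (simp add: ln_div)
      finally show "l (T n / x) / l (T n) \<le> exp e * exp (e * \<bar>ln x\<bar>)" using lT by (simp add: divide_le_eq algebra_simps)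
    qed (use \<alpha> in auto)
    finally have RR: "R n x \<le> 2 * \<alpha> * x powr (\<alpha> - 1) * (exp e * exp (e * \<bar>ln x\<bar>))" .
    have "norm (of_real (R n x) * q' n x) = R n x * norm (q' n x)" using R0[OF Tn] by (simp add: norm_mult)
    also have "\<dots> \<le> (2 * \<alpha> * x powr (\<alpha> - 1) * (exp e * exp (e * \<bar>ln x\<bar>))) * (K * min 1 (1 / x))"
      using RR q'K[OF x(1)] R0[OF Tn] \<alpha> by (intro mult_mono) auto
    also have "\<dots> = 2 * \<alpha> * K * exp e * (x powr (\<alpha> - 1) * exp (e * \<bar>ln x\<bar>) * min 1 (1 / x))"
      by (simp add: algebra_simps)
    also have "x powr (\<alpha> - 1) * exp (e * \<bar>ln x\<bar>) * min 1 (1 / x) =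
      indicator {0<..<1} x * x powr ((\<alpha> - e) - 1) + indicator {1<..} x * x powr (- (1 - \<alpha> - e) - 1) + indicator {1} x"
    proof -
      consider "x < 1" | "x = 1" | "x > 1" by linarith
      then show ?thesis
      proof cases
        case 1
        then have "exp (e * \<bar>ln x\<bar>) = x powr (- e)" using x by (simp add: powr_def)
        then show ?thesis using 1 x by (simp add: powr_add[symmetric] algebra_simps)
      next
        case 3
        then have "exp (e * \<bar>ln x\<bar>) = x powr e" by (simp add: powr_def)
        moreover have "min 1 (1 / x) = x powr (-1)" using 3 by (simp add: powr_minus_divide)
        moreover have "x powr (\<alpha> - 1) * x powr e * x powr (-1) = x powr (- (1 - \<alpha> - e) - 1)"
          unfolding powr_add[symmetric] by (simp add: algebra_simps)
        ultimately show ?thesis using 3 by simp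
      qed simp
    qed
    finally show ?thesis by (simp add: w_def)
  qed
  have main: "(\<lambda>n. CLINT x|lborel. indicator {..<d * T n} x *\<^sub>R (of_real (R n x) * q' n x)) \<longlonglongrightarrow>
      (CLINT x|lborel. indicator {0<..} x *\<^sub>R (of_real (\<alpha> * x powr (\<alpha> - 1)) * Q x))"
  proof (rule tendsto_cong[THEN iffD1])
    \<comment> \<open>Dominated convergence wants a bound for every \<open>n\<close>, but Potter's
      bound is available only once \<open>T n\<close> is large; earlier terms are set to 0.\<close>
    let ?ind = "\<lambda>n x. if T n \<ge> max X 1 then indicator {..<d * T n} x *\<^sub>R (of_real (R n x) * q' n x) else 0"
    show "\<forall>\<^sub>F n in sequentially. (CLINT x|lborel. ?ind n x) = (CLINT x|lborel. indicator {..<d * T n} x *\<^sub>R (of_real (R n x) * q' n x))"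
      using evT by eventually_elim simp
    show "(\<lambda>n. CLINT x|lborel. ?ind n x) \<longlonglongrightarrow> (CLINT x|lborel. indicator {0<..} x *\<^sub>R (of_real (\<alpha> * x powr (\<alpha> - 1)) * Q x))"
    proof (rule integral_dominated_convergence[OF _ _ wint])
      have "(\<lambda>x. of_real (\<alpha> * x powr (\<alpha> - 1)) * (indicator {0<..} x *\<^sub>R Q x)) \<in> borel_measurable borel"
        using Qm by (intro borel_measurable_times) auto
      then show "(\<lambda>x. indicator {0<..} x *\<^sub>R (of_real (\<alpha> * x powr (\<alpha> - 1)) * Q x)) \<in> borel_measurable lborel"
        by (simp add: mult_scaleR_right)
      show "?ind n \<in> borel_measurable lborel" for n by measurable
      show "AE x in lborel. norm (?ind n x) \<le> w x" for n
      proof (rule AE_I2)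
        fix x
        have w0: "0 \<le> w x" using \<alpha> K by (auto simp: w_def intro!: mult_nonneg_nonneg add_nonneg_nonneg)
        show "norm (?ind n x) \<le> w x"
        proof (cases "T n \<ge> max X 1 \<and> 0 < x \<and> x < d * T n")
          case True
          then have "norm (of_real (R n x) * q' n x) \<le> w x" by (intro Rw) auto
          then show ?thesis using True by simp
        next
          case False
          then have "?ind n x = 0" by (auto simp: q'_def indicator_def)
          then show ?thesis using w0 by simp
        qed
      qed
      show "AE x in lborel. (\<lambda>n. ?ind n x) \<longlonglongrightarrow> indicator {0<..} x *\<^sub>R (of_real (\<alpha> * x powr (\<alpha> - 1)) * Q x)"
      proof (rule AE_I2)
        fix x :: real
        show "(\<lambda>n. ?ind n x) \<longlonglongrightarrow> indicator {0<..} x *\<^sub>R (of_real (\<alpha> * x powr (\<alpha> - 1)) * Q x)"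
        proof (cases "x > 0")
          case False
          then have "?ind n x = 0" for n by (auto simp: q'_def indicator_def)
          then show ?thesis using False by simp
        next
          case x: True
          have Tx: "filterlim (\<lambda>n. T n / x) at_top sequentially"
            using filterlim_tendsto_pos_mult_at_top[OF tendsto_const[of "1 / x"] _ T] x by simp
          have xT0: "filterlim (\<lambda>n. x / T n) (at_right 0) sequentially"
          proof -
            have "(\<lambda>n. x * inverse (T n)) \<longlonglongrightarrow> x * 0" by (intro tendsto_intros tendsto_inverse_0_at_top T)
            then have "(\<lambda>n. x / T n) \<longlonglongrightarrow> 0" by (simp add: divide_inverse)
            moreover have "\<forall>\<^sub>F n in sequentially. x / T n \<in> {0<..} \<and> x / T n \<noteq> 0"
              using evT by eventually_elim (use x in auto)
            ultimately show ?thesis by (auto simp: filterlim_at elim: eventually_mono)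
          qed
          have L1: "(\<lambda>n. p (x / T n) / (\<alpha> * l (inverse (x / T n)) * (x / T n) powr (\<alpha> - 1))) \<longlonglongrightarrow> 1"
            by (rule filterlim_compose[OF asymp' xT0])
          have "0 < 1 / x" using x by simp
          then have "((\<lambda>t. l (1 / x * t) / l t) \<longlongrightarrow> 1) at_top" using l unfolding slowly_varying_def by blast
          from filterlim_compose[OF this T] have L2: "(\<lambda>n. l (1 / x * T n) / l (T n)) \<longlonglongrightarrow> 1" .
          have "(\<lambda>n. \<alpha> * x powr (\<alpha> - 1) * (p (x / T n) / (\<alpha> * l (inverse (x / T n)) * (x / T n) powr (\<alpha> - 1))) * (l (1 / x * T n) / l (T n))) \<longlonglongrightarrow> \<alpha> * x powr (\<alpha> - 1) * 1 * 1"
            by (intro tendsto_intros L1 L2)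
          moreover have "\<forall>\<^sub>F n in sequentially. \<alpha> * x powr (\<alpha> - 1) * (p (x / T n) / (\<alpha> * l (inverse (x / T n)) * (x / T n) powr (\<alpha> - 1))) * (l (1 / x * T n) / l (T n)) = R n x"
          proof -
            have "\<forall>\<^sub>F n in sequentially. T n / x \<ge> X" using Tx by (simp add: filterlim_at_top)
            with evT show ?thesis
            proof eventually_elim
              case (elim n)
              then have Tp: "T n > 0" and lx: "l (T n / x) > 0" and lT: "l (T n) > 0" using X(2) by auto
              have pw: "x powr (\<alpha> - 1) / (x / T n) powr (\<alpha> - 1) = T n powr \<alpha> / T n"
                using Tp x by (simp add: powr_divide powr_diff)
              have "\<alpha> * x powr (\<alpha> - 1) * (p (x / T n) / (\<alpha> * l (inverse (x / T n)) * (x / T n) powr (\<alpha> - 1))) * (l (1 / x * T n) / l (T n)) =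
                  (x powr (\<alpha> - 1) / (x / T n) powr (\<alpha> - 1)) * p (x / T n) / l (T n)"
                using \<alpha> lx lT by (simp add: field_simps)
              also have "\<dots> = R n x" unfolding pw R_def A_def p'_def using Tp x by (simp add: field_simps)
              finally show ?case .
            qed
          qed
          ultimately have RL: "(\<lambda>n. R n x) \<longlonglongrightarrow> \<alpha> * x powr (\<alpha> - 1)"
            by (subst (asm) tendsto_cong) auto
          have "(\<lambda>n. of_real (R n x) * q' n x) \<longlonglongrightarrow> of_real (\<alpha> * x powr (\<alpha> - 1)) * Q x"
            using qQ[OF x] x by (intro tendsto_mult tendsto_of_real RL) (simp add: q'_def)
          moreover have "\<forall>\<^sub>F n in sequentially. of_real (R n x) * q' n x = ?ind n x"
          proof -
            have "filterlim (\<lambda>n. d * T n) at_top sequentially"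
              by (rule filterlim_tendsto_pos_mult_at_top[OF tendsto_const d T])
            then have "\<forall>\<^sub>F n in sequentially. d * T n \<ge> x + 1" unfolding filterlim_at_top by blast
            with evT show ?thesis by eventually_elim simp
          qed
          ultimately have "(\<lambda>n. ?ind n x) \<longlonglongrightarrow> of_real (\<alpha> * x powr (\<alpha> - 1)) * Q x"
            by (rule Lim_transform_eventually)
          then show ?thesis using x by simp
        qed
      qed
    qed
  qed
  have tail: "(\<lambda>n. CLINT x|lborel. indicator {d * T n..} x *\<^sub>R (of_real (R n x) * q' n x)) \<longlonglongrightarrow> 0"
  proof -
    define P where "P = (\<integral>x. p' x \<partial>lborel)"
    define B where "B = exp e * exp (e * \<bar>ln X\<bar>) / l X * (K / d * P)"
    have bound: "\<forall>\<^sub>F n in sequentially. norm (CLINT x|lborel. indicator {d * T n..} x *\<^sub>R (of_real (R n x) * q' n x)) \<le> B * T n powr (- (1 - \<alpha> - e))"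
      using evT
    proof eventually_elim
      case (elim n)
      then have Tp: "T n > 0" "T n \<ge> X" "T n \<ge> 1" by auto
      have iR: "integrable lborel (\<lambda>x. p' (x / T n))"
        using lborel_integrable_real_affine[OF p'int, of "1 / T n" 0] Tp by simp
      have "norm (CLINT x|lborel. indicator {d * T n..} x *\<^sub>R (of_real (R n x) * q' n x)) \<le>
          (\<integral>x. norm (indicator {d * T n..} x *\<^sub>R (of_real (R n x) * q' n x)) \<partial>lborel)" by (rule integral_norm_bound)
      also have "\<dots> \<le> (\<integral>x. K / (d * T n) * (A n / T n) * p' (x / T n) \<partial>lborel)"
      proof (rule integral_mono')
        show "integrable lborel (\<lambda>x. K / (d * T n) * (A n / T n) * p' (x / T n))" by (rule integrable_mult_right[OF iR])
        fix x
        have nn: "0 \<le> K / (d * T n) * (A n / T n) * p' (x / T n)" using K d Tp A0[OF elim] p'0 by simp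
        show "norm (indicator {d * T n..} x *\<^sub>R (of_real (R n x) * q' n x)) \<le> K / (d * T n) * (A n / T n) * p' (x / T n)"
        proof (cases "x \<ge> d * T n")
          case True
          have "0 < d * T n" using d Tp by simp
          then have x: "x > 0" using True by linarith
          have "norm (q' n x) \<le> K * min 1 (1 / x)" by (rule q'K[OF x])
          also have "\<dots> \<le> K * (1 / (d * T n))" using True \<open>0 < d * T n\<close> K by (intro mult_left_mono) (auto simp: min_le_iff_disj frac_le)
          finally have "R n x * norm (q' n x) \<le> R n x * (K * (1 / (d * T n)))" by (rule mult_left_mono) (rule R0[OF elim])
          also have "R n x * (K * (1 / (d * T n))) = K / (d * T n) * (A n / T n) * p' (x / T n)" by (simp add: R_def ac_simps)
          finally show ?thesis using True R0[OF elim, of x] by (simp add: norm_mult)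
        qed (use nn in simp)
        show "0 \<le> K / (d * T n) * (A n / T n) * p' (x / T n)" by (rule nn)
      qed
      also have "\<dots> = K / (d * T n) * (A n / T n) * (\<integral>x. p' (x / T n) \<partial>lborel)" by (rule integral_mult_right_zero)
      also have "(\<integral>x. p' (x / T n) \<partial>lborel) = T n * P"
        unfolding P_def using lborel_integral_real_affine[of "1 / T n" p' 0] Tp by (simp add: field_simps)
      also have "K / (d * T n) * (A n / T n) * (T n * P) = T n powr \<alpha> / T n * (1 / l (T n)) * (K / d * P)"
        using Tp d X(2)[OF Tp(2)] by (simp add: A_def field_simps)
      \<comment> \<open>Potter's bound between \<open>T n\<close> and the fixed point
        \<open>X\<close> limits the decay of \<open>l\<close> and bounds \<open>1 / l (T n)\<close>
        by a multiple of \<open>T n powr e\<close>.\<close>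
      also have "\<dots> \<le> T n powr \<alpha> / T n * (exp e * exp (e * \<bar>ln X\<bar>) / l X * T n powr e) * (K / d * P)"
      proof (intro mult_right_mono mult_left_mono)
        have "l X \<le> exp e * l (T n) * exp (e * \<bar>ln X - ln (T n)\<bar>)" using Tp by (intro X(3)) auto
        also have "\<dots> \<le> exp e * l (T n) * (exp (e * \<bar>ln X\<bar>) * T n powr e)"
        proof (intro mult_left_mono)
          have "\<bar>ln X - ln (T n)\<bar> \<le> \<bar>ln X\<bar> + ln (T n)" using abs_triangle_ineq4[of "ln X" "ln (T n)"] ln_ge_zero[OF Tp(3)] by linarith
          then have "exp (e * \<bar>ln X - ln (T n)\<bar>) \<le> exp (e * (\<bar>ln X\<bar> + ln (T n)))" using e by simp
          also have "\<dots> = exp (e * \<bar>ln X\<bar>) * T n powr e" using Tp by (simp add: powr_def exp_add distrib_left)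
          finally show "exp (e * \<bar>ln X - ln (T n)\<bar>) \<le> exp (e * \<bar>ln X\<bar>) * T n powr e" .
        qed (use X(2)[OF Tp(2)] in simp)
        finally show "1 / l (T n) \<le> exp e * exp (e * \<bar>ln X\<bar>) / l X * T n powr e"
          using X(2)[OF Tp(2)] X(2)[of X] by (simp add: field_simps)
      qed (use Tp K d p'0 in \<open>auto simp: P_def intro!: mult_nonneg_nonneg integral_nonneg_AE\<close>)
      also have "\<dots> = B * (T n powr \<alpha> / T n * T n powr e)" by (simp add: B_def) (simp add: ac_simps)
      also have "T n powr \<alpha> / T n * T n powr e = T n powr (- (1 - \<alpha> - e))"
      proof -
        have "T n powr (- (1 - \<alpha> - e)) = T n powr (\<alpha> + e - 1)" by (simp add: algebra_simps)
        also have "\<dots> = T n powr \<alpha> * T n powr e / T n" using Tp by (simp add: powr_diff powr_add)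
        finally show ?thesis by simp
      qed
      finally show ?case .
    qed
    have "(\<lambda>n. B * T n powr (- (1 - \<alpha> - e))) \<longlonglongrightarrow> B * 0"
      using e by (intro tendsto_intros tendsto_neg_powr T) auto
    then have "(\<lambda>n. B * T n powr (- (1 - \<alpha> - e))) \<longlonglongrightarrow> 0" by simp
    from Lim_null_comparison[OF bound this] show ?thesis .
  qed
  have split: "\<forall>\<^sub>F n in sequentially. (CLINT x|lborel. indicator {..<d * T n} x *\<^sub>R (of_real (R n x) * q' n x)) +
      (CLINT x|lborel. indicator {d * T n..} x *\<^sub>R (of_real (R n x) * q' n x)) =
      of_real (T n powr \<alpha> / l (T n)) * (CLINT x|lborel. indicator {0<..} x *\<^sub>R (of_real (p x) * q n (T n * x)))"
    using evT
  proof eventually_elim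
    case (elim n)
    then have Tp: "T n > 0" by auto
    have iR: "integrable lborel (\<lambda>x. p' (x / T n))"
      using lborel_integrable_real_affine[OF p'int, of "1 / T n" 0] Tp by simp
    have i: "integrable lborel (\<lambda>x. of_real (R n x) * q' n x)"
    proof (rule Bochner_Integration.integrable_bound)
      show "integrable lborel (\<lambda>x. A n / T n * p' (x / T n) * K)" using iR by simp
      show "AE x in lborel. norm (of_real (R n x) * q' n x) \<le> norm (A n / T n * p' (x / T n) * K)"
      proof (rule AE_I2)
        fix x
        have "norm (q' n x) \<le> K"
        proof (cases "x > 0")
          case True
          have "K * min 1 (1 / x) \<le> K * 1" using K by (intro mult_left_mono) auto
          then show ?thesis using q'K[OF True, of n] by simp
        qed (use K in \<open>simp add: q'_def\<close>)
        then have "R n x * norm (q' n x) \<le> R n x * K" by (rule mult_left_mono) (rule R0[OF elim])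
        moreover have "norm (of_real (R n x) * q' n x) = R n x * norm (q' n x)" using R0[OF elim, of x] by (simp add: norm_mult)
        moreover have "norm (A n / T n * p' (x / T n) * K) = R n x * K"
          using R0[OF elim, of x] K unfolding R_def[symmetric] by (simp add: abs_mult)
        ultimately show "norm (of_real (R n x) * q' n x) \<le> norm (A n / T n * p' (x / T n) * K)" by (simp only:)
      qed
    qed measurable
    have "(CLINT x|lborel. of_real (R n x) * q' n x) =
        (CLINT x|lborel. indicator {..<d * T n} x *\<^sub>R (of_real (R n x) * q' n x) + indicator {d * T n..} x *\<^sub>R (of_real (R n x) * q' n x))"
      by (intro Bochner_Integration.integral_cong refl) (auto simp: indicator_def)
    also have "\<dots> = (CLINT x|lborel. indicator {..<d * T n} x *\<^sub>R (of_real (R n x) * q' n x)) + (CLINT x|lborel. indicator {d * T n..} x *\<^sub>R (of_real (R n x) * q' n x))"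
      by (intro Bochner_Integration.integral_add integrable_mult_indicator i) auto
    finally show ?case using subst[OF Tp] by (simp add: A_def)
  qed
  from tendsto_add[OF main tail] have "(\<lambda>n. (CLINT x|lborel. indicator {..<d * T n} x *\<^sub>R (of_real (R n x) * q' n x)) +
      (CLINT x|lborel. indicator {d * T n..} x *\<^sub>R (of_real (R n x) * q' n x))) \<longlonglongrightarrow>
      (CLINT x|lborel. indicator {0<..} x *\<^sub>R (of_real (\<alpha> * x powr (\<alpha> - 1)) * Q x))" by simp
  then show ?thesis by (rule Lim_transform_eventually[OF _ split])
qed

section \<open>Cumulants and simple integrals\<close>

lemma norm_integral_le:
  fixes f :: "'a \<Rightarrow> 'b::{banach, second_countable_topology}"
  assumes "integrable M f" "integrable M g" "\<And>x. norm (f x) \<le> g x"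
  shows "norm (integral\<^sup>L M f) \<le> integral\<^sup>L M g"
  by (rule order_trans[OF integral_norm_bound]) (use assms in \<open>auto intro: integral_mono\<close>)

lemma norm_iexp_diff_one_le: "norm (iexp u - 1) \<le> \<bar>u\<bar>" "norm (iexp u - 1) \<le> 2"
  using iexp_approx1[of u 0] iexp_approx2[of u 0] by (simp_all)

lemma norm_iexp_remainder_le: "norm (iexp u - 1 - \<i> * of_real u) \<le> u\<^sup>2 / 2"
  using iexp_approx1[of u 1] by (simp add: diff_diff_eq power2_eq_square)

text \<open>Factoring out \<open>iexp w\<close> leaves the quadratic remainder at
  \<open>u - w\<close> and a cross term of size \<open>\<bar>u - w\<bar> * \<bar>w\<bar>\<close>.
  The product form of the bound is suited to Cauchy-Schwarz.\<close>

lemma norm_iexp_remainder_diff_le: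
  "norm ((iexp u - 1 - \<i> * of_real u) - (iexp w - 1 - \<i> * of_real w)) \<le> 2 * \<bar>u - w\<bar> * (\<bar>u\<bar> + \<bar>w\<bar>)"
proof -
  have "iexp u = iexp w * iexp (u - w)" by (simp add: exp_add[symmetric] algebra_simps)
  then have eq: "(iexp u - 1 - \<i> * of_real u) - (iexp w - 1 - \<i> * of_real w) =
     iexp w * (iexp (u - w) - 1 - \<i> * of_real (u - w)) + \<i> * of_real (u - w) * (iexp w - 1)"
    by (simp add: algebra_simps)
  have "norm (iexp w * (iexp (u - w) - 1 - \<i> * of_real (u - w))) \<le> (u - w)\<^sup>2 / 2"
    unfolding norm_mult using norm_iexp_remainder_le[of "u - w"] by simp
  moreover have "norm (\<i> * of_real (u - w) * (iexp w - 1)) \<le> \<bar>u - w\<bar> * \<bar>w\<bar>"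
    unfolding norm_mult using norm_iexp_diff_one_le(1)[of w] by (simp add: mult_left_mono del: of_real_diff)
  moreover have "(u - w)\<^sup>2 / 2 + \<bar>u - w\<bar> * \<bar>w\<bar> \<le> 2 * \<bar>u - w\<bar> * (\<bar>u\<bar> + \<bar>w\<bar>)"
  proof -
    have "(u - w)\<^sup>2 = \<bar>u - w\<bar> * \<bar>u - w\<bar>" by (simp add: power2_eq_square)
    also have "\<dots> \<le> \<bar>u - w\<bar> * (\<bar>u\<bar> + \<bar>w\<bar>)" by (intro mult_left_mono) auto
    finally have "(u - w)\<^sup>2 / 2 + \<bar>u - w\<bar> * \<bar>w\<bar> \<le> \<bar>u - w\<bar> * (\<bar>u\<bar> + \<bar>w\<bar>) / 2 + \<bar>u - w\<bar> * (\<bar>u\<bar> + \<bar>w\<bar>)"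
      by (intro add_mono mult_left_mono) auto
    also have "\<dots> \<le> 2 * \<bar>u - w\<bar> * (\<bar>u\<bar> + \<bar>w\<bar>)" by simp
    finally show ?thesis .
  qed
  ultimately show ?thesis
    unfolding eq using norm_triangle_ineq order_trans by (smt (verit))
qed

section \<open>Levy-Khintchine exponents and their behaviour at 0 and at infinity\<close>

text \<open>The negative real part of the cumulant. It governs the modulus of characteristic
  functions and is free of the drift \<open>a\<close>.\<close>

definition levy_exponent :: "real \<Rightarrow> real measure \<Rightarrow> real \<Rightarrow> real" where
  "levy_exponent b \<mu> z = b * z\<^sup>2 / 2 + (LINT x|\<mu>. 1 - cos (z * x))"

text \<open>All jumps are compensated, not only the small ones: this is the cumulant of a variable
  with mean zero, meaningful once \<mu> has a second moment.\<close>

definition centered_cumulant :: "real \<Rightarrow> real measure \<Rightarrow> real \<Rightarrow> complex" where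
  "centered_cumulant b \<mu> z = - of_real (z\<^sup>2 / 2 * b) + (CLINT x|\<mu>. iexp (z * x) - 1 - \<i> * of_real (z * x))"

lemma levy_measurable:
  assumes "levy_measure \<mu>" shows "measurable \<mu> N = measurable borel N"
  using assms by (intro measurable_cong_sets) (auto simp: levy_measure_def)

lemma integrable_levy_min:
  assumes "levy_measure \<mu>" shows "integrable \<mu> (\<lambda>x. min 1 (x\<^sup>2))"
  using assms by (auto simp: integrable_iff_bounded levy_measure_def levy_measurable[OF assms] min_absorb2)

lemma integrable_levy_cumulant:
  assumes "levy_measure \<mu>"
  shows "integrable \<mu> (\<lambda>x. iexp (z * x) - 1 - \<i> * of_real (z * x * indicator {-1..1} x))"
proof (rule Bochner_Integration.integrable_bound)
  \<comment> \<open>The summand 2 takes care of jumps larger than 1, the summand in \<open>z\<close>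
    of the smaller ones.\<close>
  show "integrable \<mu> (\<lambda>x. (2 + z\<^sup>2) * min 1 (x\<^sup>2))" using integrable_levy_min[OF assms] by simp
  show "AE x in \<mu>. norm (iexp (z * x) - 1 - \<i> * of_real (z * x * indicator {-1..1} x)) \<le> norm ((2 + z\<^sup>2) * min 1 (x\<^sup>2))"
  proof (rule AE_I2)
    fix x :: real
    show "norm (iexp (z * x) - 1 - \<i> * of_real (z * x * indicator {-1..1} x)) \<le> norm ((2 + z\<^sup>2) * min 1 (x\<^sup>2))"
    proof (cases "x \<in> {-1..1}")
      case True
      then have x: "x\<^sup>2 \<le> 1" by (simp add: abs_square_le_1 abs_le_iff)
      have "norm (iexp (z * x) - 1 - \<i> * of_real (z * x)) \<le> (z * x)\<^sup>2 / 2" by (rule norm_iexp_remainder_le)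
      also have "\<dots> \<le> (2 + z\<^sup>2) * x\<^sup>2" by (simp add: power_mult_distrib algebra_simps)
      finally show ?thesis using True x by (simp add: abs_mult)
    next
      case False
      then have x: "x\<^sup>2 > 1" by (metis abs_le_iff abs_square_le_1 atLeastAtMost_iff minus_le_iff not_le)
      have "norm (iexp (z * x) - 1) \<le> 2" by (rule norm_iexp_diff_one_le(2))
      also have "\<dots> \<le> 2 + z\<^sup>2" by simp
      finally show ?thesis using False x by (simp add: abs_mult)
    qed
  qed
qed (simp add: levy_measurable[OF assms])

lemma integrable_one_minus_cos:
  assumes "levy_measure \<mu>" shows "integrable \<mu> (\<lambda>x. 1 - cos (z * x))"
  using integrable_Re[OF integrable_levy_cumulant[OF assms, of z], THEN integrable_minus]
  by (simp add: Re_exp)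

lemma Re_levy_cumulant:
  assumes "levy_measure \<mu>"
  shows "Re (levy_cumulant a b \<mu> z) = - levy_exponent b \<mu> z"
proof -
  have "Re (CLINT x|\<mu>. iexp (z * x) - 1 - \<i> * of_real (z * x * indicator {-1..1} x)) = (LINT x|\<mu>. - (1 - cos (z * x)))"
    by (subst integral_Re[symmetric, OF integrable_levy_cumulant[OF assms]])
       (intro Bochner_Integration.integral_cong, auto simp: Re_exp)
  also have "\<dots> = - (LINT x|\<mu>. 1 - cos (z * x))" by (rule Bochner_Integration.integral_minus)
  finally show ?thesis by (simp add: levy_cumulant_def levy_exponent_def)
qed

text \<open>Jumps contribute \<open>1 - cos\<close>, which is nonnegative. Through this inequality
  \<open>b > 0\<close> turns smallness of an exponent into smallness of a mean square.\<close>

lemma levy_exponent_ge: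
  assumes "levy_measure \<mu>" shows "b * z\<^sup>2 / 2 \<le> levy_exponent b \<mu> z"
  unfolding levy_exponent_def by (simp add: integral_nonneg_AE)

lemma levy_cumulant_0 [simp]: "levy_cumulant a b \<mu> 0 = 0" and levy_exponent_0 [simp]: "levy_exponent b \<mu> 0 = 0"
  and centered_cumulant_0 [simp]: "centered_cumulant b \<mu> 0 = 0"
  by (simp_all add: levy_cumulant_def levy_exponent_def centered_cumulant_def)

lemma continuous_levy_exponent:
  assumes "levy_measure \<mu>" shows "isCont (levy_exponent b \<mu>) z"
  unfolding continuous_at_sequentially
proof safe
  fix Z assume Z: "Z \<longlonglongrightarrow> z"
  then obtain C where C: "\<And>n. \<bar>Z n\<bar> \<le> C"
    using convergent_imp_Bseq[of Z] by (auto simp: convergent_def Bseq_def)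
  have "(\<lambda>n. LINT x|\<mu>. 1 - cos (Z n * x)) \<longlonglongrightarrow> (LINT x|\<mu>. 1 - cos (z * x))"
  proof (rule integral_dominated_convergence[where w="\<lambda>x. (2 + C\<^sup>2) * min 1 (x\<^sup>2)"])
    show "AE x in \<mu>. norm (1 - cos (Z n * x)) \<le> (2 + C\<^sup>2) * min 1 (x\<^sup>2)" for n
    proof (rule AE_I2)
      fix x :: real
      have a: "\<bar>1 - cos (Z n * x)\<bar> \<le> (Z n * x)\<^sup>2 / 2"
        using norm_iexp_remainder_le[of "Z n * x"] abs_Re_le_cmod[of "iexp (Z n * x) - 1 - \<i> * of_real (Z n * x)"]
        by (simp add: Re_exp abs_minus_commute)
      have "(Z n)\<^sup>2 \<le> C\<^sup>2" using C[of n] by (metis abs_ge_zero power2_abs power_mono)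
      then have "(Z n)\<^sup>2 * x\<^sup>2 / 2 \<le> C\<^sup>2 * x\<^sup>2 / 2" by (simp add: mult_right_mono)
      also have "\<dots> \<le> (2 + C\<^sup>2) * x\<^sup>2" by (simp add: algebra_simps)
      finally have 1: "\<bar>1 - cos (Z n * x)\<bar> \<le> (2 + C\<^sup>2) * x\<^sup>2" using a by (simp add: power_mult_distrib)
      have "\<bar>1 - cos (Z n * x)\<bar> \<le> 2" using cos_le_one[of "Z n * x"] cos_ge_minus_one[of "Z n * x"] by linarith
      also have "2 \<le> 2 + C\<^sup>2" by simp
      finally show "norm (1 - cos (Z n * x)) \<le> (2 + C\<^sup>2) * min 1 (x\<^sup>2)" using 1 by (simp add: min_def)
    qed
    show "AE x in \<mu>. (\<lambda>n. 1 - cos (Z n * x)) \<longlonglongrightarrow> 1 - cos (z * x)"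
      by (intro AE_I2 tendsto_intros Z)
  qed (use integrable_levy_min[OF assms] in \<open>auto simp: levy_measurable[OF assms]\<close>)
  then show "(levy_exponent b \<mu> \<circ> Z) \<longlonglongrightarrow> levy_exponent b \<mu> z"
    unfolding levy_exponent_def comp_def by (intro tendsto_intros Z) auto
qed

lemma levy_exponent_measurable [measurable]:
  assumes "levy_measure \<mu>" shows "levy_exponent b \<mu> \<in> borel_measurable borel"
  by (intro borel_measurable_continuous_onI continuous_at_imp_continuous_on ballI continuous_levy_exponent assms)

context
  fixes \<mu> :: "real measure"
  assumes levy: "levy_measure \<mu>" and second_moment: "integrable \<mu> (\<lambda>x. x\<^sup>2)"
begin

lemma integrable_centered_cumulant: "integrable \<mu> (\<lambda>x. iexp (z * x) - 1 - \<i> * of_real (z * x))"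
proof (rule Bochner_Integration.integrable_bound)
  show "integrable \<mu> (\<lambda>x. z\<^sup>2 / 2 * x\<^sup>2)" using second_moment by simp
  show "AE x in \<mu>. norm (iexp (z * x) - 1 - \<i> * of_real (z * x)) \<le> norm (z\<^sup>2 / 2 * x\<^sup>2)"
    using norm_iexp_remainder_le[of "z * x" for x] by (intro AE_I2) (simp add: power_mult_distrib)
qed (simp add: levy_measurable[OF levy])

text \<open>The two compensations differ by the integral of \<open>x\<close> over the jumps larger
  than 1, which is finite since \<open>\<bar>x\<bar> \<le> x^2\<close> there. The result is a shift
  of the drift.\<close>

lemma levy_cumulant_centered:
  obtains d where "\<And>a b z. levy_cumulant a b \<mu> z = \<i> * of_real (z * (a + d)) + centered_cumulant b \<mu> z"
proof
  fix a b z
  let ?d = "LINT x|\<mu>. x * indicator (- {-1..1}) x"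
  have i: "integrable \<mu> (\<lambda>x. x * indicator (- {-1..1}) x)"
  proof (rule Bochner_Integration.integrable_bound[OF second_moment])
    show "AE x in \<mu>. norm (x * indicator (- {-1..1}) x) \<le> norm (x\<^sup>2)"
    proof (rule AE_I2)
      fix x :: real
      have "\<bar>x\<bar> \<le> x\<^sup>2" if "\<bar>x\<bar> > 1"
        using mult_mono[of 1 "\<bar>x\<bar>" "\<bar>x\<bar>" "\<bar>x\<bar>"] that by (simp add: power2_eq_square)
      then show "norm (x * indicator (- {-1..1}) x) \<le> norm (x\<^sup>2)" by (auto simp: indicator_def abs_if)
    qed
  qed (simp add: levy_measurable[OF levy])
  have "(CLINT x|\<mu>. iexp (z * x) - 1 - \<i> * of_real (z * x * indicator {-1..1} x)) =
     (CLINT x|\<mu>. (iexp (z * x) - 1 - \<i> * of_real (z * x)) + \<i> * of_real z * of_real (x * indicator (- {-1..1}) x))"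
    by (intro Bochner_Integration.integral_cong) (auto simp: indicator_def algebra_simps)
  also have "\<dots> = (CLINT x|\<mu>. (iexp (z * x) - 1 - \<i> * of_real (z * x))) + (CLINT x|\<mu>. \<i> * of_real z * of_real (x * indicator (- {-1..1}) x))"
    by (rule Bochner_Integration.integral_add[OF integrable_centered_cumulant integrable_mult_right[OF integrable_of_real[OF i]]])
  also have "(CLINT x|\<mu>. \<i> * of_real z * of_real (x * indicator (- {-1..1}) x)) = \<i> * of_real z * of_real ?d"
    by (simp only: integral_mult_right_zero integral_complex_of_real)
  finally show "levy_cumulant a b \<mu> z = \<i> * of_real (z * (a + ?d)) + centered_cumulant b \<mu> z"
    by (simp add: levy_cumulant_def centered_cumulant_def algebra_simps)
qed

text \<open>Together with Cauchy-Schwarz, this bound makes the integral of the cumulant of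
  \<open>f\<close> continuous in \<open>f\<close> with respect to the mean square norm.\<close>

lemma norm_centered_cumulant_diff_le:
  assumes b: "b \<ge> 0"
  shows "norm (centered_cumulant b \<mu> y - centered_cumulant b \<mu> z) \<le>
    2 * (b + (LINT x|\<mu>. x\<^sup>2)) * (\<bar>y - z\<bar> * (\<bar>y\<bar> + \<bar>z\<bar>))"
proof -
  let ?k = "\<lambda>z x. iexp (z * x) - 1 - \<i> * of_real (z * x)"
  have "norm ((CLINT x|\<mu>. ?k y x) - (CLINT x|\<mu>. ?k z x)) = norm (CLINT x|\<mu>. ?k y x - ?k z x)"
    by (subst Bochner_Integration.integral_diff[OF integrable_centered_cumulant integrable_centered_cumulant]) simp
  also have "\<dots> \<le> (LINT x|\<mu>. 2 * (\<bar>y - z\<bar> * (\<bar>y\<bar> + \<bar>z\<bar>)) * x\<^sup>2)"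
  proof (rule norm_integral_le)
    show "norm (?k y x - ?k z x) \<le> 2 * (\<bar>y - z\<bar> * (\<bar>y\<bar> + \<bar>z\<bar>)) * x\<^sup>2" for x
    proof -
      have "norm (?k y x - ?k z x) \<le> 2 * \<bar>y * x - z * x\<bar> * (\<bar>y * x\<bar> + \<bar>z * x\<bar>)" by (rule norm_iexp_remainder_diff_le)
      also have "\<bar>y * x - z * x\<bar> = \<bar>y - z\<bar> * \<bar>x\<bar>" by (simp add: abs_mult[symmetric] algebra_simps)
      also have "2 * (\<bar>y - z\<bar> * \<bar>x\<bar>) * (\<bar>y * x\<bar> + \<bar>z * x\<bar>) = 2 * (\<bar>y - z\<bar> * (\<bar>y\<bar> + \<bar>z\<bar>)) * (\<bar>x\<bar> * \<bar>x\<bar>)"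
      proof -
        have "2 * (d * t) * (p * t + q * t) = 2 * (d * (p + q)) * (t * t)" for d p q t :: real
          by (simp add: algebra_simps)
        then show ?thesis unfolding abs_mult .
      qed
      finally show ?thesis by (simp only: abs_mult_self_eq power2_eq_square)
    qed
    show "complex_integrable \<mu> (\<lambda>x. ?k y x - ?k z x)"
      by (intro Bochner_Integration.integrable_diff integrable_centered_cumulant)
  qed (use second_moment in simp)
  finally have 1: "norm ((CLINT x|\<mu>. ?k y x) - (CLINT x|\<mu>. ?k z x)) \<le> 2 * (\<bar>y - z\<bar> * (\<bar>y\<bar> + \<bar>z\<bar>)) * (LINT x|\<mu>. x\<^sup>2)"
    by simp
  have "norm (- of_real (y\<^sup>2 / 2 * b) + of_real (z\<^sup>2 / 2 * b) :: complex) = \<bar>(y\<^sup>2 - z\<^sup>2) / 2 * b\<bar>"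
    by (simp only: of_real_minus[symmetric] of_real_add[symmetric] norm_of_real) (simp add: algebra_simps diff_divide_distrib abs_minus_commute)
  also have "\<dots> = \<bar>y - z\<bar> * \<bar>y + z\<bar> / 2 * b"
    using b by (simp add: power2_eq_square square_diff_square_factored abs_mult)
  also have "\<dots> \<le> \<bar>y - z\<bar> * (\<bar>y\<bar> + \<bar>z\<bar>) / 2 * b"
    using b by (intro mult_right_mono divide_right_mono mult_left_mono) auto
  also have "\<dots> \<le> 2 * (\<bar>y - z\<bar> * (\<bar>y\<bar> + \<bar>z\<bar>)) * b"
    using b by (intro mult_right_mono) auto
  finally have 2: "norm (- of_real (y\<^sup>2 / 2 * b) + of_real (z\<^sup>2 / 2 * b) :: complex) \<le> 2 * (\<bar>y - z\<bar> * (\<bar>y\<bar> + \<bar>z\<bar>)) * b" .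
  have "centered_cumulant b \<mu> y - centered_cumulant b \<mu> z =
     (- of_real (y\<^sup>2 / 2 * b) + of_real (z\<^sup>2 / 2 * b)) + ((CLINT x|\<mu>. ?k y x) - (CLINT x|\<mu>. ?k z x))"
    by (simp add: centered_cumulant_def)
  then have "norm (centered_cumulant b \<mu> y - centered_cumulant b \<mu> z) \<le>
    2 * (\<bar>y - z\<bar> * (\<bar>y\<bar> + \<bar>z\<bar>)) * b + 2 * (\<bar>y - z\<bar> * (\<bar>y\<bar> + \<bar>z\<bar>)) * (LINT x|\<mu>. x\<^sup>2)"
    using norm_triangle_mono[OF 2 1] by simp
  then show ?thesis by (simp add: algebra_simps)
qed

lemma norm_centered_cumulant_le:
  assumes b: "b \<ge> 0"
  shows "norm (centered_cumulant b \<mu> z) \<le> (b + (LINT x|\<mu>. x\<^sup>2)) * z\<^sup>2 / 2"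
proof -
  have "norm (CLINT x|\<mu>. iexp (z * x) - 1 - \<i> * of_real (z * x)) \<le> (LINT x|\<mu>. z\<^sup>2 / 2 * x\<^sup>2)"
    by (rule norm_integral_le)
       (use integrable_centered_cumulant second_moment norm_iexp_remainder_le[of "z * x" for x] in \<open>auto simp: power_mult_distrib\<close>)
  then have "norm (CLINT x|\<mu>. iexp (z * x) - 1 - \<i> * of_real (z * x)) \<le> z\<^sup>2 / 2 * (LINT x|\<mu>. x\<^sup>2)" by simp
  moreover have "norm (- of_real (z\<^sup>2 / 2 * b) :: complex) = z\<^sup>2 / 2 * b"
    using b by (simp only: of_real_minus[symmetric] norm_of_real) simp
  ultimately show ?thesis
    unfolding centered_cumulant_def
    by (intro order_trans[OF norm_triangle_ineq]) (simp add: algebra_simps add_divide_distrib)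
qed

lemma continuous_centered_cumulant:
  assumes b: "b \<ge> 0" shows "isCont (centered_cumulant b \<mu>) z"
proof -
  have "(\<lambda>y. 2 * (b + (LINT x|\<mu>. x\<^sup>2)) * (\<bar>y - z\<bar> * (\<bar>y\<bar> + \<bar>z\<bar>))) \<midarrow>z\<rightarrow> 2 * (b + (LINT x|\<mu>. x\<^sup>2)) * (\<bar>z - z\<bar> * (\<bar>z\<bar> + \<bar>z\<bar>))"
    by (intro tendsto_intros)
  then have "(\<lambda>y. 2 * (b + (LINT x|\<mu>. x\<^sup>2)) * (\<bar>y - z\<bar> * (\<bar>y\<bar> + \<bar>z\<bar>))) \<midarrow>z\<rightarrow> 0" by simp
  then have "(\<lambda>y. centered_cumulant b \<mu> y - centered_cumulant b \<mu> z) \<midarrow>z\<rightarrow> 0"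
    by (rule Lim_null_comparison[rotated]) (use norm_centered_cumulant_diff_le[OF b] in auto)
  then show ?thesis unfolding isCont_def by (rule LIM_zero_cancel)
qed

lemma centered_cumulant_measurable:
  assumes "b \<ge> 0" shows "centered_cumulant b \<mu> \<in> borel_measurable borel"
  by (intro borel_measurable_continuous_onI continuous_at_imp_continuous_on ballI continuous_centered_cumulant assms)

text \<open>Near 0 the Gaussian part and the jumps are of the same quadratic order, and the
  coefficient is the total variance. This is the regime that determines second moments, in contrast
  to \<open>centered_cumulant_large\<close>.\<close>

lemma centered_cumulant_small:
  "(\<lambda>n. (real n)\<^sup>2 * centered_cumulant b \<mu> (c / real n)) \<longlonglongrightarrow> of_real (- (b + (LINT x|\<mu>. x\<^sup>2)) * c\<^sup>2 / 2)"
proof -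
  let ?k = "\<lambda>z x. iexp (z * x) - 1 - \<i> * of_real (z * x)"
  have "(\<lambda>n. CLINT x|\<mu>. (real n)\<^sup>2 * ?k (c / real n) x) \<longlonglongrightarrow> (CLINT x|\<mu>. of_real (- (c\<^sup>2 / 2 * x\<^sup>2)))"
  proof (rule integral_dominated_convergence[where w="\<lambda>x. c\<^sup>2 / 2 * x\<^sup>2"])
    show "AE x in \<mu>. (\<lambda>n. (real n)\<^sup>2 * ?k (c / real n) x) \<longlonglongrightarrow> of_real (- (c\<^sup>2 / 2 * x\<^sup>2))"
    proof (rule AE_I2)
      fix x :: real
      let ?u = "\<lambda>n. c / real n * x"
      have "norm ((real n)\<^sup>2 * ?k (c / real n) x - of_real (- (c\<^sup>2 / 2 * x\<^sup>2))) \<le> \<bar>c * x\<bar>^3 / 6 * inverse (real n)" if n: "n \<ge> 1" for n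
      proof -
        have "norm (?k (c / real n) x + of_real ((?u n)\<^sup>2 / 2)) \<le> \<bar>?u n\<bar>^3 / 6"
          using iexp_approx1[of "?u n" 2]
          by (simp add: numeral_2_eq_2 numeral_3_eq_3 diff_diff_eq power2_eq_square fact_numeral algebra_simps)
        then have "(real n)\<^sup>2 * norm (?k (c / real n) x + of_real ((?u n)\<^sup>2 / 2)) \<le> (real n)\<^sup>2 * (\<bar>?u n\<bar>^3 / 6)"
          by (rule mult_left_mono) simp
        moreover have "(real n)\<^sup>2 * (\<bar>?u n\<bar>^3 / 6) = \<bar>c * x\<bar>^3 / 6 * inverse (real n)"
        proof -
          have u: "\<bar>?u n\<bar> = \<bar>c * x\<bar> / real n" by (simp add: abs_mult)
          have "(real n)\<^sup>2 * ((a / real n)^3 / 6) = a^3 / 6 * inverse (real n)" for a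
            using n by (simp add: power_divide field_simps power2_eq_square power3_eq_cube)
          then show ?thesis unfolding u by blast
        qed
        moreover have "(real n)\<^sup>2 * ?k (c / real n) x - of_real (- (c\<^sup>2 / 2 * x\<^sup>2)) = of_real ((real n)\<^sup>2) * (?k (c / real n) x + of_real ((?u n)\<^sup>2 / 2))"
        proof -
          have "complex_of_real ((real n)\<^sup>2) * of_real ((?u n)\<^sup>2 / 2) = of_real (c\<^sup>2 / 2 * x\<^sup>2)"
            unfolding of_real_mult[symmetric] using n by (simp add: power_mult_distrib power_divide)
          then show ?thesis by (simp add: distrib_left)
        qed
        ultimately show ?thesis by (simp add: norm_mult del: of_real_power)
      qed
      then have ev: "\<forall>\<^sub>F n in sequentially. norm ((real n)\<^sup>2 * ?k (c / real n) x - of_real (- (c\<^sup>2 / 2 * x\<^sup>2))) \<le> \<bar>c * x\<bar>^3 / 6 * inverse (real n)"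
        by (rule eventually_sequentiallyI)
      have "(\<lambda>n. \<bar>c * x\<bar>^3 / 6 * inverse (real n)) \<longlonglongrightarrow> 0"
        using tendsto_mult_left[OF lim_inverse_n, of "\<bar>c * x\<bar>^3 / 6"] by simp
      from Lim_null_comparison[OF ev this]
      show "(\<lambda>n. (real n)\<^sup>2 * ?k (c / real n) x) \<longlonglongrightarrow> of_real (- (c\<^sup>2 / 2 * x\<^sup>2))"
        by (rule LIM_zero_cancel)
    qed
    show "AE x in \<mu>. norm ((real n)\<^sup>2 * ?k (c / real n) x) \<le> c\<^sup>2 / 2 * x\<^sup>2" for n
    proof (rule AE_I2)
      fix x :: real
      have "norm ((real n)\<^sup>2 * ?k (c / real n) x) = (real n)\<^sup>2 * norm (?k (c / real n) x)"
        by (simp only: norm_mult norm_power norm_of_real of_real_power power2_abs abs_of_nat)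
      also have "\<dots> \<le> (real n)\<^sup>2 * ((c / real n * x)\<^sup>2 / 2)" by (intro mult_left_mono norm_iexp_remainder_le) simp
      also have "\<dots> \<le> c\<^sup>2 / 2 * x\<^sup>2" by (cases "n = 0") (simp_all add: power_mult_distrib power_divide)
      finally show "norm ((real n)\<^sup>2 * ?k (c / real n) x) \<le> c\<^sup>2 / 2 * x\<^sup>2" .
    qed
  qed (use second_moment in \<open>auto simp: levy_measurable[OF levy]\<close>)
  moreover have "(CLINT x|\<mu>. of_real (- (c\<^sup>2 / 2 * x\<^sup>2))) = of_real (- (c\<^sup>2 / 2 * (LINT x|\<mu>. x\<^sup>2)))"
    by (simp only: integral_complex_of_real) simp
  ultimately have A: "(\<lambda>n. (real n)\<^sup>2 * (CLINT x|\<mu>. ?k (c / real n) x)) \<longlonglongrightarrow> of_real (- (c\<^sup>2 / 2 * (LINT x|\<mu>. x\<^sup>2)))"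
    by (simp only: integral_mult_right_zero)
  have B: "(\<lambda>n. (real n)\<^sup>2 * - complex_of_real ((c / real n)\<^sup>2 / 2 * b)) \<longlonglongrightarrow> of_real (- (c\<^sup>2 / 2 * b))"
    by (rule tendsto_eventually, rule eventually_sequentiallyI[of 1]) (auto simp: power_divide)
  have lim: "(\<lambda>n. (real n)\<^sup>2 * centered_cumulant b \<mu> (c / real n)) \<longlonglongrightarrow> of_real (- (c\<^sup>2 / 2 * b)) + of_real (- (c\<^sup>2 / 2 * (LINT x|\<mu>. x\<^sup>2)))"
    unfolding centered_cumulant_def distrib_left by (intro tendsto_add A B)
  have eq: "of_real (- (b + (LINT x|\<mu>. x\<^sup>2)) * c\<^sup>2 / 2) = complex_of_real (- (c\<^sup>2 / 2 * b)) + of_real (- (c\<^sup>2 / 2 * (LINT x|\<mu>. x\<^sup>2)))"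
    unfolding of_real_add[symmetric] of_real_eq_iff by (simp add: field_simps)
  show ?thesis unfolding eq by (rule lim)
qed

text \<open>For a fixed jump the compensated integrand grows only linearly in \<open>R n\<close>, so
  division by the square of \<open>R n\<close> removes it, while the quadratic bound for all
  arguments allows dominated convergence. Only the Gaussian coefficient is left.\<close>

lemma centered_cumulant_large:
  assumes R: "filterlim R at_top sequentially"
  shows "(\<lambda>n. centered_cumulant b \<mu> (R n * c) / (R n)\<^sup>2) \<longlonglongrightarrow> of_real (- b * c\<^sup>2 / 2)"
proof -
  let ?k = "\<lambda>z x. iexp (z * x) - 1 - \<i> * of_real (z * x)"
  have pos: "\<forall>\<^sub>F n in sequentially. R n > 0" using R by (simp add: filterlim_at_top_dense)
  have inv: "(\<lambda>n. inverse (R n)) \<longlonglongrightarrow> 0" using R by (rule tendsto_inverse_0_at_top)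
  have "(\<lambda>n. CLINT x|\<mu>. ?k (R n * c) x / (R n)\<^sup>2) \<longlonglongrightarrow> (CLINT x|\<mu>. 0)"
  proof (rule integral_dominated_convergence[where w="\<lambda>x. c\<^sup>2 / 2 * x\<^sup>2"])
    show "AE x in \<mu>. (\<lambda>n. ?k (R n * c) x / (R n)\<^sup>2) \<longlonglongrightarrow> 0"
    proof (rule AE_I2)
      fix x :: real
      have "(\<lambda>n. 2 * (inverse (R n))\<^sup>2 + \<bar>c * x\<bar> * inverse (R n)) \<longlonglongrightarrow> 2 * 0\<^sup>2 + \<bar>c * x\<bar> * 0"
        by (intro tendsto_intros inv)
      then have "(\<lambda>n. 2 * (inverse (R n))\<^sup>2 + \<bar>c * x\<bar> * inverse (R n)) \<longlonglongrightarrow> 0" by simp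
      then show "(\<lambda>n. ?k (R n * c) x / (R n)\<^sup>2) \<longlonglongrightarrow> 0"
      proof (rule Lim_null_comparison[rotated])
        show "\<forall>\<^sub>F n in sequentially. norm (?k (R n * c) x / (R n)\<^sup>2) \<le> 2 * (inverse (R n))\<^sup>2 + \<bar>c * x\<bar> * inverse (R n)"
          using pos
        proof eventually_elim
          case (elim n)
          have "norm (?k (R n * c) x) \<le> norm (iexp (R n * c * x) - 1) + norm (\<i> * of_real (R n * c * x))"
            by (rule norm_triangle_ineq4)
          also have "\<dots> \<le> 2 + R n * \<bar>c * x\<bar>"
            using norm_iexp_diff_one_le(2)[of "R n * c * x"] elim by (simp add: norm_mult abs_mult)
          finally have "norm (?k (R n * c) x) / (R n)\<^sup>2 \<le> (2 + R n * \<bar>c * x\<bar>) / (R n)\<^sup>2"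
            by (rule divide_right_mono) simp
          moreover have "(2 + R n * \<bar>c * x\<bar>) / (R n)\<^sup>2 = 2 * (inverse (R n))\<^sup>2 + \<bar>c * x\<bar> * inverse (R n)"
            using elim by (simp add: field_simps power2_eq_square)
          ultimately show ?case by (simp only: norm_divide norm_power norm_of_real power2_abs of_real_power)
        qed
      qed
    qed
    show "AE x in \<mu>. norm (?k (R n * c) x / (R n)\<^sup>2) \<le> c\<^sup>2 / 2 * x\<^sup>2" for n
    proof (rule AE_I2)
      fix x :: real
      have "norm (?k (R n * c) x / (R n)\<^sup>2) = norm (?k (R n * c) x) / (R n)\<^sup>2" by (simp add: norm_divide norm_power)
      also have "\<dots> \<le> ((R n * c * x)\<^sup>2 / 2) / (R n)\<^sup>2" by (intro divide_right_mono norm_iexp_remainder_le) simp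
      also have "\<dots> \<le> c\<^sup>2 / 2 * x\<^sup>2" by (cases "R n = 0") (simp_all add: power_mult_distrib power_divide)
      finally show "norm (?k (R n * c) x / (R n)\<^sup>2) \<le> c\<^sup>2 / 2 * x\<^sup>2" .
    qed
  qed (use second_moment in \<open>auto simp: levy_measurable[OF levy]\<close>)
  then have A: "(\<lambda>n. (CLINT x|\<mu>. ?k (R n * c) x) / (R n)\<^sup>2) \<longlonglongrightarrow> 0"
    by (simp only: integral_divide_zero integral_zero)
  have B: "(\<lambda>n. - complex_of_real ((R n * c)\<^sup>2 / 2 * b) / (R n)\<^sup>2) \<longlonglongrightarrow> of_real (- (c\<^sup>2 / 2 * b))"
    by (rule tendsto_eventually, rule eventually_mono[OF pos]) (auto simp: power_mult_distrib)
  have lim: "(\<lambda>n. centered_cumulant b \<mu> (R n * c) / (R n)\<^sup>2) \<longlonglongrightarrow> of_real (- (c\<^sup>2 / 2 * b)) + 0"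
    unfolding centered_cumulant_def add_divide_distrib by (intro tendsto_add A B)
  have eq: "complex_of_real (- b * c\<^sup>2 / 2) = of_real (- (c\<^sup>2 / 2 * b)) + 0" by simp
  show ?thesis unfolding eq by (rule lim)
qed

end

section \<open>Simple integrands and the characteristic functions of their integrals\<close>

definition levy_simple :: "'s measure \<Rightarrow> ('s \<Rightarrow> real) \<Rightarrow> bool" where
  "levy_simple m g \<longleftrightarrow> simple_function m g \<and> emeasure m {x \<in> space m. g x \<noteq> 0} < \<infinity>"

lemma levy_simple_measurable: "levy_simple m g \<Longrightarrow> g \<in> borel_measurable m"
  by (auto simp: levy_simple_def intro: borel_measurable_simple_function)

lemma levy_simple_linear:
  assumes "levy_simple m g" "levy_simple m h"
  shows "levy_simple m (\<lambda>x. a * g x + b * h x)"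
proof -
  have [measurable]: "g \<in> borel_measurable m" "h \<in> borel_measurable m"
    using assms by (auto intro: levy_simple_measurable)
  have "emeasure m {x \<in> space m. a * g x + b * h x \<noteq> 0} \<le> emeasure m ({x \<in> space m. g x \<noteq> 0} \<union> {x \<in> space m. h x \<noteq> 0})"
    by (rule emeasure_mono) (auto, measurable)
  also have "\<dots> \<le> emeasure m {x \<in> space m. g x \<noteq> 0} + emeasure m {x \<in> space m. h x \<noteq> 0}"
    by (rule emeasure_subadditive) measurable
  also have "\<dots> < \<infinity>" using assms by (simp add: levy_simple_def)
  finally have "emeasure m {x \<in> space m. a * g x + b * h x \<noteq> 0} < \<infinity>" .
  moreover have "simple_function m (\<lambda>x. a * g x + b * h x)"
    using assms unfolding levy_simple_def
    by (intro simple_function_add[where f="\<lambda>x. a * g x"] simple_function_mult[where f="\<lambda>_. _"] simple_function_const) auto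
  ultimately show ?thesis by (simp add: levy_simple_def)
qed

lemma levy_simple_vimage_ring:
  assumes g: "levy_simple m g" and y: "y \<noteq> 0"
  shows "g -` {y} \<inter> space m \<in> levy_ring m"
proof -
  have [measurable]: "g \<in> borel_measurable m" using g by (rule levy_simple_measurable)
  have "emeasure m (g -` {y} \<inter> space m) \<le> emeasure m {x \<in> space m. g x \<noteq> 0}"
    using y by (intro emeasure_mono) auto
  also have "\<dots> < \<infinity>" using g by (simp add: levy_simple_def)
  finally show ?thesis
    unfolding levy_ring_def by simp
qed

text \<open>The condition \<open>\<kappa> 0 = 0\<close> lets the zero set of \<open>g\<close>,
  usually of infinite measure, drop out of the sum.\<close>

lemma levy_simple_sum_indicator:
  fixes \<kappa> :: "real \<Rightarrow> 'c::real_vector"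
  assumes g: "levy_simple m g" and \<kappa>: "\<kappa> 0 = 0" and x: "x \<in> space m"
  shows "\<kappa> (z * g x) = (\<Sum>y\<in>g ` space m - {0}. indicator (g -` {y} \<inter> space m) x *\<^sub>R \<kappa> (z * y))"
proof -
  have fin: "finite (g ` space m - {0})" using g by (auto simp: levy_simple_def simple_function_def)
  have "(\<Sum>y\<in>g ` space m - {0}. indicator (g -` {y} \<inter> space m) x *\<^sub>R \<kappa> (z * y)) =
        (\<Sum>y\<in>g ` space m - {0}. if y = g x then \<kappa> (z * y) else 0)"
    using x by (intro sum.cong) (auto simp: indicator_def)
  also have "\<dots> = \<kappa> (z * g x)" using fin x \<kappa> by (auto simp: sum.delta)
  finally show ?thesis by simp
qed

lemma levy_simple_comp_integral:
  fixes \<kappa> :: "real \<Rightarrow> 'c::{banach, second_countable_topology}"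
  assumes g: "levy_simple m g" and \<kappa>: "\<kappa> 0 = 0"
  shows "integrable m (\<lambda>x. \<kappa> (z * g x))"
    and "(\<integral>x. \<kappa> (z * g x) \<partial>m) = (\<Sum>y\<in>g ` space m - {0}. measure m (g -` {y} \<inter> space m) *\<^sub>R \<kappa> (z * y))"
proof -
  let ?S = "\<lambda>x. \<Sum>y\<in>g ` space m - {0}. indicator (g -` {y} \<inter> space m) x *\<^sub>R \<kappa> (z * y)"
  have r: "g -` {y} \<inter> space m \<in> sets m" "emeasure m (g -` {y} \<inter> space m) < \<infinity>" if "y \<in> g ` space m - {0}" for y
    using levy_simple_vimage_ring[OF g, of y] that by (auto simp: levy_ring_def)
  have "integrable m ?S"
    using r by (intro Bochner_Integration.integrable_sum integrable_scaleR_left integrable_real_indicator) auto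
  then show "integrable m (\<lambda>x. \<kappa> (z * g x))"
    by (subst Bochner_Integration.integrable_cong[OF refl levy_simple_sum_indicator[of m g \<kappa>, OF g \<kappa>]]) auto
  have "(\<integral>x. \<kappa> (z * g x) \<partial>m) = integral\<^sup>L m ?S"
    by (intro Bochner_Integration.integral_cong refl levy_simple_sum_indicator[of m g \<kappa>, OF g \<kappa>])
  also have "\<dots> = (\<Sum>y\<in>g ` space m - {0}. measure m (g -` {y} \<inter> space m) *\<^sub>R \<kappa> (z * y))"
  proof (subst Bochner_Integration.integral_sum)
    show "integrable m (\<lambda>x. indicator (g -` {y} \<inter> space m) x *\<^sub>R \<kappa> (z * y))" if "y \<in> g ` space m - {0}" for y
      using r[OF that] by (intro integrable_scaleR_left integrable_real_indicator) auto
  qed (use r in \<open>auto intro!: sum.cong\<close>)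
  finally show "(\<integral>x. \<kappa> (z * g x) \<partial>m) = (\<Sum>y\<in>g ` space m - {0}. measure m (g -` {y} \<inter> space m) *\<^sub>R \<kappa> (z * y))" .
qed

context
  fixes M :: "'w measure" and m :: "'s measure" and \<kappa> \<Lambda>
  assumes M: "prob_space M" and basis: "levy_basis M m \<kappa> \<Lambda>"
begin

lemma levy_basis_measurable: "A \<in> levy_ring m \<Longrightarrow> \<Lambda> A \<in> borel_measurable M"
  using basis by (auto simp: levy_basis_def)

lemma empty_levy_ring: "{} \<in> levy_ring m"
  by (simp add: levy_ring_def)

lemma Un_levy_ring: "A \<in> levy_ring m \<Longrightarrow> B \<in> levy_ring m \<Longrightarrow> A \<union> B \<in> levy_ring m"
  using emeasure_subadditive[of A m B] by (auto simp: levy_ring_def intro: le_less_trans)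

text \<open>Countable additivity on a sequence of empty sets gives a convergent constant series,
  whose term must vanish.\<close>

lemma levy_basis_empty: "AE \<omega> in M. \<Lambda> {} \<omega> = 0"
proof -
  have "\<forall>A::nat \<Rightarrow> 's set. range A \<subseteq> levy_ring m \<and> disjoint_family A \<longrightarrow> (\<Union>n. A n) \<in> levy_ring m \<longrightarrow>
      (AE \<omega> in M. (\<lambda>n. \<Lambda> (A n) \<omega>) sums \<Lambda> (\<Union>n. A n) \<omega>)"
    using basis unfolding levy_basis_def by blast
  from this[rule_format, of "\<lambda>_. {}"] have "AE \<omega> in M. (\<lambda>n::nat. \<Lambda> {} \<omega>) sums \<Lambda> {} \<omega>"
    using empty_levy_ring by (auto simp: disjoint_family_on_def)
  then show ?thesis
    by eventually_elim (auto dest!: sums_summable simp: summable_const_iff)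
qed

lemma levy_basis_Un:
  assumes A: "A \<in> levy_ring m" and B: "B \<in> levy_ring m" and AB: "A \<inter> B = {}"
  shows "AE \<omega> in M. \<Lambda> (A \<union> B) \<omega> = \<Lambda> A \<omega> + \<Lambda> B \<omega>"
proof -
  have "disjoint_family (binaryset A B)"
    using AB by (auto simp: disjoint_family_on_def binaryset_def)
  moreover have "range (binaryset A B) \<subseteq> levy_ring m"
    using A B empty_levy_ring by (auto simp: range_binaryset_eq)
  moreover have "(\<Union>n. binaryset A B n) \<in> levy_ring m"
    using Un_levy_ring[OF A B] by (simp add: UN_binaryset_eq)
  ultimately have "AE \<omega> in M. (\<lambda>n. \<Lambda> (binaryset A B n) \<omega>) sums \<Lambda> (\<Union>n. binaryset A B n) \<omega>"
    using basis unfolding levy_basis_def by blast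
  then show ?thesis
    using levy_basis_empty
  proof eventually_elim
    case (elim \<omega>)
    have "(\<lambda>n. \<Lambda> (binaryset A B n) \<omega>) sums (\<Lambda> A \<omega> + \<Lambda> B \<omega>)"
      by (rule binaryset_sums[where f="\<lambda>A. \<Lambda> A \<omega>"]) (fact elim(2))
    with elim(1) show ?case by (simp add: UN_binaryset_eq sums_unique2)
  qed
qed

lemma levy_basis_UN:
  assumes "finite I" "\<And>i. i \<in> I \<Longrightarrow> B i \<in> levy_ring m" "disjoint_family_on B I"
  shows "(\<Union>i\<in>I. B i) \<in> levy_ring m \<and> (AE \<omega> in M. \<Lambda> (\<Union>i\<in>I. B i) \<omega> = (\<Sum>i\<in>I. \<Lambda> (B i) \<omega>))"
  using assms
proof (induction I)
  case empty
  then show ?case using levy_basis_empty empty_levy_ring by simp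
next
  case (insert i I)
  then have IH: "(\<Union>i\<in>I. B i) \<in> levy_ring m" "AE \<omega> in M. \<Lambda> (\<Union>i\<in>I. B i) \<omega> = (\<Sum>i\<in>I. \<Lambda> (B i) \<omega>)"
    by (auto simp: disjoint_family_on_def)
  have "B i \<inter> (\<Union>i\<in>I. B i) = {}"
    using insert.hyps insert.prems(2) by (auto simp: disjoint_family_on_def)
  from levy_basis_Un[OF _ IH(1) this] insert.prems(1)
  have "AE \<omega> in M. \<Lambda> (B i \<union> (\<Union>i\<in>I. B i)) \<omega> = \<Lambda> (B i) \<omega> + \<Lambda> (\<Union>i\<in>I. B i) \<omega>" by simp
  with IH(2) have "AE \<omega> in M. \<Lambda> (\<Union>i\<in>insert i I. B i) \<omega> = (\<Sum>i\<in>insert i I. \<Lambda> (B i) \<omega>)"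
    by eventually_elim (use insert.hyps in simp)
  then show ?case using Un_levy_ring[OF _ IH(1)] insert.prems(1) by simp
qed

text \<open>The simple integral is defined through the level sets of \<open>g\<close>, but comparing
  two integrands needs a common partition on which values may repeat. Additivity of the basis holds
  only almost surely, hence the form of the conclusion.\<close>

lemma simple_levy_integral_partition:
  assumes I: "finite I" and B: "\<And>i. i \<in> I \<Longrightarrow> B i \<in> levy_ring m" and dis: "disjoint_family_on B I"
    and gB: "\<And>i x. i \<in> I \<Longrightarrow> x \<in> B i \<Longrightarrow> g x = c i"
    and g0: "\<And>x. x \<in> space m \<Longrightarrow> x \<notin> (\<Union>i\<in>I. B i) \<Longrightarrow> g x = 0"
    and g: "levy_simple m g"
  shows "AE \<omega> in M. simple_levy_integral m \<Lambda> g \<omega> = (\<Sum>i\<in>I. c i * \<Lambda> (B i) \<omega>)"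
proof -
  let ?Y = "g ` space m - {0}"
  have fY: "finite ?Y" using g by (auto simp: levy_simple_def simple_function_def)
  have sp: "B i \<subseteq> space m" if "i \<in> I" for i
    using B[OF that] sets.sets_into_space by (auto simp: levy_ring_def)
  have pre: "g -` {y} \<inter> space m = (\<Union>i\<in>{i\<in>I. c i = y}. B i)" if "y \<noteq> 0" for y
  proof (intro equalityI subsetI)
    fix x assume x: "x \<in> g -` {y} \<inter> space m"
    then have "x \<in> (\<Union>i\<in>I. B i)" using g0[of x] that by (cases "x \<in> (\<Union>i\<in>I. B i)") auto
    then obtain i where "i \<in> I" "x \<in> B i" by blast
    with x gB show "x \<in> (\<Union>i\<in>{i\<in>I. c i = y}. B i)" by auto
  next
    fix x assume "x \<in> (\<Union>i\<in>{i\<in>I. c i = y}. B i)"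
    then show "x \<in> g -` {y} \<inter> space m" using gB sp by auto
  qed
  have "AE \<omega> in M. \<forall>y\<in>?Y. \<Lambda> (g -` {y} \<inter> space m) \<omega> = (\<Sum>i\<in>{i\<in>I. c i = y}. \<Lambda> (B i) \<omega>)"
  proof (intro AE_finite_allI[OF fY])
    fix y assume "y \<in> ?Y"
    then show "AE \<omega> in M. \<Lambda> (g -` {y} \<inter> space m) \<omega> = (\<Sum>i\<in>{i\<in>I. c i = y}. \<Lambda> (B i) \<omega>)"
      using pre[of y] levy_basis_UN[of "{i\<in>I. c i = y}" B] I B dis by (auto simp: disjoint_family_on_def)
  qed
  then show ?thesis
    using levy_basis_empty
  proof eventually_elim
    case (elim \<omega>)
    have emp: "B i = {}" if "i \<in> I" "c i \<noteq> 0" "c i \<notin> ?Y" for i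
    proof (rule ccontr)
      assume "B i \<noteq> {}"
      then obtain x where x: "x \<in> B i" by auto
      then have "c i = g x" "x \<in> space m" using gB[OF that(1)] sp[OF that(1)] by auto
      then show False using that by auto
    qed
    have "simple_levy_integral m \<Lambda> g \<omega> = (\<Sum>y\<in>?Y. y * (\<Sum>i\<in>{i\<in>I. c i = y}. \<Lambda> (B i) \<omega>))"
      unfolding simple_levy_integral_def using elim(1) by (intro sum.cong) auto
    also have "\<dots> = (\<Sum>y\<in>?Y. (\<Sum>i\<in>{i\<in>I. c i = y}. c i * \<Lambda> (B i) \<omega>))"
      by (simp add: sum_distrib_left)
    \<comment> \<open>A nonzero value \<open>c i\<close> outside the range of \<open>g\<close>
      belongs to an empty cell and contributes a multiple of \<open>\<Lambda> {}\<close>, which is 0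
      almost surely.\<close>
    also have "\<dots> = (\<Sum>y\<in>?Y \<union> c ` I. (\<Sum>i\<in>{i\<in>I. c i = y}. c i * \<Lambda> (B i) \<omega>))"
    proof (rule sum.mono_neutral_left)
      show "\<forall>y\<in>?Y \<union> c ` I - ?Y. (\<Sum>i\<in>{i\<in>I. c i = y}. c i * \<Lambda> (B i) \<omega>) = 0"
      proof (intro ballI sum.neutral)
        fix y i assume y: "y \<in> ?Y \<union> c ` I - ?Y" and i: "i \<in> {i\<in>I. c i = y}"
        show "c i * \<Lambda> (B i) \<omega> = 0"
          using emp[of i] i y elim(2) by (cases "c i = 0") auto
      qed
    qed (use fY I in auto)
    also have "\<dots> = (\<Sum>i\<in>I. c i * \<Lambda> (B i) \<omega>)"
      by (rule sum.group) (use fY I in auto)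
    finally show ?case .
  qed
qed

lemma simple_levy_integral_linear:
  assumes g: "levy_simple m g" and h: "levy_simple m h"
  shows "AE \<omega> in M. simple_levy_integral m \<Lambda> (\<lambda>x. a * g x + b * h x) \<omega> =
     a * simple_levy_integral m \<Lambda> g \<omega> + b * simple_levy_integral m \<Lambda> h \<omega>"
proof -
  \<comment> \<open>Pairs of joint values index a partition of the joint support on which
    \<open>g\<close>, \<open>h\<close> and their combination are all constant.\<close>
  define I where "I = (\<lambda>x. (g x, h x)) ` space m - {(0, 0)}"
  define B where "B p = {x \<in> space m. g x = fst p \<and> h x = snd p}" for p
  have gm [measurable]: "g \<in> borel_measurable m" "h \<in> borel_measurable m" using g h levy_simple_measurable by auto
  have "I \<subseteq> (g ` space m) \<times> (h ` space m)" by (auto simp: I_def)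
  then have I: "finite I" using g h by (auto simp: levy_simple_def simple_function_def intro: finite_subset)
  have Bm: "B p \<in> levy_ring m" if p: "p \<in> I" for p
  proof -
    have s: "B p \<in> sets m" unfolding B_def by measurable
    have "fst p \<noteq> 0 \<or> snd p \<noteq> 0" using p by (auto simp: I_def)
    then have "emeasure m (B p) \<le> emeasure m {x \<in> space m. g x \<noteq> 0} \<or> emeasure m (B p) \<le> emeasure m {x \<in> space m. h x \<noteq> 0}"
      by (elim disj_forward; intro emeasure_mono) (auto simp: B_def)
    then have "emeasure m (B p) < \<infinity>" using g h unfolding levy_simple_def by (meson le_less_trans)
    then show ?thesis using s by (simp add: levy_ring_def)
  qed
  have dis: "disjoint_family_on B I" by (auto simp: disjoint_family_on_def B_def prod_eq_iff)
  have out: "g x = 0 \<and> h x = 0" if "x \<in> space m" "x \<notin> (\<Union>p\<in>I. B p)" for x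
    using that by (force simp: I_def B_def)
  have out3: "a * g x + b * h x = 0" if "x \<in> space m" "x \<notin> (\<Union>p\<in>I. B p)" for x
    using out[OF that] by simp
  have Bv: "x \<in> B p \<Longrightarrow> g x = fst p" "x \<in> B p \<Longrightarrow> h x = snd p"
    "x \<in> B p \<Longrightarrow> a * g x + b * h x = a * fst p + b * snd p" for x p by (auto simp: B_def)
  have "AE \<omega> in M. simple_levy_integral m \<Lambda> g \<omega> = (\<Sum>p\<in>I. fst p * \<Lambda> (B p) \<omega>)"
    by (rule simple_levy_integral_partition[OF I Bm dis Bv(1) out[THEN conjunct1] g])
  moreover have "AE \<omega> in M. simple_levy_integral m \<Lambda> h \<omega> = (\<Sum>p\<in>I. snd p * \<Lambda> (B p) \<omega>)"
    by (rule simple_levy_integral_partition[OF I Bm dis Bv(2) out[THEN conjunct2] h])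
  moreover have "AE \<omega> in M. simple_levy_integral m \<Lambda> (\<lambda>x. a * g x + b * h x) \<omega> = (\<Sum>p\<in>I. (a * fst p + b * snd p) * \<Lambda> (B p) \<omega>)"
    by (rule simple_levy_integral_partition[OF I Bm dis Bv(3) out3 levy_simple_linear[OF g h]])
  ultimately show ?thesis
    by eventually_elim (simp add: sum_distrib_left sum.distrib[symmetric] algebra_simps)
qed

lemma simple_levy_integral_measurable:
  assumes g: "levy_simple m g" shows "simple_levy_integral m \<Lambda> g \<in> borel_measurable M"
  unfolding simple_levy_integral_def[abs_def]
  by (intro borel_measurable_sum borel_measurable_times levy_basis_measurable levy_simple_vimage_ring[OF g]) auto

lemma cf_simple_levy_integral:
  assumes g: "levy_simple m g" and \<kappa>0: "\<kappa> 0 = 0"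
  shows "(CLINT \<omega>|M. iexp (z * simple_levy_integral m \<Lambda> g \<omega>)) = exp (\<integral>x. \<kappa> (z * g x) \<partial>m)"
proof -
  interpret prob_space M by fact
  define Y where "Y = g ` space m - {0}"
  have fY: "finite Y" using g by (auto simp: Y_def levy_simple_def simple_function_def)
  define B where "B y = g -` {y} \<inter> space m" for y
  have B: "B y \<in> levy_ring m" if "y \<in> Y" for y
    unfolding B_def by (rule levy_simple_vimage_ring[OF g]) (use that in \<open>auto simp: Y_def\<close>)
  define K where "K = {0..<card Y}"
  obtain e where e: "bij_betw e K Y" using ex_bij_betw_nat_finite[OF fY] by (auto simp: K_def)
  have eY: "e n \<in> Y" if "n \<in> K" for n using e that by (auto simp: bij_betw_def)
  \<comment> \<open>Independence of the basis is stated for infinite sequences, so the finitely many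
    level sets are numbered and padded with empty sets.\<close>
  define A where "A n = (if n \<in> K then B (e n) else {})" for n
  have "disjoint_family A"
    using e by (auto simp: disjoint_family_on_def A_def B_def bij_betw_def inj_on_def)
  moreover have "range A \<subseteq> levy_ring m" using B eY empty_levy_ring by (auto simp: A_def)
  ultimately have "indep_vars (\<lambda>_. borel) (\<lambda>n. \<Lambda> (A n)) UNIV"
    using basis unfolding levy_basis_def by blast
  then have "indep_vars (\<lambda>_. borel) (\<lambda>n. \<Lambda> (A n)) K" by (rule indep_vars_subset) auto
  then have ind: "indep_vars (\<lambda>_. borel) (\<lambda>n \<omega>. e n * \<Lambda> (A n) \<omega>) K"
    by (rule indep_vars_compose2) simp
  have "simple_levy_integral m \<Lambda> g \<omega> = (\<Sum>n\<in>K. e n * \<Lambda> (A n) \<omega>)" for \<omega>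
    unfolding simple_levy_integral_def Y_def[symmetric]
    by (subst sum.reindex_bij_betw[OF e, symmetric]) (auto simp: A_def B_def intro!: sum.cong)
  then have "(CLINT \<omega>|M. iexp (z * simple_levy_integral m \<Lambda> g \<omega>)) = (CLINT \<omega>|M. iexp (z * (\<Sum>n\<in>K. e n * \<Lambda> (A n) \<omega>)))"
    by simp
  also have "\<dots> = char (distr M borel (\<lambda>\<omega>. \<Sum>n\<in>K. e n * \<Lambda> (A n) \<omega>)) z"
    unfolding char_def
    by (subst integral_distr) (auto intro!: borel_measurable_sum borel_measurable_times levy_basis_measurable simp: A_def B eY)
  also have "\<dots> = (\<Prod>n\<in>K. char (distr M borel (\<lambda>\<omega>. e n * \<Lambda> (A n) \<omega>)) z)"
    by (rule char_distr_sum[OF ind])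
  also have "\<dots> = (\<Prod>n\<in>K. exp (of_real (measure m (B (e n))) * \<kappa> (z * e n)))"
  proof (rule prod.cong)
    fix n assume n: "n \<in> K"
    have [measurable]: "\<Lambda> (B (e n)) \<in> borel_measurable M" using B[OF eY[OF n]] by (rule levy_basis_measurable)
    have "char (distr M borel (\<lambda>\<omega>. e n * \<Lambda> (A n) \<omega>)) z = char (distr M borel (\<Lambda> (B (e n)))) (z * e n)"
      unfolding char_def using n by (simp add: integral_distr A_def ac_simps)
    also have "\<dots> = exp (of_real (measure m (B (e n))) * \<kappa> (z * e n))"
      using basis B[OF eY[OF n]] unfolding levy_basis_def by blast
    finally show "char (distr M borel (\<lambda>\<omega>. e n * \<Lambda> (A n) \<omega>)) z = exp (of_real (measure m (B (e n))) * \<kappa> (z * e n))" .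
  qed simp
  also have "\<dots> = exp (\<Sum>n\<in>K. of_real (measure m (B (e n))) * \<kappa> (z * e n))"
    by (simp add: exp_sum K_def)
  also have "(\<Sum>n\<in>K. of_real (measure m (B (e n))) * \<kappa> (z * e n)) = (\<Sum>y\<in>Y. measure m (B y) *\<^sub>R \<kappa> (z * y))"
    by (subst sum.reindex_bij_betw[OF e, symmetric]) (simp add: scaleR_conv_of_real)
  also have "\<dots> = (\<integral>x. \<kappa> (z * g x) \<partial>m)"
    unfolding levy_simple_comp_integral(2)[OF g, of \<kappa>, OF \<kappa>0] Y_def B_def ..
  finally show ?thesis .
qed

end

section \<open>Characteristic functions and second moments\<close>

definition cf :: "'w measure \<Rightarrow> ('w \<Rightarrow> real) \<Rightarrow> real \<Rightarrow> complex" where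
  "cf M Y s = (CLINT \<omega>|M. iexp (s * Y \<omega>))"

lemma inv_nat_mult: "1 / real n * y = y / real n" by simp

lemma n_sin_limit: "(\<lambda>n. real n * sin (c / real n)) \<longlonglongrightarrow> c"
proof -
  have "norm (real n * sin (c / real n) - c) \<le> c\<^sup>2 / 2 * inverse (real n)" if n: "n \<ge> 1" for n
  proof -
    have "\<bar>Im (iexp (c / real n) - 1 - \<i> * of_real (c / real n))\<bar> \<le> (c / real n)\<^sup>2 / 2"
      by (rule order_trans[OF abs_Im_le_cmod norm_iexp_remainder_le])
    then have "\<bar>sin (c / real n) - c / real n\<bar> \<le> (c / real n)\<^sup>2 / 2"
      by (simp add: Im_exp del: of_real_divide)
    then have "real n * \<bar>sin (c / real n) - c / real n\<bar> \<le> real n * ((c / real n)\<^sup>2 / 2)"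
      by (rule mult_left_mono) simp
    moreover have "real n * \<bar>sin (c / real n) - c / real n\<bar> = \<bar>real n * sin (c / real n) - c\<bar>"
      using n by (subst abs_of_nat[symmetric], subst abs_mult[symmetric]) (simp add: right_diff_distrib)
    moreover have "real n * ((c / real n)\<^sup>2 / 2) = c\<^sup>2 / 2 * inverse (real n)"
      using n by (simp add: field_simps power2_eq_square)
    ultimately show ?thesis by simp
  qed
  then have ev: "\<forall>\<^sub>F n in sequentially. norm (real n * sin (c / real n) - c) \<le> c\<^sup>2 / 2 * inverse (real n)"
    by (rule eventually_sequentiallyI)
  have "(\<lambda>n. c\<^sup>2 / 2 * inverse (real n)) \<longlonglongrightarrow> 0"
    using tendsto_mult_left[OF lim_inverse_n, of "c\<^sup>2 / 2"] by simp
  from Lim_null_comparison[OF ev this] show ?thesis by (rule LIM_zero_cancel)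
qed

lemma n_cos_limit: "(\<lambda>n. (real n)\<^sup>2 * (2 * (1 - cos (c / real n)))) \<longlonglongrightarrow> c\<^sup>2"
proof -
  have eq: "(real n)\<^sup>2 * (2 * (1 - cos (c / real n))) = (2 * (real n * sin (c / 2 / real n)))\<^sup>2" for n
  proof -
    have "cos (c / real n) = cos (2 * (c / 2 / real n))" by simp
    also have "\<dots> = 1 - 2 * (sin (c / 2 / real n))\<^sup>2" by (rule cos_double_sin)
    finally show ?thesis by (simp add: power_mult_distrib)
  qed
  have "(\<lambda>n. (2 * (real n * sin (c / 2 / real n)))\<^sup>2) \<longlonglongrightarrow> (2 * (c / 2))\<^sup>2"
    by (intro tendsto_intros n_sin_limit)
  then show ?thesis unfolding eq by simp
qed

lemma one_minus_cos_le: "0 \<le> 1 - cos u" "1 - cos u \<le> u\<^sup>2 / 2" for u :: real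
proof -
  have "\<bar>Re (iexp u - 1 - \<i> * of_real u)\<bar> \<le> u\<^sup>2 / 2"
    by (rule order_trans[OF abs_Re_le_cmod norm_iexp_remainder_le])
  then show "1 - cos u \<le> u\<^sup>2 / 2" by (simp add: Re_exp)
qed simp

lemma n_cos_bound: "0 \<le> (real n)\<^sup>2 * (2 * (1 - cos (c / real n)))" "(real n)\<^sup>2 * (2 * (1 - cos (c / real n))) \<le> c\<^sup>2"
proof -
  have "(real n)\<^sup>2 * (2 * (1 - cos (c / real n))) \<le> (real n)\<^sup>2 * (2 * ((c / real n)\<^sup>2 / 2))"
    by (intro mult_left_mono one_minus_cos_le) auto
  also have "\<dots> \<le> c\<^sup>2" by (cases "n = 0") (simp_all add: power_divide)
  finally show "(real n)\<^sup>2 * (2 * (1 - cos (c / real n))) \<le> c\<^sup>2" .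
qed (simp add: one_minus_cos_le)

context prob_space
begin

lemma integrable_cf [simp]: "Y \<in> borel_measurable M \<Longrightarrow> integrable M (\<lambda>\<omega>. iexp (s * Y \<omega>))"
  by (rule integrable_const_bound[where B=1]) (auto simp del: of_real_mult)

lemma Re_cf: "Y \<in> borel_measurable M \<Longrightarrow> Re (cf M Y s) = expectation (\<lambda>\<omega>. cos (s * Y \<omega>))"
  and Im_cf: "Y \<in> borel_measurable M \<Longrightarrow> Im (cf M Y s) = expectation (\<lambda>\<omega>. sin (s * Y \<omega>))"
proof -
  assume Y: "Y \<in> borel_measurable M"
  have "Re (iexp u) = cos u" "Im (iexp u) = sin u" for u by (simp_all add: Re_exp Im_exp)
  then show "Re (cf M Y s) = expectation (\<lambda>\<omega>. cos (s * Y \<omega>))" "Im (cf M Y s) = expectation (\<lambda>\<omega>. sin (s * Y \<omega>))"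
    unfolding cf_def integral_Re[OF integrable_cf[OF Y], symmetric] integral_Im[OF integrable_cf[OF Y], symmetric] by (simp_all only:)
qed

lemma integrable_square_imp:
  assumes "Y \<in> borel_measurable M" "integrable M (\<lambda>\<omega>. (Y \<omega>)\<^sup>2)"
  shows "integrable M (Y :: 'a \<Rightarrow> real)"
  using square_integrable_imp_integrable[OF assms] .

text \<open>The moments are difference quotients of the characteristic function at 0, taken along
  \<open>1 / n\<close>; the squared variable and the modulus of the variable are the dominating
  functions.\<close>

lemma expectation_limits:
  assumes Y[measurable]: "Y \<in> borel_measurable M" and Y2: "integrable M (\<lambda>\<omega>. (Y \<omega>)\<^sup>2)"
  shows "(\<lambda>n. (real n)\<^sup>2 * (2 * (1 - Re (cf M Y (1 / real n))))) \<longlonglongrightarrow> expectation (\<lambda>\<omega>. (Y \<omega>)\<^sup>2)"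
    and "(\<lambda>n. real n * Im (cf M Y (1 / real n))) \<longlonglongrightarrow> expectation Y"
proof -
  have bc: "integrable M (\<lambda>\<omega>. cos (Y \<omega> / real n))" for n
    by (rule integrable_const_bound[where B=1]) auto
  have "(\<lambda>n. expectation (\<lambda>\<omega>. (real n)\<^sup>2 * (2 * (1 - cos (Y \<omega> / real n))))) \<longlonglongrightarrow> expectation (\<lambda>\<omega>. (Y \<omega>)\<^sup>2)"
  proof (rule integral_dominated_convergence[OF _ _ Y2])
    show "AE \<omega> in M. (\<lambda>n. (real n)\<^sup>2 * (2 * (1 - cos (Y \<omega> / real n)))) \<longlonglongrightarrow> (Y \<omega>)\<^sup>2"
      by (rule AE_I2, rule n_cos_limit)
    show "AE \<omega> in M. norm ((real n)\<^sup>2 * (2 * (1 - cos (Y \<omega> / real n)))) \<le> (Y \<omega>)\<^sup>2" for n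
      by (rule AE_I2) (simp only: real_norm_def abs_of_nonneg n_cos_bound)
  qed measurable
  moreover have "expectation (\<lambda>\<omega>. (real n)\<^sup>2 * (2 * (1 - cos (Y \<omega> / real n)))) = (real n)\<^sup>2 * (2 * (1 - Re (cf M Y (1 / real n))))" for n
    using bc[of n] by (simp add: Re_cf prob_space)
  ultimately show "(\<lambda>n. (real n)\<^sup>2 * (2 * (1 - Re (cf M Y (1 / real n))))) \<longlonglongrightarrow> expectation (\<lambda>\<omega>. (Y \<omega>)\<^sup>2)" by (simp only:)
  have "(\<lambda>n. expectation (\<lambda>\<omega>. real n * sin (Y \<omega> / real n))) \<longlonglongrightarrow> expectation Y"
  proof (rule integral_dominated_convergence[where w="\<lambda>\<omega>. \<bar>Y \<omega>\<bar>"])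
    show "AE \<omega> in M. norm (real n * sin (Y \<omega> / real n)) \<le> \<bar>Y \<omega>\<bar>" for n
    proof (rule AE_I2)
      fix \<omega>
      have "\<bar>real n * sin (Y \<omega> / real n)\<bar> \<le> real n * \<bar>Y \<omega> / real n\<bar>"
        unfolding abs_mult by (intro mult_mono abs_sin_x_le_abs_x) auto
      then show "norm (real n * sin (Y \<omega> / real n)) \<le> \<bar>Y \<omega>\<bar>" by (cases "n = 0") auto
    qed
  qed (use integrable_square_imp[OF Y Y2] in \<open>auto intro: n_sin_limit\<close>)
  then show "(\<lambda>n. real n * Im (cf M Y (1 / real n))) \<longlonglongrightarrow> expectation Y"
    by (simp add: Im_cf)
qed

text \<open>A converse to \<open>expectation_limits\<close>: the second moment is not assumed but
  obtained from Fatou, since the rescaled functions \<open>1 - cos\<close> are nonnegative and tend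
  to the square.\<close>

lemma moments_of_cf:
  assumes Y[measurable]: "Y \<in> borel_measurable M"
    and lim: "(\<lambda>n. (real n)\<^sup>2 * (cf M Y (1 / real n) - 1)) \<longlonglongrightarrow> of_real (- V / 2)"
  shows "integrable M (\<lambda>\<omega>. (Y \<omega>)\<^sup>2)" "expectation (\<lambda>\<omega>. (Y \<omega>)\<^sup>2) = V" "expectation Y = 0"
proof -
  have lim2: "(\<lambda>n. (real n)\<^sup>2 * (2 * (1 - Re (cf M Y (1 / real n))))) \<longlonglongrightarrow> V"
    using tendsto_mult[OF tendsto_const[of "-2"] tendsto_Re[OF lim]] by (simp add: algebra_simps)
  have "(\<integral>\<^sup>+\<omega>. ennreal ((Y \<omega>)\<^sup>2) \<partial>M) = (\<integral>\<^sup>+\<omega>. liminf (\<lambda>n. ennreal ((real n)\<^sup>2 * (2 * (1 - cos (Y \<omega> / real n))))) \<partial>M)"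
    by (intro nn_integral_cong lim_imp_Liminf[symmetric] tendsto_ennrealI n_cos_limit) auto
  also have "\<dots> \<le> liminf (\<lambda>n. \<integral>\<^sup>+\<omega>. ennreal ((real n)\<^sup>2 * (2 * (1 - cos (Y \<omega> / real n)))) \<partial>M)"
    by (rule nn_integral_liminf) measurable
  also have "\<dots> = liminf (\<lambda>n. ennreal ((real n)\<^sup>2 * (2 * (1 - Re (cf M Y (1 / real n))))))"
  proof -
    have bc: "integrable M (\<lambda>\<omega>. cos (Y \<omega> / real n))" for n
      by (rule integrable_const_bound[where B=1]) auto
    have "(\<integral>\<^sup>+\<omega>. ennreal ((real n)\<^sup>2 * (2 * (1 - cos (Y \<omega> / real n)))) \<partial>M) = ennreal ((real n)\<^sup>2 * (2 * (1 - Re (cf M Y (1 / real n)))))" for n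
      using bc[of n] by (subst nn_integral_eq_integral) (auto simp: Re_cf prob_space n_cos_bound one_minus_cos_le)
    then show ?thesis by simp
  qed
  also have "\<dots> = ennreal V"
    by (intro lim_imp_Liminf tendsto_ennrealI lim2) simp
  also have "\<dots> < \<infinity>" by simp
  finally show Y2: "integrable M (\<lambda>\<omega>. (Y \<omega>)\<^sup>2)"
    by (intro integrableI_nonneg) auto
  show "expectation (\<lambda>\<omega>. (Y \<omega>)\<^sup>2) = V"
    using LIMSEQ_unique[OF expectation_limits(1)[OF Y Y2] lim2] .
  \<comment> \<open>The imaginary part is of quadratic order in \<open>1 / n\<close>, so it still
    vanishes after multiplication by \<open>n\<close>; its limit would be the mean.\<close>
  have "(\<lambda>n. inverse (real n) * Im ((real n)\<^sup>2 * (cf M Y (1 / real n) - 1))) \<longlonglongrightarrow> 0 * Im (of_real (- V / 2))"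
    by (intro tendsto_mult tendsto_Im lim lim_inverse_n)
  then have "(\<lambda>n. inverse (real n) * Im ((real n)\<^sup>2 * (cf M Y (1 / real n) - 1))) \<longlonglongrightarrow> 0" by simp
  moreover have "inverse (real n) * Im ((real n)\<^sup>2 * (cf M Y (1 / real n) - 1)) = real n * Im (cf M Y (1 / real n))" for n
  proof -
    have "Im ((real n)\<^sup>2 * (cf M Y (1 / real n) - 1)) = (real n)\<^sup>2 * Im (cf M Y (1 / real n))"
      by (simp add: of_real_power[symmetric] del: of_real_power of_real_of_nat_eq)
    then show ?thesis by (cases "n = 0") (simp_all add: power2_eq_square)
  qed
  ultimately have "(\<lambda>n. real n * Im (cf M Y (1 / real n))) \<longlonglongrightarrow> 0" by (simp only:)
  then show "expectation Y = 0"
    using LIMSEQ_unique[OF expectation_limits(2)[OF Y Y2]] by blast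
qed

text \<open>Second moments of centred variables can be read off from the modulus of the characteristic function,
  which does not see deterministic shifts.\<close>

lemma centered_second_moment_le:
  assumes Y[measurable]: "Y \<in> borel_measurable M" and Y2: "integrable M (\<lambda>\<omega>. (Y \<omega>)\<^sup>2)" and EY: "expectation Y = 0"
    and bound: "\<And>n. n \<ge> 1 \<Longrightarrow> 1 - C / (real n)\<^sup>2 \<le> (norm (cf M Y (1 / real n)))\<^sup>2"
  shows "expectation (\<lambda>\<omega>. (Y \<omega>)\<^sup>2) \<le> C"
proof -
  let ?r = "\<lambda>n. Re (cf M Y (1 / real n))" and ?i = "\<lambda>n. Im (cf M Y (1 / real n))"
  let ?V = "expectation (\<lambda>\<omega>. (Y \<omega>)\<^sup>2)"
  note L = expectation_limits[OF Y Y2]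
  have "(\<lambda>n. (inverse (real n))\<^sup>2 * ((real n)\<^sup>2 * (2 * (1 - ?r n))) / 2) \<longlonglongrightarrow> 0\<^sup>2 * ?V / 2"
    by (intro tendsto_intros L lim_inverse_n) simp
  moreover have "\<forall>\<^sub>F n in sequentially. (inverse (real n))\<^sup>2 * ((real n)\<^sup>2 * (2 * (1 - ?r n))) / 2 = 1 - ?r n"
    by (rule eventually_sequentiallyI[of 1]) (simp add: field_simps)
  ultimately have "(\<lambda>n. 1 - ?r n) \<longlonglongrightarrow> 0" by (subst (asm) tendsto_cong) auto
  then have r1: "?r \<longlonglongrightarrow> 1" using tendsto_diff[OF tendsto_const[of 1], of "\<lambda>n. 1 - ?r n"] by fastforce
  \<comment> \<open>With \<open>r\<close> and \<open>i\<close> the real and imaginary part,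
    \<open>1 - (r^2 + i^2) = (1 - r) * (1 + r) - i^2\<close>. After rescaling, the first term tends
    to the second moment because \<open>r\<close> tends to 1, the second to the square of the mean,
    which is 0.\<close>
  have "(\<lambda>n. (real n)\<^sup>2 * (2 * (1 - ?r n)) * (1 + ?r n) / 2 - (real n * ?i n)\<^sup>2) \<longlonglongrightarrow> ?V * (1 + 1) / 2 - 0\<^sup>2"
    using L(2) unfolding EY by (intro tendsto_intros L r1) auto
  then have lim: "(\<lambda>n. (real n)\<^sup>2 * (2 * (1 - ?r n)) * (1 + ?r n) / 2 - (real n * ?i n)\<^sup>2) \<longlonglongrightarrow> ?V" by simp
  show ?thesis
  proof (rule LIMSEQ_le_const2[OF lim], intro exI allI impI)
    fix n :: nat assume n: "n \<ge> 1"
    have "(real n)\<^sup>2 * (2 * (1 - ?r n)) * (1 + ?r n) / 2 - (real n * ?i n)\<^sup>2 = (real n)\<^sup>2 * (1 - (norm (cf M Y (1 / real n)))\<^sup>2)"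
    proof -
      have "N\<^sup>2 * (2 * (1 - r)) * (1 + r) / 2 - (N * i)\<^sup>2 = N\<^sup>2 * (1 - (r\<^sup>2 + i\<^sup>2))" for N r i :: real
        by (simp add: power2_eq_square field_simps)
      then show ?thesis unfolding cmod_power2 by blast
    qed
    also have "\<dots> \<le> (real n)\<^sup>2 * (C / (real n)\<^sup>2)"
      using bound[OF n] by (intro mult_left_mono) auto
    finally show "(real n)\<^sup>2 * (2 * (1 - ?r n)) * (1 + ?r n) / 2 - (real n * ?i n)\<^sup>2 \<le> C" using n by simp
  qed
qed

lemma Re_cf_ge:
  assumes Y[measurable]: "Y \<in> borel_measurable M" and Y2: "integrable M (\<lambda>\<omega>. (Y \<omega>)\<^sup>2)"
  shows "1 - s\<^sup>2 * expectation (\<lambda>\<omega>. (Y \<omega>)\<^sup>2) / 2 \<le> Re (cf M Y s)"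
proof -
  have "expectation (\<lambda>\<omega>. 1 - s\<^sup>2 / 2 * (Y \<omega>)\<^sup>2) \<le> expectation (\<lambda>\<omega>. cos (s * Y \<omega>))"
  proof (rule integral_mono)
    show "integrable M (\<lambda>\<omega>. cos (s * Y \<omega>))" by (rule integrable_const_bound[where B=1]) auto
    show "1 - s\<^sup>2 / 2 * (Y \<omega>)\<^sup>2 \<le> cos (s * Y \<omega>)" for \<omega>
      using one_minus_cos_le(2)[of "s * Y \<omega>"] by (simp add: power_mult_distrib)
  qed (use Y2 in auto)
  then show ?thesis using Y2 by (simp add: Re_cf prob_space)
qed

text \<open>The distance is at most \<open>\<bar>s\<bar> * d\<close> where the variables differ by
  at most \<open>d\<close>, and at most 2 on the remaining event of small probability. Working with
  the difference \<open>Y n - Z\<close> lets the estimate be used after a common variable has been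
  subtracted from both.\<close>

lemma conv_in_prob_cf:
  assumes Y[measurable]: "\<And>n. Y n \<in> borel_measurable M" and Z[measurable]: "Z \<in> borel_measurable M" and conv: "conv_in_prob M Y Z"
  shows "(\<lambda>n. expectation (\<lambda>\<omega>. norm (iexp (s * (Y n \<omega> - Z \<omega>)) - 1))) \<longlonglongrightarrow> 0"
proof (rule tendstoI)
  fix e :: real assume e: "e > 0"
  define d where "d = e / (2 * (\<bar>s\<bar> + 1))"
  have d: "d > 0" "\<bar>s\<bar> * d < e / 2" using e by (auto simp: d_def field_simps)
  let ?A = "\<lambda>n. {\<omega> \<in> space M. \<bar>Y n \<omega> - Z \<omega>\<bar> > d}"
  have "(\<lambda>n. prob (?A n)) \<longlonglongrightarrow> 0" using conv d by (auto simp: conv_in_prob_def)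
  then have "\<forall>\<^sub>F n in sequentially. prob (?A n) < e / 4" by (rule order_tendstoD) (use e in simp)
  then show "\<forall>\<^sub>F n in sequentially. dist (expectation (\<lambda>\<omega>. norm (iexp (s * (Y n \<omega> - Z \<omega>)) - 1))) 0 < e"
  proof eventually_elim
    case (elim n)
    have "expectation (\<lambda>\<omega>. norm (iexp (s * (Y n \<omega> - Z \<omega>)) - 1)) \<le> expectation (\<lambda>\<omega>. \<bar>s\<bar> * d + 2 * indicator (?A n) \<omega>)"
    proof (rule integral_mono)
      show "integrable M (\<lambda>\<omega>. norm (iexp (s * (Y n \<omega> - Z \<omega>)) - 1))"
        by (rule integrable_const_bound[where B=2]) (use norm_iexp_diff_one_le(2) in \<open>auto simp del: of_real_mult of_real_diff\<close>)
      show "integrable M (\<lambda>\<omega>. \<bar>s\<bar> * d + 2 * indicat_real (?A n) \<omega>)"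
        by (intro Bochner_Integration.integrable_add integrable_const integrable_mult_right integrable_real_indicator) (auto simp: emeasure_eq_measure)
      fix \<omega> assume w: "\<omega> \<in> space M"
      show "norm (iexp (s * (Y n \<omega> - Z \<omega>)) - 1) \<le> \<bar>s\<bar> * d + 2 * indicat_real (?A n) \<omega>"
      proof (cases "\<bar>Y n \<omega> - Z \<omega>\<bar> > d")
        case True
        then have "\<omega> \<in> ?A n" using w by simp
        then have "indicat_real (?A n) \<omega> = 1" by (rule indicator_simps)
        moreover have "0 \<le> \<bar>s\<bar> * d" using d(1) by simp
        ultimately show ?thesis using norm_iexp_diff_one_le(2)[of "s * (Y n \<omega> - Z \<omega>)"] by linarith
      next
        case False
        then have "\<bar>s * (Y n \<omega> - Z \<omega>)\<bar> \<le> \<bar>s\<bar> * d" unfolding abs_mult by (intro mult_left_mono) auto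
        moreover have "0 \<le> indicat_real (?A n) \<omega>" by simp
        ultimately show ?thesis using norm_iexp_diff_one_le(1)[of "s * (Y n \<omega> - Z \<omega>)"] by linarith
      qed
    qed
    also have "\<dots> = \<bar>s\<bar> * d + 2 * prob (?A n)"
      by (simp add: prob_space emeasure_eq_measure)
    also have "\<dots> < e" using d(2) elim by linarith
    finally have "expectation (\<lambda>\<omega>. norm (iexp (s * (Y n \<omega> - Z \<omega>)) - 1)) < e" .
    moreover have "0 \<le> expectation (\<lambda>\<omega>. norm (iexp (s * (Y n \<omega> - Z \<omega>)) - 1))"
      by (intro integral_nonneg_AE AE_I2) simp
    ultimately show ?case unfolding dist_real_def by linarith
  qed
qed

lemma norm_cf_diff_le:
  assumes [measurable]: "Y \<in> borel_measurable M" "Z \<in> borel_measurable M"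
  shows "norm (cf M Y s - cf M Z s) \<le> expectation (\<lambda>\<omega>. norm (iexp (s * (Y \<omega> - Z \<omega>)) - 1))"
proof -
  have "norm (cf M Y s - cf M Z s) = norm (CLINT \<omega>|M. iexp (s * Y \<omega>) - iexp (s * Z \<omega>))"
    unfolding cf_def by (subst Bochner_Integration.integral_diff[OF integrable_cf integrable_cf]) (simp_all only: assms)
  also have "\<dots> \<le> expectation (\<lambda>\<omega>. norm (iexp (s * Y \<omega>) - iexp (s * Z \<omega>)))" by (rule integral_norm_bound)
  also have "\<dots> = expectation (\<lambda>\<omega>. norm (iexp (s * (Y \<omega> - Z \<omega>)) - 1))"
  proof (rule Bochner_Integration.integral_cong)
    fix \<omega>
    have "iexp (s * Y \<omega>) - iexp (s * Z \<omega>) = iexp (s * Z \<omega>) * (iexp (s * (Y \<omega> - Z \<omega>)) - 1)"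
    proof -
      have "s * Y \<omega> = s * Z \<omega> + s * (Y \<omega> - Z \<omega>)" by (simp add: algebra_simps)
      then have "iexp (s * Y \<omega>) = iexp (s * Z \<omega>) * iexp (s * (Y \<omega> - Z \<omega>))"
        by (simp only: of_real_add distrib_left exp_add)
      then show ?thesis by (simp only: right_diff_distrib mult_1_right)
    qed
    then show "norm (iexp (s * Y \<omega>) - iexp (s * Z \<omega>)) = norm (iexp (s * (Y \<omega> - Z \<omega>)) - 1)"
      by (simp only: norm_mult norm_exp_i_times mult_1)
  qed simp
  finally show ?thesis .
qed

end

text \<open>Inverts \<open>exp (- t) \<le> 1 / (1 + t)\<close>: a modulus close to 1 means a small
  exponent. The restriction on \<open>x\<close> produces the factor 2.\<close>

lemma exp_neg_ge_imp:
  assumes "1 - x \<le> exp (- t)" "x \<le> 1 / 2" "0 \<le> (t::real)"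
  shows "t \<le> 2 * x"
proof -
  have "exp (- t) \<le> 1 / (1 + t)"
    using exp_ge_add_one_self[of t] assms(3) by (simp add: exp_minus field_simps)
  then have "1 - x \<le> 1 / (1 + t)" using assms(1) by linarith
  then have "(1 - x) * (1 + t) \<le> 1" using assms(3) by (simp add: pos_le_divide_eq)
  then have "t * (1 - x) \<le> x" by (simp add: algebra_simps)
  moreover have "t * (1 / 2) \<le> t * (1 - x)" using assms by (intro mult_left_mono) auto
  ultimately show ?thesis by simp
qed

text \<open>The exponents tend to 0, where \<open>exp\<close> has derivative 1. The quotient
  \<open>(exp z - 1) / z\<close> is extended continuously by \<open>q\<close>, so terms with
  \<open>w n = 0\<close> need no separate treatment.\<close>

lemma exp_scaled_limit:
  fixes w :: "nat \<Rightarrow> complex"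
  assumes w: "(\<lambda>n. (real n)\<^sup>2 * w n) \<longlonglongrightarrow> L"
  shows "(\<lambda>n. (real n)\<^sup>2 * (exp (w n) - 1)) \<longlonglongrightarrow> L"
proof -
  define q where "q z = (if z = 0 then 1 else (exp z - 1) / z)" for z :: complex
  have "(\<lambda>h. (exp (0 + h) - exp 0) / h) \<midarrow>0\<rightarrow> exp (0::complex)"
    using DERIV_exp[of "0::complex"] unfolding DERIV_def .
  then have "(\<lambda>h::complex. (exp h - 1) / h) \<midarrow>0\<rightarrow> 1" by simp
  then have "q \<midarrow>0\<rightarrow> 1" by (rule Lim_transform_eventually) (auto simp: q_def eventually_at_filter)
  then have q: "isCont q 0" by (simp add: isCont_def q_def)
  have "(\<lambda>n. of_real ((inverse (real n))\<^sup>2) * ((real n)\<^sup>2 * w n)) \<longlonglongrightarrow> of_real (0\<^sup>2) * L"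
    by (intro tendsto_mult tendsto_of_real tendsto_power lim_inverse_n w)
  moreover have "\<forall>\<^sub>F n in sequentially. of_real ((inverse (real n))\<^sup>2) * ((real n)\<^sup>2 * w n) = w n"
    by (rule eventually_sequentiallyI[of 1]) (simp add: power_inverse field_simps)
  ultimately have "w \<longlonglongrightarrow> 0" by (subst (asm) tendsto_cong) auto
  then have "(\<lambda>n. (real n)\<^sup>2 * w n * q (w n)) \<longlonglongrightarrow> L * q 0"
    by (intro tendsto_mult w isCont_tendsto_compose[OF q])
  moreover have "(real n)\<^sup>2 * w n * q (w n) = (real n)\<^sup>2 * (exp (w n) - 1)" for n
    by (simp add: q_def)
  moreover have "L * q 0 = L" by (simp add: q_def)
  ultimately show ?thesis by (simp only:)
qed

section \<open>Square integrable integrals\<close>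

lemma Cauchy_Schwarz_integral:
  fixes f g :: "'a \<Rightarrow> real"
  assumes [measurable]: "f \<in> borel_measurable M" "g \<in> borel_measurable M"
    and f2: "integrable M (\<lambda>x. (f x)\<^sup>2)" and g2: "integrable M (\<lambda>x. (g x)\<^sup>2)"
  shows "integrable M (\<lambda>x. f x * g x)"
    and "\<bar>\<integral>x. f x * g x \<partial>M\<bar> \<le> sqrt (\<integral>x. (f x)\<^sup>2 \<partial>M) * sqrt (\<integral>x. (g x)\<^sup>2 \<partial>M)"
proof -
  show fg: "integrable M (\<lambda>x. f x * g x)"
  proof (rule Bochner_Integration.integrable_bound)
    show "integrable M (\<lambda>x. (f x)\<^sup>2 + (g x)\<^sup>2)" using f2 g2 by simp
    show "AE x in M. norm (f x * g x) \<le> norm ((f x)\<^sup>2 + (g x)\<^sup>2)"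
    proof (rule AE_I2)
      fix x
      have "2 * \<bar>f x\<bar> * \<bar>g x\<bar> \<le> \<bar>f x\<bar>\<^sup>2 + \<bar>g x\<bar>\<^sup>2" by (rule sum_squares_bound)
      moreover have "0 \<le> \<bar>f x\<bar> * \<bar>g x\<bar>" by simp
      ultimately have "\<bar>f x\<bar> * \<bar>g x\<bar> \<le> \<bar>f x\<bar>\<^sup>2 + \<bar>g x\<bar>\<^sup>2" by linarith
      then show "norm (f x * g x) \<le> norm ((f x)\<^sup>2 + (g x)\<^sup>2)" by (simp add: abs_mult)
    qed
  qed measurable
  let ?F = "\<integral>x. (f x)\<^sup>2 \<partial>M" and ?G = "\<integral>x. (g x)\<^sup>2 \<partial>M" and ?I = "\<integral>x. f x * g x \<partial>M"
  have F: "0 \<le> ?F" and G: "0 \<le> ?G" by simp_all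
  have quad: "0 \<le> t\<^sup>2 * ?F + 2 * t * ?I + ?G" for t
  proof -
    have "0 \<le> (\<integral>x. (t * f x + g x)\<^sup>2 \<partial>M)" by simp
    also have "(\<integral>x. (t * f x + g x)\<^sup>2 \<partial>M) = (\<integral>x. t\<^sup>2 * (f x)\<^sup>2 + 2 * t * (f x * g x) + (g x)\<^sup>2 \<partial>M)"
      by (intro Bochner_Integration.integral_cong) (auto simp: power2_eq_square algebra_simps)
    also have "\<dots> = t\<^sup>2 * ?F + 2 * t * ?I + ?G" using f2 g2 fg by simp
    finally show ?thesis .
  qed
  have "?I\<^sup>2 \<le> ?F * ?G"
  proof (cases "?F = 0")
    case True
    have "?I = 0"
    proof (rule ccontr)
      assume I: "?I \<noteq> 0"
      \<comment> \<open>Without its quadratic term the nonnegative polynomial \<open>quad\<close>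
        would take the value -1 at this point.\<close>
      have "2 * (- (?G + 1) / (2 * ?I)) * ?I = - (?G + 1)" using I by (simp add: field_simps)
      then show False using quad[of "- (?G + 1) / (2 * ?I)"] True by simp
    qed
    then show ?thesis using True by simp
  next
    case False
    then have "(- ?I / ?F)\<^sup>2 * ?F + 2 * (- ?I / ?F) * ?I + ?G = ?G - ?I\<^sup>2 / ?F"
      by (simp add: field_simps power2_eq_square)
    then have "?I\<^sup>2 / ?F \<le> ?G" using quad[of "- ?I / ?F"] by simp
    then show ?thesis using False F by (simp add: pos_divide_le_eq mult.commute)
  qed
  then have "sqrt (?I\<^sup>2) \<le> sqrt (?F * ?G)" by (rule real_sqrt_le_mono)
  then show "\<bar>?I\<bar> \<le> sqrt ?F * sqrt ?G" by (simp add: real_sqrt_mult)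
qed

lemma integrable_square_linear:
  fixes f g :: "'a \<Rightarrow> real"
  assumes "f \<in> borel_measurable M" "g \<in> borel_measurable M"
    and "integrable M (\<lambda>x. (f x)\<^sup>2)" "integrable M (\<lambda>x. (g x)\<^sup>2)"
  shows "integrable M (\<lambda>x. (a * f x + b * g x)\<^sup>2)"
    and "(\<integral>x. (a * f x + b * g x)\<^sup>2 \<partial>M) =
      a\<^sup>2 * (\<integral>x. (f x)\<^sup>2 \<partial>M) + 2 * a * b * (\<integral>x. f x * g x \<partial>M) + b\<^sup>2 * (\<integral>x. (g x)\<^sup>2 \<partial>M)"
proof -
  have eq: "(a * f x + b * g x)\<^sup>2 = a\<^sup>2 * (f x)\<^sup>2 + 2 * a * b * (f x * g x) + b\<^sup>2 * (g x)\<^sup>2" for x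
    by (simp add: power2_eq_square algebra_simps)
  show "integrable M (\<lambda>x. (a * f x + b * g x)\<^sup>2)"
    unfolding eq using assms Cauchy_Schwarz_integral(1)[OF assms] by simp
  show "(\<integral>x. (a * f x + b * g x)\<^sup>2 \<partial>M) =
      a\<^sup>2 * (\<integral>x. (f x)\<^sup>2 \<partial>M) + 2 * a * b * (\<integral>x. f x * g x \<partial>M) + b\<^sup>2 * (\<integral>x. (g x)\<^sup>2 \<partial>M)"
    unfolding eq using assms Cauchy_Schwarz_integral(1)[OF assms] by simp
qed

lemmas integrable_square_diff = integrable_square_linear(1)[where a=1 and b="-1", simplified]

lemma integral_square_linear_le:
  fixes f g :: "'a \<Rightarrow> real"
  assumes f: "f \<in> borel_measurable M" "g \<in> borel_measurable M"
    and f2: "integrable M (\<lambda>x. (f x)\<^sup>2)" "integrable M (\<lambda>x. (g x)\<^sup>2)"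
  shows "(\<integral>x. (a * f x + b * g x)\<^sup>2 \<partial>M) \<le> 2 * a\<^sup>2 * (\<integral>x. (f x)\<^sup>2 \<partial>M) + 2 * b\<^sup>2 * (\<integral>x. (g x)\<^sup>2 \<partial>M)"
proof -
  have "0 \<le> (\<integral>x. (a * f x + (- b) * g x)\<^sup>2 \<partial>M)" by simp
  then show ?thesis
    unfolding integrable_square_linear(2)[OF assms] by simp
qed

lemma integral_square_LIMSEQ:
  fixes f :: "'a \<Rightarrow> real"
  assumes f: "f \<in> borel_measurable M" "integrable M (\<lambda>x. (f x)\<^sup>2)"
    and g: "\<And>n. g n \<in> borel_measurable M" "\<And>n. integrable M (\<lambda>x. (g n x)\<^sup>2)"
    and lim: "(\<lambda>n. \<integral>x. (g n x - f x)\<^sup>2 \<partial>M) \<longlonglongrightarrow> 0"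
  shows "(\<lambda>n. \<integral>x. (g n x)\<^sup>2 \<partial>M) \<longlonglongrightarrow> (\<integral>x. (f x)\<^sup>2 \<partial>M)"
proof -
  let ?d = "\<lambda>n. \<integral>x. (g n x - f x)\<^sup>2 \<partial>M"
  have d2: "integrable M (\<lambda>x. (g n x - f x)\<^sup>2)" for n using integrable_square_diff[OF g(1) f(1) g(2) f(2)] .
  have dm: "(\<lambda>x. g n x - f x) \<in> borel_measurable M" for n using f g by simp
  have "norm ((\<integral>x. (g n x)\<^sup>2 \<partial>M) - (\<integral>x. (f x)\<^sup>2 \<partial>M)) \<le> ?d n + 2 * (sqrt (\<integral>x. (f x)\<^sup>2 \<partial>M) * sqrt (?d n))" for n
  proof -
    have "(\<integral>x. (g n x)\<^sup>2 \<partial>M) = (\<integral>x. (1 * f x + 1 * (g n x - f x))\<^sup>2 \<partial>M)" by simp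
    also have "\<dots> = (\<integral>x. (f x)\<^sup>2 \<partial>M) + 2 * (\<integral>x. f x * (g n x - f x) \<partial>M) + ?d n"
      by (subst integrable_square_linear(2)[OF f(1) dm f(2) d2]) simp
    finally have "(\<integral>x. (g n x)\<^sup>2 \<partial>M) - (\<integral>x. (f x)\<^sup>2 \<partial>M) = 2 * (\<integral>x. f x * (g n x - f x) \<partial>M) + ?d n" by simp
    moreover have "0 \<le> ?d n" by simp
    ultimately show ?thesis using Cauchy_Schwarz_integral(2)[OF f(1) dm f(2) d2, of n] unfolding real_norm_def by linarith
  qed
  then have ev: "\<forall>\<^sub>F n in sequentially. norm ((\<integral>x. (g n x)\<^sup>2 \<partial>M) - (\<integral>x. (f x)\<^sup>2 \<partial>M)) \<le> ?d n + 2 * (sqrt (\<integral>x. (f x)\<^sup>2 \<partial>M) * sqrt (?d n))"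
    by simp
  have "(\<lambda>n. ?d n + 2 * (sqrt (\<integral>x. (f x)\<^sup>2 \<partial>M) * sqrt (?d n))) \<longlonglongrightarrow> 0 + 2 * (sqrt (\<integral>x. (f x)\<^sup>2 \<partial>M) * sqrt 0)"
    by (intro tendsto_intros lim)
  then have "(\<lambda>n. ?d n + 2 * (sqrt (\<integral>x. (f x)\<^sup>2 \<partial>M) * sqrt (?d n))) \<longlonglongrightarrow> 0" by simp
  from Lim_null_comparison[OF ev this] show ?thesis by (rule LIM_zero_cancel)
qed

lemma nn_integral_liminf_le:
  fixes f :: "nat \<Rightarrow> 'a \<Rightarrow> real"
  assumes [measurable]: "\<And>n. f n \<in> borel_measurable M"
    and lim: "AE x in M. (\<lambda>n. f n x) \<longlonglongrightarrow> g x"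
    and le: "\<forall>\<^sub>F n in sequentially. (\<integral>\<^sup>+x. ennreal (f n x) \<partial>M) \<le> C"
  shows "(\<integral>\<^sup>+x. ennreal (g x) \<partial>M) \<le> C"
proof -
  have "(\<integral>\<^sup>+x. ennreal (g x) \<partial>M) = (\<integral>\<^sup>+x. liminf (\<lambda>n. ennreal (f n x)) \<partial>M)"
    by (rule nn_integral_cong_AE) (use lim in \<open>eventually_elim, auto intro!: lim_imp_Liminf[symmetric] tendsto_ennrealI\<close>)
  also have "\<dots> \<le> liminf (\<lambda>n. \<integral>\<^sup>+x. ennreal (f n x) \<partial>M)" by (rule nn_integral_liminf) measurable
  also have "\<dots> \<le> limsup (\<lambda>n. \<integral>\<^sup>+x. ennreal (f n x) \<partial>M)" by (rule Liminf_le_Limsup) simp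
  also have "\<dots> \<le> C" by (rule Limsup_bounded) (fact le)
  finally show ?thesis .
qed

section \<open>From convergence in probability to mean square convergence\<close>

locale gaussian_levy_basis = prob_space M
  for M :: "'w measure" and m :: "'s measure" and a b :: real and \<mu> :: "real measure" and \<Lambda> +
  assumes basis: "levy_basis M m (levy_cumulant a b \<mu>) \<Lambda>"
    and levy: "levy_measure \<mu>" and b_pos: "b > 0"
begin

abbreviation "I \<equiv> simple_levy_integral m \<Lambda>"

lemma I_measurable: "levy_simple m g \<Longrightarrow> I g \<in> borel_measurable M"
  by (rule simple_levy_integral_measurable[OF prob_space_axioms basis])

lemma levy_simple_square:
  assumes "levy_simple m g" shows "integrable m (\<lambda>x. (g x)\<^sup>2)" "integrable m g"
  using levy_simple_comp_integral(1)[OF assms, of "\<lambda>z. z\<^sup>2" 1] levy_simple_comp_integral(1)[OF assms, of "\<lambda>z. z" 1] by simp_all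

lemma cf_I:
  assumes g: "levy_simple m g" shows "cf M (I g) s = exp (\<integral>x. levy_cumulant a b \<mu> (s * g x) \<partial>m)"
  unfolding cf_def by (rule cf_simple_levy_integral[OF prob_space_axioms basis g]) simp

lemma norm_cf_I:
  assumes g: "levy_simple m g"
  shows "norm (cf M (I g) s) = exp (- (\<integral>x. levy_exponent b \<mu> (s * g x) \<partial>m))"
proof -
  have "Re (\<integral>x. levy_cumulant a b \<mu> (s * g x) \<partial>m) = (\<integral>x. Re (levy_cumulant a b \<mu> (s * g x)) \<partial>m)"
    by (rule integral_Re[symmetric]) (rule levy_simple_comp_integral[OF g], simp)
  also have "\<dots> = - (\<integral>x. levy_exponent b \<mu> (s * g x) \<partial>m)"
    by (simp add: Re_levy_cumulant[OF levy])
  finally show ?thesis unfolding cf_I[OF g] by (simp only: norm_exp_eq_Re)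
qed

lemma levy_exponent_nonneg: "0 \<le> levy_exponent b \<mu> z"
  using levy_exponent_ge[OF levy, of b z] b_pos by (meson order_trans zero_le_power2 divide_nonneg_pos mult_nonneg_nonneg less_imp_le zero_less_numeral)

lemma square_le_levy_exponent:
  assumes g: "levy_simple m g"
  shows "b / 2 * (\<integral>x. (g x)\<^sup>2 \<partial>m) \<le> (\<integral>x. levy_exponent b \<mu> (g x) \<partial>m)"
proof -
  have "(\<integral>x. b / 2 * (g x)\<^sup>2 \<partial>m) \<le> (\<integral>x. levy_exponent b \<mu> (g x) \<partial>m)"
    by (rule integral_mono)
      (use levy_simple_square[OF g] levy_simple_comp_integral(1)[OF g, of "levy_exponent b \<mu>" 1] levy_exponent_ge[OF levy] in auto)
  then show ?thesis by simp
qed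

context
  fixes f :: "'s \<Rightarrow> real" and Y :: "'w \<Rightarrow> real" and \<phi> :: "nat \<Rightarrow> 's \<Rightarrow> real"
  assumes f_meas [measurable]: "f \<in> borel_measurable m" and Y_meas [measurable]: "Y \<in> borel_measurable M"
    and \<phi>: "\<And>n. levy_simple m (\<phi> n)" and \<phi>f: "AE x in m. (\<lambda>n. \<phi> n x) \<longlonglongrightarrow> f x"
    and conv: "conv_in_prob M (\<lambda>n. I (\<phi> n)) Y"
    and Y2: "integrable M (\<lambda>\<omega>. (Y \<omega>)\<^sup>2)" and EY: "expectation Y = 0"
begin

lemma \<phi>_meas [measurable]: "\<phi> n \<in> borel_measurable m" by (rule levy_simple_measurable[OF \<phi>])

lemma \<phi>_diff: "levy_simple m (\<lambda>x. \<phi> n x - \<phi> k x)"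
  using levy_simple_linear[OF \<phi> \<phi>, of 1 n "-1" k] by simp

lemma I_\<phi>_diff: "AE \<omega> in M. I (\<lambda>x. \<phi> n x - \<phi> k x) \<omega> = I (\<phi> n) \<omega> - I (\<phi> k) \<omega>"
  using simple_levy_integral_linear[OF prob_space_axioms basis \<phi> \<phi>, of 1 n "-1" k] by simp

lemma cf_I_\<phi>_diff_limit: "(\<lambda>N. cf M (I (\<lambda>x. \<phi> N x - \<phi> n x)) s) \<longlonglongrightarrow> cf M (\<lambda>\<omega>. Y \<omega> - I (\<phi> n) \<omega>) s"
proof -
  note [measurable] = I_measurable[OF \<phi>] I_measurable[OF \<phi>_diff]
  have "cf M (I (\<lambda>x. \<phi> N x - \<phi> n x)) s = cf M (\<lambda>\<omega>. I (\<phi> N) \<omega> - I (\<phi> n) \<omega>) s" for N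
    unfolding cf_def by (rule integral_cong_AE) (measurable, use I_\<phi>_diff[of N n] in \<open>eventually_elim, simp only:\<close>)
  moreover have "(\<lambda>N. cf M (\<lambda>\<omega>. I (\<phi> N) \<omega> - I (\<phi> n) \<omega>) s) \<longlonglongrightarrow> cf M (\<lambda>\<omega>. Y \<omega> - I (\<phi> n) \<omega>) s"
  proof -
    have ev: "\<forall>\<^sub>F N in sequentially. norm (cf M (\<lambda>\<omega>. I (\<phi> N) \<omega> - I (\<phi> n) \<omega>) s - cf M (\<lambda>\<omega>. Y \<omega> - I (\<phi> n) \<omega>) s)
        \<le> expectation (\<lambda>\<omega>. norm (iexp (s * (I (\<phi> N) \<omega> - Y \<omega>)) - 1))"
    proof (rule eventuallyI)
      fix N
      have "norm (cf M (\<lambda>\<omega>. I (\<phi> N) \<omega> - I (\<phi> n) \<omega>) s - cf M (\<lambda>\<omega>. Y \<omega> - I (\<phi> n) \<omega>) s) \<le>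
          expectation (\<lambda>\<omega>. norm (iexp (s * ((I (\<phi> N) \<omega> - I (\<phi> n) \<omega>) - (Y \<omega> - I (\<phi> n) \<omega>))) - 1))"
        by (rule norm_cf_diff_le) measurable
      then show "norm (cf M (\<lambda>\<omega>. I (\<phi> N) \<omega> - I (\<phi> n) \<omega>) s - cf M (\<lambda>\<omega>. Y \<omega> - I (\<phi> n) \<omega>) s)
        \<le> expectation (\<lambda>\<omega>. norm (iexp (s * (I (\<phi> N) \<omega> - Y \<omega>)) - 1))" by (simp only: diff_diff_eq2 diff_add_cancel add_diff_cancel_right' diff_add_eq)
    qed
    from Lim_null_comparison[OF ev conv_in_prob_cf[OF I_measurable[OF \<phi>] Y_meas conv]]
    show ?thesis by (rule LIM_zero_cancel)
  qed
  ultimately show ?thesis by (simp only:)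
qed

text \<open>The Gaussian part of the exponent dominates \<open>b * z\<^sup>2 / 2\<close>, and so upgrades convergence in probability of the
  integrals to convergence in \<open>L\<^sup>2(m)\<close> of the integrands.\<close>

lemma \<phi>_Cauchy:
  assumes e: "e > 0"
  obtains n0 where "\<And>n N. n \<ge> n0 \<Longrightarrow> N \<ge> n0 \<Longrightarrow> (\<integral>x. (\<phi> N x - \<phi> n x)\<^sup>2 \<partial>m) \<le> e"
proof -
  note [measurable] = I_measurable[OF \<phi>] I_measurable[OF \<phi>_diff]
  \<comment> \<open>The bound 1/4 meets the condition \<open>2 * d \<le> 1 / 2\<close> of
    \<open>exp_neg_ge_imp\<close>; the other one turns \<open>4 * d\<close> into
    \<open>b / 2 * e\<close>.\<close>
  define d where "d = min (1 / 4) (b * e / 8)"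
  have d: "d > 0" using e b_pos by (simp add: d_def)
  let ?e = "\<lambda>n. expectation (\<lambda>\<omega>. norm (iexp (1 * (I (\<phi> n) \<omega> - Y \<omega>)) - 1))"
  have "?e \<longlonglongrightarrow> 0" by (rule conv_in_prob_cf[OF I_measurable[OF \<phi>] Y_meas conv])
  then have "\<forall>\<^sub>F n in sequentially. ?e n < d" using d by (rule order_tendstoD)
  then obtain n0 where n0: "\<And>n. n \<ge> n0 \<Longrightarrow> ?e n < d" unfolding eventually_sequentially by blast
  show ?thesis
  proof
    fix n N assume n: "n \<ge> n0" "N \<ge> n0"
    let ?W = "\<lambda>x. \<phi> N x - \<phi> n x"
    have m1: "(\<lambda>\<omega>. (I (\<phi> N) \<omega> - Y \<omega>) - (I (\<phi> n) \<omega> - Y \<omega>)) \<in> borel_measurable M"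
      and m2: "(\<lambda>\<omega>. - (I (\<phi> n) \<omega> - Y \<omega>)) \<in> borel_measurable M" by measurable
    have c1: "cf M (I ?W) 1 = cf M (\<lambda>\<omega>. (I (\<phi> N) \<omega> - Y \<omega>) - (I (\<phi> n) \<omega> - Y \<omega>)) 1"
      unfolding cf_def by (rule integral_cong_AE) (measurable, use I_\<phi>_diff[of N n] in \<open>eventually_elim, simp\<close>)
    \<comment> \<open>The variable \<open>- (I (\<phi> n) - Y)\<close> serves as an intermediate
      point between the difference of the integrals and 0, so that only distances to
      \<open>Y\<close> enter.\<close>
    have "norm (cf M (\<lambda>\<omega>. (I (\<phi> N) \<omega> - Y \<omega>) - (I (\<phi> n) \<omega> - Y \<omega>)) 1 - cf M (\<lambda>\<omega>. - (I (\<phi> n) \<omega> - Y \<omega>)) 1) \<le> ?e N"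
      using norm_cf_diff_le[OF m1 m2, of 1] by (simp only: diff_minus_eq_add diff_add_cancel)
    moreover have "norm (cf M (\<lambda>\<omega>. 0) 1 - cf M (\<lambda>\<omega>. - (I (\<phi> n) \<omega> - Y \<omega>)) 1) \<le> ?e n"
      using norm_cf_diff_le[OF borel_measurable_const m2, of 0 1] by (simp only: diff_minus_eq_add add_0)
    moreover have "cf M (\<lambda>\<omega>. 0) 1 = 1" by (simp add: cf_def prob_space)
    ultimately have "norm (1 - cf M (I ?W) 1) \<le> ?e N + ?e n"
      unfolding c1 by (smt (verit) norm_triangle_ineq4 norm_minus_commute norm_triangle_sub norm_diff_triangle_le)
    then have "1 - 2 * d \<le> norm (cf M (I ?W) 1)"
      using n0[OF n(1)] n0[OF n(2)] norm_triangle_ineq2[of 1 "cf M (I ?W) 1"] by (simp only: norm_one)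
    then have "1 - 2 * d \<le> exp (- (\<integral>x. levy_exponent b \<mu> (1 * ?W x) \<partial>m))" unfolding norm_cf_I[OF \<phi>_diff] .
    then have "(\<integral>x. levy_exponent b \<mu> (1 * ?W x) \<partial>m) \<le> 2 * (2 * d)"
      by (rule exp_neg_ge_imp) (auto simp: d_def levy_exponent_nonneg)
    then have "b / 2 * (\<integral>x. (?W x)\<^sup>2 \<partial>m) \<le> 4 * d"
      using square_le_levy_exponent[OF \<phi>_diff[of N n]] by simp
    also have "\<dots> \<le> b / 2 * e" by (simp add: d_def)
    finally show "(\<integral>x. (?W x)\<^sup>2 \<partial>m) \<le> e" using b_pos by simp
  qed
qed

text \<open>Fatou in the second index of the Cauchy estimate identifies the mean square limit with
  the almost everywhere limit \<open>f\<close>. Square integrability of \<open>f\<close> follows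
  because it differs from some simple \<open>\<phi> n\<close> by a square integrable
  function.\<close>

lemma \<phi>_L2_limit:
  shows "integrable m (\<lambda>x. (f x)\<^sup>2)" "(\<lambda>n. \<integral>x. (\<phi> n x - f x)\<^sup>2 \<partial>m) \<longlonglongrightarrow> 0"
proof -
  have bound: "\<exists>n0. \<forall>n\<ge>n0. integrable m (\<lambda>x. (\<phi> n x - f x)\<^sup>2) \<and> (\<integral>x. (\<phi> n x - f x)\<^sup>2 \<partial>m) \<le> e" if e: "e > 0" for e
  proof -
    obtain n0 where n0: "\<And>n N. n \<ge> n0 \<Longrightarrow> N \<ge> n0 \<Longrightarrow> (\<integral>x. (\<phi> N x - \<phi> n x)\<^sup>2 \<partial>m) \<le> e"
      using \<phi>_Cauchy[OF e] by blast
    have "integrable m (\<lambda>x. (\<phi> n x - f x)\<^sup>2) \<and> (\<integral>x. (\<phi> n x - f x)\<^sup>2 \<partial>m) \<le> e" if n: "n \<ge> n0" for n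
    proof -
      have "(\<integral>\<^sup>+x. ennreal ((f x - \<phi> n x)\<^sup>2) \<partial>m) \<le> ennreal e"
      proof (rule nn_integral_liminf_le)
        show "AE x in m. (\<lambda>N. (\<phi> N x - \<phi> n x)\<^sup>2) \<longlonglongrightarrow> (f x - \<phi> n x)\<^sup>2"
          using \<phi>f by eventually_elim (intro tendsto_intros)
        show "\<forall>\<^sub>F N in sequentially. (\<integral>\<^sup>+x. ennreal ((\<phi> N x - \<phi> n x)\<^sup>2) \<partial>m) \<le> ennreal e"
        proof (rule eventually_sequentiallyI)
          fix N assume N: "N \<ge> n0"
          have "(\<integral>\<^sup>+x. ennreal ((\<phi> N x - \<phi> n x)\<^sup>2) \<partial>m) = ennreal (\<integral>x. (\<phi> N x - \<phi> n x)\<^sup>2 \<partial>m)"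
            by (rule nn_integral_eq_integral[OF levy_simple_square(1)[OF \<phi>_diff]]) simp
          then show "(\<integral>\<^sup>+x. ennreal ((\<phi> N x - \<phi> n x)\<^sup>2) \<partial>m) \<le> ennreal e"
            using n0[OF n N] by (simp add: ennreal_leI)
        qed
      qed measurable
      then have le: "(\<integral>\<^sup>+x. ennreal ((\<phi> n x - f x)\<^sup>2) \<partial>m) \<le> ennreal e" by (simp add: power2_commute)
      then have i: "integrable m (\<lambda>x. (\<phi> n x - f x)\<^sup>2)"
        by (intro integrableI_nonneg) (auto intro: le_less_trans)
      from le have "(\<integral>x. (\<phi> n x - f x)\<^sup>2 \<partial>m) \<le> e"
        using e by (subst (asm) nn_integral_eq_integral[OF i]) auto
      with i show ?thesis by blast
    qed
    then show ?thesis by blast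
  qed
  from bound[of 1] obtain n where "integrable m (\<lambda>x. (\<phi> n x - f x)\<^sup>2)" by auto
  from integrable_square_diff[OF _ _ levy_simple_square(1)[OF \<phi>[of n]] this]
  show "integrable m (\<lambda>x. (f x)\<^sup>2)" by simp
  show "(\<lambda>n. \<integral>x. (\<phi> n x - f x)\<^sup>2 \<partial>m) \<longlonglongrightarrow> 0"
  proof (rule LIMSEQ_I)
    fix r :: real assume "r > 0"
    then obtain n0 where "\<forall>n\<ge>n0. (\<integral>x. (\<phi> n x - f x)\<^sup>2 \<partial>m) \<le> r / 2" using bound[of "r / 2"] by auto
    then show "\<exists>no. \<forall>n\<ge>no. norm ((\<integral>x. (\<phi> n x - f x)\<^sup>2 \<partial>m) - 0) < r"
      using \<open>r > 0\<close> by (intro exI[of _ n0]) (auto intro: le_less_trans)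
  qed
qed

text \<open>By Fatou for \<open>k\<^sup>2 * (1 - cos (f x * y / k))\<close>, the product of \<open>\<integral>f\<^sup>2\<close> and \<open>\<integral>y\<^sup>2\<close> is bounded by a multiple of
  the second moment of \<open>Y\<close>.\<close>

lemma second_moment_levy_measure:
  assumes f0: "\<not> (AE x in m. f x = 0)"
  shows "integrable \<mu> (\<lambda>x. x\<^sup>2)"
proof -
  note [measurable] = I_measurable[OF \<phi>]
  note [measurable] = levy_exponent_measurable[OF levy]
  \<comment> \<open>The added 1 makes the lower bound on the modulus strict, so that it persists for
    the approximating integrals from some index on.\<close>
  define C where "C = expectation (\<lambda>\<omega>. (Y \<omega>)\<^sup>2) + 1"
  have C: "C \<ge> 1" by (simp add: C_def)
  have small: "(\<integral>\<^sup>+x. ennreal (levy_exponent b \<mu> (s * f x)) \<partial>m) \<le> ennreal (2 * (s\<^sup>2 * C))"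
    if s: "s \<noteq> 0" "s\<^sup>2 * C \<le> 1 / 2" for s
  proof (rule nn_integral_liminf_le)
    show "AE x in m. (\<lambda>n. levy_exponent b \<mu> (s * \<phi> n x)) \<longlonglongrightarrow> levy_exponent b \<mu> (s * f x)"
      using \<phi>f by eventually_elim (intro isCont_tendsto_compose[OF continuous_levy_exponent[OF levy]] tendsto_intros)
    have ev: "\<forall>\<^sub>F n in sequentially. norm (cf M (I (\<phi> n)) s - cf M Y s) \<le> expectation (\<lambda>\<omega>. norm (iexp (s * (I (\<phi> n) \<omega> - Y \<omega>)) - 1))"
      by (rule eventuallyI, rule norm_cf_diff_le) measurable
    from Lim_null_comparison[OF ev conv_in_prob_cf[OF I_measurable[OF \<phi>] Y_meas conv]]
    have "(\<lambda>n. cf M (I (\<phi> n)) s) \<longlonglongrightarrow> cf M Y s" by (rule LIM_zero_cancel)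
    then have "(\<lambda>n. norm (cf M (I (\<phi> n)) s)) \<longlonglongrightarrow> norm (cf M Y s)" by (rule tendsto_norm)
    moreover have "1 - s\<^sup>2 * C < norm (cf M Y s)"
    proof -
      have "1 - s\<^sup>2 * C < 1 - s\<^sup>2 * expectation (\<lambda>\<omega>. (Y \<omega>)\<^sup>2) / 2"
      proof -
        have "s\<^sup>2 > 0" "0 \<le> s\<^sup>2 * expectation (\<lambda>\<omega>. (Y \<omega>)\<^sup>2)" using s by simp_all
        moreover have "s\<^sup>2 * C = s\<^sup>2 * expectation (\<lambda>\<omega>. (Y \<omega>)\<^sup>2) + s\<^sup>2" by (simp add: C_def distrib_left)
        ultimately show ?thesis by linarith
      qed
      also have "\<dots> \<le> Re (cf M Y s)" by (rule Re_cf_ge[OF Y_meas Y2])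
      also have "\<dots> \<le> norm (cf M Y s)" by (rule complex_Re_le_cmod)
      finally show ?thesis .
    qed
    ultimately have "\<forall>\<^sub>F n in sequentially. 1 - s\<^sup>2 * C < norm (cf M (I (\<phi> n)) s)" by (rule order_tendstoD)
    then show "\<forall>\<^sub>F n in sequentially. (\<integral>\<^sup>+x. ennreal (levy_exponent b \<mu> (s * \<phi> n x)) \<partial>m) \<le> ennreal (2 * (s\<^sup>2 * C))"
    proof eventually_elim
      case (elim n)
      then have "1 - s\<^sup>2 * C \<le> exp (- (\<integral>x. levy_exponent b \<mu> (s * \<phi> n x) \<partial>m))" unfolding norm_cf_I[OF \<phi>] by simp
      then have "(\<integral>x. levy_exponent b \<mu> (s * \<phi> n x) \<partial>m) \<le> 2 * (s\<^sup>2 * C)"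
        by (rule exp_neg_ge_imp) (use s in \<open>auto simp: levy_exponent_nonneg\<close>)
      moreover have "(\<integral>\<^sup>+x. ennreal (levy_exponent b \<mu> (s * \<phi> n x)) \<partial>m) = ennreal (\<integral>x. levy_exponent b \<mu> (s * \<phi> n x) \<partial>m)"
        by (rule nn_integral_eq_integral) (auto simp: levy_exponent_nonneg intro: levy_simple_comp_integral(1)[OF \<phi>])
      ultimately show ?case by (simp add: ennreal_leI)
    qed
  qed measurable
  \<comment> \<open>The jump part of the exponent at \<open>f x / k\<close>, rescaled so that its
    integrand tends to the square of \<open>f x * y\<close>. Its integral over \<open>m\<close>
    stays below \<open>4 * C\<close> for large \<open>k\<close>, because \<open>small\<close> bounds
    the whole exponent.\<close>
  define h where "h k x = (\<integral>\<^sup>+y. ennreal ((real k)\<^sup>2 * (2 * (1 - cos (f x * y / real k)))) \<partial>\<mu>)" for k x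
  have h_eq: "h k x = ennreal ((real k)\<^sup>2 * (2 * (levy_exponent b \<mu> (1 / real k * f x) - b * (1 / real k * f x)\<^sup>2 / 2)))" for k x
  proof -
    have i: "integrable \<mu> (\<lambda>y. (real k)\<^sup>2 * (2 * (1 - cos (1 / real k * f x * y))))"
      by (intro integrable_mult_right integrable_one_minus_cos[OF levy])
    have "f x * y / real k = 1 / real k * f x * y" for y by simp
    then have "h k x = (\<integral>\<^sup>+y. ennreal ((real k)\<^sup>2 * (2 * (1 - cos (1 / real k * f x * y)))) \<partial>\<mu>)"
      unfolding h_def by (simp only:)
    also have "\<dots> = ennreal (\<integral>y. (real k)\<^sup>2 * (2 * (1 - cos (1 / real k * f x * y))) \<partial>\<mu>)"
      by (rule nn_integral_eq_integral[OF i]) (simp add: one_minus_cos_le)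
    also have "(\<integral>y. (real k)\<^sup>2 * (2 * (1 - cos (1 / real k * f x * y))) \<partial>\<mu>) = (real k)\<^sup>2 * (2 * (\<integral>y. 1 - cos (1 / real k * f x * y) \<partial>\<mu>))"
      by (simp only: integral_mult_right_zero)
    finally show ?thesis unfolding levy_exponent_def by simp
  qed
  have hm: "h k \<in> borel_measurable m" for k unfolding h_eq by measurable
  have h_le: "(\<integral>\<^sup>+x. h k x \<partial>m) \<le> ennreal (4 * C)" if k: "k \<ge> 1" "1 / (real k)\<^sup>2 * C \<le> 1 / 2" for k
  proof -
    have "(\<integral>\<^sup>+x. h k x \<partial>m) \<le> (\<integral>\<^sup>+x. ennreal (2 * (real k)\<^sup>2) * ennreal (levy_exponent b \<mu> (1 / real k * f x)) \<partial>m)"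
    proof (rule nn_integral_mono)
      fix x
      have "0 \<le> (real k)\<^sup>2 * (b * (1 / real k * f x)\<^sup>2)" using b_pos by simp
      then show "h k x \<le> ennreal (2 * (real k)\<^sup>2) * ennreal (levy_exponent b \<mu> (1 / real k * f x))"
        unfolding h_eq by (subst ennreal_mult[symmetric]) (auto simp: levy_exponent_nonneg algebra_simps intro!: ennreal_leI)
    qed
    also have "\<dots> = ennreal (2 * (real k)\<^sup>2) * (\<integral>\<^sup>+x. ennreal (levy_exponent b \<mu> (1 / real k * f x)) \<partial>m)"
      by (rule nn_integral_cmult) measurable
    also have "\<dots> \<le> ennreal (2 * (real k)\<^sup>2) * ennreal (2 * ((1 / real k)\<^sup>2 * C))"
      by (intro mult_left_mono small) (use k in \<open>auto simp: power_divide\<close>)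
    also have "\<dots> = ennreal (4 * C)"
      using k C by (subst ennreal_mult[symmetric]) (auto simp: power_divide)
    finally show ?thesis .
  qed
  have "(\<integral>\<^sup>+x. ennreal ((f x)\<^sup>2) * (\<integral>\<^sup>+y. ennreal (y\<^sup>2) \<partial>\<mu>) \<partial>m) = (\<integral>\<^sup>+x. (\<integral>\<^sup>+y. ennreal ((f x * y)\<^sup>2) \<partial>\<mu>) \<partial>m)"
    by (intro nn_integral_cong, subst nn_integral_cmult[symmetric])
      (auto simp: levy_measurable[OF levy] power_mult_distrib ennreal_mult)
  also have "\<dots> \<le> (\<integral>\<^sup>+x. liminf (\<lambda>k. h k x) \<partial>m)"
  proof (rule nn_integral_mono)
    fix x
    have "(\<integral>\<^sup>+y. ennreal ((f x * y)\<^sup>2) \<partial>\<mu>) = (\<integral>\<^sup>+y. liminf (\<lambda>k. ennreal ((real k)\<^sup>2 * (2 * (1 - cos (f x * y / real k))))) \<partial>\<mu>)"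
      by (intro nn_integral_cong lim_imp_Liminf[symmetric] tendsto_ennrealI n_cos_limit) auto
    also have "\<dots> \<le> liminf (\<lambda>k. h k x)"
      unfolding h_def by (rule nn_integral_liminf) (simp add: levy_measurable[OF levy])
    finally show "(\<integral>\<^sup>+y. ennreal ((f x * y)\<^sup>2) \<partial>\<mu>) \<le> liminf (\<lambda>k. h k x)" .
  qed
  also have "\<dots> \<le> liminf (\<lambda>k. \<integral>\<^sup>+x. h k x \<partial>m)" by (rule nn_integral_liminf[OF hm])
  also have "\<dots> \<le> limsup (\<lambda>k. \<integral>\<^sup>+x. h k x \<partial>m)" by (rule Liminf_le_Limsup) simp
  also have "\<dots> \<le> ennreal (4 * C)"
  proof (rule Limsup_bounded)
    have "(\<lambda>k. (inverse (real k))\<^sup>2 * C) \<longlonglongrightarrow> 0\<^sup>2 * C" by (intro tendsto_intros lim_inverse_n)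
    then have "\<forall>\<^sub>F k in sequentially. (inverse (real k))\<^sup>2 * C < 1 / 2" by (rule order_tendstoD) simp
    then show "\<forall>\<^sub>F k in sequentially. (\<integral>\<^sup>+x. h k x \<partial>m) \<le> ennreal (4 * C)"
      using eventually_ge_at_top[of 1]
    proof eventually_elim
      case (elim k)
      have "(inverse (real k))\<^sup>2 = 1 / (real k)\<^sup>2" by (simp add: inverse_eq_divide power_one_over)
      with elim(1) have "1 / (real k)\<^sup>2 * C \<le> 1 / 2" by simp
      with elim(2) show ?case by (rule h_le)
    qed
  qed
  finally have fin: "(\<integral>\<^sup>+x. ennreal ((f x)\<^sup>2) \<partial>m) * (\<integral>\<^sup>+y. ennreal (y\<^sup>2) \<partial>\<mu>) \<le> ennreal (4 * C)"
    by (subst (asm) nn_integral_multc) measurable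
  have "(\<integral>\<^sup>+x. ennreal ((f x)\<^sup>2) \<partial>m) \<noteq> 0"
  proof
    assume "(\<integral>\<^sup>+x. ennreal ((f x)\<^sup>2) \<partial>m) = 0"
    then have "AE x in m. ennreal ((f x)\<^sup>2) = 0" by (subst (asm) nn_integral_0_iff_AE) auto
    then have "AE x in m. f x = 0" by eventually_elim simp
    with f0 show False by blast
  qed
  then have "(\<integral>\<^sup>+y. ennreal (y\<^sup>2) \<partial>\<mu>) < \<infinity>"
    using fin by (cases "(\<integral>\<^sup>+y. ennreal (y\<^sup>2) \<partial>\<mu>) = \<infinity>") (auto simp: ennreal_mult_top top_unique less_top)
  then show ?thesis
    by (intro integrableI_nonneg) (auto simp: levy_measurable[OF levy])
qed

end

end

lemma null_limit_mono:
  fixes f g :: "nat \<Rightarrow> real"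
  assumes "\<And>n. 0 \<le> f n" "\<And>n. f n \<le> g n" "g \<longlonglongrightarrow> 0"
  shows "f \<longlonglongrightarrow> 0"
  by (rule Lim_null_comparison[OF _ assms(3)]) (use assms(1,2) in simp)

lemma integral_square_linear_diff_le:
  fixes f g h k :: "'a \<Rightarrow> real"
  assumes m: "g \<in> borel_measurable M" "k \<in> borel_measurable M" "f \<in> borel_measurable M" "h \<in> borel_measurable M"
    and i: "integrable M (\<lambda>x. (g x)\<^sup>2)" "integrable M (\<lambda>x. (k x)\<^sup>2)" "integrable M (\<lambda>x. (f x)\<^sup>2)" "integrable M (\<lambda>x. (h x)\<^sup>2)"
  shows "(\<integral>x. ((c * g x + d * k x) - (c * f x + d * h x))\<^sup>2 \<partial>M) \<le>
        2 * c\<^sup>2 * (\<integral>x. (g x - f x)\<^sup>2 \<partial>M) + 2 * d\<^sup>2 * (\<integral>x. (k x - h x)\<^sup>2 \<partial>M)"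
proof -
  have gf: "(\<lambda>x. g x - f x) \<in> borel_measurable M" "integrable M (\<lambda>x. (g x - f x)\<^sup>2)"
    by (rule borel_measurable_diff[OF m(1,3)], rule integrable_square_diff[OF m(1,3) i(1,3)])
  have kh: "(\<lambda>x. k x - h x) \<in> borel_measurable M" "integrable M (\<lambda>x. (k x - h x)\<^sup>2)"
    by (rule borel_measurable_diff[OF m(2,4)], rule integrable_square_diff[OF m(2,4) i(2,4)])
  have "(\<integral>x. ((c * g x + d * k x) - (c * f x + d * h x))\<^sup>2 \<partial>M) = (\<integral>x. (c * (g x - f x) + d * (k x - h x))\<^sup>2 \<partial>M)"
    by (intro Bochner_Integration.integral_cong refl) (simp add: algebra_simps)
  also have "\<dots> \<le> 2 * c\<^sup>2 * (\<integral>x. (g x - f x)\<^sup>2 \<partial>M) + 2 * d\<^sup>2 * (\<integral>x. (k x - h x)\<^sup>2 \<partial>M)"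
    by (rule integral_square_linear_le[OF gf(1) kh(1) gf(2) kh(2)])
  finally show ?thesis .
qed

text \<open>Simple approximants bounded by \<open>2 * \<bar>f\<bar>\<close> inherit square
  integrability, and this forces each level set of a nonzero value to have finite measure.\<close>

lemma levy_simple_dense:
  fixes f :: "'s \<Rightarrow> real"
  assumes f[measurable]: "f \<in> borel_measurable m" and f2: "integrable m (\<lambda>x. (f x)\<^sup>2)"
  obtains g where "\<And>n. levy_simple m (g n)" "(\<lambda>n. \<integral>x. (g n x - f x)\<^sup>2 \<partial>m) \<longlonglongrightarrow> 0"
proof -
  obtain g where g: "\<And>n. simple_function m (g n)" "\<And>x. x \<in> space m \<Longrightarrow> (\<lambda>n. g n x) \<longlonglongrightarrow> f x"
    "\<And>n x. x \<in> space m \<Longrightarrow> norm (g n x) \<le> 2 * norm (f x)"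
    using borel_measurable_implies_sequence_metric[OF f, of 0] unfolding dist_norm diff_0_right by blast
  have [measurable]: "g n \<in> borel_measurable m" for n using g(1) by (rule borel_measurable_simple_function)
  have g2: "(g n x)\<^sup>2 \<le> 4 * (f x)\<^sup>2" if "x \<in> space m" for n x
  proof -
    have "\<bar>g n x\<bar>\<^sup>2 \<le> (2 * \<bar>f x\<bar>)\<^sup>2" using g(3)[OF that, of n] by (intro power_mono) auto
    then show ?thesis by (simp add: power_mult_distrib)
  qed
  have ig: "integrable m (\<lambda>x. (g n x)\<^sup>2)" for n
    by (rule Bochner_Integration.integrable_bound[of m "\<lambda>x. 4 * (f x)\<^sup>2"]) (use f2 g2 in \<open>auto intro!: AE_I2\<close>)
  have "levy_simple m (g n)" for n
  proof -
    let ?Y = "g n ` space m - {0}"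
    have fY: "finite ?Y" using g(1)[of n] by (auto simp: simple_function_def)
    have fin: "emeasure m (g n -` {y} \<inter> space m) < \<infinity>" if y: "y \<in> ?Y" for y
    proof -
      have "ennreal (y\<^sup>2) * emeasure m (g n -` {y} \<inter> space m) = (\<integral>\<^sup>+x. ennreal (y\<^sup>2) * indicator (g n -` {y} \<inter> space m) x \<partial>m)"
        by (rule nn_integral_cmult_indicator[symmetric]) measurable
      also have "\<dots> \<le> (\<integral>\<^sup>+x. ennreal ((g n x)\<^sup>2) \<partial>m)"
        by (intro nn_integral_mono) (auto simp: indicator_def)
      also have "\<dots> < \<infinity>" using ig[of n] by (simp add: integrable_iff_bounded)
      finally show ?thesis using y by (auto simp: ennreal_mult_less_top)
    qed
    have "{x \<in> space m. g n x \<noteq> 0} = (\<Union>y\<in>?Y. g n -` {y} \<inter> space m)" by auto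
    also have "emeasure m \<dots> \<le> (\<Sum>y\<in>?Y. emeasure m (g n -` {y} \<inter> space m))"
      by (rule emeasure_subadditive_finite[OF fY]) auto
    also have "\<dots> < \<infinity>" using fin fY by (simp add: ennreal_sum_less_top)
    finally show ?thesis using g(1) by (simp add: levy_simple_def)
  qed
  moreover have "(\<lambda>n. \<integral>x. (g n x - f x)\<^sup>2 \<partial>m) \<longlonglongrightarrow> (\<integral>x. 0 \<partial>m)"
  \<comment> \<open>The constant is \<open>2 * 4 + 2\<close>, from doubling the sum of the squares
    of \<open>g n\<close> and \<open>f\<close> and from the bound \<open>2 * \<bar>f\<bar>\<close>
    on \<open>g n\<close>.\<close>
  proof (rule integral_dominated_convergence[where w="\<lambda>x. 10 * (f x)\<^sup>2"])
    show "AE x in m. (\<lambda>n. (g n x - f x)\<^sup>2) \<longlonglongrightarrow> 0"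
    proof (rule AE_I2)
      fix x assume "x \<in> space m"
      from tendsto_power[OF tendsto_diff[OF g(2)[OF this] tendsto_const[of "f x"]], of 2]
      show "(\<lambda>n. (g n x - f x)\<^sup>2) \<longlonglongrightarrow> 0" by simp
    qed
    show "AE x in m. norm ((g n x - f x)\<^sup>2) \<le> 10 * (f x)\<^sup>2" for n
    proof (rule AE_I2)
      fix x assume x: "x \<in> space m"
      have "(g n x - f x)\<^sup>2 \<le> 2 * (g n x)\<^sup>2 + 2 * (f x)\<^sup>2"
        using zero_le_power2[of "g n x + f x"] by (simp add: power2_eq_square algebra_simps)
      then show "norm ((g n x - f x)\<^sup>2) \<le> 10 * (f x)\<^sup>2" using g2[OF x, of n] by simp
    qed
  qed (use f2 in auto)
  then have "(\<lambda>n. \<integral>x. (g n x - f x)\<^sup>2 \<partial>m) \<longlonglongrightarrow> 0" by (simp only: integral_zero)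
  ultimately show ?thesis using that by blast
qed

text \<open>Cauchy-Schwarz in the time variable and Tonelli reduce everything to the uniform bound
  \<open>C\<close> on a set of finite length. The last claim determines the time integral weakly, by
  its inner products. The lemma is applied to sample paths, to the kernels over the control measure
  and to the slices of the kernel at a fixed rate.\<close>

lemma set_integral_L2:
  fixes h :: "real \<Rightarrow> 'q \<Rightarrow> real" and A :: "real set"
  assumes Q: "sigma_finite_measure Q" and A[measurable]: "A \<in> sets lborel" and finA: "emeasure lborel A < \<infinity>"
    and h[measurable]: "(\<lambda>(s, x). h s x) \<in> borel_measurable (lborel \<Otimes>\<^sub>M Q)"
    and h2: "\<And>s. s \<in> A \<Longrightarrow> integrable Q (\<lambda>x. (h s x)\<^sup>2)" and hC: "\<And>s. s \<in> A \<Longrightarrow> (\<integral>x. (h s x)\<^sup>2 \<partial>Q) \<le> C"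
  shows "(\<lambda>x. LBINT s:A. h s x) \<in> borel_measurable Q"
    and "integrable Q (\<lambda>x. (LBINT s:A. h s x)\<^sup>2)"
    and "\<And>U. U \<in> borel_measurable Q \<Longrightarrow> integrable Q (\<lambda>x. (U x)\<^sup>2) \<Longrightarrow>
      (\<integral>x. U x * (LBINT s:A. h s x) \<partial>Q) = (LBINT s:A. (\<integral>x. U x * h s x \<partial>Q))"
proof -
  interpret Q: sigma_finite_measure Q by fact
  interpret P: pair_sigma_finite lborel Q ..
  have hs[measurable]: "h s \<in> borel_measurable Q" for s
    using measurable_compose[OF measurable_Pair1'[of s lborel Q] h] by simp
  define k where "k s x = indicator A s * h s x" for s x
  have km[measurable]: "(\<lambda>(s, x). k s x) \<in> borel_measurable (lborel \<Otimes>\<^sub>M Q)" unfolding k_def by measurable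
  have LB: "(LBINT s:A. h s x) = (\<integral>s. k s x \<partial>lborel)" for x
    by (simp add: set_lebesgue_integral_def k_def)
  show Hm: "(\<lambda>x. LBINT s:A. h s x) \<in> borel_measurable Q"
    unfolding LB by measurable
  have ks: "(\<integral>\<^sup>+x. ennreal ((k s x)\<^sup>2) \<partial>Q) \<le> ennreal C * indicator A s" for s
  proof (cases "s \<in> A")
    case True
    then have "(\<integral>\<^sup>+x. ennreal ((k s x)\<^sup>2) \<partial>Q) = ennreal (\<integral>x. (h s x)\<^sup>2 \<partial>Q)"
      unfolding k_def using nn_integral_eq_integral[OF h2[OF True]] by simp
    then show ?thesis using hC[OF True] True by (simp add: ennreal_leI)
  qed (simp add: k_def)
  have k2: "(\<integral>\<^sup>+s. (\<integral>\<^sup>+x. ennreal ((k s x)\<^sup>2) \<partial>Q) \<partial>lborel) \<le> ennreal C * emeasure lborel A"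
  proof -
    have "(\<integral>\<^sup>+s. (\<integral>\<^sup>+x. ennreal ((k s x)\<^sup>2) \<partial>Q) \<partial>lborel) \<le> (\<integral>\<^sup>+s. ennreal C * indicator A s \<partial>lborel)"
      by (intro nn_integral_mono ks)
    also have "\<dots> = ennreal C * emeasure lborel A" by (rule nn_integral_cmult_indicator[OF A])
    finally show ?thesis .
  qed
  have "(\<integral>\<^sup>+x. ennreal ((LBINT s:A. h s x)\<^sup>2) \<partial>Q) \<le> (\<integral>\<^sup>+x. (\<integral>\<^sup>+s. ennreal ((k s x)\<^sup>2) \<partial>lborel) * emeasure lborel A \<partial>Q)"
  proof (rule nn_integral_mono)
    fix x assume x: "x \<in> space Q"
    have kx[measurable]: "(\<lambda>s. k s x) \<in> borel_measurable lborel"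
      using measurable_compose[OF measurable_Pair2'[OF x, of lborel] km] by simp
    \<comment> \<open>Where the section is not integrable, its Bochner integral is 0 by convention
      and the bound is trivial.\<close>
    have "ennreal \<bar>\<integral>s. k s x \<partial>lborel\<bar> \<le> (\<integral>\<^sup>+s. ennreal \<bar>k s x\<bar> \<partial>lborel)"
      using integral_norm_bound_ennreal[of lborel "\<lambda>s. k s x"]
      by (cases "integrable lborel (\<lambda>s. k s x)") (auto simp: not_integrable_integral_eq)
    also have "\<dots> = (\<integral>\<^sup>+s. ennreal \<bar>k s x\<bar> * indicator A s \<partial>lborel)"
      by (intro nn_integral_cong) (auto simp: k_def indicator_def)
    finally have "(ennreal \<bar>\<integral>s. k s x \<partial>lborel\<bar>)\<^sup>2 \<le> (\<integral>\<^sup>+s. ennreal \<bar>k s x\<bar> * indicator A s \<partial>lborel)\<^sup>2"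
      by (rule power_mono) simp
    also have "\<dots> \<le> (\<integral>\<^sup>+s. (ennreal \<bar>k s x\<bar>)\<^sup>2 \<partial>lborel) * (\<integral>\<^sup>+s. (indicator A s)\<^sup>2 \<partial>lborel)"
      by (rule Cauchy_Schwarz_nn_integral) measurable
    also have "(\<integral>\<^sup>+s. (indicator A s)\<^sup>2 \<partial>lborel) = (\<integral>\<^sup>+s. indicator A s \<partial>lborel)"
      by (intro nn_integral_cong) (auto simp: indicator_def)
    also have "\<dots> = emeasure lborel A" by (rule nn_integral_indicator[OF A])
    finally show "ennreal ((LBINT s:A. h s x)\<^sup>2) \<le> (\<integral>\<^sup>+s. ennreal ((k s x)\<^sup>2) \<partial>lborel) * emeasure lborel A"
      unfolding LB by (simp add: ennreal_power)
  qed
  also have "\<dots> = (\<integral>\<^sup>+x. (\<integral>\<^sup>+s. ennreal ((k s x)\<^sup>2) \<partial>lborel) \<partial>Q) * emeasure lborel A"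
    by (rule nn_integral_multc) measurable
  also have "(\<integral>\<^sup>+x. (\<integral>\<^sup>+s. ennreal ((k s x)\<^sup>2) \<partial>lborel) \<partial>Q) = (\<integral>\<^sup>+s. (\<integral>\<^sup>+x. ennreal ((k s x)\<^sup>2) \<partial>Q) \<partial>lborel)"
    by (rule P.Fubini') measurable
  also have "\<dots> * emeasure lborel A \<le> ennreal C * emeasure lborel A * emeasure lborel A"
    by (intro mult_right_mono k2) simp
  also have "\<dots> < \<infinity>" using finA by (auto simp: ennreal_mult_less_top)
  finally show "integrable Q (\<lambda>x. (LBINT s:A. h s x)\<^sup>2)"
    by (intro integrableI_nonneg) (use Hm in auto)
  fix U :: "'q \<Rightarrow> real" assume U[measurable]: "U \<in> borel_measurable Q" and U2: "integrable Q (\<lambda>x. (U x)\<^sup>2)"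
  have "integrable (lborel \<Otimes>\<^sub>M Q) (\<lambda>(s, x). U x * k s x)"
  proof (rule integrableI_bounded)
    have "(\<integral>\<^sup>+p. norm (case p of (s, x) \<Rightarrow> U x * k s x) \<partial>(lborel \<Otimes>\<^sub>M Q)) = (\<integral>\<^sup>+s. (\<integral>\<^sup>+x. ennreal \<bar>U x * k s x\<bar> \<partial>Q) \<partial>lborel)"
      by (subst Q.nn_integral_fst[symmetric]) (auto simp: case_prod_beta)
    also have "\<dots> \<le> (\<integral>\<^sup>+s. (ennreal (\<integral>x. (U x)\<^sup>2 \<partial>Q) + ennreal C) * indicator A s \<partial>lborel)"
    proof (rule nn_integral_mono)
      fix s
      show "(\<integral>\<^sup>+x. ennreal \<bar>U x * k s x\<bar> \<partial>Q) \<le> (ennreal (\<integral>x. (U x)\<^sup>2 \<partial>Q) + ennreal C) * indicator A s"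
      proof (cases "s \<in> A")
        case True
        have "(\<integral>\<^sup>+x. ennreal \<bar>U x * k s x\<bar> \<partial>Q) \<le> (\<integral>\<^sup>+x. ennreal ((U x)\<^sup>2) + ennreal ((k s x)\<^sup>2) \<partial>Q)"
        proof (rule nn_integral_mono)
          fix x
          have "2 * \<bar>U x\<bar> * \<bar>k s x\<bar> \<le> \<bar>U x\<bar>\<^sup>2 + \<bar>k s x\<bar>\<^sup>2" by (rule sum_squares_bound)
          moreover have "0 \<le> \<bar>U x\<bar> * \<bar>k s x\<bar>" by simp
          ultimately have "\<bar>U x\<bar> * \<bar>k s x\<bar> \<le> \<bar>U x\<bar>\<^sup>2 + \<bar>k s x\<bar>\<^sup>2" by linarith
          then have "\<bar>U x * k s x\<bar> \<le> (U x)\<^sup>2 + (k s x)\<^sup>2" by (simp add: abs_mult)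
          then show "ennreal \<bar>U x * k s x\<bar> \<le> ennreal ((U x)\<^sup>2) + ennreal ((k s x)\<^sup>2)"
            by (simp add: ennreal_plus[symmetric] ennreal_leI del: ennreal_plus)
        qed
        also have "\<dots> = (\<integral>\<^sup>+x. ennreal ((U x)\<^sup>2) \<partial>Q) + (\<integral>\<^sup>+x. ennreal ((k s x)\<^sup>2) \<partial>Q)"
          by (rule nn_integral_add) (use True in \<open>auto simp: k_def\<close>)
        also have "(\<integral>\<^sup>+x. ennreal ((U x)\<^sup>2) \<partial>Q) = ennreal (\<integral>x. (U x)\<^sup>2 \<partial>Q)"
          by (rule nn_integral_eq_integral[OF U2]) simp
        also have "ennreal (\<integral>x. (U x)\<^sup>2 \<partial>Q) + (\<integral>\<^sup>+x. ennreal ((k s x)\<^sup>2) \<partial>Q) \<le> ennreal (\<integral>x. (U x)\<^sup>2 \<partial>Q) + ennreal C"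
          using ks[of s] True by (intro add_left_mono) simp
        finally show ?thesis using True by simp
      qed (simp add: k_def)
    qed
    also have "\<dots> = (ennreal (\<integral>x. (U x)\<^sup>2 \<partial>Q) + ennreal C) * emeasure lborel A" by (rule nn_integral_cmult_indicator[OF A])
    also have "\<dots> < \<infinity>" using finA by (auto simp: ennreal_mult_less_top)
    finally show "(\<integral>\<^sup>+p. norm (case p of (s, x) \<Rightarrow> U x * k s x) \<partial>(lborel \<Otimes>\<^sub>M Q)) < \<infinity>" .
  qed measurable
  from P.Fubini_integral[OF this]
  have "(\<integral>x. (\<integral>s. U x * k s x \<partial>lborel) \<partial>Q) = (\<integral>s. (\<integral>x. U x * k s x \<partial>Q) \<partial>lborel)" .
  moreover have "(\<integral>s. U x * k s x \<partial>lborel) = U x * (LBINT s:A. h s x)" for x by (simp add: LB)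
  moreover have "(\<integral>x. U x * k s x \<partial>Q) = indicator A s *\<^sub>R (\<integral>x. U x * h s x \<partial>Q)" for s
    unfolding k_def real_scaleR_def by (subst integral_mult_right_zero[symmetric]) (simp add: mult.left_commute)
  ultimately show "(\<integral>x. U x * (LBINT s:A. h s x) \<partial>Q) = (LBINT s:A. (\<integral>x. U x * h s x \<partial>Q))"
    by (simp only: set_lebesgue_integral_def)
qed

section \<open>The isometry and the stochastic Fubini theorem\<close>

locale square_integrable_levy_basis = gaussian_levy_basis M m a b \<mu> \<Lambda>
  for M :: "'w measure" and m :: "'s measure" and a b \<mu> \<Lambda> +
  assumes second_moment: "integrable \<mu> (\<lambda>x. x\<^sup>2)"
begin

text \<open>The mean of the basis per unit of control measure. It is chosen by its defining
  equation, which determines it uniquely.\<close>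

definition "drift = (SOME c. \<forall>z. levy_cumulant a b \<mu> z = \<i> * of_real (z * c) + centered_cumulant b \<mu> z)"

text \<open>The full variance per unit of control measure, with the Gaussian part included.\<close>

definition "jump_variance = b + (LINT x|\<mu>. x\<^sup>2)"

text \<open>Without centring, the second moment would contain the square of the integral of
  \<open>g\<close>, which the mean square norm does not control when the control measure is
  infinite.\<close>

definition "J g \<omega> = I g \<omega> - drift * (\<integral>x. g x \<partial>m)"

lemma levy_cumulant_drift: "levy_cumulant a b \<mu> z = \<i> * of_real (z * drift) + centered_cumulant b \<mu> z"
proof -
  obtain d where "\<And>a b z. levy_cumulant a b \<mu> z = \<i> * of_real (z * (a + d)) + centered_cumulant b \<mu> z"
    using levy_cumulant_centered[OF levy second_moment] by blast
  then have "\<exists>c. \<forall>z. levy_cumulant a b \<mu> z = \<i> * of_real (z * c) + centered_cumulant b \<mu> z" by blast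
  from someI_ex[OF this] show ?thesis unfolding drift_def by blast
qed

lemma b_nonneg: "b \<ge> 0" using b_pos by simp

lemma variance_pos: "jump_variance > 0"
  unfolding jump_variance_def using b_pos by (intro add_pos_nonneg) auto

lemma norm_centered_cumulant_le': "norm (centered_cumulant b \<mu> z) \<le> jump_variance * z\<^sup>2 / 2"
  unfolding jump_variance_def by (rule norm_centered_cumulant_le[OF levy second_moment b_nonneg])

lemma levy_exponent_le: "levy_exponent b \<mu> z \<le> jump_variance * z\<^sup>2 / 2"
proof -
  have "levy_exponent b \<mu> z = - Re (centered_cumulant b \<mu> z)"
    using Re_levy_cumulant[OF levy, of a b z] unfolding levy_cumulant_drift by simp
  also have "\<dots> \<le> norm (centered_cumulant b \<mu> z)" using abs_Re_le_cmod[of "centered_cumulant b \<mu> z"] by linarith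
  also note norm_centered_cumulant_le'
  finally show ?thesis .
qed

lemma J_measurable: "levy_simple m g \<Longrightarrow> J g \<in> borel_measurable M"
  unfolding J_def[abs_def] using I_measurable by simp

lemma cf_shift: "Y \<in> borel_measurable M \<Longrightarrow> cf M (\<lambda>\<omega>. Y \<omega> - c) s = cf M Y s * iexp (- (s * c))"
proof -
  have "iexp (s * (y - c)) = iexp (s * y) * iexp (- (s * c))" for y
  proof -
    have "s * (y - c) = s * y + - (s * c)" by (simp add: right_diff_distrib)
    then show ?thesis by (simp only: of_real_add distrib_left exp_add)
  qed
  then show ?thesis by (simp only: cf_def integral_mult_left_zero)
qed

lemma norm_cf_shift: "Y \<in> borel_measurable M \<Longrightarrow> norm (cf M (\<lambda>\<omega>. Y \<omega> - c) s) = norm (cf M Y s)"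
  by (simp only: cf_shift norm_mult norm_exp_i_times mult_1_right)

lemma cf_J:
  assumes g: "levy_simple m g"
  shows "cf M (J g) s = exp (\<integral>x. centered_cumulant b \<mu> (s * g x) \<partial>m)"
proof -
  have i: "integrable m (\<lambda>x. centered_cumulant b \<mu> (s * g x))" by (rule levy_simple_comp_integral[OF g]) simp
  have ig: "integrable m (\<lambda>x. complex_of_real (g x))" using levy_simple_square[OF g] by simp
  have "(\<integral>x. levy_cumulant a b \<mu> (s * g x) \<partial>m) = (\<integral>x. \<i> * of_real (s * drift) * of_real (g x) + centered_cumulant b \<mu> (s * g x) \<partial>m)"
    by (intro Bochner_Integration.integral_cong refl) (simp add: levy_cumulant_drift)
  also have "\<dots> = (\<integral>x. \<i> * of_real (s * drift) * of_real (g x) \<partial>m) + (\<integral>x. centered_cumulant b \<mu> (s * g x) \<partial>m)"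
    by (rule Bochner_Integration.integral_add[OF integrable_mult_right[OF ig] i])
  also have "(\<integral>x. \<i> * of_real (s * drift) * of_real (g x) \<partial>m) = \<i> * of_real (s * (drift * (\<integral>x. g x \<partial>m)))"
    by (simp only: integral_mult_right_zero integral_complex_of_real) (simp add: mult.assoc)
  finally have eq: "(\<integral>x. levy_cumulant a b \<mu> (s * g x) \<partial>m) =
     \<i> * of_real (s * (drift * (\<integral>x. g x \<partial>m))) + (\<integral>x. centered_cumulant b \<mu> (s * g x) \<partial>m)" .
  have "cf M (J g) s = exp (\<integral>x. levy_cumulant a b \<mu> (s * g x) \<partial>m) * iexp (- (s * (drift * (\<integral>x. g x \<partial>m))))"
    unfolding J_def[abs_def] cf_shift[OF I_measurable[OF g]] cf_I[OF g] ..
  also have "\<dots> = exp (\<integral>x. centered_cumulant b \<mu> (s * g x) \<partial>m)"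
    unfolding eq exp_add[symmetric] by (simp only: of_real_minus) simp
  finally show ?thesis .
qed

text \<open>The moments come from the quadratic expansion of the cumulant at 0, integrated over
  \<open>m\<close>, so no moments of the basis on individual sets have to be computed.\<close>

lemma moments_J:
  assumes g: "levy_simple m g"
  shows "integrable M (\<lambda>\<omega>. (J g \<omega>)\<^sup>2)" "expectation (\<lambda>\<omega>. (J g \<omega>)\<^sup>2) = jump_variance * (\<integral>x. (g x)\<^sup>2 \<partial>m)" "expectation (J g) = 0"
proof -
  let ?w = "\<lambda>n. \<integral>x. centered_cumulant b \<mu> (1 / real n * g x) \<partial>m"
  note [measurable] = levy_simple_measurable[OF g] centered_cumulant_measurable[OF levy second_moment b_nonneg]
  have "(\<lambda>n. \<integral>x. (real n)\<^sup>2 * centered_cumulant b \<mu> (g x / real n) \<partial>m) \<longlonglongrightarrow> (\<integral>x. of_real (- jump_variance * (g x)\<^sup>2 / 2) \<partial>m)"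
  proof (rule integral_dominated_convergence[where w="\<lambda>x. jump_variance * (g x)\<^sup>2 / 2"])
    show "AE x in m. (\<lambda>n. (real n)\<^sup>2 * centered_cumulant b \<mu> (g x / real n)) \<longlonglongrightarrow> of_real (- jump_variance * (g x)\<^sup>2 / 2)"
      unfolding jump_variance_def by (rule AE_I2) (rule centered_cumulant_small[OF levy second_moment])
    show "AE x in m. norm ((real n)\<^sup>2 * centered_cumulant b \<mu> (g x / real n)) \<le> jump_variance * (g x)\<^sup>2 / 2" for n
    proof (rule AE_I2)
      fix x
      have "norm (of_real ((real n)\<^sup>2) * centered_cumulant b \<mu> (g x / real n)) \<le> (real n)\<^sup>2 * (jump_variance * (g x / real n)\<^sup>2 / 2)"
        unfolding norm_mult norm_of_real by (intro mult_mono norm_centered_cumulant_le') auto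
      also have "\<dots> \<le> jump_variance * (g x)\<^sup>2 / 2" using variance_pos by (cases "n = 0") (simp_all add: power_divide)
      finally show "norm ((real n)\<^sup>2 * centered_cumulant b \<mu> (g x / real n)) \<le> jump_variance * (g x)\<^sup>2 / 2" by simp
    qed
  qed (use levy_simple_square[OF g] in auto)
  moreover have "(\<integral>x. complex_of_real (- jump_variance * (g x)\<^sup>2 / 2) \<partial>m) = of_real (- (jump_variance * (\<integral>x. (g x)\<^sup>2 \<partial>m)) / 2)"
    by (simp only: integral_complex_of_real) simp
  ultimately have "(\<lambda>n. (real n)\<^sup>2 * ?w n) \<longlonglongrightarrow> of_real (- (jump_variance * (\<integral>x. (g x)\<^sup>2 \<partial>m)) / 2)"
    by (simp only: integral_mult_right_zero inv_nat_mult)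
  from exp_scaled_limit[OF this]
  have lim: "(\<lambda>n. (real n)\<^sup>2 * (cf M (J g) (1 / real n) - 1)) \<longlonglongrightarrow> of_real (- (jump_variance * (\<integral>x. (g x)\<^sup>2 \<partial>m)) / 2)"
    unfolding cf_J[OF g] .
  show "integrable M (\<lambda>\<omega>. (J g \<omega>)\<^sup>2)" "expectation (\<lambda>\<omega>. (J g \<omega>)\<^sup>2) = jump_variance * (\<integral>x. (g x)\<^sup>2 \<partial>m)" "expectation (J g) = 0"
    using moments_of_cf[OF J_measurable[OF g] lim] by auto
qed

lemma J_linear:
  assumes g: "levy_simple m g" and h: "levy_simple m h"
  shows "AE \<omega> in M. J (\<lambda>x. c * g x + d * h x) \<omega> = c * J g \<omega> + d * J h \<omega>"
  using simple_levy_integral_linear[OF prob_space_axioms basis g h, of c d]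
  by eventually_elim (simp add: J_def levy_simple_square[OF g] levy_simple_square[OF h] algebra_simps)

text \<open>The integrals are centred by \<open>J\<close>, so that \<open>f \<mapsto> V\<close> is an isometry up to the factor \<open>jump_variance\<close>.\<close>

definition has_L2 :: "('s \<Rightarrow> real) \<Rightarrow> ('w \<Rightarrow> real) \<Rightarrow> bool" where
  "has_L2 f V \<longleftrightarrow> f \<in> borel_measurable m \<and> integrable m (\<lambda>x. (f x)\<^sup>2) \<and> V \<in> borel_measurable M \<and> integrable M (\<lambda>\<omega>. (V \<omega>)\<^sup>2) \<and>
     (\<exists>g. (\<forall>n. levy_simple m (g n)) \<and> (\<lambda>n. \<integral>x. (g n x - f x)\<^sup>2 \<partial>m) \<longlonglongrightarrow> 0 \<and> (\<lambda>n. expectation (\<lambda>\<omega>. (J (g n) \<omega> - V \<omega>)\<^sup>2)) \<longlonglongrightarrow> 0)"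

lemma has_L2D:
  assumes "has_L2 f V"
  shows "f \<in> borel_measurable m" "integrable m (\<lambda>x. (f x)\<^sup>2)" "V \<in> borel_measurable M" "integrable M (\<lambda>\<omega>. (V \<omega>)\<^sup>2)"
  using assms unfolding has_L2_def by blast+

lemma has_L2_J:
  assumes g: "levy_simple m g" shows "has_L2 g (J g)"
proof -
  have "(\<lambda>n::nat. \<integral>x. (g x - g x)\<^sup>2 \<partial>m) \<longlonglongrightarrow> 0" "(\<lambda>n::nat. expectation (\<lambda>\<omega>. (J g \<omega> - J g \<omega>)\<^sup>2)) \<longlonglongrightarrow> 0"
    by simp_all
  then show ?thesis
    unfolding has_L2_def
    using g levy_simple_measurable[OF g] levy_simple_square(1)[OF g] J_measurable[OF g] moments_J(1)[OF g]
    by (intro conjI exI[of _ "\<lambda>_::nat. g"] allI)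
qed

lemma has_L2_linear:
  assumes f: "has_L2 f V" and h: "has_L2 h W"
  shows "has_L2 (\<lambda>x. c * f x + d * h x) (\<lambda>\<omega>. c * V \<omega> + d * W \<omega>)"
proof -
  note [measurable] = has_L2D(1,3)[OF f] has_L2D(1,3)[OF h]
  note f2 = has_L2D(2)[OF f] has_L2D(2)[OF h] and V2 = has_L2D(4)[OF f] has_L2D(4)[OF h]
  obtain g where g: "\<And>n. levy_simple m (g n)" "(\<lambda>n. \<integral>x. (g n x - f x)\<^sup>2 \<partial>m) \<longlonglongrightarrow> 0"
    "(\<lambda>n. expectation (\<lambda>\<omega>. (J (g n) \<omega> - V \<omega>)\<^sup>2)) \<longlonglongrightarrow> 0"
    using f unfolding has_L2_def by blast
  obtain k where k: "\<And>n. levy_simple m (k n)" "(\<lambda>n. \<integral>x. (k n x - h x)\<^sup>2 \<partial>m) \<longlonglongrightarrow> 0"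
    "(\<lambda>n. expectation (\<lambda>\<omega>. (J (k n) \<omega> - W \<omega>)\<^sup>2)) \<longlonglongrightarrow> 0"
    using h unfolding has_L2_def by blast
  note [measurable] = levy_simple_measurable[OF g(1)] levy_simple_measurable[OF k(1)] J_measurable[OF g(1)] J_measurable[OF k(1)]
  have gm: "g n \<in> borel_measurable m" and km: "k n \<in> borel_measurable m" for n
    by (rule levy_simple_measurable[OF g(1)], rule levy_simple_measurable[OF k(1)])
  let ?l = "\<lambda>n x. c * g n x + d * k n x"
  have l: "levy_simple m (?l n)" for n by (rule levy_simple_linear[OF g(1) k(1)])
  note [measurable] = J_measurable[OF l]
  have "(\<lambda>n. \<integral>x. (?l n x - (c * f x + d * h x))\<^sup>2 \<partial>m) \<longlonglongrightarrow> 0"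
  proof (rule null_limit_mono)
    show "0 \<le> (\<integral>x. (?l n x - (c * f x + d * h x))\<^sup>2 \<partial>m)" for n
      by (intro integral_nonneg_AE AE_I2 zero_le_power2)
    show "(\<integral>x. (?l n x - (c * f x + d * h x))\<^sup>2 \<partial>m) \<le>
        2 * c\<^sup>2 * (\<integral>x. (g n x - f x)\<^sup>2 \<partial>m) + 2 * d\<^sup>2 * (\<integral>x. (k n x - h x)\<^sup>2 \<partial>m)" for n
      using integral_square_linear_diff_le[OF gm[of n] km[of n] has_L2D(1)[OF f] has_L2D(1)[OF h]
          levy_simple_square(1)[OF g(1)[of n]] levy_simple_square(1)[OF k(1)[of n]] f2, of c d] .
    have "(\<lambda>n. 2 * c\<^sup>2 * (\<integral>x. (g n x - f x)\<^sup>2 \<partial>m) + 2 * d\<^sup>2 * (\<integral>x. (k n x - h x)\<^sup>2 \<partial>m)) \<longlonglongrightarrow> 2 * c\<^sup>2 * 0 + 2 * d\<^sup>2 * 0"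
      by (intro tendsto_intros g k)
    then show "(\<lambda>n. 2 * c\<^sup>2 * (\<integral>x. (g n x - f x)\<^sup>2 \<partial>m) + 2 * d\<^sup>2 * (\<integral>x. (k n x - h x)\<^sup>2 \<partial>m)) \<longlonglongrightarrow> 0" by simp
  qed
  moreover have "(\<lambda>n. expectation (\<lambda>\<omega>. (J (?l n) \<omega> - (c * V \<omega> + d * W \<omega>))\<^sup>2)) \<longlonglongrightarrow> 0"
  proof (rule null_limit_mono)
    show "0 \<le> expectation (\<lambda>\<omega>. (J (?l n) \<omega> - (c * V \<omega> + d * W \<omega>))\<^sup>2)" for n
      by (intro integral_nonneg_AE AE_I2 zero_le_power2)
    show "expectation (\<lambda>\<omega>. (J (?l n) \<omega> - (c * V \<omega> + d * W \<omega>))\<^sup>2) \<le>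
        2 * c\<^sup>2 * expectation (\<lambda>\<omega>. (J (g n) \<omega> - V \<omega>)\<^sup>2) + 2 * d\<^sup>2 * expectation (\<lambda>\<omega>. (J (k n) \<omega> - W \<omega>)\<^sup>2)" for n
    proof -
      have "expectation (\<lambda>\<omega>. (J (?l n) \<omega> - (c * V \<omega> + d * W \<omega>))\<^sup>2) =
          expectation (\<lambda>\<omega>. ((c * J (g n) \<omega> + d * J (k n) \<omega>) - (c * V \<omega> + d * W \<omega>))\<^sup>2)"
        by (rule integral_cong_AE) (measurable, use J_linear[OF g(1)[of n] k(1)[of n], of c d] in \<open>eventually_elim, simp only:\<close>)
      also have "\<dots> \<le> 2 * c\<^sup>2 * expectation (\<lambda>\<omega>. (J (g n) \<omega> - V \<omega>)\<^sup>2) + 2 * d\<^sup>2 * expectation (\<lambda>\<omega>. (J (k n) \<omega> - W \<omega>)\<^sup>2)"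
        using integral_square_linear_diff_le[OF J_measurable[OF g(1)[of n]] J_measurable[OF k(1)[of n]] has_L2D(3)[OF f] has_L2D(3)[OF h]
          moments_J(1)[OF g(1)[of n]] moments_J(1)[OF k(1)[of n]] V2, of c d] .
      finally show "expectation (\<lambda>\<omega>. (J (?l n) \<omega> - (c * V \<omega> + d * W \<omega>))\<^sup>2) \<le>
        2 * c\<^sup>2 * expectation (\<lambda>\<omega>. (J (g n) \<omega> - V \<omega>)\<^sup>2) + 2 * d\<^sup>2 * expectation (\<lambda>\<omega>. (J (k n) \<omega> - W \<omega>)\<^sup>2)" .
    qed
    have "(\<lambda>n. 2 * c\<^sup>2 * expectation (\<lambda>\<omega>. (J (g n) \<omega> - V \<omega>)\<^sup>2) + 2 * d\<^sup>2 * expectation (\<lambda>\<omega>. (J (k n) \<omega> - W \<omega>)\<^sup>2)) \<longlonglongrightarrow> 2 * c\<^sup>2 * 0 + 2 * d\<^sup>2 * 0"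
      by (intro tendsto_intros g k)
    then show "(\<lambda>n. 2 * c\<^sup>2 * expectation (\<lambda>\<omega>. (J (g n) \<omega> - V \<omega>)\<^sup>2) + 2 * d\<^sup>2 * expectation (\<lambda>\<omega>. (J (k n) \<omega> - W \<omega>)\<^sup>2)) \<longlonglongrightarrow> 0" by simp
  qed
  ultimately have "\<exists>l. (\<forall>n. levy_simple m (l n)) \<and> (\<lambda>n. \<integral>x. (l n x - (c * f x + d * h x))\<^sup>2 \<partial>m) \<longlonglongrightarrow> 0 \<and>
      (\<lambda>n. expectation (\<lambda>\<omega>. (J (l n) \<omega> - (c * V \<omega> + d * W \<omega>))\<^sup>2)) \<longlonglongrightarrow> 0"
    using l by (intro exI[of _ ?l] conjI allI)
  moreover have "(\<lambda>x. c * f x + d * h x) \<in> borel_measurable m" "(\<lambda>\<omega>. c * V \<omega> + d * W \<omega>) \<in> borel_measurable M"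
    by (intro borel_measurable_add borel_measurable_times borel_measurable_const has_L2D(1,3)[OF f] has_L2D(1,3)[OF h])+
  ultimately show ?thesis
    using integrable_square_linear(1)[OF has_L2D(1)[OF f] has_L2D(1)[OF h] f2, of c d]
      integrable_square_linear(1)[OF has_L2D(3)[OF f] has_L2D(3)[OF h] V2, of c d]
    unfolding has_L2_def by (intro conjI)
qed

lemma has_L2_isometry:
  assumes f: "has_L2 f V"
  shows "expectation (\<lambda>\<omega>. (V \<omega>)\<^sup>2) = jump_variance * (\<integral>x. (f x)\<^sup>2 \<partial>m)"
proof -
  obtain g where g: "\<And>n. levy_simple m (g n)" "(\<lambda>n. \<integral>x. (g n x - f x)\<^sup>2 \<partial>m) \<longlonglongrightarrow> 0"
    "(\<lambda>n. expectation (\<lambda>\<omega>. (J (g n) \<omega> - V \<omega>)\<^sup>2)) \<longlonglongrightarrow> 0"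
    using f unfolding has_L2_def by blast
  have "(\<lambda>n. \<integral>x. (g n x)\<^sup>2 \<partial>m) \<longlonglongrightarrow> (\<integral>x. (f x)\<^sup>2 \<partial>m)"
    by (rule integral_square_LIMSEQ[OF has_L2D(1,2)[OF f] levy_simple_measurable[OF g(1)] levy_simple_square(1)[OF g(1)] g(2)])
  from tendsto_mult_left[OF this, of jump_variance]
  have "(\<lambda>n. expectation (\<lambda>\<omega>. (J (g n) \<omega>)\<^sup>2)) \<longlonglongrightarrow> jump_variance * (\<integral>x. (f x)\<^sup>2 \<partial>m)"
    by (simp add: moments_J(2)[OF g(1)])
  moreover have "(\<lambda>n. expectation (\<lambda>\<omega>. (J (g n) \<omega>)\<^sup>2)) \<longlonglongrightarrow> expectation (\<lambda>\<omega>. (V \<omega>)\<^sup>2)"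
    by (rule integral_square_LIMSEQ[OF has_L2D(3,4)[OF f] J_measurable[OF g(1)] moments_J(1)[OF g(1)] g(3)])
  ultimately show ?thesis using LIMSEQ_unique by blast
qed

lemma has_L2_inner:
  assumes f: "has_L2 f V" and h: "has_L2 h W"
  shows "expectation (\<lambda>\<omega>. V \<omega> * W \<omega>) = jump_variance * (\<integral>x. f x * h x \<partial>m)"
proof -
  have "expectation (\<lambda>\<omega>. (1 * V \<omega> + 1 * W \<omega>)\<^sup>2) = jump_variance * (\<integral>x. (1 * f x + 1 * h x)\<^sup>2 \<partial>m)"
    by (rule has_L2_isometry[OF has_L2_linear[OF f h]])
  then show ?thesis
    unfolding integrable_square_linear(2)[OF has_L2D(1)[OF f] has_L2D(1)[OF h] has_L2D(2)[OF f] has_L2D(2)[OF h]]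
      integrable_square_linear(2)[OF has_L2D(3)[OF f] has_L2D(3)[OF h] has_L2D(4)[OF f] has_L2D(4)[OF h]]
    by (simp add: has_L2_isometry[OF f] has_L2_isometry[OF h] algebra_simps)
qed

text \<open>Expanding the square shows that the distance of \<open>V\<close> to
  \<open>J (g n)\<close> equals, up to the factor \<open>jump_variance\<close>, that of
  \<open>f\<close> to \<open>g n\<close>. Hence the right norm and the right inner products with
  simple integrals already identify \<open>V\<close> as the integral of \<open>f\<close>.\<close>

lemma has_L2I_inner:
  assumes f: "f \<in> borel_measurable m" "integrable m (\<lambda>x. (f x)\<^sup>2)"
    and V: "V \<in> borel_measurable M" "integrable M (\<lambda>\<omega>. (V \<omega>)\<^sup>2)"
    and iso: "expectation (\<lambda>\<omega>. (V \<omega>)\<^sup>2) = jump_variance * (\<integral>x. (f x)\<^sup>2 \<partial>m)"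
    and inner: "\<And>g. levy_simple m g \<Longrightarrow> expectation (\<lambda>\<omega>. V \<omega> * J g \<omega>) = jump_variance * (\<integral>x. f x * g x \<partial>m)"
  shows "has_L2 f V"
proof -
  obtain g where g: "\<And>n. levy_simple m (g n)" "(\<lambda>n. \<integral>x. (g n x - f x)\<^sup>2 \<partial>m) \<longlonglongrightarrow> 0"
    using levy_simple_dense[OF f] by blast
  have "expectation (\<lambda>\<omega>. (J (g n) \<omega> - V \<omega>)\<^sup>2) = jump_variance * (\<integral>x. (g n x - f x)\<^sup>2 \<partial>m)" for n
  proof -
    have "expectation (\<lambda>\<omega>. (1 * V \<omega> + (-1) * J (g n) \<omega>)\<^sup>2) = jump_variance * (\<integral>x. (1 * f x + (-1) * g n x)\<^sup>2 \<partial>m)"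
      unfolding integrable_square_linear(2)[OF f(1) levy_simple_measurable[OF g(1)] f(2) levy_simple_square(1)[OF g(1)]]
        integrable_square_linear(2)[OF V(1) J_measurable[OF g(1)] V(2) moments_J(1)[OF g(1)]]
      by (simp add: iso inner[OF g(1)] moments_J(2)[OF g(1)] algebra_simps)
    then show ?thesis by (simp add: power2_commute)
  qed
  moreover have "(\<lambda>n. jump_variance * (\<integral>x. (g n x - f x)\<^sup>2 \<partial>m)) \<longlonglongrightarrow> 0"
    using tendsto_mult_left[OF g(2), of jump_variance] by simp
  ultimately have "(\<lambda>n. expectation (\<lambda>\<omega>. (J (g n) \<omega> - V \<omega>)\<^sup>2)) \<longlonglongrightarrow> 0" by (simp only:)
  then show ?thesis
    unfolding has_L2_def using f V g by blast
qed

lemma has_L2_sum: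
  assumes "finite K" "\<And>k. k \<in> K \<Longrightarrow> has_L2 (f k) (V k)"
  shows "has_L2 (\<lambda>x. \<Sum>k\<in>K. c k * f k x) (\<lambda>\<omega>. \<Sum>k\<in>K. c k * V k \<omega>)"
  using assms
proof (induction K)
  case empty
  have "has_L2 (\<lambda>x. 0) (\<lambda>\<omega>. 0)" by (rule has_L2I_inner) auto
  then show ?case by simp
next
  case (insert k K)
  have "has_L2 (\<lambda>x. c k * f k x + 1 * (\<Sum>k\<in>K. c k * f k x)) (\<lambda>\<omega>. c k * V k \<omega> + 1 * (\<Sum>k\<in>K. c k * V k \<omega>))"
    using insert by (intro has_L2_linear) auto
  then show ?case using insert.hyps by simp
qed

text \<open>The stochastic Fubini theorem. By \<open>has_L2I_inner\<close> only scalar identities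
  are left, and inner products pass through the time integral on both sides by
  \<open>set_integral_L2\<close>. No approximation of the time integral or of its integrand in time
  is involved.\<close>

lemma has_L2_integral:
  fixes f :: "real \<Rightarrow> 's \<Rightarrow> real" and X :: "real \<Rightarrow> 'w \<Rightarrow> real"
  assumes m: "sigma_finite_measure m" and A: "A \<in> sets lborel" "emeasure lborel A < \<infinity>"
    and fm: "(\<lambda>(s, x). f s x) \<in> borel_measurable (lborel \<Otimes>\<^sub>M m)"
    and Xm: "(\<lambda>(s, x). X s x) \<in> borel_measurable (lborel \<Otimes>\<^sub>M M)"
    and fX: "\<And>s. s \<in> A \<Longrightarrow> has_L2 (f s) (X s)"
    and fC: "\<And>s. s \<in> A \<Longrightarrow> (\<integral>x. (f s x)\<^sup>2 \<partial>m) \<le> C"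
  shows "has_L2 (\<lambda>x. LBINT s:A. f s x) (\<lambda>\<omega>. LBINT s:A. X s \<omega>)"
proof -
  have M: "sigma_finite_measure M" ..
  have XC: "expectation (\<lambda>\<omega>. (X s \<omega>)\<^sup>2) \<le> jump_variance * C" if "s \<in> A" for s
    using has_L2_isometry[OF fX[OF that]] fC[OF that] variance_pos by simp
  let ?F = "\<lambda>x. LBINT s:A. f s x" and ?V = "\<lambda>\<omega>. LBINT s:A. X s \<omega>"
  have F1: "?F \<in> borel_measurable m" and F2: "integrable m (\<lambda>x. (?F x)\<^sup>2)"
    using set_integral_L2(1,2)[OF m A fm has_L2D(2)[OF fX] fC] by blast+
  have F3: "(\<integral>x. u x * ?F x \<partial>m) = (LBINT s:A. (\<integral>x. u x * f s x \<partial>m))"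
    if "u \<in> borel_measurable m" "integrable m (\<lambda>x. (u x)\<^sup>2)" for u
    by (rule set_integral_L2(3)[OF m A fm has_L2D(2)[OF fX] fC that])
  have V1: "?V \<in> borel_measurable M" and V2: "integrable M (\<lambda>\<omega>. (?V \<omega>)\<^sup>2)"
    using set_integral_L2(1,2)[OF M A Xm has_L2D(4)[OF fX] XC] by blast+
  have V3: "expectation (\<lambda>\<omega>. U \<omega> * ?V \<omega>) = (LBINT s:A. expectation (\<lambda>\<omega>. U \<omega> * X s \<omega>))"
    if "U \<in> borel_measurable M" "integrable M (\<lambda>\<omega>. (U \<omega>)\<^sup>2)" for U
    by (rule set_integral_L2(3)[OF M A Xm has_L2D(4)[OF fX] XC that])
  have inner: "expectation (\<lambda>\<omega>. W \<omega> * ?V \<omega>) = jump_variance * (\<integral>x. h x * ?F x \<partial>m)" if hW: "has_L2 h W" for h W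
  proof -
    have "expectation (\<lambda>\<omega>. W \<omega> * ?V \<omega>) = (LBINT s:A. expectation (\<lambda>\<omega>. W \<omega> * X s \<omega>))"
      by (rule V3[OF has_L2D(3,4)[OF hW]])
    also have "\<dots> = (LBINT s:A. jump_variance * (\<integral>x. h x * f s x \<partial>m))"
      by (rule set_lebesgue_integral_cong[OF A(1)]) (use has_L2_inner[OF hW fX] in auto)
    also have "\<dots> = jump_variance * (LBINT s:A. (\<integral>x. h x * f s x \<partial>m))"
      by (rule set_integral_mult_right)
    also have "(LBINT s:A. (\<integral>x. h x * f s x \<partial>m)) = (\<integral>x. h x * ?F x \<partial>m)"
      by (rule F3[OF has_L2D(1,2)[OF hW], symmetric])
    finally show ?thesis .
  qed
  show ?thesis
  proof (rule has_L2I_inner)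
    show "?F \<in> borel_measurable m" "integrable m (\<lambda>x. (?F x)\<^sup>2)" "?V \<in> borel_measurable M" "integrable M (\<lambda>\<omega>. (?V \<omega>)\<^sup>2)"
      by (fact F1 F2 V1 V2)+
    have comm: "expectation (\<lambda>\<omega>. ?V \<omega> * W \<omega>) = jump_variance * (\<integral>x. ?F x * h x \<partial>m)" if "has_L2 h W" for h W
      using inner[OF that] unfolding mult.commute[of "?V _"] mult.commute[of "?F _"] .
    show "expectation (\<lambda>\<omega>. ?V \<omega> * J g \<omega>) = jump_variance * (\<integral>x. ?F x * g x \<partial>m)" if "levy_simple m g" for g
      by (rule comm[OF has_L2_J[OF that]])
    \<comment> \<open>For the norm, the time integral is its own test variable; \<open>comm\<close>
      already evaluates its product with every \<open>X s\<close>.\<close>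
    have "expectation (\<lambda>\<omega>. ?V \<omega> * ?V \<omega>) = (LBINT s:A. expectation (\<lambda>\<omega>. ?V \<omega> * X s \<omega>))"
      by (rule V3[OF V1 V2])
    also have "\<dots> = (LBINT s:A. jump_variance * (\<integral>x. ?F x * f s x \<partial>m))"
      by (rule set_lebesgue_integral_cong[OF A(1)]) (use comm[OF fX] in blast)
    also have "\<dots> = jump_variance * (LBINT s:A. (\<integral>x. ?F x * f s x \<partial>m))"
      by (rule set_integral_mult_right)
    also have "(LBINT s:A. (\<integral>x. ?F x * f s x \<partial>m)) = (\<integral>x. ?F x * ?F x \<partial>m)"
      by (rule F3[OF F1 F2, symmetric])
    finally show "expectation (\<lambda>\<omega>. (?V \<omega>)\<^sup>2) = jump_variance * (\<integral>x. (?F x)\<^sup>2 \<partial>m)"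
      unfolding power2_eq_square .
  qed
qed

lemma integrable_centered_cumulant_L2:
  assumes "f \<in> borel_measurable m" "integrable m (\<lambda>x. (f x)\<^sup>2)"
  shows "integrable m (\<lambda>x. centered_cumulant b \<mu> (s * f x))"
proof (rule Bochner_Integration.integrable_bound)
  show "integrable m (\<lambda>x. jump_variance * s\<^sup>2 / 2 * (f x)\<^sup>2)" by (rule integrable_mult_right[OF assms(2)])
  show "AE x in m. norm (centered_cumulant b \<mu> (s * f x)) \<le> norm (jump_variance * s\<^sup>2 / 2 * (f x)\<^sup>2)"
  proof (rule AE_I2)
    fix x show "norm (centered_cumulant b \<mu> (s * f x)) \<le> norm (jump_variance * s\<^sup>2 / 2 * (f x)\<^sup>2)"
      using norm_centered_cumulant_le'[of "s * f x"] variance_pos by (simp add: power_mult_distrib)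
  qed
  show "(\<lambda>x. centered_cumulant b \<mu> (s * f x)) \<in> borel_measurable m"
    by (rule measurable_compose[OF borel_measurable_times[OF borel_measurable_const assms(1)] centered_cumulant_measurable[OF levy second_moment b_nonneg]])
qed

text \<open>Both sides are continuous under mean square approximation. The left side is Lipschitz in
  the mean distance of the variables; on the right, the local Lipschitz bound of the cumulant is
  combined with Cauchy-Schwarz and with convergence of the norms.\<close>

lemma cf_has_L2:
  assumes f: "has_L2 f V"
  shows "cf M V s = exp (\<integral>x. centered_cumulant b \<mu> (s * f x) \<partial>m)"
proof -
  obtain g where g: "\<And>n. levy_simple m (g n)" "(\<lambda>n. \<integral>x. (g n x - f x)\<^sup>2 \<partial>m) \<longlonglongrightarrow> 0"
    "(\<lambda>n. expectation (\<lambda>\<omega>. (J (g n) \<omega> - V \<omega>)\<^sup>2)) \<longlonglongrightarrow> 0"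
    using f unfolding has_L2_def by blast
  note f2 = has_L2D(2)[OF f] and V2 = has_L2D(4)[OF f] and g2 = levy_simple_square(1)[OF g(1)]
  have gm: "g n \<in> borel_measurable m" for n by (rule levy_simple_measurable[OF g(1)])
  note fm = has_L2D(1)[OF f] and Vm = has_L2D(3)[OF f] and Jm = J_measurable[OF g(1)]
  have "(\<lambda>n. cf M (J (g n)) s) \<longlonglongrightarrow> cf M V s"
  proof -
    let ?D = "\<lambda>n. expectation (\<lambda>\<omega>. (J (g n) \<omega> - V \<omega>)\<^sup>2)"
    have ev: "\<forall>\<^sub>F n in sequentially. norm (cf M (J (g n)) s - cf M V s) \<le> \<bar>s\<bar> * sqrt (?D n)"
    proof (rule eventuallyI)
      fix n
      have D2: "integrable M (\<lambda>\<omega>. (J (g n) \<omega> - V \<omega>)\<^sup>2)"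
        by (rule integrable_square_diff[OF Jm Vm moments_J(1)[OF g(1)] V2])
      have Dm: "(\<lambda>\<omega>. J (g n) \<omega> - V \<omega>) \<in> borel_measurable M" by (rule borel_measurable_diff[OF Jm Vm])
      have Da: "integrable M (\<lambda>\<omega>. \<bar>J (g n) \<omega> - V \<omega>\<bar>)" by (rule integrable_abs, rule integrable_square_imp[OF Dm D2])
      have "norm (cf M (J (g n)) s - cf M V s) \<le> expectation (\<lambda>\<omega>. norm (iexp (s * (J (g n) \<omega> - V \<omega>)) - 1))"
        by (rule norm_cf_diff_le[OF Jm Vm])
      also have "\<dots> \<le> expectation (\<lambda>\<omega>. \<bar>s\<bar> * \<bar>J (g n) \<omega> - V \<omega>\<bar>)"
      proof (rule integral_mono)
        show "integrable M (\<lambda>\<omega>. norm (iexp (s * (J (g n) \<omega> - V \<omega>)) - 1))"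
          by (intro integrable_norm Bochner_Integration.integrable_diff integrable_cf Dm integrable_const)
        show "norm (iexp (s * (J (g n) \<omega> - V \<omega>)) - 1) \<le> \<bar>s\<bar> * \<bar>J (g n) \<omega> - V \<omega>\<bar>" for \<omega>
          using norm_iexp_diff_one_le(1)[of "s * (J (g n) \<omega> - V \<omega>)"] unfolding abs_mult .
      qed (rule integrable_mult_right[OF Da])
      also have "\<dots> = \<bar>s\<bar> * expectation (\<lambda>\<omega>. \<bar>J (g n) \<omega> - V \<omega>\<bar> * 1)" by simp
      also have "\<dots> \<le> \<bar>s\<bar> * sqrt (?D n)"
      proof (intro mult_left_mono)
        have "\<bar>expectation (\<lambda>\<omega>. \<bar>J (g n) \<omega> - V \<omega>\<bar> * 1)\<bar> \<le> sqrt (expectation (\<lambda>\<omega>. \<bar>J (g n) \<omega> - V \<omega>\<bar>\<^sup>2)) * sqrt (expectation (\<lambda>\<omega>. 1\<^sup>2))"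
          by (rule Cauchy_Schwarz_integral(2)[OF borel_measurable_abs[OF Dm] borel_measurable_const]) (use D2 in simp_all)
        then show "expectation (\<lambda>\<omega>. \<bar>J (g n) \<omega> - V \<omega>\<bar> * 1) \<le> sqrt (?D n)"
          by (simp add: prob_space)
      qed simp
      finally show "norm (cf M (J (g n)) s - cf M V s) \<le> \<bar>s\<bar> * sqrt (?D n)" .
    qed
    have "(\<lambda>n. \<bar>s\<bar> * sqrt (?D n)) \<longlonglongrightarrow> \<bar>s\<bar> * sqrt 0" by (intro tendsto_intros g(3))
    then have "(\<lambda>n. \<bar>s\<bar> * sqrt (?D n)) \<longlonglongrightarrow> 0" by simp
    from Lim_null_comparison[OF ev this] show ?thesis by (rule LIM_zero_cancel)
  qed
  moreover have "(\<lambda>n. cf M (J (g n)) s) \<longlonglongrightarrow> exp (\<integral>x. centered_cumulant b \<mu> (s * f x) \<partial>m)"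
  proof -
    let ?D = "\<lambda>n. \<integral>x. (g n x - f x)\<^sup>2 \<partial>m"
    let ?S = "\<lambda>n. 2 * (\<integral>x. (g n x)\<^sup>2 \<partial>m) + 2 * (\<integral>x. (f x)\<^sup>2 \<partial>m)"
    let ?c = "2 * jump_variance * s\<^sup>2"
    have ev: "\<forall>\<^sub>F n in sequentially. norm ((\<integral>x. centered_cumulant b \<mu> (s * g n x) \<partial>m) - (\<integral>x. centered_cumulant b \<mu> (s * f x) \<partial>m))
        \<le> ?c * (sqrt (?D n) * sqrt (?S n))"
    proof (rule eventuallyI)
      fix n
      have D2: "integrable m (\<lambda>x. \<bar>g n x - f x\<bar>\<^sup>2)" using integrable_square_diff[OF gm has_L2D(1)[OF f] g2 f2] by simp
      have a2: "integrable m (\<lambda>x. \<bar>g n x\<bar>\<^sup>2)" "integrable m (\<lambda>x. \<bar>f x\<bar>\<^sup>2)" using g2 f2 by simp_all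
      have am: "(\<lambda>x. \<bar>g n x - f x\<bar>) \<in> borel_measurable m" "(\<lambda>x. \<bar>g n x\<bar>) \<in> borel_measurable m" "(\<lambda>x. \<bar>f x\<bar>) \<in> borel_measurable m"
        by (intro borel_measurable_abs borel_measurable_diff gm fm)+
      have S2: "integrable m (\<lambda>x. (\<bar>g n x\<bar> + \<bar>f x\<bar>)\<^sup>2)"
        using integrable_square_linear(1)[OF am(2,3) a2, of 1 1] by simp
      have Sm: "(\<lambda>x. \<bar>g n x\<bar> + \<bar>f x\<bar>) \<in> borel_measurable m" by (rule borel_measurable_add[OF am(2,3)])
      have prod: "integrable m (\<lambda>x. \<bar>g n x - f x\<bar> * (\<bar>g n x\<bar> + \<bar>f x\<bar>))"
        by (rule Cauchy_Schwarz_integral(1)[OF am(1) Sm D2 S2])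
      have "norm ((\<integral>x. centered_cumulant b \<mu> (s * g n x) \<partial>m) - (\<integral>x. centered_cumulant b \<mu> (s * f x) \<partial>m)) =
          norm (\<integral>x. centered_cumulant b \<mu> (s * g n x) - centered_cumulant b \<mu> (s * f x) \<partial>m)"
        by (subst Bochner_Integration.integral_diff[OF integrable_centered_cumulant_L2[OF gm g2] integrable_centered_cumulant_L2[OF fm f2]]) (rule refl)
      also have "\<dots> \<le> (\<integral>x. ?c * (\<bar>g n x - f x\<bar> * (\<bar>g n x\<bar> + \<bar>f x\<bar>)) \<partial>m)"
      proof (rule norm_integral_le)
        fix x
        have "norm (centered_cumulant b \<mu> (s * g n x) - centered_cumulant b \<mu> (s * f x)) \<le>
            2 * jump_variance * (\<bar>s * g n x - s * f x\<bar> * (\<bar>s * g n x\<bar> + \<bar>s * f x\<bar>))"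
          unfolding jump_variance_def by (rule norm_centered_cumulant_diff_le[OF levy second_moment b_nonneg])
        also have "\<bar>s * g n x - s * f x\<bar> = \<bar>s\<bar> * \<bar>g n x - f x\<bar>" by (simp only: right_diff_distrib[symmetric] abs_mult)
        also have "2 * jump_variance * (\<bar>s\<bar> * \<bar>g n x - f x\<bar> * (\<bar>s * g n x\<bar> + \<bar>s * f x\<bar>)) =
            2 * jump_variance * (\<bar>s\<bar> * \<bar>s\<bar>) * (\<bar>g n x - f x\<bar> * (\<bar>g n x\<bar> + \<bar>f x\<bar>))"
        proof -
          have "2 * v * (t * q * (t * p + t * r)) = 2 * v * (t * t) * (q * (p + r))" for v t p q r :: real by (simp add: algebra_simps)
          then show ?thesis unfolding abs_mult .
        qed
        finally show "norm (centered_cumulant b \<mu> (s * g n x) - centered_cumulant b \<mu> (s * f x)) \<le> ?c * (\<bar>g n x - f x\<bar> * (\<bar>g n x\<bar> + \<bar>f x\<bar>))"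
          by (simp only: abs_mult_self_eq power2_eq_square)
      qed (intro Bochner_Integration.integrable_diff integrable_centered_cumulant_L2 gm g2 fm f2, rule integrable_mult_right[OF prod])
      also have "\<dots> = ?c * (\<integral>x. \<bar>g n x - f x\<bar> * (\<bar>g n x\<bar> + \<bar>f x\<bar>) \<partial>m)" by (rule integral_mult_right_zero)
      also have "\<dots> \<le> ?c * (sqrt (?D n) * sqrt (?S n))"
      proof (intro mult_left_mono)
        have "\<bar>\<integral>x. \<bar>g n x - f x\<bar> * (\<bar>g n x\<bar> + \<bar>f x\<bar>) \<partial>m\<bar> \<le> sqrt (\<integral>x. \<bar>g n x - f x\<bar>\<^sup>2 \<partial>m) * sqrt (\<integral>x. (\<bar>g n x\<bar> + \<bar>f x\<bar>)\<^sup>2 \<partial>m)"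
          by (rule Cauchy_Schwarz_integral(2)[OF am(1) Sm D2 S2])
        moreover have "(\<integral>x. (\<bar>g n x\<bar> + \<bar>f x\<bar>)\<^sup>2 \<partial>m) \<le> ?S n"
          using integral_square_linear_le[OF am(2,3) a2, of 1 1] by simp
        then have "sqrt (\<integral>x. \<bar>g n x - f x\<bar>\<^sup>2 \<partial>m) * sqrt (\<integral>x. (\<bar>g n x\<bar> + \<bar>f x\<bar>)\<^sup>2 \<partial>m) \<le> sqrt (?D n) * sqrt (?S n)"
          by (intro mult_mono real_sqrt_le_mono) (auto intro!: real_sqrt_ge_zero)
        ultimately show "(\<integral>x. \<bar>g n x - f x\<bar> * (\<bar>g n x\<bar> + \<bar>f x\<bar>) \<partial>m) \<le> sqrt (?D n) * sqrt (?S n)" by linarith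
      qed (use variance_pos in simp)
      finally show "norm ((\<integral>x. centered_cumulant b \<mu> (s * g n x) \<partial>m) - (\<integral>x. centered_cumulant b \<mu> (s * f x) \<partial>m))
        \<le> ?c * (sqrt (?D n) * sqrt (?S n))" .
    qed
    have "(\<lambda>n. \<integral>x. (g n x)\<^sup>2 \<partial>m) \<longlonglongrightarrow> (\<integral>x. (f x)\<^sup>2 \<partial>m)"
      by (rule integral_square_LIMSEQ[OF has_L2D(1,2)[OF f] gm g2 g(2)])
    then have "(\<lambda>n. ?c * (sqrt (?D n) * sqrt (?S n))) \<longlonglongrightarrow> ?c * (sqrt 0 * sqrt (2 * (\<integral>x. (f x)\<^sup>2 \<partial>m) + 2 * (\<integral>x. (f x)\<^sup>2 \<partial>m)))"
      by (intro tendsto_intros g(2))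
    then have "(\<lambda>n. ?c * (sqrt (?D n) * sqrt (?S n))) \<longlonglongrightarrow> 0" by simp
    from LIM_zero_cancel[OF Lim_null_comparison[OF ev this]]
    show ?thesis unfolding cf_J[OF g(1)] by (rule tendsto_exp)
  qed
  ultimately show ?thesis using LIMSEQ_unique by blast
qed

text \<open>Convergence in probability does not give mean square convergence by itself. Here the
  differences \<open>Y - J (\<phi> n)\<close> are centred, so their second moments are bounded
  through the modulus of their characteristic functions. That modulus is a limit of moduli for
  \<open>\<phi> N - \<phi> n\<close>, which the Cauchy property keeps close to 1, and the
  deterministic shift between \<open>I\<close> and \<open>J\<close> leaves it unchanged.\<close>

lemma has_L2_of_conv_in_prob:
  assumes f[measurable]: "f \<in> borel_measurable m" and Y[measurable]: "Y \<in> borel_measurable M"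
    and \<phi>: "\<And>n. levy_simple m (\<phi> n)" and \<phi>f: "AE x in m. (\<lambda>n. \<phi> n x) \<longlonglongrightarrow> f x"
    and conv: "conv_in_prob M (\<lambda>n. I (\<phi> n)) Y"
    and Y2: "integrable M (\<lambda>\<omega>. (Y \<omega>)\<^sup>2)" and EY: "expectation Y = 0"
  shows "has_L2 f Y"
proof -
  note [measurable] = I_measurable[OF \<phi>] J_measurable[OF \<phi>]
  note L2 = \<phi>_L2_limit[OF f Y \<phi> \<phi>f conv Y2 EY]
  note diff = \<phi>_diff[OF f Y \<phi> \<phi>f conv Y2 EY]
  have D2: "integrable M (\<lambda>\<omega>. (Y \<omega> - J (\<phi> n) \<omega>)\<^sup>2)" for n
    by (rule integrable_square_diff) (use Y2 moments_J(1)[OF \<phi>] in auto)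
  have ED: "expectation (\<lambda>\<omega>. Y \<omega> - J (\<phi> n) \<omega>) = 0" for n
    using EY moments_J(3)[OF \<phi>[of n]] integrable_square_imp[OF Y Y2] integrable_square_imp[OF J_measurable[OF \<phi>] moments_J(1)[OF \<phi>], of n] by simp
  have "(\<lambda>n. expectation (\<lambda>\<omega>. (J (\<phi> n) \<omega> - Y \<omega>)\<^sup>2)) \<longlonglongrightarrow> 0"
  proof (rule LIMSEQ_I)
    fix r :: real assume r: "r > 0"
    define e where "e = r / (2 * jump_variance)"
    have e: "e > 0" "jump_variance * e < r" using r variance_pos by (simp_all add: e_def)
    obtain n0 where n0: "\<And>n N. n \<ge> n0 \<Longrightarrow> N \<ge> n0 \<Longrightarrow> (\<integral>x. (\<phi> N x - \<phi> n x)\<^sup>2 \<partial>m) \<le> e"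
      using \<phi>_Cauchy[OF f Y \<phi> \<phi>f conv Y2 EY e(1)] by blast
    have "expectation (\<lambda>\<omega>. (Y \<omega> - J (\<phi> n) \<omega>)\<^sup>2) \<le> jump_variance * e" if n: "n \<ge> n0" for n
    proof (rule centered_second_moment_le[OF _ D2 ED])
      fix k :: nat assume k: "k \<ge> 1"
      let ?s = "1 / real k"
      have "exp (- (jump_variance * ?s\<^sup>2 / 2 * e)) \<le> norm (cf M (I (\<lambda>x. \<phi> N x - \<phi> n x)) ?s)" if N: "N \<ge> n0" for N
      proof -
        have "(\<integral>x. levy_exponent b \<mu> (?s * (\<phi> N x - \<phi> n x)) \<partial>m) \<le> (\<integral>x. jump_variance * ?s\<^sup>2 / 2 * (\<phi> N x - \<phi> n x)\<^sup>2 \<partial>m)"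
        proof (rule integral_mono)
          show "integrable m (\<lambda>x. levy_exponent b \<mu> (?s * (\<phi> N x - \<phi> n x)))" by (rule levy_simple_comp_integral(1)[OF diff]) simp
          show "levy_exponent b \<mu> (?s * (\<phi> N x - \<phi> n x)) \<le> jump_variance * ?s\<^sup>2 / 2 * (\<phi> N x - \<phi> n x)\<^sup>2" for x
            using levy_exponent_le[of "?s * (\<phi> N x - \<phi> n x)"] by (simp add: power_mult_distrib power_divide)
        qed (use levy_simple_square(1)[OF diff] in simp)
        also have "\<dots> = jump_variance * ?s\<^sup>2 / 2 * (\<integral>x. (\<phi> N x - \<phi> n x)\<^sup>2 \<partial>m)" by (rule integral_mult_right_zero)
        also have "\<dots> \<le> jump_variance * ?s\<^sup>2 / 2 * e" using n0[OF n N] variance_pos by (intro mult_left_mono) auto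
        finally show ?thesis unfolding norm_cf_I[OF diff] by simp
      qed
      then have "exp (- (jump_variance * ?s\<^sup>2 / 2 * e)) \<le> norm (cf M (\<lambda>\<omega>. Y \<omega> - I (\<phi> n) \<omega>) ?s)"
        by (intro LIMSEQ_le_const[OF tendsto_norm[OF cf_I_\<phi>_diff_limit[OF f Y \<phi> \<phi>f conv Y2 EY]]]) blast
      also have "\<dots> = norm (cf M (\<lambda>\<omega>. Y \<omega> - J (\<phi> n) \<omega>) ?s)"
      proof -
        have "(\<lambda>\<omega>. Y \<omega> - J (\<phi> n) \<omega>) = (\<lambda>\<omega>. (Y \<omega> - I (\<phi> n) \<omega>) - (- (drift * (\<integral>x. \<phi> n x \<partial>m))))" by (simp add: J_def fun_eq_iff)
        then show ?thesis by (simp only: norm_cf_shift[of "\<lambda>\<omega>. Y \<omega> - I (\<phi> n) \<omega>"] borel_measurable_diff Y I_measurable[OF \<phi>])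
      qed
      finally have "(exp (- (jump_variance * ?s\<^sup>2 / 2 * e)))\<^sup>2 \<le> (norm (cf M (\<lambda>\<omega>. Y \<omega> - J (\<phi> n) \<omega>) ?s))\<^sup>2"
        by (rule power_mono) simp
      moreover have "(exp (- (jump_variance * ?s\<^sup>2 / 2 * e)))\<^sup>2 = exp (- (jump_variance * e / (real k)\<^sup>2))"
        by (simp add: power2_eq_square exp_add[symmetric] power_divide)
      moreover have "1 - jump_variance * e / (real k)\<^sup>2 \<le> exp (- (jump_variance * e / (real k)\<^sup>2))"
        using exp_ge_add_one_self[of "- (jump_variance * e / (real k)\<^sup>2)"] by simp
      ultimately show "1 - jump_variance * e / (real k)\<^sup>2 \<le> (norm (cf M (\<lambda>\<omega>. Y \<omega> - J (\<phi> n) \<omega>) (1 / real k)))\<^sup>2" by linarith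
    qed measurable
    then have "norm (expectation (\<lambda>\<omega>. (J (\<phi> n) \<omega> - Y \<omega>)\<^sup>2) - 0) < r" if "n \<ge> n0" for n
      using le_less_trans[OF _ e(2)] that by (simp add: power2_commute[of "J (\<phi> n) _"])
    then show "\<exists>no. \<forall>n\<ge>no. norm (expectation (\<lambda>\<omega>. (J (\<phi> n) \<omega> - Y \<omega>)\<^sup>2) - 0) < r" by blast
  qed
  then show ?thesis unfolding has_L2_def using f Y Y2 L2 \<phi> by blast
qed

end

section \<open>The integrated kernel\<close>

text \<open>This is the covariance of an Ornstein-Uhlenbeck process with rate \<open>x\<close>. The
  product is supported on \<open>s \<le> x * min u v\<close>, and
  \<open>2 * min u v - (u + v)\<close> is \<open>- \<bar>u - v\<bar>\<close>.\<close>

lemma nn_integral_kernel_product: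
  assumes x: "x > 0"
  shows "(\<integral>\<^sup>+s. ennreal (supOU_kernel u (x, s) * supOU_kernel v (x, s)) \<partial>lborel) = ennreal (exp (- x * \<bar>u - v\<bar>) / 2)"
proof -
  let ?c = "x * min u v"
  have prod: "supOU_kernel u (x, s) * supOU_kernel v (x, s) = exp (2 * s - x * (u + v)) * indicator {..?c} s" for s
  proof -
    have "s \<le> ?c \<longleftrightarrow> s \<le> x * u \<and> s \<le> x * v" using x by (auto simp: min_def mult_left_mono elim: order_trans)
    moreover have "exp (- x * u + s) * exp (- x * v + s) = exp (2 * s - x * (u + v))"
      unfolding exp_add[symmetric] by (simp add: algebra_simps)
    ultimately show ?thesis by (auto simp: supOU_kernel_def indicator_def)
  qed
  \<comment> \<open>Reflection about the right end of the support moves it to the half-line of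
    nonnegative numbers.\<close>
  have "(\<integral>\<^sup>+s. ennreal (exp (2 * s - x * (u + v)) * indicator {..?c} s) \<partial>lborel) =
      ennreal \<bar>-1\<bar> * (\<integral>\<^sup>+y. ennreal (exp (2 * (?c + -1 * y) - x * (u + v)) * indicator {..?c} (?c + -1 * y)) \<partial>lborel)"
    by (rule nn_integral_real_affine) auto
  also have "\<dots> = (\<integral>\<^sup>+y. ennreal (exp (2 * ?c - x * (u + v)) * exp (- 2 * y)) * indicator {0..} y \<partial>lborel)"
    by (simp only: abs_neg_one ennreal_1 mult_1_left, intro nn_integral_cong) (auto simp: indicator_def exp_add[symmetric] algebra_simps)
  also have "\<dots> = ennreal (0 - (- exp (2 * ?c - x * (u + v)) * exp (- 2 * 0) / 2))"
  proof (rule nn_integral_FTC_atLeast)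
    show "DERIV (\<lambda>y. - exp (2 * ?c - x * (u + v)) * exp (- 2 * y) / 2) y :> exp (2 * ?c - x * (u + v)) * exp (- 2 * y)" for y
      by (auto intro!: derivative_eq_intros)
    have "((\<lambda>y. exp (- 2 * y)) \<longlongrightarrow> (0::real)) at_top"
      by (rule filterlim_compose[OF exp_at_bot]) (rule filterlim_tendsto_neg_mult_at_bot[OF tendsto_const _ filterlim_ident], simp)
    from tendsto_mult_left[OF this, of "- exp (2 * ?c - x * (u + v)) / 2"]
    show "((\<lambda>y. - exp (2 * ?c - x * (u + v)) * exp (- 2 * y) / 2) \<longlongrightarrow> 0) at_top" by simp
  qed auto
  also have "\<dots> = ennreal (exp (- x * \<bar>u - v\<bar>) / 2)"
    by (cases "u \<le> v") (simp_all add: min_def algebra_simps)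
  finally show ?thesis unfolding prod .
qed

lemma supOU_kernel_nonneg: "0 \<le> supOU_kernel u p"
  by (cases p) (simp add: supOU_kernel_def)

lemma supOU_kernel_measurable [measurable]:
  "(\<lambda>(u, p). supOU_kernel u p) \<in> borel_measurable (borel \<Otimes>\<^sub>M (borel \<Otimes>\<^sub>M borel))"
proof -
  have eq: "(\<lambda>(u, p). supOU_kernel u p) = (\<lambda>z. if snd (snd z) \<le> fst (snd z) * fst z then exp (- fst (snd z) * fst z + snd (snd z)) else 0)"
    by (auto simp: supOU_kernel_def fun_eq_iff indicator_def)
  show ?thesis unfolding eq by measurable
qed

lemma kernel_product_integral:
  assumes x: "x > 0"
  shows "integrable lborel (\<lambda>s. supOU_kernel u (x, s) * supOU_kernel v (x, s))"
    and "(\<integral>s. supOU_kernel u (x, s) * supOU_kernel v (x, s) \<partial>lborel) = exp (- x * \<bar>u - v\<bar>) / 2"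
proof -
  have [measurable]: "(\<lambda>s. supOU_kernel u (x, s)) \<in> borel_measurable borel" for u
    using measurable_compose[OF _ supOU_kernel_measurable, of "\<lambda>s. (u, x, s)" borel] by simp
  show "integrable lborel (\<lambda>s. supOU_kernel u (x, s) * supOU_kernel v (x, s))"
    by (rule integrableI_nonneg) (auto simp: supOU_kernel_nonneg nn_integral_kernel_product[OF x])
  show "(\<integral>s. supOU_kernel u (x, s) * supOU_kernel v (x, s) \<partial>lborel) = exp (- x * \<bar>u - v\<bar>) / 2"
    by (subst integral_eq_nn_integral) (auto simp: supOU_kernel_nonneg nn_integral_kernel_product[OF x])
qed

section \<open>Covariance of the integrated kernel at a fixed rate\<close>

definition integrated_kernel :: "real \<Rightarrow> real \<times> real \<Rightarrow> real" where
  "integrated_kernel t p = (LBINT u:{0..t}. supOU_kernel u p)"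

definition kernel_covariance :: "real \<Rightarrow> real \<Rightarrow> real \<Rightarrow> real" where
  "kernel_covariance s t x = (LBINT u:{0..s}. LBINT v:{0..t}. exp (- x * \<bar>u - v\<bar>) / 2)"

lemma integrated_kernel_measurable [measurable]: "integrated_kernel t \<in> borel_measurable (borel \<Otimes>\<^sub>M borel)"
proof -
  have [measurable]: "(\<lambda>(p, u). supOU_kernel u p) \<in> borel_measurable ((borel \<Otimes>\<^sub>M borel) \<Otimes>\<^sub>M lborel)"
    using measurable_compose[OF _ supOU_kernel_measurable, of "\<lambda>(p, u). (u, p)" "(borel \<Otimes>\<^sub>M borel) \<Otimes>\<^sub>M lborel"]
    by (simp add: case_prod_beta')
  show ?thesis unfolding integrated_kernel_def[abs_def] set_lebesgue_integral_def by measurable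
qed

text \<open>The weak description of the time integral in \<open>set_integral_L2\<close> is applied
  to one factor after the other, which leaves the product of two unintegrated kernels under a double
  time integral.\<close>

lemma integrated_kernel_products:
  assumes x: "x > 0"
  shows "integrable lborel (\<lambda>y. (integrated_kernel t (x, y))\<^sup>2)"
    and "(\<integral>y. integrated_kernel s (x, y) * integrated_kernel t (x, y) \<partial>lborel) = kernel_covariance s t x"
proof -
  have lb: "sigma_finite_measure (lborel :: real measure)" ..
  have A: "{0..t} \<in> sets lborel" "emeasure lborel {0..t} < \<infinity>" for t :: real by (auto simp: emeasure_lborel_Icc_eq)
  have m: "(\<lambda>(u, y). supOU_kernel u (x, y)) \<in> borel_measurable (lborel \<Otimes>\<^sub>M lborel)"
    using measurable_compose[OF _ supOU_kernel_measurable, of "\<lambda>(u, y). (u, x, y)" "lborel \<Otimes>\<^sub>M lborel"]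
    by (simp add: case_prod_beta')
  have km: "(\<lambda>s. supOU_kernel u (x, s)) \<in> borel_measurable lborel" for u
    using measurable_compose[OF _ supOU_kernel_measurable, of "\<lambda>s. (u, x, s)" lborel] by simp
  have k2: "integrable lborel (\<lambda>y. (supOU_kernel u (x, y))\<^sup>2)" for u
    using kernel_product_integral(1)[OF x, of u u] by (simp add: power2_eq_square)
  have k2b: "(\<integral>y. (supOU_kernel u (x, y))\<^sup>2 \<partial>lborel) \<le> 1 / 2" for u
    using kernel_product_integral(2)[OF x, of u u] by (simp add: power2_eq_square)
  have G: "(\<lambda>y. integrated_kernel t (x, y)) \<in> borel_measurable lborel" "integrable lborel (\<lambda>y. (integrated_kernel t (x, y))\<^sup>2)" for t
    unfolding integrated_kernel_def by (rule set_integral_L2(1,2)[OF lb A m k2 k2b])+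
  show "integrable lborel (\<lambda>y. (integrated_kernel t (x, y))\<^sup>2)" by (rule G)
  have L: "(\<integral>y. U y * integrated_kernel t (x, y) \<partial>lborel) = (LBINT u:{0..t}. (\<integral>y. U y * supOU_kernel u (x, y) \<partial>lborel))"
    if "U \<in> borel_measurable lborel" "integrable lborel (\<lambda>y. (U y)\<^sup>2)" for U t
    unfolding integrated_kernel_def by (rule set_integral_L2(3)[OF lb A m k2 k2b that])
  have "(\<integral>y. integrated_kernel s (x, y) * integrated_kernel t (x, y) \<partial>lborel) = (\<integral>y. integrated_kernel t (x, y) * integrated_kernel s (x, y) \<partial>lborel)"
    by (simp only: mult.commute)
  also have "\<dots> = (LBINT u:{0..s}. (\<integral>y. integrated_kernel t (x, y) * supOU_kernel u (x, y) \<partial>lborel))"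
    by (rule L[OF G])
  also have "\<dots> = (LBINT u:{0..s}. (\<integral>y. supOU_kernel u (x, y) * integrated_kernel t (x, y) \<partial>lborel))"
    by (simp only: mult.commute)
  also have "\<dots> = (LBINT u:{0..s}. LBINT v:{0..t}. (\<integral>y. supOU_kernel u (x, y) * supOU_kernel v (x, y) \<partial>lborel))"
    by (simp only: L[OF km k2])
  also have "\<dots> = kernel_covariance s t x"
    unfolding kernel_covariance_def by (simp only: kernel_product_integral(2)[OF x])
  finally show "(\<integral>y. integrated_kernel s (x, y) * integrated_kernel t (x, y) \<partial>lborel) = kernel_covariance s t x" .
qed

text \<open>In nonnegative form, comparison and exchange of integrals need no integrability; all
  later estimates and the Gamma computation start from here.\<close>

lemma kernel_covariance_nn:
  "ennreal (kernel_covariance s t x) = (\<integral>\<^sup>+u. indicator {0..s} u * (\<integral>\<^sup>+v. indicator {0..t} v * ennreal (exp (- x * \<bar>u - v\<bar>) / 2) \<partial>lborel) \<partial>lborel)"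
proof -
  define L where "L u = (LBINT v:{0..t}. exp (- x * \<bar>u - v\<bar>) / 2)" for u
  \<comment> \<open>A crude bound for all \<open>u\<close> and \<open>v\<close> in question, valid
    for a rate of either sign.\<close>
  define C where "C = (LBINT v:{0..t}. exp (\<bar>x\<bar> * (\<bar>s\<bar> + \<bar>t\<bar>)) / 2)"
  have inner: "ennreal (L u) = (\<integral>\<^sup>+v. indicator {0..t} v * ennreal (exp (- x * \<bar>u - v\<bar>) / 2) \<partial>lborel)"
    and icont: "0 \<le> L u" for u
  proof -
    have "set_integrable lborel {0..t} (\<lambda>v. exp (- x * \<bar>u - v\<bar>) / 2)"
      by (rule borel_integrable_atLeastAtMost') (auto intro!: continuous_intros)
    then show "ennreal (L u) = (\<integral>\<^sup>+v. indicator {0..t} v * ennreal (exp (- x * \<bar>u - v\<bar>) / 2) \<partial>lborel)"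
      unfolding set_integrable_def set_lebesgue_integral_def L_def
      by (subst nn_integral_eq_integral[symmetric]) (auto intro!: nn_integral_cong simp: indicator_def)
    show "0 \<le> L u"
      unfolding set_lebesgue_integral_def L_def by (intro integral_nonneg_AE AE_I2) auto
  qed
  have m: "L \<in> borel_measurable lborel"
    unfolding set_lebesgue_integral_def L_def by measurable
  have bound: "L u \<le> C" if "u \<in> {0..s}" for u
    unfolding L_def C_def
  proof (rule set_integral_mono)
    show "set_integrable lborel {0..t} (\<lambda>v. exp (- x * \<bar>u - v\<bar>) / 2)" "set_integrable lborel {0..t} (\<lambda>v. exp (\<bar>x\<bar> * (\<bar>s\<bar> + \<bar>t\<bar>)) / 2)"
      by (rule borel_integrable_atLeastAtMost'; auto intro!: continuous_intros)+
    fix v assume "v \<in> {0..t}"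
    then have "\<bar>u - v\<bar> \<le> \<bar>s\<bar> + \<bar>t\<bar>" using that by auto
    then have "\<bar>x\<bar> * \<bar>u - v\<bar> \<le> \<bar>x\<bar> * (\<bar>s\<bar> + \<bar>t\<bar>)" by (rule mult_left_mono) simp
    moreover have "- x * \<bar>u - v\<bar> \<le> \<bar>x\<bar> * \<bar>u - v\<bar>" by (rule mult_right_mono) auto
    ultimately show "exp (- x * \<bar>u - v\<bar>) / 2 \<le> exp (\<bar>x\<bar> * (\<bar>s\<bar> + \<bar>t\<bar>)) / 2" by simp
  qed
  have "integrable lborel (\<lambda>u. indicator {0..s} u *\<^sub>R L u)"
  proof (rule Bochner_Integration.integrable_bound)
    show "integrable lborel (\<lambda>u. indicat_real {0..s} u * C)"
      by (intro integrable_mult_left integrable_real_indicator) (auto simp: emeasure_lborel_Icc_eq)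
    show "AE u in lborel. norm (indicator {0..s} u *\<^sub>R L u) \<le>
        norm (indicat_real {0..s} u * C)"
    proof (rule AE_I2)
      fix u show "norm (indicator {0..s} u *\<^sub>R L u) \<le>
        norm (indicat_real {0..s} u * C)"
        using bound[of u] icont[of u] by (cases "u \<in> {0..s}") auto
    qed
  qed (use m in measurable)
  then have "ennreal (kernel_covariance s t x) = (\<integral>\<^sup>+u. ennreal (indicator {0..s} u *\<^sub>R L u) \<partial>lborel)"
  proof -
    assume i: "integrable lborel (\<lambda>u. indicator {0..s} u *\<^sub>R L u)"
    have "kernel_covariance s t x = (\<integral>u. indicator {0..s} u *\<^sub>R L u \<partial>lborel)"
      by (simp only: kernel_covariance_def L_def set_lebesgue_integral_def)
    then show ?thesis using nn_integral_eq_integral[OF i] icont by simp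
  qed
  also have "\<dots> = (\<integral>\<^sup>+u. indicator {0..s} u * (\<integral>\<^sup>+v. indicator {0..t} v * ennreal (exp (- x * \<bar>u - v\<bar>) / 2) \<partial>lborel) \<partial>lborel)"
    by (intro nn_integral_cong, unfold inner[symmetric]) (simp add: indicator_def)
  finally show ?thesis .
qed

lemma kernel_covariance_measurable [measurable]: "kernel_covariance s t \<in> borel_measurable borel"
  unfolding kernel_covariance_def[abs_def] set_lebesgue_integral_def by measurable

lemma kernel_covariance_nonneg: "0 \<le> kernel_covariance s t x"
  unfolding kernel_covariance_def set_lebesgue_integral_def by (intro integral_nonneg_AE AE_I2) auto

lemma nn_integral_two_sided_exp:
  assumes x: "x > 0"
  shows "(\<integral>\<^sup>+v. ennreal (exp (- x * \<bar>u - v\<bar>) / 2) \<partial>lborel) \<le> ennreal (1 / x)"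
proof -
  have ft: "(\<integral>\<^sup>+y. ennreal (exp (- x * y) / 2) * indicator {0..} y \<partial>lborel) = ennreal (1 / (2 * x))"
  proof -
    have "(\<integral>\<^sup>+y. ennreal (exp (- x * y) / 2) * indicator {0..} y \<partial>lborel) = ennreal (0 - (- exp (- x * 0) / (2 * x)))"
    proof (rule nn_integral_FTC_atLeast)
      show "DERIV (\<lambda>y. - exp (- x * y) / (2 * x)) y :> exp (- x * y) / 2" for y
        using x by (auto intro!: derivative_eq_intros)
      have "((\<lambda>y. exp (- x * y)) \<longlongrightarrow> (0::real)) at_top"
        by (rule filterlim_compose[OF exp_at_bot]) (rule filterlim_tendsto_neg_mult_at_bot[OF tendsto_const _ filterlim_ident], use x in simp)
      from tendsto_mult_left[OF this, of "- 1 / (2 * x)"]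
      show "((\<lambda>y. - exp (- x * y) / (2 * x)) \<longlongrightarrow> 0) at_top" by simp
    qed auto
    then show ?thesis by simp
  qed
  have "(\<integral>\<^sup>+v. ennreal (exp (- x * \<bar>u - v\<bar>) / 2) \<partial>lborel) \<le>
      (\<integral>\<^sup>+v. ennreal (exp (- x * (v - u)) / 2) * indicator {0..} (v - u) + ennreal (exp (- x * (u - v)) / 2) * indicator {0..} (u - v) \<partial>lborel)"
    by (intro nn_integral_mono) (auto simp: indicator_def abs_if intro!: ennreal_leI)
  also have "\<dots> = (\<integral>\<^sup>+v. ennreal (exp (- x * (v - u)) / 2) * indicator {0..} (v - u) \<partial>lborel) + (\<integral>\<^sup>+v. ennreal (exp (- x * (u - v)) / 2) * indicator {0..} (u - v) \<partial>lborel)"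
    by (rule nn_integral_add) measurable
  also have "(\<integral>\<^sup>+v. ennreal (exp (- x * (v - u)) / 2) * indicator {0..} (v - u) \<partial>lborel) = ennreal (1 / (2 * x))"
    by (subst nn_integral_real_affine[where t=u and c=1]) (use ft in auto)
  also have "(\<integral>\<^sup>+v. ennreal (exp (- x * (u - v)) / 2) * indicator {0..} (u - v) \<partial>lborel) = ennreal (1 / (2 * x))"
    by (subst nn_integral_real_affine[where t=u and c="-1"]) (use ft in auto)
  also have "ennreal (1 / (2 * x)) + ennreal (1 / (2 * x)) = ennreal (1 / x)"
    using x by (subst ennreal_plus[symmetric]) auto
  finally show ?thesis .
qed

text \<open>Two bounds are combined: the exponential is at most 1, which is used for rates up to 1,
  and extending one time integral to the whole line gives \<open>s / x\<close>, which is used for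
  larger rates. The resulting \<open>min 1 (1 / x)\<close> is the decay required by
  \<open>regularly_varying_density_limit\<close>.\<close>

lemma kernel_covariance_le:
  assumes x: "x > 0" and st: "s \<ge> 0" "t \<ge> 0"
  shows "kernel_covariance s t x \<le> (s * t + s) * min 1 (1 / x)"
proof -
  have "ennreal (kernel_covariance s t x) \<le> (\<integral>\<^sup>+u. indicator {0..s} u * ennreal (1 / x) \<partial>lborel)"
    unfolding kernel_covariance_nn
  proof (intro nn_integral_mono mult_left_mono)
    fix u
    have "(\<integral>\<^sup>+v. indicator {0..t} v * ennreal (exp (- x * \<bar>u - v\<bar>) / 2) \<partial>lborel) \<le> (\<integral>\<^sup>+v. ennreal (exp (- x * \<bar>u - v\<bar>) / 2) \<partial>lborel)"
      by (intro nn_integral_mono) (auto simp: indicator_def)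
    also have "\<dots> \<le> ennreal (1 / x)" by (rule nn_integral_two_sided_exp[OF x])
    finally show "(\<integral>\<^sup>+v. indicator {0..t} v * ennreal (exp (- x * \<bar>u - v\<bar>) / 2) \<partial>lborel) \<le> ennreal (1 / x)" .
  qed simp
  also have "\<dots> = ennreal (s * (1 / x))" using st x by (simp add: nn_integral_multc ennreal_mult'[symmetric])
  finally have 1: "kernel_covariance s t x \<le> s * (1 / x)" using st x by (subst (asm) ennreal_le_iff) auto
  have "ennreal (kernel_covariance s t x) \<le> (\<integral>\<^sup>+u. indicator {0..s} u * ennreal t \<partial>lborel)"
    unfolding kernel_covariance_nn
  proof (intro nn_integral_mono mult_left_mono)
    fix u
    have "(\<integral>\<^sup>+v. indicator {0..t} v * ennreal (exp (- x * \<bar>u - v\<bar>) / 2) \<partial>lborel) \<le> (\<integral>\<^sup>+v. indicator {0..t} v \<partial>lborel)"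
    proof (intro nn_integral_mono)
      fix v
      have "exp (- x * \<bar>u - v\<bar>) / 2 \<le> 1" using x by (smt (verit) exp_le_one_iff mult_nonneg_nonneg abs_ge_zero field_sum_of_halves exp_gt_zero mult_minus_left)
      then have "ennreal (exp (- x * \<bar>u - v\<bar>) / 2) \<le> 1" by (metis ennreal_1 ennreal_leI)
      then show "indicator {0..t} v * ennreal (exp (- x * \<bar>u - v\<bar>) / 2) \<le> indicator {0..t} v" by (auto simp: indicator_def)
    qed
    also have "\<dots> = ennreal t" using st by simp
    finally show "(\<integral>\<^sup>+v. indicator {0..t} v * ennreal (exp (- x * \<bar>u - v\<bar>) / 2) \<partial>lborel) \<le> ennreal t" .
  qed simp
  also have "\<dots> = ennreal (s * t)" using st by (simp add: nn_integral_multc ennreal_mult)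
  finally have 2: "kernel_covariance s t x \<le> s * t" using st by (subst (asm) ennreal_le_iff) auto
  show ?thesis
  proof (cases "x \<le> 1")
    case True
    then have "min 1 (1 / x) = 1" using x by simp
    then show ?thesis using 2 st by (simp add: add_increasing2)
  next
    case False
    then have "min 1 (1 / x) = 1 / x" by simp
    moreover have "0 \<le> s * t * (1 / x)" using st x by simp
    ultimately show ?thesis using 1 by (simp only: distrib_right)
  qed
qed

section \<open>The Gamma integral and the fractional covariance\<close>

text \<open>Substituting \<open>w * x\<close> in the Gamma integral produces
  \<open>w powr (- \<alpha>)\<close>, and \<open>\<alpha> * Gamma \<alpha>\<close> is
  \<open>Gamma (1 + \<alpha>)\<close>. The factor 1/2 comes from the covariance of the
  kernel.\<close>

lemma nn_integral_Gamma_scaled: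
  assumes \<alpha>: "\<alpha> > 0" and w: "w > 0"
  shows "(\<integral>\<^sup>+x. ennreal (indicator {0<..} x * (\<alpha> * x powr (\<alpha> - 1)) * (exp (- x * w) / 2)) \<partial>lborel) = ennreal (Gamma (1 + \<alpha>) / 2 * w powr (- \<alpha>))"
proof -
  let ?g = "\<lambda>t. indicator {0..} t * t powr (\<alpha> - 1) / exp t"
  have "ennreal (Gamma \<alpha>) = (\<integral>\<^sup>+t. ennreal (?g t) \<partial>lborel)"
    by (rule Gamma_conv_nn_integral_real[OF \<alpha>])
  also have "\<dots> = ennreal \<bar>w\<bar> * (\<integral>\<^sup>+x. ennreal (?g (0 + w * x)) \<partial>lborel)"
    by (rule nn_integral_real_affine) (use w in auto)
  finally have G: "ennreal (Gamma \<alpha>) = ennreal w * (\<integral>\<^sup>+x. ennreal (?g (w * x)) \<partial>lborel)" using w by simp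
  have pt: "indicator {0<..} x * (\<alpha> * x powr (\<alpha> - 1)) * (exp (- x * w) / 2) = (\<alpha> / 2 * w powr (- \<alpha>)) * (w * ?g (w * x))" for x
  proof (cases "x > 0")
    case True
    have "w powr (- \<alpha>) * (w * (w * x) powr (\<alpha> - 1)) = x powr (\<alpha> - 1)"
    proof -
      have "w powr (\<alpha> - 1) * w powr (- \<alpha>) = w powr (-1)" by (simp add: powr_add[symmetric])
      then have "w * (w powr (\<alpha> - 1) * w powr (- \<alpha>)) = 1" using w by (simp add: powr_minus)
      then show ?thesis using True w by (simp add: powr_mult algebra_simps)
    qed
    then have "(\<alpha> / 2 * w powr (- \<alpha>)) * (w * ((w * x) powr (\<alpha> - 1) / exp (w * x))) = \<alpha> / 2 * (x powr (\<alpha> - 1) / exp (w * x))"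
      by (simp only: times_divide_eq_right mult.assoc)
    also have "\<dots> = (\<alpha> * x powr (\<alpha> - 1)) * (exp (- x * w) / 2)"
    proof -
      have "exp (- x * w) = inverse (exp (w * x))" by (simp only: exp_minus[symmetric] mult_minus_left mult_minus_right mult.commute)
      then show ?thesis by (simp only: divide_inverse mult.assoc mult.commute mult.left_commute)
    qed
    finally have e: "(\<alpha> * x powr (\<alpha> - 1)) * (exp (- x * w) / 2) = (\<alpha> / 2 * w powr (- \<alpha>)) * (w * ((w * x) powr (\<alpha> - 1) / exp (w * x)))" ..
    have "indicator {0<..} x = (1::real)" "indicator {0..} (w * x) = (1::real)" using True w by auto
    then show ?thesis by (simp only: e mult_1_left)
  next
    case False
    then have "?g (w * x) = 0" using w by (auto simp: indicator_def zero_le_mult_iff not_less)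
    then show ?thesis using False by simp
  qed
  have "(\<integral>\<^sup>+x. ennreal (indicator {0<..} x * (\<alpha> * x powr (\<alpha> - 1)) * (exp (- x * w) / 2)) \<partial>lborel) =
      (\<integral>\<^sup>+x. ennreal (\<alpha> / 2 * w powr (- \<alpha>)) * (ennreal w * ennreal (?g (w * x))) \<partial>lborel)"
  proof (intro nn_integral_cong)
    fix x
    have "ennreal (c * (d * g)) = ennreal c * (ennreal d * ennreal g)" if "0 \<le> c" "0 \<le> d" "0 \<le> g" for c d g
      using that by (simp add: ennreal_mult)
    from this[of "\<alpha> / 2 * w powr (- \<alpha>)" w "?g (w * x)"]
    show "ennreal (indicator {0<..} x * (\<alpha> * x powr (\<alpha> - 1)) * (exp (- x * w) / 2)) =
      ennreal (\<alpha> / 2 * w powr (- \<alpha>)) * (ennreal w * ennreal (?g (w * x)))"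
      unfolding pt using \<alpha> w by simp
  qed
  also have "\<dots> = ennreal (\<alpha> / 2 * w powr (- \<alpha>)) * (ennreal w * (\<integral>\<^sup>+x. ennreal (?g (w * x)) \<partial>lborel))"
    by (simp add: nn_integral_cmult)
  also have "\<dots> = ennreal (\<alpha> / 2 * w powr (- \<alpha>)) * ennreal (Gamma \<alpha>)" unfolding G ..
  also have "\<dots> = ennreal (Gamma (1 + \<alpha>) / 2 * w powr (- \<alpha>))"
  proof -
    have "\<alpha> \<notin> \<int>\<^sub>\<le>\<^sub>0" using \<alpha> by (auto elim!: nonpos_Ints_cases)
    then have "Gamma (1 + \<alpha>) = \<alpha> * Gamma \<alpha>" using Gamma_plus1[of \<alpha>] by (simp add: add.commute)
    then show ?thesis using \<alpha> Gamma_real_pos[OF \<alpha>] by (subst ennreal_mult[symmetric]) (auto simp: algebra_simps)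
  qed
  finally show ?thesis .
qed

context
  fixes \<alpha> :: real assumes \<alpha>: "0 < \<alpha>" "\<alpha> < 1"
begin

text \<open>\<open>P1\<close> is the odd primitive of \<open>\<bar>z\<bar> powr (- \<alpha>)\<close>
  and \<open>P2\<close> the even primitive of \<open>P1\<close>. The maxima with 0 cover both signs
  in one formula, because a power of 0 is 0.\<close>

definition "P1 z = (max z 0 powr (1 - \<alpha>) - max (- z) 0 powr (1 - \<alpha>)) / (1 - \<alpha>)"
definition "P2 z = (max z 0 powr (2 - \<alpha>) + max (- z) 0 powr (2 - \<alpha>)) / ((1 - \<alpha>) * (2 - \<alpha>))"

lemma continuous_P1: "continuous_on A P1"
  unfolding P1_def[abs_def] using \<alpha> by (intro continuous_intros continuous_on_powr') auto

lemma continuous_P2: "continuous_on A P2"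
  unfolding P2_def[abs_def] using \<alpha> by (intro continuous_intros continuous_on_powr') auto

lemma P1_minus: "P1 (- z) = - P1 z" and P2_minus: "P2 (- z) = P2 z" and P2_0: "P2 0 = 0"
  using \<alpha> by (auto simp: P1_def P2_def divide_simps)

lemma DERIV_P_pos:
  assumes z: "z > 0"
  shows "DERIV P1 z :> \<bar>z\<bar> powr (- \<alpha>)" "DERIV P2 z :> P1 z"
proof -
  have "DERIV (\<lambda>z. z powr (1 - \<alpha>) / (1 - \<alpha>)) z :> (1 - \<alpha>) * z powr (1 - \<alpha> - 1) / (1 - \<alpha>)"
    by (rule DERIV_cdivide[OF has_real_derivative_powr[OF z]])
  moreover have "(1 - \<alpha>) * z powr (1 - \<alpha> - 1) / (1 - \<alpha>) = \<bar>z\<bar> powr (- \<alpha>)" using z \<alpha> by simp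
  ultimately have "DERIV (\<lambda>z. z powr (1 - \<alpha>) / (1 - \<alpha>)) z :> \<bar>z\<bar> powr (- \<alpha>)" by (simp only:)
  then show "DERIV P1 z :> \<bar>z\<bar> powr (- \<alpha>)"
    by (rule has_field_derivative_transform_within_open[where S="{0<..}"]) (use z in \<open>auto simp: P1_def\<close>)
  have "DERIV (\<lambda>z. z powr (2 - \<alpha>) / ((1 - \<alpha>) * (2 - \<alpha>))) z :> (2 - \<alpha>) * z powr (2 - \<alpha> - 1) / ((1 - \<alpha>) * (2 - \<alpha>))"
    by (rule DERIV_cdivide[OF has_real_derivative_powr[OF z]])
  moreover have "(2 - \<alpha>) * z powr (2 - \<alpha> - 1) / ((1 - \<alpha>) * (2 - \<alpha>)) = P1 z" using z \<alpha> by (simp add: P1_def)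
  ultimately have "DERIV (\<lambda>z. z powr (2 - \<alpha>) / ((1 - \<alpha>) * (2 - \<alpha>))) z :> P1 z" by (simp only:)
  then show "DERIV P2 z :> P1 z"
    by (rule has_field_derivative_transform_within_open[where S="{0<..}"]) (use z in \<open>auto simp: P2_def\<close>)
qed

lemma DERIV_P:
  assumes z: "z \<noteq> 0"
  shows "DERIV P1 z :> \<bar>z\<bar> powr (- \<alpha>)" "DERIV P2 z :> P1 z"
proof -
  have "DERIV P1 z :> \<bar>z\<bar> powr (- \<alpha>) \<and> DERIV P2 z :> P1 z"
  proof (cases "z > 0")
    case True
    then show ?thesis using DERIV_P_pos by blast
  next
    case False
    then have "- z > 0" using z by simp
    from DERIV_P_pos[OF this] have "DERIV (\<lambda>x. P1 (- x)) z :> - (\<bar>z\<bar> powr (- \<alpha>))" "DERIV (\<lambda>x. P2 (- x)) z :> - P1 (- z)"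
      unfolding DERIV_mirror by simp_all
    from DERIV_minus[OF this(1)] this(2) show ?thesis by (simp add: P1_minus P2_minus)
  qed
  then show "DERIV P1 z :> \<bar>z\<bar> powr (- \<alpha>)" "DERIV P2 z :> P1 z" by auto
qed

lemma P2_abs: "P2 z = \<bar>z\<bar> powr (2 - \<alpha>) / ((1 - \<alpha>) * (2 - \<alpha>))"
  by (auto simp: P2_def max_def)

text \<open>The integrand is singular on the diagonal, but its primitives are continuous across it.
  The fundamental theorem of calculus with finitely many exceptional points therefore applies twice,
  and evenness of \<open>P2\<close> gives the symmetric form.\<close>

lemma nn_integral_double_singular:
  assumes st: "s \<ge> 0" "t \<ge> 0"
  shows "(\<integral>\<^sup>+u. indicator {0..s} u * (\<integral>\<^sup>+v. indicator {0..t} v * ennreal (\<bar>u - v\<bar> powr (- \<alpha>)) \<partial>lborel) \<partial>lborel) =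
    ennreal (P2 s + P2 t - P2 (t - s))"
proof -
  have inner: "(\<integral>\<^sup>+v. indicator {0..t} v * ennreal (\<bar>u - v\<bar> powr (- \<alpha>)) \<partial>lborel) = ennreal (P1 u + P1 (t - u))" for u
  proof -
    have "((\<lambda>v. \<bar>u - v\<bar> powr (- \<alpha>)) has_integral (- P1 (u - t) - - P1 (u - 0))) {0..t}"
    proof (rule fundamental_theorem_of_calculus_interior_strong[where S="{u}"])
      fix v assume "v \<in> {0<..<t} - {u}"
      then have "u - v \<noteq> 0" by auto
      have "DERIV (\<lambda>v. u - v) v :> - 1" by (auto intro!: derivative_eq_intros)
      from DERIV_minus[OF DERIV_chain2[where f=P1 and g="\<lambda>v. u - v", OF DERIV_P(1)[OF \<open>u - v \<noteq> 0\<close>] this]]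
      have "DERIV (\<lambda>v. - P1 (u - v)) v :> \<bar>u - v\<bar> powr (- \<alpha>)" by simp
      then show "((\<lambda>v. - P1 (u - v)) has_vector_derivative \<bar>u - v\<bar> powr (- \<alpha>)) (at v)"
        by (simp add: has_real_derivative_iff_has_vector_derivative)
    next
      show "continuous_on {0..t} (\<lambda>v. - P1 (u - v))"
        by (intro continuous_intros continuous_on_compose2[OF continuous_P1[of UNIV]]) auto
    qed (use st in auto)
    from nn_integral_has_integral_lebesgue'[OF _ this]
    have "(\<integral>\<^sup>+v. ennreal (\<bar>u - v\<bar> powr (- \<alpha>)) * indicator {0..t} v \<partial>lborel) = ennreal (- P1 (u - t) - - P1 (u - 0))" by simp
    moreover have "- P1 (u - t) - - P1 (u - 0) = P1 u + P1 (t - u)" using P1_minus[of "u - t"] by simp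
    ultimately show ?thesis by (simp only: mult.commute)
  qed
  have nonneg: "0 \<le> P1 u + P1 (t - u)" if "u \<ge> 0" for u
  proof (cases "u \<le> t")
    case True
    then show ?thesis using that \<alpha> by (simp add: P1_def)
  next
    case False
    then have "(u - t) powr (1 - \<alpha>) \<le> u powr (1 - \<alpha>)" using \<alpha> st by (intro powr_mono2) auto
    from divide_right_mono[OF this, of "1 - \<alpha>"] show ?thesis using False that \<alpha> st by (simp add: P1_def)
  qed
  have "((\<lambda>u. P1 u + P1 (t - u)) has_integral ((P2 s - P2 (t - s)) - (P2 0 - P2 (t - 0)))) {0..s}"
  proof (rule fundamental_theorem_of_calculus_interior_strong[where S="{0, t}"])
    fix u assume u: "u \<in> {0<..<s} - {0, t}"
    then have n: "u \<noteq> 0" "t - u \<noteq> 0" by auto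
    have "DERIV (\<lambda>u. t - u) u :> - 1" by (auto intro!: derivative_eq_intros)
    from DERIV_chain2[where f=P2 and g="\<lambda>u. t - u", OF DERIV_P(2)[OF n(2)] this]
    have "DERIV (\<lambda>u. P2 (t - u)) u :> - P1 (t - u)" by simp
    then have "DERIV (\<lambda>u. P2 u - P2 (t - u)) u :> P1 u + P1 (t - u)"
      using DERIV_diff[OF DERIV_P(2)[OF n(1)]] by fastforce
    then show "((\<lambda>u. P2 u - P2 (t - u)) has_vector_derivative P1 u + P1 (t - u)) (at u)"
      by (simp add: has_real_derivative_iff_has_vector_derivative)
  next
    show "continuous_on {0..s} (\<lambda>u. P2 u - P2 (t - u))"
      by (intro continuous_intros continuous_P2 continuous_on_compose2[OF continuous_P2[of UNIV]]) auto
  qed (use st in auto)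
  then have "((\<lambda>u. P1 u + P1 (t - u)) has_integral (P2 s + P2 t - P2 (t - s))) {0..s}" by (simp add: P2_0 algebra_simps)
  from nn_integral_has_integral_lebesgue'[OF _ this]
  have "(\<integral>\<^sup>+u. ennreal (P1 u + P1 (t - u)) * indicator {0..s} u \<partial>lborel) = ennreal (P2 s + P2 t - P2 (t - s))"
    using nonneg by simp
  then show ?thesis unfolding inner by (simp only: mult.commute)
qed

text \<open>Integrating over the rate first turns the exponentials into the kernel
  \<open>\<bar>u - v\<bar> powr (- \<alpha>)\<close>, whose double integral is the covariance of
  fractional Brownian motion up to a constant. Everything is nonnegative, so Tonelli suffices, and
  integrability is read off from the finite value.\<close>

lemma integral_kernel_covariance:
  assumes st: "s \<ge> 0" "t \<ge> 0"
  shows "integrable lborel (\<lambda>x. indicator {0<..} x * (\<alpha> * x powr (\<alpha> - 1)) * kernel_covariance s t x)"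
    and "(\<integral>x. indicator {0<..} x * (\<alpha> * x powr (\<alpha> - 1)) * kernel_covariance s t x \<partial>lborel) =
      Gamma (1 + \<alpha>) / ((2 - \<alpha>) * (1 - \<alpha>)) * ((s powr (2 - \<alpha>) + t powr (2 - \<alpha>) - \<bar>t - s\<bar> powr (2 - \<alpha>)) / 2)"
proof -
  let ?a = "\<lambda>x. indicator {0<..} x * (\<alpha> * x powr (\<alpha> - 1)) :: real"
  have a0: "0 \<le> ?a x" for x using \<alpha> by (auto simp: indicator_def)
  have G0: "Gamma (1 + \<alpha>) / 2 \<ge> 0" using \<alpha> Gamma_real_pos[of "1 + \<alpha>"] by simp
  have "(\<integral>\<^sup>+x. ennreal (?a x * kernel_covariance s t x) \<partial>lborel) =
     (\<integral>\<^sup>+x. (\<integral>\<^sup>+u. ennreal (?a x) * (indicator {0..s} u * (\<integral>\<^sup>+v. indicator {0..t} v * ennreal (exp (- x * \<bar>u - v\<bar>) / 2) \<partial>lborel)) \<partial>lborel) \<partial>lborel)"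
  proof (intro nn_integral_cong)
    fix x
    have "(\<integral>\<^sup>+u. ennreal (?a x) * (indicator {0..s} u * (\<integral>\<^sup>+v. indicator {0..t} v * ennreal (exp (- x * \<bar>u - v\<bar>) / 2) \<partial>lborel)) \<partial>lborel) =
        ennreal (?a x) * ennreal (kernel_covariance s t x)"
      unfolding kernel_covariance_nn by (rule nn_integral_cmult) measurable
    then show "ennreal (?a x * kernel_covariance s t x) =
        (\<integral>\<^sup>+u. ennreal (?a x) * (indicator {0..s} u * (\<integral>\<^sup>+v. indicator {0..t} v * ennreal (exp (- x * \<bar>u - v\<bar>) / 2) \<partial>lborel)) \<partial>lborel)"
      unfolding ennreal_mult[OF a0 kernel_covariance_nonneg] by (rule sym)
  qed
  also have "\<dots> = (\<integral>\<^sup>+u. (\<integral>\<^sup>+x. ennreal (?a x) * (indicator {0..s} u * (\<integral>\<^sup>+v. indicator {0..t} v * ennreal (exp (- x * \<bar>u - v\<bar>) / 2) \<partial>lborel)) \<partial>lborel) \<partial>lborel)"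
    by (rule lborel_pair.Fubini') measurable
  also have "\<dots> = (\<integral>\<^sup>+u. indicator {0..s} u * (\<integral>\<^sup>+x. (\<integral>\<^sup>+v. ennreal (?a x) * (indicator {0..t} v * ennreal (exp (- x * \<bar>u - v\<bar>) / 2)) \<partial>lborel) \<partial>lborel) \<partial>lborel)"
  proof (intro nn_integral_cong)
    fix u
    have "(\<integral>\<^sup>+x. ennreal (?a x) * (indicator {0..s} u * (\<integral>\<^sup>+v. indicator {0..t} v * ennreal (exp (- x * \<bar>u - v\<bar>) / 2) \<partial>lborel)) \<partial>lborel) =
      (\<integral>\<^sup>+x. indicator {0..s} u * (\<integral>\<^sup>+v. ennreal (?a x) * (indicator {0..t} v * ennreal (exp (- x * \<bar>u - v\<bar>) / 2)) \<partial>lborel) \<partial>lborel)"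
    proof (intro nn_integral_cong)
      fix x
      have "(\<integral>\<^sup>+v. ennreal (?a x) * (indicator {0..t} v * ennreal (exp (- x * \<bar>u - v\<bar>) / 2)) \<partial>lborel) =
          ennreal (?a x) * (\<integral>\<^sup>+v. indicator {0..t} v * ennreal (exp (- x * \<bar>u - v\<bar>) / 2) \<partial>lborel)"
        by (rule nn_integral_cmult) measurable
      then show "ennreal (?a x) * (indicator {0..s} u * (\<integral>\<^sup>+v. indicator {0..t} v * ennreal (exp (- x * \<bar>u - v\<bar>) / 2) \<partial>lborel)) =
          indicator {0..s} u * (\<integral>\<^sup>+v. ennreal (?a x) * (indicator {0..t} v * ennreal (exp (- x * \<bar>u - v\<bar>) / 2)) \<partial>lborel)"
        by (simp only: mult.left_commute)
    qed
    also have "\<dots> = indicator {0..s} u * (\<integral>\<^sup>+x. (\<integral>\<^sup>+v. ennreal (?a x) * (indicator {0..t} v * ennreal (exp (- x * \<bar>u - v\<bar>) / 2)) \<partial>lborel) \<partial>lborel)"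
      by (rule nn_integral_cmult) measurable
    finally show "(\<integral>\<^sup>+x. ennreal (?a x) * (indicator {0..s} u * (\<integral>\<^sup>+v. indicator {0..t} v * ennreal (exp (- x * \<bar>u - v\<bar>) / 2) \<partial>lborel)) \<partial>lborel) =
      indicator {0..s} u * (\<integral>\<^sup>+x. (\<integral>\<^sup>+v. ennreal (?a x) * (indicator {0..t} v * ennreal (exp (- x * \<bar>u - v\<bar>) / 2)) \<partial>lborel) \<partial>lborel)" .
  qed
  also have "\<dots> = (\<integral>\<^sup>+u. indicator {0..s} u * (ennreal (Gamma (1 + \<alpha>) / 2) * (\<integral>\<^sup>+v. indicator {0..t} v * ennreal (\<bar>u - v\<bar> powr (- \<alpha>)) \<partial>lborel)) \<partial>lborel)"
  proof (intro nn_integral_cong arg_cong2[where f="(*)"] refl)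
    fix u
    have "(\<integral>\<^sup>+x. (\<integral>\<^sup>+v. ennreal (?a x) * (indicator {0..t} v * ennreal (exp (- x * \<bar>u - v\<bar>) / 2)) \<partial>lborel) \<partial>lborel) =
       (\<integral>\<^sup>+v. (\<integral>\<^sup>+x. ennreal (?a x) * (indicator {0..t} v * ennreal (exp (- x * \<bar>u - v\<bar>) / 2)) \<partial>lborel) \<partial>lborel)"
      by (rule lborel_pair.Fubini') measurable
    also have "\<dots> = (\<integral>\<^sup>+v. ennreal (Gamma (1 + \<alpha>) / 2) * (indicator {0..t} v * ennreal (\<bar>u - v\<bar> powr (- \<alpha>))) \<partial>lborel)"
    proof (rule nn_integral_cong_AE)
      \<comment> \<open>On the diagonal the Gamma integral diverges while the power on the right
        evaluates to 0; the two sides agree only off this null set.\<close>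
      have "AE v in lborel. v \<noteq> u" by (rule AE_lborel_singleton)
      then show "AE v in lborel. (\<integral>\<^sup>+x. ennreal (?a x) * (indicator {0..t} v * ennreal (exp (- x * \<bar>u - v\<bar>) / 2)) \<partial>lborel) =
          ennreal (Gamma (1 + \<alpha>) / 2) * (indicator {0..t} v * ennreal (\<bar>u - v\<bar> powr (- \<alpha>)))"
      proof eventually_elim
        case (elim v)
        have "(\<integral>\<^sup>+x. ennreal (?a x) * (indicator {0..t} v * ennreal (exp (- x * \<bar>u - v\<bar>) / 2)) \<partial>lborel) =
          (\<integral>\<^sup>+x. indicator {0..t} v * ennreal (?a x * (exp (- x * \<bar>u - v\<bar>) / 2)) \<partial>lborel)"
        proof (intro nn_integral_cong)
          fix x
          have "ennreal (?a x * (exp (- x * \<bar>u - v\<bar>) / 2)) = ennreal (?a x) * ennreal (exp (- x * \<bar>u - v\<bar>) / 2)"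
            by (rule ennreal_mult[OF a0]) simp
          then show "ennreal (?a x) * (indicator {0..t} v * ennreal (exp (- x * \<bar>u - v\<bar>) / 2)) = indicator {0..t} v * ennreal (?a x * (exp (- x * \<bar>u - v\<bar>) / 2))"
            by (simp only: mult.left_commute)
        qed
        also have "\<dots> = indicator {0..t} v * (\<integral>\<^sup>+x. ennreal (?a x * (exp (- x * \<bar>u - v\<bar>) / 2)) \<partial>lborel)"
          by (rule nn_integral_cmult) measurable
        also have "(\<integral>\<^sup>+x. ennreal (?a x * (exp (- x * \<bar>u - v\<bar>) / 2)) \<partial>lborel) = ennreal (Gamma (1 + \<alpha>) / 2 * \<bar>u - v\<bar> powr (- \<alpha>))"
          by (rule nn_integral_Gamma_scaled) (use \<alpha> elim in auto)
        also have "\<dots> = ennreal (Gamma (1 + \<alpha>) / 2) * ennreal (\<bar>u - v\<bar> powr (- \<alpha>))" by (rule ennreal_mult[OF G0]) simp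
        finally show ?case by (simp only: mult.left_commute)
      qed
    qed
    also have "\<dots> = ennreal (Gamma (1 + \<alpha>) / 2) * (\<integral>\<^sup>+v. indicator {0..t} v * ennreal (\<bar>u - v\<bar> powr (- \<alpha>)) \<partial>lborel)"
      by (rule nn_integral_cmult) measurable
    finally show "(\<integral>\<^sup>+x. (\<integral>\<^sup>+v. ennreal (?a x) * (indicator {0..t} v * ennreal (exp (- x * \<bar>u - v\<bar>) / 2)) \<partial>lborel) \<partial>lborel) =
      ennreal (Gamma (1 + \<alpha>) / 2) * (\<integral>\<^sup>+v. indicator {0..t} v * ennreal (\<bar>u - v\<bar> powr (- \<alpha>)) \<partial>lborel)" .
  qed
  also have "\<dots> = ennreal (Gamma (1 + \<alpha>) / 2) * (\<integral>\<^sup>+u. indicator {0..s} u * (\<integral>\<^sup>+v. indicator {0..t} v * ennreal (\<bar>u - v\<bar> powr (- \<alpha>)) \<partial>lborel) \<partial>lborel)"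
    by (subst nn_integral_cmult[symmetric]) (measurable, simp only: mult.left_commute)
  also have "\<dots> = ennreal (Gamma (1 + \<alpha>) / 2 * (P2 s + P2 t - P2 (t - s)))"
    unfolding nn_integral_double_singular[OF st] by (rule ennreal_mult'[symmetric, OF G0])
  finally have nn: "(\<integral>\<^sup>+x. ennreal (?a x * kernel_covariance s t x) \<partial>lborel) = ennreal (Gamma (1 + \<alpha>) / 2 * (P2 s + P2 t - P2 (t - s)))" .
  have k0: "0 \<le> ?a x * kernel_covariance s t x" for x using a0 kernel_covariance_nonneg by simp
  show "integrable lborel (\<lambda>x. ?a x * kernel_covariance s t x)"
    by (rule integrableI_nonneg) (use k0 in \<open>auto simp: nn\<close>)
  have "0 \<le> P2 s + P2 t - P2 (t - s)"
  proof -
    have "\<bar>t - s\<bar> powr (2 - \<alpha>) \<le> max s t powr (2 - \<alpha>)" using st \<alpha> by (intro powr_mono2) auto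
    also have "\<dots> \<le> s powr (2 - \<alpha>) + t powr (2 - \<alpha>)" by (auto simp: max_def)
    finally show ?thesis using \<alpha> st by (simp add: P2_abs add_divide_distrib[symmetric] diff_divide_distrib[symmetric])
  qed
  then have "0 \<le> Gamma (1 + \<alpha>) / 2 * (P2 s + P2 t - P2 (t - s))" using G0 by simp
  moreover have "(\<integral>x. ?a x * kernel_covariance s t x \<partial>lborel) = enn2real (\<integral>\<^sup>+x. ennreal (?a x * kernel_covariance s t x) \<partial>lborel)"
    by (rule integral_eq_nn_integral) (use k0 in auto)
  ultimately have "(\<integral>x. ?a x * kernel_covariance s t x \<partial>lborel) = Gamma (1 + \<alpha>) / 2 * (P2 s + P2 t - P2 (t - s))"
    unfolding nn by simp
  also have "\<dots> = Gamma (1 + \<alpha>) / ((2 - \<alpha>) * (1 - \<alpha>)) * ((s powr (2 - \<alpha>) + t powr (2 - \<alpha>) - \<bar>t - s\<bar> powr (2 - \<alpha>)) / 2)"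
  proof -
    have "P2 s + P2 t - P2 (t - s) = (s powr (2 - \<alpha>) + t powr (2 - \<alpha>) - \<bar>t - s\<bar> powr (2 - \<alpha>)) / ((1 - \<alpha>) * (2 - \<alpha>))"
      using st by (simp add: P2_abs add_divide_distrib diff_divide_distrib)
    then show ?thesis by (simp add: mult.commute)
  qed
  finally show "(\<integral>x. ?a x * kernel_covariance s t x \<partial>lborel) =
      Gamma (1 + \<alpha>) / ((2 - \<alpha>) * (1 - \<alpha>)) * ((s powr (2 - \<alpha>) + t powr (2 - \<alpha>) - \<bar>t - s\<bar> powr (2 - \<alpha>)) / 2)" .
qed

end

section \<open>Convergence to fractional Brownian motion\<close>

text \<open>The passage from the random to the analytic side: the conclusions no longer mention the
  Levy basis or any approximating sequence.\<close>

lemma supOU_integrated_cf: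
  fixes M :: "'w measure" and K :: "'i set"
  assumes supOU: "supOU_process M a b \<mu> \<pi> X" and b: "b > 0"
    and Xm: "(\<lambda>(t, \<omega>). X t \<omega>) \<in> borel_measurable (borel \<Otimes>\<^sub>M M)"
    and X2: "\<And>t. integrable M (\<lambda>\<omega>. (X t \<omega>)\<^sup>2)" and X0: "\<And>t. integral\<^sup>L M (X t) = 0"
  shows "integrable \<mu> (\<lambda>x. x\<^sup>2)"
    and "integrated_process X t \<in> borel_measurable M"
    and "finite K \<Longrightarrow> (CLINT \<omega>|M. iexp (\<Sum>k\<in>K. c k * integrated_process X (\<tau> k) \<omega>)) =
      exp (CLINT x|\<pi> \<Otimes>\<^sub>M lborel. centered_cumulant b \<mu> (\<Sum>k\<in>K. c k * integrated_kernel (\<tau> k) x))"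
    and "finite K \<Longrightarrow> integrable (\<pi> \<Otimes>\<^sub>M lborel) (\<lambda>x. centered_cumulant b \<mu> (\<Sum>k\<in>K. c k * integrated_kernel (\<tau> k) x))"
proof -
  let ?m = "\<pi> \<Otimes>\<^sub>M lborel :: (real \<times> real) measure"
  have M: "prob_space M" and levy: "levy_measure \<mu>" and \<pi>: "prob_space \<pi>"
    and sets_\<pi>: "sets \<pi> = sets (restrict_space borel {0<..})"
    using supOU unfolding supOU_process_def by auto
  obtain \<Lambda> where basis: "levy_basis M ?m (levy_cumulant a b \<mu>) \<Lambda>"
    and int: "\<And>t. has_levy_integral M ?m \<Lambda> (supOU_kernel t) (X t)"
    using supOU unfolding supOU_process_def by auto
  interpret \<pi>: prob_space \<pi> by (rule \<pi>)
  interpret P: pair_sigma_finite \<pi> "lborel :: real measure" ..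
  have m: "sigma_finite_measure ?m" by unfold_locales
  have space_\<pi>: "space \<pi> = {0<..}"
    using sets_eq_imp_space_eq[OF sets_\<pi>] by (simp add: space_restrict_space)
  have id_\<pi>: "(\<lambda>x. x) \<in> borel_measurable \<pi>"
    unfolding measurable_cong_sets[OF sets_\<pi> refl] by (intro measurable_restrict_space1) simp
  have g: "gaussian_levy_basis M ?m a b \<mu> \<Lambda>"
    by (intro gaussian_levy_basis.intro gaussian_levy_basis_axioms.intro M basis levy b)
  have km: "supOU_kernel t \<in> borel_measurable ?m" and XtM: "X t \<in> borel_measurable M" for t
    using int[of t] unfolding has_levy_integral_def by auto
  \<comment> \<open>The mean square norm of the kernel does not depend on \<open>t\<close>. It
    supplies the uniform bound of the Fubini step, and being positive it rules out a vanishing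
    kernel when the second moment of \<mu> is derived.\<close>
  have nn: "(\<integral>\<^sup>+z. ennreal ((supOU_kernel t z)\<^sup>2) \<partial>?m) = ennreal (1 / 2)" for t
  proof -
    have "(\<lambda>z. ennreal ((supOU_kernel t z)\<^sup>2)) \<in> borel_measurable ?m" using km[of t] by measurable
    from lborel.nn_integral_fst[OF this]
    have "(\<integral>\<^sup>+z. ennreal ((supOU_kernel t z)\<^sup>2) \<partial>?m) = (\<integral>\<^sup>+x. \<integral>\<^sup>+s. ennreal ((supOU_kernel t (x, s))\<^sup>2) \<partial>lborel \<partial>\<pi>)" ..
    also have "\<dots> = (\<integral>\<^sup>+x. ennreal (1 / 2) \<partial>\<pi>)"
    proof (rule nn_integral_cong)
      fix x assume "x \<in> space \<pi>"
      then show "(\<integral>\<^sup>+s. ennreal ((supOU_kernel t (x, s))\<^sup>2) \<partial>lborel) = ennreal (1 / 2)"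
        using nn_integral_kernel_product[of x t t] space_\<pi> by (simp add: power2_eq_square)
    qed
    also have "\<dots> = ennreal (1 / 2)" by (simp add: \<pi>.emeasure_space_1)
    finally show ?thesis .
  qed
  have sq: "(\<integral>z. (supOU_kernel t z)\<^sup>2 \<partial>?m) \<le> 1 / 2" for t
  proof -
    have "(\<integral>z. (supOU_kernel t z)\<^sup>2 \<partial>?m) = enn2real (\<integral>\<^sup>+z. ennreal ((supOU_kernel t z)\<^sup>2) \<partial>?m)"
      by (rule integral_eq_nn_integral) (use km[of t] in auto)
    also have "\<dots> = 1 / 2" unfolding nn by (rule enn2real_ennreal) simp
    finally show ?thesis by simp
  qed
  have not0: "\<not> (AE z in ?m. supOU_kernel t z = 0)" for t
  proof
    assume "AE z in ?m. supOU_kernel t z = 0"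
    then have "(\<integral>\<^sup>+z. ennreal ((supOU_kernel t z)\<^sup>2) \<partial>?m) = (\<integral>\<^sup>+z. 0 \<partial>?m)"
      by (intro nn_integral_cong_AE) auto
    then show False unfolding nn by simp
  qed
  have approx: "\<exists>\<phi>. (\<forall>n. levy_simple ?m (\<phi> n)) \<and> (AE x in ?m. (\<lambda>n. \<phi> n x) \<longlonglongrightarrow> supOU_kernel t x) \<and>
      conv_in_prob M (\<lambda>n. simple_levy_integral ?m \<Lambda> (\<phi> n)) (X t)" for t
    using int[of t] unfolding has_levy_integral_def levy_simple_def by blast
  obtain \<phi> where \<phi>: "\<And>n. levy_simple ?m (\<phi> n)" "AE x in ?m. (\<lambda>n. \<phi> n x) \<longlonglongrightarrow> supOU_kernel 0 x"
      "conv_in_prob M (\<lambda>n. simple_levy_integral ?m \<Lambda> (\<phi> n)) (X 0)"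
    using approx[of 0] by blast
  show second_moment: "integrable \<mu> (\<lambda>x. x\<^sup>2)"
    by (rule gaussian_levy_basis.second_moment_levy_measure[OF g km XtM \<phi> X2 X0 not0])
  interpret square_integrable_levy_basis M ?m a b \<mu> \<Lambda>
    by (intro square_integrable_levy_basis.intro square_integrable_levy_basis_axioms.intro g second_moment)
  have hX: "has_L2 (supOU_kernel t) (X t)" for t
    using approx[of t] has_L2_of_conv_in_prob[OF km XtM _ _ _ X2 X0] by blast
  have fm: "(\<lambda>(s, x). supOU_kernel s x) \<in> borel_measurable (lborel \<Otimes>\<^sub>M ?m)"
  proof -
    have "(\<lambda>z. (fst z, fst (snd z), snd (snd z))) \<in> measurable (lborel \<Otimes>\<^sub>M ?m) (borel \<Otimes>\<^sub>M (borel \<Otimes>\<^sub>M borel))"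
      using id_\<pi> by measurable
    from measurable_compose[OF this supOU_kernel_measurable] show ?thesis
      by (simp only: case_prod_unfold fst_conv snd_conv prod.collapse)
  qed
  have Xm': "(\<lambda>(s, x). X s x) \<in> borel_measurable (lborel \<Otimes>\<^sub>M M)"
    using Xm by (subst measurable_cong_sets[OF sets_pair_measure_cong[OF sets_lborel refl] refl])
  have hI: "has_L2 (integrated_kernel t) (integrated_process X t)" for t
    unfolding integrated_kernel_def[abs_def] integrated_process_def[abs_def]
    by (rule has_L2_integral[OF m _ _ fm Xm' hX sq]) (auto simp: emeasure_lborel_Icc_eq)
  show "integrated_process X t \<in> borel_measurable M" by (rule has_L2D(3)[OF hI])
  assume K: "finite K"
  have s: "has_L2 (\<lambda>x. \<Sum>k\<in>K. c k * integrated_kernel (\<tau> k) x) (\<lambda>\<omega>. \<Sum>k\<in>K. c k * integrated_process X (\<tau> k) \<omega>)"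
    by (rule has_L2_sum[OF K hI])
  show "(CLINT \<omega>|M. iexp (\<Sum>k\<in>K. c k * integrated_process X (\<tau> k) \<omega>)) =
      exp (CLINT x|?m. centered_cumulant b \<mu> (\<Sum>k\<in>K. c k * integrated_kernel (\<tau> k) x))"
    using cf_has_L2[OF s, of 1] unfolding cf_def mult_1_left .
  show "integrable ?m (\<lambda>x. centered_cumulant b \<mu> (\<Sum>k\<in>K. c k * integrated_kernel (\<tau> k) x))"
    using integrable_centered_cumulant_L2[OF has_L2D(1,2)[OF s], of 1] unfolding mult_1_left .
qed

text \<open>Time and rate enter the kernel only through their product, so a change of time scale is
  a change of rate, up to the Jacobian of the time integral.\<close>

lemma integrated_kernel_scaling:
  assumes T: "T > 0"
  shows "integrated_kernel (T * t) (x, s) = T * integrated_kernel t (T * x, s)"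
proof -
  have "integrated_kernel (T * t) (x, s) = \<bar>T\<bar> *\<^sub>R (\<integral>u. indicator {0..T * t} (0 + T * u) *\<^sub>R supOU_kernel (0 + T * u) (x, s) \<partial>lborel)"
    unfolding integrated_kernel_def set_lebesgue_integral_def by (rule lborel_integral_real_affine) (use T in simp)
  also have "(\<integral>u. indicator {0..T * t} (0 + T * u) *\<^sub>R supOU_kernel (0 + T * u) (x, s) \<partial>lborel) =
      (\<integral>u. indicator {0..t} u *\<^sub>R supOU_kernel u (T * x, s) \<partial>lborel)"
  proof (rule Bochner_Integration.integral_cong[OF refl])
    fix u
    have "T * u \<in> {0..T * t} \<longleftrightarrow> u \<in> {0..t}" using T by (simp add: zero_le_mult_iff)
    moreover have "supOU_kernel (T * u) (x, s) = supOU_kernel u (T * x, s)"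
      by (simp add: supOU_kernel_def mult.assoc mult.commute mult.left_commute)
    ultimately show "indicator {0..T * t} (0 + T * u) *\<^sub>R supOU_kernel (0 + T * u) (x, s) = indicator {0..t} u *\<^sub>R supOU_kernel u (T * x, s)"
      by (simp add: indicator_def)
  qed
  finally show ?thesis using T by (simp add: integrated_kernel_def set_lebesgue_integral_def)
qed

text \<open>Potter's bound with exponent \<open>\<alpha> / 2\<close> shows that \<open>l\<close>
  grows at most like \<open>x powr (\<alpha> / 2)\<close>, which leaves
  \<open>x powr (\<alpha> / 2)\<close> in the quotient. This drives the arguments of the cumulant to
  infinity in the main limit.\<close>

lemma slowly_varying_ratio_at_top:
  assumes l: "slowly_varying l" and \<alpha>: "\<alpha> > 0"
  shows "filterlim (\<lambda>x. x powr \<alpha> / l x) at_top at_top" and "eventually (\<lambda>x. l x > 0) at_top"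
proof -
  have e0: "\<alpha> / 2 > 0" using \<alpha> by simp
  obtain X where X: "X > 0" and lX: "\<And>x. x \<ge> X \<Longrightarrow> l x > 0"
    and bd: "\<And>x y. x \<ge> X \<Longrightarrow> y \<ge> X \<Longrightarrow> l y \<le> exp (\<alpha> / 2) * l x * exp (\<alpha> / 2 * \<bar>ln y - ln x\<bar>)"
    using potter_bound[OF l e0] by metis
  show "eventually (\<lambda>x. l x > 0) at_top" unfolding eventually_at_top_linorder using lX by blast
  \<comment> \<open>All factors that do not depend on \<open>x\<close> in Potter's bound between
    \<open>X\<close> and \<open>x\<close>.\<close>
  define C where "C = exp (\<alpha> / 2) * l X * exp (- (\<alpha> / 2 * ln X))"
  have C: "C > 0" using lX[of X] by (simp add: C_def)
  have "filterlim (\<lambda>x. inverse C * x powr (\<alpha> / 2)) at_top at_top"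
      proof (rule filterlim_tendsto_pos_mult_at_top[OF tendsto_const])
    have "filterlim (\<lambda>x. exp (\<alpha> / 2 * ln x)) at_top at_top"
      by (intro filterlim_compose[OF exp_at_top] filterlim_tendsto_pos_mult_at_top[OF tendsto_const e0 ln_at_top])
    moreover have "eventually (\<lambda>x. exp (\<alpha> / 2 * ln x) = x powr (\<alpha> / 2)) at_top"
      by (rule eventually_mono[OF eventually_gt_at_top[of 0]]) (simp add: powr_def)
    ultimately show "filterlim (\<lambda>x. x powr (\<alpha> / 2)) at_top at_top"
      by (rule filterlim_cong[THEN iffD1, OF refl refl, rotated])
  qed (use C in simp)
  moreover have "eventually (\<lambda>x. inverse C * x powr (\<alpha> / 2) \<le> x powr \<alpha> / l x) at_top"
  proof (rule eventually_mono[OF eventually_ge_at_top[of X]])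
    fix x assume x: "X \<le> x"
    have "\<bar>ln x - ln X\<bar> = ln x - ln X" using x X by simp
    then have "l x \<le> exp (\<alpha> / 2) * l X * exp (\<alpha> / 2 * (ln x - ln X))" using bd[of X x] x by simp
    also have "\<dots> = C * x powr (\<alpha> / 2)"
      using x X by (simp add: C_def powr_def exp_add[symmetric] algebra_simps diff_divide_distrib)
    finally have le: "l x \<le> C * x powr (\<alpha> / 2)" .
    have "inverse C * x powr (\<alpha> / 2) = x powr \<alpha> / (C * x powr (\<alpha> / 2))"
      using x X C powr_add[of x "\<alpha> / 2" "\<alpha> / 2"] by (simp add: divide_simps)
    also have "\<dots> \<le> x powr \<alpha> / l x"
      by (rule divide_left_mono[OF le]) (use x X C lX[OF x] in auto)
    finally show "inverse C * x powr (\<alpha> / 2) \<le> x powr \<alpha> / l x" .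
  qed
  ultimately show "filterlim (\<lambda>x. x powr \<alpha> / l x) at_top at_top" by (rule filterlim_at_top_mono)
qed

text \<open>The inner integral over \<open>s\<close>, divided by the square of \<open>r n\<close>,
  is bounded by a multiple of the covariance form \<open>v\<close>, uniformly in \<open>n\<close>.
  This bound serves two limits: it yields the domination in the rate variable for
  \<open>regularly_varying_density_limit\<close>, and the integrand behind it dominates the
  pointwise limit in which the jumps disappear.\<close>

lemma cumulant_integral_limit:
  fixes J :: "'i set" and p l :: "real \<Rightarrow> real" and T :: "nat \<Rightarrow> real" and \<alpha> :: real
  defines "A \<equiv> \<lambda>n. T n powr (1 - \<alpha> / 2) * l (T n) powr (1 / 2)"
  assumes levy: "levy_measure \<mu>" and second_moment: "integrable \<mu> (\<lambda>x. x\<^sup>2)" and b: "b \<ge> 0"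
    and \<pi>: "prob_space \<pi>" and pm: "p \<in> borel_measurable (restrict_space borel {0<..})"
    and p0: "\<And>x. x > 0 \<Longrightarrow> p x \<ge> 0"
    and density: "\<pi> = density (restrict_space lborel {0<..}) (\<lambda>x. ennreal (p x))"
    and \<alpha>: "0 < \<alpha>" "\<alpha> < 1" and slow: "slowly_varying l"
    and asymp: "p \<sim>[at_right 0] (\<lambda>x. \<alpha> * l (inverse x) * x powr (\<alpha> - 1))"
    and T: "filterlim T at_top sequentially"
    and J: "finite J" and t: "\<And>j. j \<in> J \<Longrightarrow> t j \<ge> 0"
    and int: "\<And>n. integrable (\<pi> \<Otimes>\<^sub>M lborel) (\<lambda>z. centered_cumulant b \<mu> (\<Sum>j\<in>J. c j / A n * integrated_kernel (T n * t j) z))"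
  shows "(\<lambda>n. CLINT z|\<pi> \<Otimes>\<^sub>M lborel. centered_cumulant b \<mu> (\<Sum>j\<in>J. c j / A n * integrated_kernel (T n * t j) z))
    \<longlonglongrightarrow> of_real (- (b * (Gamma (1 + \<alpha>) / ((2 - \<alpha>) * (1 - \<alpha>)))) / 2 *
        (\<Sum>i\<in>J. \<Sum>j\<in>J. c i * c j * ((t i powr (2 - \<alpha>) + t j powr (2 - \<alpha>) - \<bar>t j - t i\<bar> powr (2 - \<alpha>)) / 2)))"
proof -
  define \<kappa> where "\<kappa> = centered_cumulant b \<mu>"
  define V where "V = b + (LINT x|\<mu>. x\<^sup>2)"
  define G where "G x s = (\<Sum>j\<in>J. c j * integrated_kernel (t j) (x, s))" for x s
  \<comment> \<open>What is left of the normalisation after the kernel has released its factor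
    \<open>T n\<close>. For large \<open>n\<close> its square is
    \<open>T n powr \<alpha> / l (T n)\<close>, exactly the prefactor in
    \<open>regularly_varying_density_limit\<close>.\<close>
  define r where "r n = T n / A n" for n
  define q where "q n x = (CLINT s|lborel. \<kappa> (r n * G x s) / of_real ((r n)\<^sup>2))" for n x
  define v where "v x = (\<Sum>i\<in>J. \<Sum>j\<in>J. c i * c j * kernel_covariance (t i) (t j) x)" for x
  define Q where "Q x = complex_of_real (- b / 2 * v x)" for x
  define C where "C = (\<Sum>i\<in>J. \<Sum>j\<in>J. \<bar>c i * c j\<bar> * (t i * t j + t i))"
  have [measurable]: "\<kappa> \<in> borel_measurable borel"
    unfolding \<kappa>_def by (rule centered_cumulant_measurable[OF levy second_moment b])
  have \<kappa>_le: "norm (\<kappa> z) \<le> V * z\<^sup>2 / 2" for z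
    unfolding \<kappa>_def V_def by (rule norm_centered_cumulant_le[OF levy second_moment b])
  have V0: "V \<ge> 0" unfolding V_def using b by (intro add_nonneg_nonneg) auto
  have Gm: "(\<lambda>z. G (fst z) (snd z)) \<in> borel_measurable (borel \<Otimes>\<^sub>M lborel)"
    unfolding G_def
  proof (intro borel_measurable_sum borel_measurable_times borel_measurable_const)
    fix j
    have "(\<lambda>z. (fst z, snd z)) \<in> measurable (borel \<Otimes>\<^sub>M lborel) (borel \<Otimes>\<^sub>M borel)" by measurable
    from measurable_compose[OF this integrated_kernel_measurable]
    show "(\<lambda>z. integrated_kernel (t j) (fst z, snd z)) \<in> borel_measurable (borel \<Otimes>\<^sub>M lborel)" .
  qed
  have Gx: "(\<lambda>s. G x s) \<in> borel_measurable lborel" for x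
    using measurable_compose[OF measurable_Pair1' Gm, of x] by simp
  have kx: "(\<lambda>s. integrated_kernel u (x, s)) \<in> borel_measurable lborel" for u x
    using measurable_compose[OF measurable_Pair1'[of x borel borel] integrated_kernel_measurable[of u]] by simp
  have G2: "integrable lborel (\<lambda>s. (G x s)\<^sup>2)" "(\<integral>s. (G x s)\<^sup>2 \<partial>lborel) = v x" if x: "x > 0" for x
  proof -
    have eq: "(G x s)\<^sup>2 = (\<Sum>i\<in>J. \<Sum>j\<in>J. (c i * c j) * (integrated_kernel (t i) (x, s) * integrated_kernel (t j) (x, s)))" for s
      unfolding G_def power2_eq_square sum_product by (intro sum.cong refl) (simp only: mult.assoc mult.left_commute)
    have i: "integrable lborel (\<lambda>s. (c i * c j) * (integrated_kernel (t i) (x, s) * integrated_kernel (t j) (x, s)))" for i j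
      by (intro integrable_mult_right Cauchy_Schwarz_integral(1) kx integrated_kernel_products(1)[OF x])
    show "integrable lborel (\<lambda>s. (G x s)\<^sup>2)"
      unfolding eq by (intro Bochner_Integration.integrable_sum i)
    have "(\<integral>s. (G x s)\<^sup>2 \<partial>lborel) = (\<Sum>i\<in>J. \<integral>s. (\<Sum>j\<in>J. (c i * c j) * (integrated_kernel (t i) (x, s) * integrated_kernel (t j) (x, s))) \<partial>lborel)"
      unfolding eq by (rule Bochner_Integration.integral_sum) (intro Bochner_Integration.integrable_sum i)
    also have "\<dots> = (\<Sum>i\<in>J. \<Sum>j\<in>J. \<integral>s. (c i * c j) * (integrated_kernel (t i) (x, s) * integrated_kernel (t j) (x, s)) \<partial>lborel)"
      by (intro sum.cong refl Bochner_Integration.integral_sum i)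
    also have "\<dots> = v x"
      unfolding v_def by (simp only: integral_mult_right_zero integrated_kernel_products(2)[OF x])
    finally show "(\<integral>s. (G x s)\<^sup>2 \<partial>lborel) = v x" .
  qed
  have v_le: "v x \<le> C * min 1 (1 / x)" if x: "x > 0" for x
  proof -
    have "c i * c j * kernel_covariance (t i) (t j) x \<le> \<bar>c i * c j\<bar> * (t i * t j + t i) * min 1 (1 / x)" if "i \<in> J" "j \<in> J" for i j
    proof -
      have "c i * c j * kernel_covariance (t i) (t j) x \<le> \<bar>c i * c j\<bar> * kernel_covariance (t i) (t j) x"
        by (intro mult_right_mono kernel_covariance_nonneg) simp
      also have "\<dots> \<le> \<bar>c i * c j\<bar> * ((t i * t j + t i) * min 1 (1 / x))"
        by (intro mult_left_mono kernel_covariance_le x t that) simp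
      finally show ?thesis by (simp only: mult.assoc)
    qed
    then show ?thesis unfolding v_def C_def sum_distrib_right by (intro sum_mono)
  qed
  have r2: "eventually (\<lambda>n. T n > 0 \<and> r n > 0 \<and> (r n)\<^sup>2 = T n powr \<alpha> / l (T n)) sequentially"
  proof -
    have "eventually (\<lambda>n. T n > 0 \<and> l (T n) > 0) sequentially"
      by (rule eventually_compose_filterlim[OF eventually_conj[OF eventually_gt_at_top[of "0::real"] slowly_varying_ratio_at_top(2)[OF slow \<alpha>(1)]] T])
    then show ?thesis
    proof (rule eventually_mono)
      fix n assume *: "T n > 0 \<and> l (T n) > 0"
      have "(T n powr (1 - \<alpha> / 2))\<^sup>2 = T n powr (2 - \<alpha>)"
        unfolding power2_eq_square powr_add[symmetric] by simp
      moreover have "(l (T n) powr (1 / 2))\<^sup>2 = l (T n)"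
        unfolding power2_eq_square powr_add[symmetric] using * by simp
      moreover have "(T n)\<^sup>2 = T n powr (2 - \<alpha>) * T n powr \<alpha>"
        unfolding powr_add[symmetric] using * by simp
      ultimately have "(r n)\<^sup>2 = T n powr \<alpha> / l (T n)"
        using * unfolding r_def A_def by (simp add: power_divide power_mult_distrib)
      then show "T n > 0 \<and> r n > 0 \<and> (r n)\<^sup>2 = T n powr \<alpha> / l (T n)" using * by (simp add: r_def A_def)
    qed
  qed
  have r_top: "filterlim r at_top sequentially"
  proof -
    have "filterlim (\<lambda>n. sqrt (T n powr \<alpha> / l (T n))) at_top sequentially"
      by (rule filterlim_compose[OF sqrt_at_top filterlim_compose[OF slowly_varying_ratio_at_top(1)[OF slow \<alpha>(1)] T]])
    moreover have "eventually (\<lambda>n. sqrt (T n powr \<alpha> / l (T n)) = r n) sequentially"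
      using r2 by (rule eventually_mono) (metis less_imp_le real_sqrt_abs abs_of_nonneg)
    ultimately show ?thesis by (rule filterlim_cong[THEN iffD1, OF refl refl, rotated])
  qed
  have \<kappa>q_le: "norm (\<kappa> (r n * y) / of_real ((r n)\<^sup>2)) \<le> V / 2 * y\<^sup>2" for n y
  \<comment> \<open>For small \<open>n\<close> the scale \<open>r n\<close> may vanish; division by
    0 then yields 0, and the bound holds for every \<open>n\<close>.\<close>
  proof (cases "r n = 0")
    case True then show ?thesis using V0 by simp
  next
    case False
    have "norm (\<kappa> (r n * y) / of_real ((r n)\<^sup>2)) = norm (\<kappa> (r n * y)) / (r n)\<^sup>2"
      by (simp only: norm_divide norm_of_real abs_power2)
    also have "\<dots> \<le> (V * (r n * y)\<^sup>2 / 2) / (r n)\<^sup>2" by (intro divide_right_mono \<kappa>_le) simp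
    also have "\<dots> = V / 2 * y\<^sup>2" using False by (simp add: power_mult_distrib)
    finally show ?thesis .
  qed
  have \<kappa>Gm: "(\<lambda>s. \<kappa> (r n * G x s) / of_real ((r n)\<^sup>2)) \<in> borel_measurable lborel" for n x
    using Gx[of x] by measurable
  have q_le: "norm (q n x) \<le> V / 2 * C * min 1 (1 / x)" if x: "x > 0" for n x
  proof -
    have "norm (q n x) \<le> (\<integral>s. V / 2 * (G x s)\<^sup>2 \<partial>lborel)"
      unfolding q_def
    proof (rule norm_integral_le)
      show i: "integrable lborel (\<lambda>s. V / 2 * (G x s)\<^sup>2)" by (intro integrable_mult_right G2(1)[OF x])
      show "integrable lborel (\<lambda>s. \<kappa> (r n * G x s) / of_real ((r n)\<^sup>2))"
      proof (rule Bochner_Integration.integrable_bound[OF i \<kappa>Gm])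
        show "AE s in lborel. norm (\<kappa> (r n * G x s) / of_real ((r n)\<^sup>2)) \<le> norm (V / 2 * (G x s)\<^sup>2)"
          by (intro AE_I2 order_trans[OF \<kappa>q_le]) simp
      qed
    qed (rule \<kappa>q_le)
    also have "\<dots> = V / 2 * v x" by (simp only: integral_mult_right_zero G2(2)[OF x])
    also have "\<dots> \<le> V / 2 * (C * min 1 (1 / x))" by (rule mult_left_mono[OF v_le[OF x]]) (use V0 in simp)
    finally show ?thesis by (simp only: mult.assoc)
  qed
  have qQ: "(\<lambda>n. q n x) \<longlonglongrightarrow> Q x" if x: "x > 0" for x
  proof -
    have "(\<lambda>n. CLINT s|lborel. \<kappa> (r n * G x s) / of_real ((r n)\<^sup>2)) \<longlonglongrightarrow> (CLINT s|lborel. of_real (- b * (G x s)\<^sup>2 / 2))"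
    proof (rule integral_dominated_convergence)
      show "(\<lambda>s. complex_of_real (- b * (G x s)\<^sup>2 / 2)) \<in> borel_measurable lborel" using Gx[of x] by measurable
      show "integrable lborel (\<lambda>s. V / 2 * (G x s)\<^sup>2)" by (intro integrable_mult_right G2(1)[OF x])
      show "AE s in lborel. (\<lambda>n. \<kappa> (r n * G x s) / of_real ((r n)\<^sup>2)) \<longlonglongrightarrow> complex_of_real (- b * (G x s)\<^sup>2 / 2)"
        unfolding \<kappa>_def by (intro AE_I2 centered_cumulant_large[OF levy second_moment r_top])
      show "AE s in lborel. norm (\<kappa> (r n * G x s) / of_real ((r n)\<^sup>2)) \<le> V / 2 * (G x s)\<^sup>2" for n
        by (intro AE_I2 \<kappa>q_le)
    qed (rule \<kappa>Gm)
    moreover have "(CLINT s|lborel. of_real (- b * (G x s)\<^sup>2 / 2)) = Q x"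
    proof -
      have "(\<integral>s. - b * (G x s)\<^sup>2 / 2 \<partial>lborel) = (\<integral>s. - b / 2 * (G x s)\<^sup>2 \<partial>lborel)"
        by (intro Bochner_Integration.integral_cong refl) simp
      also have "\<dots> = - b / 2 * v x" by (simp only: integral_mult_right_zero G2(2)[OF x])
      finally show ?thesis unfolding Q_def by (simp only: integral_complex_of_real)
    qed
    ultimately show ?thesis unfolding q_def by (simp only:)
  qed
  have qm: "q n \<in> borel_measurable borel" for n
  proof -
    have "(\<lambda>z. \<kappa> (r n * G (fst z) (snd z)) / of_real ((r n)\<^sup>2)) \<in> borel_measurable (borel \<Otimes>\<^sub>M lborel)"
      using Gm by measurable
    then have "(\<lambda>(x, s). \<kappa> (r n * G x s) / of_real ((r n)\<^sup>2)) \<in> borel_measurable (borel \<Otimes>\<^sub>M lborel)"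
      by (simp only: case_prod_beta')
    then show ?thesis unfolding q_def[abs_def] by (rule lborel.borel_measurable_lebesgue_integral)
  qed
  have pm': "p \<in> borel_measurable (restrict_space lborel {0<..})"
    using pm by (subst measurable_cong_sets[OF sets_restrict_space_cong[OF sets_lborel] refl])
  have p_AE: "AE x in restrict_space lborel {0<..}. 0 \<le> p x"
    by (intro AE_I2) (simp add: space_restrict_space p0)
  have pint: "set_integrable lborel {0<..} p"
  proof -
    have "(\<integral>\<^sup>+x. ennreal (p x) \<partial>restrict_space lborel {0<..}) = emeasure \<pi> (space \<pi>)"
    proof -
      let ?R = "restrict_space lborel {0<..} :: real measure"
      have "emeasure \<pi> (space \<pi>) = emeasure (density ?R (\<lambda>x. ennreal (p x))) (space ?R)" by (simp add: density)
      also have "\<dots> = (\<integral>\<^sup>+x. ennreal (p x) * indicator (space ?R) x \<partial>?R)"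
        by (rule emeasure_density[OF _ sets.top]) (use pm' in measurable)
      also have "\<dots> = (\<integral>\<^sup>+x. ennreal (p x) \<partial>?R)" by (intro nn_integral_cong) simp
      finally show ?thesis ..
    qed
    then have "(\<integral>\<^sup>+x. ennreal (p x) \<partial>restrict_space lborel {0<..}) < \<infinity>"
      by (simp add: prob_space.emeasure_space_1[OF \<pi>])
    from integrableI_nonneg[OF pm' p_AE this] show ?thesis
      unfolding set_integrable_def by (subst (asm) integrable_restrict_space) auto
  qed
  have main: "(\<lambda>n. of_real (T n powr \<alpha> / l (T n)) * (CLINT x|lborel. indicator {0<..} x *\<^sub>R (of_real (p x) * q n (T n * x))))
      \<longlonglongrightarrow> (CLINT x|lborel. indicator {0<..} x *\<^sub>R (of_real (\<alpha> * x powr (\<alpha> - 1)) * Q x))"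
  proof (rule regularly_varying_density_limit[OF \<alpha> slow pm p0 pint asymp T _ _ q_le qQ])
    show "(\<lambda>x. indicator {0<..} x *\<^sub>R q n x) \<in> borel_measurable borel" for n using qm[of n] by measurable
    have [measurable]: "v \<in> borel_measurable borel" unfolding v_def[abs_def] by measurable
    show "(\<lambda>x. indicator {0<..} x *\<^sub>R Q x) \<in> borel_measurable borel" unfolding Q_def by measurable
  qed
  have id: "eventually (\<lambda>n. of_real (T n powr \<alpha> / l (T n)) * (CLINT x|lborel. indicator {0<..} x *\<^sub>R (of_real (p x) * q n (T n * x))) =
      (CLINT z|\<pi> \<Otimes>\<^sub>M lborel. \<kappa> (\<Sum>j\<in>J. c j / A n * integrated_kernel (T n * t j) z))) sequentially"
    using r2
  proof (rule eventually_mono)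
    fix n assume *: "T n > 0 \<and> r n > 0 \<and> (r n)\<^sup>2 = T n powr \<alpha> / l (T n)"
    interpret \<pi>: prob_space \<pi> by (rule \<pi>)
    interpret P: pair_sigma_finite \<pi> "lborel :: real measure" ..
    have F: "(\<Sum>j\<in>J. c j / A n * integrated_kernel (T n * t j) (x, s)) = r n * G (T n * x) s" for x s
      unfolding G_def r_def sum_distrib_left using * by (intro sum.cong refl) (simp add: integrated_kernel_scaling)
    have "r n > 0" using * by blast
    then have r0: "complex_of_real ((r n)\<^sup>2) \<noteq> 0" by simp
    have inner: "(CLINT s|lborel. \<kappa> (r n * G x s)) = of_real ((r n)\<^sup>2) * q n x" for x
      unfolding q_def integral_divide_zero using r0 by simp
    have qT: "(\<lambda>x. of_real ((r n)\<^sup>2) * q n (T n * x)) \<in> borel_measurable (restrict_space lborel {0<..})"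
    proof (rule measurable_restrict_space1)
      have [measurable]: "q n \<in> borel_measurable borel" by (rule qm)
      show "(\<lambda>x. of_real ((r n)\<^sup>2) * q n (T n * x)) \<in> borel_measurable lborel" by measurable
    qed
    have "(CLINT z|\<pi> \<Otimes>\<^sub>M lborel. \<kappa> (\<Sum>j\<in>J. c j / A n * integrated_kernel (T n * t j) z)) =
        (CLINT x|\<pi>. CLINT s|lborel. \<kappa> (\<Sum>j\<in>J. c j / A n * integrated_kernel (T n * t j) (x, s)))"
      using P.integral_fst'[OF int[of n]] unfolding \<kappa>_def by (rule sym)
    also have "\<dots> = (CLINT x|\<pi>. of_real ((r n)\<^sup>2) * q n (T n * x))"
      by (simp only: F inner)
    also have "\<dots> = (CLINT x|restrict_space lborel {0<..}. p x *\<^sub>R (of_real ((r n)\<^sup>2) * q n (T n * x)))"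
      unfolding density by (rule integral_density[OF qT pm' p_AE])
    also have "\<dots> = (CLINT x|lborel. indicator {0<..} x *\<^sub>R (p x *\<^sub>R (of_real ((r n)\<^sup>2) * q n (T n * x))))"
      by (rule integral_restrict_space) simp
    also have "\<dots> = (CLINT x|lborel. of_real ((r n)\<^sup>2) * (indicator {0<..} x *\<^sub>R (of_real (p x) * q n (T n * x))))"
      by (intro Bochner_Integration.integral_cong refl) (simp only: scaleR_conv_of_real mult.left_commute)
    also have "\<dots> = of_real ((r n)\<^sup>2) * (CLINT x|lborel. indicator {0<..} x *\<^sub>R (of_real (p x) * q n (T n * x)))"
      by (rule integral_mult_right_zero)
    finally show "of_real (T n powr \<alpha> / l (T n)) * (CLINT x|lborel. indicator {0<..} x *\<^sub>R (of_real (p x) * q n (T n * x))) =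
      (CLINT z|\<pi> \<Otimes>\<^sub>M lborel. \<kappa> (\<Sum>j\<in>J. c j / A n * integrated_kernel (T n * t j) z))"
      using * by (simp only:)
  qed
  let ?a = "\<lambda>x. indicator {0<..} x * (\<alpha> * x powr (\<alpha> - 1))"
  let ?R = "\<lambda>i j. (t i powr (2 - \<alpha>) + t j powr (2 - \<alpha>) - \<bar>t j - t i\<bar> powr (2 - \<alpha>)) / 2"
  let ?\<Gamma> = "Gamma (1 + \<alpha>) / ((2 - \<alpha>) * (1 - \<alpha>))"
  have kc: "integrable lborel (\<lambda>x. (- b / 2 * (c i * c j)) * (?a x * kernel_covariance (t i) (t j) x))"
    "(\<integral>x. (- b / 2 * (c i * c j)) * (?a x * kernel_covariance (t i) (t j) x) \<partial>lborel) = - b / 2 * (c i * c j) * (?\<Gamma> * ?R i j)"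
    if "i \<in> J" "j \<in> J" for i j
    using integral_kernel_covariance[OF \<alpha> t t, OF that] by (simp_all only: integrable_mult_right integral_mult_right_zero)
  have "(CLINT x|lborel. indicator {0<..} x *\<^sub>R (of_real (\<alpha> * x powr (\<alpha> - 1)) * Q x)) =
      (CLINT x|lborel. of_real (\<Sum>i\<in>J. \<Sum>j\<in>J. (- b / 2 * (c i * c j)) * (?a x * kernel_covariance (t i) (t j) x)))"
  proof (intro Bochner_Integration.integral_cong refl)
    fix x
    have "?a x * (- b / 2 * v x) = (\<Sum>i\<in>J. \<Sum>j\<in>J. (- b / 2 * (c i * c j)) * (?a x * kernel_covariance (t i) (t j) x))"
      unfolding v_def sum_distrib_left by (intro sum.cong refl) (simp only: mult.assoc mult.left_commute)
    moreover have "indicator {0<..} x *\<^sub>R (of_real (\<alpha> * x powr (\<alpha> - 1)) * Q x) = complex_of_real (?a x * (- b / 2 * v x))"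
      unfolding Q_def by (simp only: scaleR_conv_of_real of_real_mult mult.assoc)
    ultimately show "indicator {0<..} x *\<^sub>R (of_real (\<alpha> * x powr (\<alpha> - 1)) * Q x) =
      complex_of_real (\<Sum>i\<in>J. \<Sum>j\<in>J. (- b / 2 * (c i * c j)) * (?a x * kernel_covariance (t i) (t j) x))" by (simp only:)
  qed
  also have "\<dots> = of_real (\<Sum>i\<in>J. \<integral>x. (\<Sum>j\<in>J. (- b / 2 * (c i * c j)) * (?a x * kernel_covariance (t i) (t j) x)) \<partial>lborel)"
    unfolding integral_complex_of_real
    by (subst Bochner_Integration.integral_sum) (intro Bochner_Integration.integrable_sum kc(1), assumption+, rule refl)
  also have "\<dots> = of_real (\<Sum>i\<in>J. \<Sum>j\<in>J. - b / 2 * (c i * c j) * (?\<Gamma> * ?R i j))"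
  proof (intro arg_cong[where f=of_real] sum.cong refl)
    fix i assume i: "i \<in> J"
    have "(\<integral>x. (\<Sum>j\<in>J. (- b / 2 * (c i * c j)) * (?a x * kernel_covariance (t i) (t j) x)) \<partial>lborel) =
        (\<Sum>j\<in>J. \<integral>x. (- b / 2 * (c i * c j)) * (?a x * kernel_covariance (t i) (t j) x) \<partial>lborel)"
      by (intro Bochner_Integration.integral_sum kc(1) i)
    also have "\<dots> = (\<Sum>j\<in>J. - b / 2 * (c i * c j) * (?\<Gamma> * ?R i j))" by (intro sum.cong refl kc(2) i)
    finally show "(\<integral>x. (\<Sum>j\<in>J. (- b / 2 * (c i * c j)) * (?a x * kernel_covariance (t i) (t j) x)) \<partial>lborel) =
        (\<Sum>j\<in>J. - b / 2 * (c i * c j) * (?\<Gamma> * ?R i j))" .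
  qed
  also have "\<dots> = of_real (- (b * ?\<Gamma>) / 2 * (\<Sum>i\<in>J. \<Sum>j\<in>J. c i * c j * ?R i j))"
    unfolding sum_distrib_left by (intro arg_cong[where f=of_real] sum.cong refl) simp
  finally show ?thesis using main unfolding tendsto_cong[OF id] \<kappa>_def by (simp only:)
qed

text \<open>Linear combinations of a Gaussian process may degenerate to constants. With mean zero
  such a constant is 0, and the formula holds with variance 0.\<close>

lemma (in prob_space) normal_cf:
  assumes Y: "normal_rv M Y"
  shows "integrable M (\<lambda>\<omega>. (Y \<omega>)\<^sup>2)"
    and "expectation Y = 0 \<Longrightarrow> (CLINT \<omega>|M. iexp (Y \<omega>)) = of_real (exp (- expectation (\<lambda>\<omega>. (Y \<omega>)\<^sup>2) / 2))"
proof -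
  have Ym: "Y \<in> borel_measurable M" using Y by (simp add: normal_rv_def)
  have "integrable M (\<lambda>\<omega>. (Y \<omega>)\<^sup>2) \<and> (expectation Y = 0 \<longrightarrow> (CLINT \<omega>|M. iexp (Y \<omega>)) = of_real (exp (- expectation (\<lambda>\<omega>. (Y \<omega>)\<^sup>2) / 2)))"
  proof (cases "\<exists>m s. s > 0 \<and> distributed M lborel Y (\<lambda>x. ennreal (normal_density m s x))")
    case True
    then obtain m s where s: "s > 0" and D: "distributed M lborel Y (\<lambda>x. ennreal (normal_density m s x))" by blast
    have "integrable M (\<lambda>\<omega>. (Y \<omega> - m)\<^sup>2)"
      using integrable_normal_moment[OF s, of m 2] distributed_integrable[OF D, of "\<lambda>x. (x - m)\<^sup>2"] by simp
    from integrable_square_linear(1)[OF _ _ this, of "\<lambda>_. m" 1 1] Ym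
    have i: "integrable M (\<lambda>\<omega>. (Y \<omega>)\<^sup>2)" by simp
    have "(CLINT \<omega>|M. iexp (Y \<omega>)) = of_real (exp (- expectation (\<lambda>\<omega>. (Y \<omega>)\<^sup>2) / 2))" if 0: "expectation Y = 0"
    proof -
      have m0: "m = 0" using normal_distributed_expectation[OF s D] 0 by simp
      have var: "expectation (\<lambda>\<omega>. (Y \<omega>)\<^sup>2) = s\<^sup>2" using normal_distributed_variance[OF s D] 0 by simp
      have "distributed M lborel (\<lambda>\<omega>. (Y \<omega> - m) / s) (\<lambda>x. ennreal (std_normal_density x))"
        using normal_standard_normal_convert[OF s] D by simp
      then have W: "distributed M lborel (\<lambda>\<omega>. Y \<omega> / s) (\<lambda>x. ennreal (std_normal_density x))" by (simp add: m0)
      have "(CLINT \<omega>|M. iexp (s * (Y \<omega> / s))) = char (distr M lborel (\<lambda>\<omega>. Y \<omega> / s)) s"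
        unfolding char_def by (subst integral_distr) (use Ym in auto)
      also have "\<dots> = of_real (exp (- s\<^sup>2 / 2))"
        unfolding distributed_distr_eq_density[OF W] char_std_normal_distribution ..
      finally have "(CLINT \<omega>|M. iexp (s * (Y \<omega> / s))) = of_real (exp (- s\<^sup>2 / 2))" .
      moreover have "s * (Y \<omega> / s) = Y \<omega>" for \<omega> using s by simp
      ultimately show ?thesis by (simp only: var)
    qed
    with i show ?thesis by blast
  next
    case False
    then obtain m where ae: "AE \<omega> in M. Y \<omega> = m" using Y unfolding normal_rv_def by blast
    have E: "expectation (\<lambda>\<omega>. g (Y \<omega>)) = g m" if "g \<in> borel_measurable borel" for g :: "real \<Rightarrow> real"
    proof -
      have "expectation (\<lambda>\<omega>. g (Y \<omega>)) = expectation (\<lambda>_. g m)"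
        by (rule integral_cong_AE) (use ae that Ym in auto)
      then show ?thesis by (simp add: prob_space)
    qed
    have "integrable M (\<lambda>\<omega>. (Y \<omega>)\<^sup>2)"
      by (rule Bochner_Integration.integrable_cong_AE_imp[of _ "\<lambda>_. m\<^sup>2"]) (use ae Ym in auto)
    moreover have "(CLINT \<omega>|M. iexp (Y \<omega>)) = of_real (exp (- expectation (\<lambda>\<omega>. (Y \<omega>)\<^sup>2) / 2))" if 0: "expectation Y = 0"
    proof -
      have m: "m = 0" using 0 E[of "\<lambda>x. x"] by simp
      have "(CLINT \<omega>|M. iexp (Y \<omega>)) = (CLINT \<omega>|M. 1)"
        by (rule integral_cong_AE) (use ae Ym m in auto)
      also have "\<dots> = 1" by (simp add: prob_space)
      finally show ?thesis using E[of "\<lambda>x. x\<^sup>2"] m by simp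
    qed
    ultimately show ?thesis by blast
  qed
  then show "integrable M (\<lambda>\<omega>. (Y \<omega>)\<^sup>2)"
    and "expectation Y = 0 \<Longrightarrow> (CLINT \<omega>|M. iexp (Y \<omega>)) = of_real (exp (- expectation (\<lambda>\<omega>. (Y \<omega>)\<^sup>2) / 2))" by blast+
qed

text \<open>A centred normal variable has a characteristic function determined by its variance, and
  the variance of a linear combination is the quadratic form of the covariance.\<close>

lemma fBm_cf:
  assumes B: "standard_fBm N H B" and J: "finite J" "J \<subseteq> {0..}"
  shows "\<And>j. j \<in> J \<Longrightarrow> B j \<in> borel_measurable N"
    and "(CLINT \<omega>|N. iexp (\<Sum>j\<in>J. d j * B j \<omega>)) =
      of_real (exp (- (\<Sum>i\<in>J. \<Sum>j\<in>J. d i * d j * ((i powr (2 * H) + j powr (2 * H) - \<bar>j - i\<bar> powr (2 * H)) / 2)) / 2))"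
proof -
  have gp: "gaussian_process N {0..} B" and mean: "\<And>t. t \<ge> 0 \<Longrightarrow> integral\<^sup>L N (B t) = 0"
    and cov: "\<And>s t. s \<ge> 0 \<Longrightarrow> t \<ge> 0 \<Longrightarrow> integral\<^sup>L N (\<lambda>\<omega>. B s \<omega> * B t \<omega>) = (s powr (2 * H) + t powr (2 * H) - \<bar>t - s\<bar> powr (2 * H)) / 2"
    using B unfolding standard_fBm_def by blast+
  interpret N: prob_space N using gp unfolding gaussian_process_def by blast
  have nrv: "normal_rv N (\<lambda>\<omega>. \<Sum>j\<in>K. c j * B j \<omega>)" if "finite K" "K \<subseteq> {0..}" for K c
    using gp that unfolding gaussian_process_def by blast
  have nB: "normal_rv N (B j)" if "j \<ge> 0" for j
    using nrv[of "{j}" "\<lambda>_. 1"] that by simp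
  have Bm: "B j \<in> borel_measurable N" if "j \<ge> 0" for j using nB[OF that] by (simp add: normal_rv_def)
  have B2: "integrable N (\<lambda>\<omega>. (B j \<omega>)\<^sup>2)" if "j \<ge> 0" for j by (rule N.normal_cf(1)[OF nB[OF that]])
  have B1: "integrable N (B j)" if "j \<ge> 0" for j using N.square_integrable_imp_integrable[OF Bm B2] that by blast
  have J0: "j \<ge> 0" if "j \<in> J" for j using J that by auto
  show "\<And>j. j \<in> J \<Longrightarrow> B j \<in> borel_measurable N" using Bm J0 by blast
  have "N.expectation (\<lambda>\<omega>. \<Sum>j\<in>J. d j * B j \<omega>) = (\<Sum>j\<in>J. d j * N.expectation (B j))"
    by (subst Bochner_Integration.integral_sum) (use B1 J0 in auto)
  also have "\<dots> = 0" using mean J0 by (intro sum.neutral) auto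
  finally have 0: "N.expectation (\<lambda>\<omega>. \<Sum>j\<in>J. d j * B j \<omega>) = 0" .
  have eq: "(\<Sum>j\<in>J. d j * B j \<omega>)\<^sup>2 = (\<Sum>i\<in>J. \<Sum>j\<in>J. (d i * d j) * (B i \<omega> * B j \<omega>))" for \<omega>
    unfolding power2_eq_square sum_product by (intro sum.cong refl) (simp only: mult.assoc mult.left_commute)
  have i: "integrable N (\<lambda>\<omega>. (d i * d j) * (B i \<omega> * B j \<omega>))" if "i \<in> J" "j \<in> J" for i j
    using that by (intro integrable_mult_right Cauchy_Schwarz_integral(1) Bm B2 J0)
  have "N.expectation (\<lambda>\<omega>. (\<Sum>j\<in>J. d j * B j \<omega>)\<^sup>2) = (\<Sum>i\<in>J. N.expectation (\<lambda>\<omega>. \<Sum>j\<in>J. (d i * d j) * (B i \<omega> * B j \<omega>)))"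
    unfolding eq by (rule Bochner_Integration.integral_sum) (intro Bochner_Integration.integrable_sum i)
  also have "\<dots> = (\<Sum>i\<in>J. \<Sum>j\<in>J. N.expectation (\<lambda>\<omega>. (d i * d j) * (B i \<omega> * B j \<omega>)))"
    by (intro sum.cong refl Bochner_Integration.integral_sum i)
  also have "\<dots> = (\<Sum>i\<in>J. \<Sum>j\<in>J. d i * d j * ((i powr (2 * H) + j powr (2 * H) - \<bar>j - i\<bar> powr (2 * H)) / 2))"
    by (intro sum.cong refl) (simp only: integral_mult_right_zero cov J0)
  finally have var: "N.expectation (\<lambda>\<omega>. (\<Sum>j\<in>J. d j * B j \<omega>)\<^sup>2) =
      (\<Sum>i\<in>J. \<Sum>j\<in>J. d i * d j * ((i powr (2 * H) + j powr (2 * H) - \<bar>j - i\<bar> powr (2 * H)) / 2))" .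
  show "(CLINT \<omega>|N. iexp (\<Sum>j\<in>J. d j * B j \<omega>)) =
      of_real (exp (- (\<Sum>i\<in>J. \<Sum>j\<in>J. d i * d j * ((i powr (2 * H) + j powr (2 * H) - \<bar>j - i\<bar> powr (2 * H)) / 2)) / 2))"
    using N.normal_cf(2)[OF nrv[OF J] 0] unfolding var .
qed

theorem theorem3p1:
  fixes M :: "'w measure" and X :: "real \<Rightarrow> 'w \<Rightarrow> real"
    and N :: "'v measure" and B :: "real \<Rightarrow> 'v \<Rightarrow> real"
    and \<mu> \<pi> :: "real measure" and p l :: "real \<Rightarrow> real" and a b \<alpha> \<sigma> :: real
  assumes supOU: "supOU_process M a b \<mu> \<pi> X"
    and measurable_process: "(\<lambda>(t, \<omega>). X t \<omega>) \<in> borel_measurable (borel \<Otimes>\<^sub>M M)"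
    and finite_variance: "\<And>t. integrable M (\<lambda>\<omega>. (X t \<omega>)^2)"
    and zero_mean: "\<And>t. integral\<^sup>L M (X t) = 0"
    and p_measurable: "p \<in> borel_measurable (restrict_space borel {0<..})"
    and p_nonneg: "\<And>x. x > 0 \<Longrightarrow> p x \<ge> 0"
    and density: "\<pi> = density (restrict_space lborel {0<..}) (\<lambda>x. ennreal (p x))"
    and alpha: "0 < \<alpha>" "\<alpha> < 1"
    and slow: "slowly_varying l"
    and p_asymp: "p \<sim>[at_right 0] (\<lambda>x. \<alpha> * l (inverse x) * x powr (\<alpha> - 1))"
    and b_pos: "b > 0"
    and fBm: "standard_fBm N (1 - \<alpha> / 2) B"
    and sigma: "\<sigma>^2 = b * (Gamma (1 + \<alpha>) / ((2 - \<alpha>) * (1 - \<alpha>)))"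
  shows "fdd_converges at_top {0..}
           M (\<lambda>T t \<omega>. integrated_process X (T * t) \<omega> / (T powr (1 - \<alpha> / 2) * l T powr (1 / 2)))
           N (\<lambda>t \<omega>. \<sigma> * B t \<omega>)"
  unfolding fdd_converges_def
proof (intro allI impI)
  fix J and g :: "(real \<Rightarrow> real) \<Rightarrow> real"
  assume "finite J \<and> J \<subseteq> {0..} \<and> continuous_map (powertop_real J) euclideanreal g \<and> bounded (g ` topspace (powertop_real J))"
  then have J: "finite J" "J \<subseteq> {0..}" and g: "continuous_map (powertop_real J) euclideanreal g" "bounded (g ` topspace (powertop_real J))"
    by blast+
  have M: "prob_space M" and levy: "levy_measure \<mu>" and \<pi>: "prob_space \<pi>"
    using supOU unfolding supOU_process_def by auto
  have N: "prob_space N" using fBm unfolding standard_fBm_def gaussian_process_def by blast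
  have J0: "\<And>j. j \<in> J \<Longrightarrow> 0 \<le> j" using J by auto
  note S = supOU_integrated_cf[OF supOU b_pos measurable_process finite_variance zero_mean]
  show "((\<lambda>T. LINT \<omega>|M. g (\<lambda>t\<in>J. integrated_process X (T * t) \<omega> / (T powr (1 - \<alpha> / 2) * l T powr (1 / 2))))
    \<longlongrightarrow> (LINT \<omega>|N. g (\<lambda>t\<in>J. \<sigma> * B t \<omega>))) at_top"
  \<comment> \<open>The continuity theorem and the dominated convergence arguments are sequential,
    so the limit in \<open>T\<close> is tested along arbitrary sequences tending to
    infinity.\<close>
  proof (rule tendsto_at_topI_sequentially)
    fix T :: "nat \<Rightarrow> real" assume T: "filterlim T at_top sequentially"
    define A where "A n = T n powr (1 - \<alpha> / 2) * l (T n) powr (1 / 2)" for n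
    have "(\<lambda>n. LINT \<omega>|M. g (\<lambda>t\<in>J. integrated_process X (T n * t) \<omega> / A n)) \<longlonglongrightarrow> (LINT \<omega>|N. g (\<lambda>t\<in>J. \<sigma> * B t \<omega>))"
    proof (rule continuous_test_convergence[OF M N J(1) _ _ _ g])
      show "(\<lambda>\<omega>. integrated_process X (T n * j) \<omega> / A n) \<in> borel_measurable M" for n j
        by (intro borel_measurable_divide S(2) borel_measurable_const)
      show "(\<lambda>\<omega>. \<sigma> * B j \<omega>) \<in> borel_measurable N" if "j \<in> J" for j
        by (intro borel_measurable_times borel_measurable_const fBm_cf(1)[OF fBm J that])
      fix c :: "real \<Rightarrow> real"
      let ?S = "\<Sum>i\<in>J. \<Sum>j\<in>J. c i * c j * ((i powr (2 - \<alpha>) + j powr (2 - \<alpha>) - \<bar>j - i\<bar> powr (2 - \<alpha>)) / 2)"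
      let ?E = "\<lambda>n. CLINT z|\<pi> \<Otimes>\<^sub>M lborel. centered_cumulant b \<mu> (\<Sum>j\<in>J. c j / A n * integrated_kernel (T n * j) z)"
      have E: "(CLINT \<omega>|M. iexp (\<Sum>j\<in>J. c j * (integrated_process X (T n * j) \<omega> / A n))) = exp (?E n)" for n
        using S(3)[OF J(1), of "\<lambda>j. c j / A n" "\<lambda>j. T n * j"] by (simp only: times_divide_eq_left times_divide_eq_right)
      have "?E \<longlonglongrightarrow> of_real (- (b * (Gamma (1 + \<alpha>) / ((2 - \<alpha>) * (1 - \<alpha>)))) / 2 * ?S)"
        unfolding A_def
        by (rule cumulant_integral_limit[OF levy S(1) less_imp_le[OF b_pos] \<pi> p_measurable p_nonneg density alpha slow p_asymp T J(1) J0 S(4)[OF J(1)]])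
      then have "(\<lambda>n. exp (?E n)) \<longlonglongrightarrow> exp (of_real (- \<sigma>\<^sup>2 / 2 * ?S))"
        unfolding sigma by (rule tendsto_exp)
      moreover have "(CLINT \<omega>|N. iexp (\<Sum>j\<in>J. c j * (\<sigma> * B j \<omega>))) = exp (of_real (- \<sigma>\<^sup>2 / 2 * ?S))"
      proof -
        have H: "2 * (1 - \<alpha> / 2) = 2 - \<alpha>" by simp
        \<comment> \<open>The factor \<sigma> is absorbed into the coefficients. Only its square
          survives, so its sign, which the hypothesis leaves open, does not matter.\<close>
        have "(\<Sum>i\<in>J. \<Sum>j\<in>J. c i * \<sigma> * (c j * \<sigma>) * ((i powr (2 - \<alpha>) + j powr (2 - \<alpha>) - \<bar>j - i\<bar> powr (2 - \<alpha>)) / 2)) = \<sigma>\<^sup>2 * ?S"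
          unfolding sum_distrib_left power2_eq_square by (intro sum.cong refl) (simp only: mult.assoc mult.commute mult.left_commute)
        then show ?thesis
          using fBm_cf(2)[OF fBm J, of "\<lambda>j. c j * \<sigma>"] unfolding H by (simp only: mult.assoc exp_of_real[symmetric] minus_mult_left times_divide_eq_left)
      qed
      ultimately show "(\<lambda>n. CLINT \<omega>|M. iexp (\<Sum>j\<in>J. c j * (integrated_process X (T n * j) \<omega> / A n))) \<longlonglongrightarrow>
          (CLINT \<omega>|N. iexp (\<Sum>j\<in>J. c j * (\<sigma> * B j \<omega>)))"
        unfolding E by (simp only:)
    qed
    then show "(\<lambda>n. LINT \<omega>|M. g (\<lambda>t\<in>J. integrated_process X (T n * t) \<omega> / (T n powr (1 - \<alpha> / 2) * l (T n) powr (1 / 2))))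
        \<longlonglongrightarrow> (LINT \<omega>|N. g (\<lambda>t\<in>J. \<sigma> * B t \<omega>))" unfolding A_def .
  qed
qed

end
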